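(* Let $\mathcal{A}$ be a partial combinatory algebra and $\mathcal{A}_\#\subseteq\mathcal{A}$ a sub-pca, and assume there is a strongly inaccessible (in particular uncountable) cardinal exceeding the cardinality of $\mathcal{A}$. Let $\mathcal{E}$ be a subtopos of the nested realizability topos $\mathbf{RT}(\mathcal{A},\mathcal{A}_\#)$ induced by a local operator $j$ on the tripos $\mathscr{P}(\mathcal{A},\mathcal{A}_\#)$. Then there exists an internal model of intuitionistic set theory $\mathsf{IZF}$ in $\mathcal{E}$, i.e. an object $V$ of $\mathcal{E}$ together with a binary relation $\varepsilon\rightarrowtail V\times V$ such that all axioms of $\mathsf{IZF}$ hold for $(V,\varepsilon)$ in the internal logic of $\mathcal{E}$.
   Context: A sub-pca $\mathcal{A}_\#$ of a pca $\mathcal{A}$ (partial application written by juxtaposition) is a subset closed under application (when defined) such that there are $k,s\in\mathcal{A}_\#$ with, for all $x,y,z\in\mathcal{A}$: $kxy=x$, $sxy$ is always defined, and $sxyz\simeq xz(yz)$. Let $\bar k=k(skk)$ and let $p,p_0,p_1\in\mathcal{A}_\#$ be pairing and projection combinators. For $A,B\subseteq\mathcal{A}$ put $A\to B=\{a\in\mathcal{A}\mid ax\text{ is defined and }ax\in B\text{ for all }x\in A\}$, $A\wedge B=\{pxy\mid x\in A,y\in B\}$, $A\vee B=(\{k\}\wedge A)\cup(\{\bar k\}\wedge B)$. Let $\Sigma=\Sigma(\mathcal{A},\mathcal{A}_\#)$ be the set of pairs $A=(A_p,A_a)$ with $A_p\subseteq\mathcal{A}$, $A_a\subseteq\mathcal{A}_\#$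 and $A_a\subseteq A_p$. On $\Sigma$ the operations $\wedge,\vee$ are componentwise and $$A\to B=\bigl(A_p\to B_p,\ \mathcal{A}_\#\cap(A_p\to B_p)\cap(A_a\to B_a)\bigr).$$ The nested realizability tripos $\mathscr{P}(\mathcal{A},\mathcal{A}_\#)$ over $\mathbf{Set}$ has as fibre over $I$ the set $\Sigma^I$ preordered by $\phi\vdash_I\psi$ iff $\bigcap_{i\in I}(\phi(i)\to\psi(i))_a\neq\emptyset$, with reindexing by precomposition. The nested realizability topos $\mathbf{RT}(\mathcal{A},\mathcal{A}_\#)$ is the topos obtained from this tripos by the standard tripos-to-topos construction (objects: sets with a $\Sigma$-valued partial equivalence relation in the logic of the tripos; morphisms: equivalence classes of functional relations). A local operator (closure operator) $j$ on $\mathscr{P}(\mathcal{A},\mathcal{A}_\#)$ is a function $j:\Sigma\to\Sigma$ such that $q\vdash j(q)$ and $j(j(q))\vdash j(q)$ hold in the fibre over $\Sigma$ (with $q$ the generic variable), and $(q\to r)\vdash(j(q)\to j(r))$ holds in the fibre over $\Sigma\times\Sigma$. It induces a Lawvere–Tierney topology on $\mathbf{RT}(\mathcal{A},\mathcal{A}_\#)$, and the subtopos induced by $j$ is the corresponding sheaf subtopos. $\mathsf{IZF}$ is the first-order theory over intuitionistic logic in the language of set theory with axioms Extensionality, Pairing, Union, Power Set, Infinity, full Separation, Collection, and $\in$-Induction. *)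

theory Defs
  imports "HOL-Library.FuncSet"
begin

unbundle cardinal_syntax

section \<open>Categories and subobjects\<close>

record ('o, 'm) category =
  Obj :: "'o set"
  Arr :: "'m set"
  Src :: "'m \<Rightarrow> 'o"
  Trg :: "'m \<Rightarrow> 'o"
  Idn :: "'o \<Rightarrow> 'm"
  Cmp :: "'m \<Rightarrow> 'm \<Rightarrow> 'm"  \<comment> \<open>\<open>Cmp C g f\<close> is \<open>g\<close> after \<open>f\<close>\<close>

definition hom :: "('o, 'm) category \<Rightarrow> 'o \<Rightarrow> 'o \<Rightarrow> 'm set" where
  "hom C X Y = {f \<in> Arr C. Src C f = X \<and> Trg C f = Y}"

definition full_subcategory :: "('o, 'm) category \<Rightarrow> 'o set \<Rightarrow> ('o, 'm) category" where
  "full_subcategory C S =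
     C \<lparr>Obj := Obj C \<inter> S, Arr := {f \<in> Arr C. Src C f \<in> S \<and> Trg C f \<in> S}\<rparr>"

definition mono_arr :: "('o, 'm) category \<Rightarrow> 'm \<Rightarrow> bool" where
  "mono_arr C m \<longleftrightarrow> m \<in> Arr C \<and>
     (\<forall>W \<in> Obj C. \<forall>f \<in> hom C W (Src C m). \<forall>g \<in> hom C W (Src C m).
        Cmp C m f = Cmp C m g \<longrightarrow> f = g)"

definition terminal_obj :: "('o, 'm) category \<Rightarrow> 'o \<Rightarrow> bool" where
  "terminal_obj C T \<longleftrightarrow> T \<in> Obj C \<and> (\<forall>W \<in> Obj C. \<exists>!f. f \<in> hom C W T)"

definition is_product ::
  "('o, 'm) category \<Rightarrow> 'o \<Rightarrow> 'o \<Rightarrow> 'o \<Rightarrow> 'm \<Rightarrow> 'm \<Rightarrow> bool" where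
  "is_product C X Y P p q \<longleftrightarrow>
     P \<in> Obj C \<and> p \<in> hom C P X \<and> q \<in> hom C P Y \<and>
     (\<forall>W \<in> Obj C. \<forall>f \<in> hom C W X. \<forall>g \<in> hom C W Y.
        \<exists>!h. h \<in> hom C W P \<and> Cmp C p h = f \<and> Cmp C q h = g)"

definition is_equalizer :: "('o, 'm) category \<Rightarrow> 'm \<Rightarrow> 'm \<Rightarrow> 'm \<Rightarrow> bool" where
  "is_equalizer C f g m \<longleftrightarrow>
     f \<in> Arr C \<and> g \<in> hom C (Src C f) (Trg C f) \<and> m \<in> Arr C \<and> Trg C m = Src C f \<and>
     Cmp C f m = Cmp C g m \<and>
     (\<forall>W \<in> Obj C. \<forall>u \<in> hom C W (Src C f). Cmp C f u = Cmp C g u \<longrightarrow>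
        (\<exists>!h. h \<in> hom C W (Src C m) \<and> Cmp C m h = u))"

text \<open>\<open>is_pullback C f g p q\<close>: the square with \<open>f \<circ> p = g \<circ> q\<close> is a pullback, so \<open>p\<close> is the
  pullback of \<open>g\<close> along \<open>f\<close>.\<close>

definition is_pullback :: "('o, 'm) category \<Rightarrow> 'm \<Rightarrow> 'm \<Rightarrow> 'm \<Rightarrow> 'm \<Rightarrow> bool" where
  "is_pullback C f g p q \<longleftrightarrow>
     f \<in> Arr C \<and> g \<in> Arr C \<and> Trg C f = Trg C g \<and>
     p \<in> Arr C \<and> Trg C p = Src C f \<and> q \<in> hom C (Src C p) (Src C g) \<and>
     Cmp C f p = Cmp C g q \<and>
     (\<forall>W \<in> Obj C. \<forall>u \<in> hom C W (Src C f). \<forall>v \<in> hom C W (Src C g).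
        Cmp C f u = Cmp C g v \<longrightarrow>
        (\<exists>!h. h \<in> hom C W (Src C p) \<and> Cmp C p h = u \<and> Cmp C q h = v))"

text \<open>Subobjects are represented by monomorphisms, compared by factorization.\<close>

definition subobj :: "('o, 'm) category \<Rightarrow> 'o \<Rightarrow> 'm set" where
  "subobj C X = {m. mono_arr C m \<and> Trg C m = X}"

definition sub_le :: "('o, 'm) category \<Rightarrow> 'm \<Rightarrow> 'm \<Rightarrow> bool" where
  "sub_le C m n \<longleftrightarrow> (\<exists>h \<in> hom C (Src C m) (Src C n). m = Cmp C n h)"

definition inverse_image :: "('o, 'm) category \<Rightarrow> 'm \<Rightarrow> 'm \<Rightarrow> 'm \<Rightarrow> bool" where
  "inverse_image C f n n' \<longleftrightarrow> n' \<in> subobj C (Src C f) \<and> (\<exists>q. is_pullback C f n n' q)"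


section \<open>Sheaves for a Lawvere--Tierney topology\<close>

text \<open>In a category \<open>C\<close> with subobject classifier \<open>t : 1 \<rightarrow> \<Omega>\<close>, let \<open>J : \<Omega> \<rightarrow> \<Omega>\<close> be a
  Lawvere--Tierney topology. A subobject \<open>m\<close> of \<open>B\<close> with characteristic map \<open>\<chi>\<close> is dense if
  \<open>J \<circ> \<chi>\<close> is the characteristic map \<open>B \<rightarrow> 1 \<rightarrow> \<Omega>\<close> of the maximal subobject.\<close>

definition dense_mono :: "('o, 'm) category \<Rightarrow> 'm \<Rightarrow> 'm \<Rightarrow> 'm \<Rightarrow> bool" where
  "dense_mono C t J m \<longleftrightarrow> mono_arr C m \<and>
     (\<exists>\<chi> q r. is_pullback C \<chi> t m q \<and> r \<in> hom C (Trg C m) (Src C t) \<and>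
        Cmp C J \<chi> = Cmp C t r)"

definition is_sheaf :: "('o, 'm) category \<Rightarrow> 'm \<Rightarrow> 'm \<Rightarrow> 'o \<Rightarrow> bool" where
  "is_sheaf C t J X \<longleftrightarrow> X \<in> Obj C \<and>
     (\<forall>m. dense_mono C t J m \<longrightarrow>
        (\<forall>f \<in> hom C (Src C m) X. \<exists>!g. g \<in> hom C (Trg C m) X \<and> Cmp C g m = f))"

definition sheaf_category :: "('o, 'm) category \<Rightarrow> 'm \<Rightarrow> 'm \<Rightarrow> ('o, 'm) category" where
  "sheaf_category C t J = full_subcategory C {X. is_sheaf C t J X}"


section \<open>First-order formulas in the language of set theory\<close>

text \<open>Variables are de Bruijn indices.\<close>

datatype fm =
    Mem nat nat
  | Eq nat nat
  | Bot
  | And fm fm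
  | Or fm fm
  | Imp fm fm
  | Forall fm
  | Exists fm

definition Iff :: "fm \<Rightarrow> fm \<Rightarrow> fm" where
  "Iff \<phi> \<psi> = And (Imp \<phi> \<psi>) (Imp \<psi> \<phi>)"

definition Neg :: "fm \<Rightarrow> fm" where
  "Neg \<phi> = Imp \<phi> Bot"

primrec vars_below :: "nat \<Rightarrow> fm \<Rightarrow> bool" where
  "vars_below n (Mem i k) \<longleftrightarrow> i < n \<and> k < n"
| "vars_below n (Eq i k) \<longleftrightarrow> i < n \<and> k < n"
| "vars_below n Bot \<longleftrightarrow> True"
| "vars_below n (And \<phi> \<psi>) \<longleftrightarrow> vars_below n \<phi> \<and> vars_below n \<psi>"
| "vars_below n (Or \<phi> \<psi>) \<longleftrightarrow> vars_below n \<phi> \<and> vars_below n \<psi>"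
| "vars_below n (Imp \<phi> \<psi>) \<longleftrightarrow> vars_below n \<phi> \<and> vars_below n \<psi>"
| "vars_below n (Forall \<phi>) \<longleftrightarrow> vars_below (Suc n) \<phi>"
| "vars_below n (Exists \<phi>) \<longleftrightarrow> vars_below (Suc n) \<phi>"

text \<open>\<open>lift c \<phi>\<close> renames the free variables of \<open>\<phi>\<close> so that index \<open>c\<close> becomes fresh.\<close>

definition lift_var :: "nat \<Rightarrow> nat \<Rightarrow> nat" where
  "lift_var c i = (if i < c then i else Suc i)"

primrec lift :: "nat \<Rightarrow> fm \<Rightarrow> fm" where
  "lift c (Mem i k) = Mem (lift_var c i) (lift_var c k)"
| "lift c (Eq i k) = Eq (lift_var c i) (lift_var c k)"
| "lift c Bot = Bot"
| "lift c (And \<phi> \<psi>) = And (lift c \<phi>) (lift c \<psi>)"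
| "lift c (Or \<phi> \<psi>) = Or (lift c \<phi>) (lift c \<psi>)"
| "lift c (Imp \<phi> \<psi>) = Imp (lift c \<phi>) (lift c \<psi>)"
| "lift c (Forall \<phi>) = Forall (lift (Suc c) \<phi>)"
| "lift c (Exists \<phi>) = Exists (lift (Suc c) \<phi>)"


section \<open>The axioms of IZF\<close>

text \<open>\<open>\<forall>x y. (\<forall>z. z \<in> x \<leftrightarrow> z \<in> y) \<rightarrow> x = y\<close>\<close>
definition ax_extensionality :: fm where
  "ax_extensionality = Forall (Forall (Imp (Forall (Iff (Mem 0 2) (Mem 0 1))) (Eq 1 0)))"

text \<open>\<open>\<forall>x y. \<exists>z. \<forall>w. w \<in> z \<leftrightarrow> w = x \<or> w = y\<close>\<close>
definition ax_pairing :: fm where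
  "ax_pairing = Forall (Forall (Exists (Forall (Iff (Mem 0 1) (Or (Eq 0 3) (Eq 0 2))))))"

text \<open>\<open>\<forall>x. \<exists>y. \<forall>z. z \<in> y \<leftrightarrow> (\<exists>w. w \<in> x \<and> z \<in> w)\<close>\<close>
definition ax_union :: fm where
  "ax_union = Forall (Exists (Forall (Iff (Mem 0 1) (Exists (And (Mem 0 3) (Mem 1 0))))))"

text \<open>\<open>\<forall>x. \<exists>y. \<forall>z. z \<in> y \<leftrightarrow> (\<forall>w. w \<in> z \<rightarrow> w \<in> x)\<close>\<close>
definition ax_power_set :: fm where
  "ax_power_set = Forall (Exists (Forall (Iff (Mem 0 1) (Forall (Imp (Mem 0 1) (Mem 0 3))))))"

text \<open>\<open>\<exists>a. (\<exists>x. x \<in> a \<and> (\<forall>y. \<not> y \<in> x)) \<and>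
  (\<forall>x. x \<in> a \<rightarrow> (\<exists>y. y \<in> a \<and> (\<forall>z. z \<in> y \<leftrightarrow> z \<in> x \<or> z = x)))\<close>\<close>
definition ax_infinity :: fm where
  "ax_infinity = Exists (And
     (Exists (And (Mem 0 1) (Forall (Neg (Mem 0 1)))))
     (Forall (Imp (Mem 0 1)
        (Exists (And (Mem 0 2) (Forall (Iff (Mem 0 1) (Or (Mem 0 2) (Eq 0 2)))))))))"

text \<open>For \<open>\<phi>(x, a, \<dots>)\<close>, parameters after \<open>a\<close>:
  \<open>\<forall>a. \<exists>y. \<forall>x. x \<in> y \<leftrightarrow> x \<in> a \<and> \<phi>(x, a, \<dots>)\<close>\<close>
definition ax_separation :: "fm \<Rightarrow> fm" where
  "ax_separation \<phi> = Forall (Exists (Forall (Iff (Mem 0 1) (And (Mem 0 2) (lift 1 \<phi>)))))"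

text \<open>For \<open>\<phi>(y, x, a, \<dots>)\<close>:
  \<open>\<forall>a. (\<forall>x. x \<in> a \<rightarrow> (\<exists>y. \<phi>(y, x, a, \<dots>))) \<rightarrow>
       (\<exists>b. \<forall>x. x \<in> a \<rightarrow> (\<exists>y. y \<in> b \<and> \<phi>(y, x, a, \<dots>)))\<close>\<close>
definition ax_collection :: "fm \<Rightarrow> fm" where
  "ax_collection \<phi> = Forall (Imp
     (Forall (Imp (Mem 0 1) (Exists \<phi>)))
     (Exists (Forall (Imp (Mem 0 2) (Exists (And (Mem 0 2) (lift 2 \<phi>)))))))"

text \<open>For \<open>\<phi>(x, \<dots>)\<close>: \<open>(\<forall>x. (\<forall>y. y \<in> x \<rightarrow> \<phi>(y, \<dots>)) \<rightarrow> \<phi>(x, \<dots>)) \<rightarrow> (\<forall>x. \<phi>(x, \<dots>))\<close>\<close>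
definition ax_induction :: "fm \<Rightarrow> fm" where
  "ax_induction \<phi> = Imp (Forall (Imp (Forall (Imp (Mem 0 1) (lift 1 \<phi>))) \<phi>)) (Forall \<phi>)"

text \<open>The schemes are closed universally over their \<open>n\<close> parameters.\<close>

definition IZF :: "fm set" where
  "IZF =
     {ax_extensionality, ax_pairing, ax_union, ax_power_set, ax_infinity} \<union>
     {(Forall ^^ n) (ax_separation \<phi>) | n \<phi>. vars_below (n + 2) \<phi>} \<union>
     {(Forall ^^ n) (ax_collection \<phi>) | n \<phi>. vars_below (n + 3) \<phi>} \<union>
     {(Forall ^^ n) (ax_induction \<phi>) | n \<phi>. vars_below (n + 1) \<phi>}"


section \<open>Internal first-order logic\<close>

text \<open>An object with a binary relation: a monomorphism \<open>Eps\<close> into a product \<open>Sqr\<close> of \<open>Univ\<close> with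
  itself, thought of as \<open>{(x, y) | x \<in> y}\<close>.\<close>

record ('o, 'm) rel_structure =
  Univ :: 'o
  Sqr :: 'o
  Proj1 :: 'm
  Proj2 :: 'm
  Eps :: 'm

definition is_rel_structure :: "('o, 'm) category \<Rightarrow> ('o, 'm) rel_structure \<Rightarrow> bool" where
  "is_rel_structure C M \<longleftrightarrow> Univ M \<in> Obj C \<and>
     is_product C (Univ M) (Univ M) (Sqr M) (Proj1 M) (Proj2 M) \<and> Eps M \<in> subobj C (Sqr M)"

text \<open>\<open>interp C M \<phi> X \<alpha> m\<close>: the subobject \<open>m\<close> of \<open>X\<close> is the interpretation
  \<open>{x : X | \<phi>(\<alpha>\<^sub>0(x), \<alpha>\<^sub>1(x), \<dots>)}\<close>, where \<open>\<alpha>\<^sub>i : X \<rightarrow> Univ M\<close> is the value of variable \<open>i\<close>.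
  Connectives are the Heyting operations of the subobject poset of \<open>X\<close>, and quantifiers are the
  adjoints to inverse image along the projection \<open>X \<times> Univ M \<rightarrow> X\<close>. Forall of these are
  determined up to isomorphism by their universal property, hence the relational form.\<close>

primrec interp ::
  "('o, 'm) category \<Rightarrow> ('o, 'm) rel_structure \<Rightarrow> fm \<Rightarrow> 'o \<Rightarrow> 'm list \<Rightarrow> 'm \<Rightarrow> bool" where
  "interp C M (Mem i k) X \<alpha> m \<longleftrightarrow>
     (\<exists>h \<in> hom C X (Sqr M). Cmp C (Proj1 M) h = \<alpha> ! i \<and> Cmp C (Proj2 M) h = \<alpha> ! k \<and>
        inverse_image C h (Eps M) m)"
| "interp C M (Eq i k) X \<alpha> m \<longleftrightarrow>
     m \<in> subobj C X \<and> is_equalizer C (\<alpha> ! i) (\<alpha> ! k) m"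
| "interp C M Bot X \<alpha> m \<longleftrightarrow>
     m \<in> subobj C X \<and> (\<forall>n \<in> subobj C X. sub_le C m n)"
| "interp C M (And \<phi> \<psi>) X \<alpha> m \<longleftrightarrow> m \<in> subobj C X \<and>
     (\<exists>m1 m2. interp C M \<phi> X \<alpha> m1 \<and> interp C M \<psi> X \<alpha> m2 \<and>
        (\<forall>n \<in> subobj C X. sub_le C n m \<longleftrightarrow> sub_le C n m1 \<and> sub_le C n m2))"
| "interp C M (Or \<phi> \<psi>) X \<alpha> m \<longleftrightarrow> m \<in> subobj C X \<and>
     (\<exists>m1 m2. interp C M \<phi> X \<alpha> m1 \<and> interp C M \<psi> X \<alpha> m2 \<and>
        (\<forall>n \<in> subobj C X. sub_le C m n \<longleftrightarrow> sub_le C m1 n \<and> sub_le C m2 n))"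
| "interp C M (Imp \<phi> \<psi>) X \<alpha> m \<longleftrightarrow> m \<in> subobj C X \<and>
     (\<exists>m1 m2. interp C M \<phi> X \<alpha> m1 \<and> interp C M \<psi> X \<alpha> m2 \<and>
        (\<forall>n \<in> subobj C X. sub_le C n m \<longleftrightarrow>
           (\<forall>l \<in> subobj C X. sub_le C l n \<and> sub_le C l m1 \<longrightarrow> sub_le C l m2)))"
| "interp C M (Forall \<phi>) X \<alpha> m \<longleftrightarrow> m \<in> subobj C X \<and>
     (\<exists>Y q1 q2 m'. is_product C X (Univ M) Y q1 q2 \<and>
        interp C M \<phi> Y (q2 # map (\<lambda>a. Cmp C a q1) \<alpha>) m' \<and>
        (\<forall>n \<in> subobj C X. \<forall>n'. inverse_image C q1 n n' \<longrightarrow>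
           (sub_le C n m \<longleftrightarrow> sub_le C n' m')))"
| "interp C M (Exists \<phi>) X \<alpha> m \<longleftrightarrow> m \<in> subobj C X \<and>
     (\<exists>Y q1 q2 m'. is_product C X (Univ M) Y q1 q2 \<and>
        interp C M \<phi> Y (q2 # map (\<lambda>a. Cmp C a q1) \<alpha>) m' \<and>
        (\<forall>n \<in> subobj C X. \<forall>n'. inverse_image C q1 n n' \<longrightarrow>
           (sub_le C m n \<longleftrightarrow> sub_le C m' n')))"

text \<open>A sentence holds if its interpretation is the maximal subobject of \<open>1\<close>.\<close>

definition holds :: "('o, 'm) category \<Rightarrow> ('o, 'm) rel_structure \<Rightarrow> fm \<Rightarrow> bool" where
  "holds C M \<phi> \<longleftrightarrow>
     (\<exists>T m. terminal_obj C T \<and> interp C M \<phi> T [] m \<and> sub_le C (Idn C T) m)"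

definition internal_IZF_model :: "('o, 'm) category \<Rightarrow> ('o, 'm) rel_structure \<Rightarrow> bool" where
  "internal_IZF_model C M \<longleftrightarrow> is_rel_structure C M \<and> (\<forall>\<phi> \<in> IZF. holds C M \<phi>)"


section \<open>Partial combinatory algebras\<close>

type_synonym 'a papp = "'a \<Rightarrow> 'a \<Rightarrow> 'a option"

definition oapp :: "'a papp \<Rightarrow> 'a option \<Rightarrow> 'a option \<Rightarrow> 'a option" where
  "oapp app u v = Option.bind u (\<lambda>a. Option.bind v (app a))"

definition ks_combinators :: "'a papp \<Rightarrow> 'a \<Rightarrow> 'a \<Rightarrow> bool" where
  "ks_combinators app k s \<longleftrightarrow>
     (\<forall>x y. oapp app (app k x) (Some y) = Some x) \<and>
     (\<forall>x y. oapp app (app s x) (Some y) \<noteq> None) \<and>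
     (\<forall>x y z. oapp app (oapp app (app s x) (Some y)) (Some z) = oapp app (app x z) (app y z))"

definition pca :: "'a papp \<Rightarrow> bool" where
  "pca app \<longleftrightarrow> (\<exists>k s. ks_combinators app k s)"

definition sub_pca :: "'a papp \<Rightarrow> 'a set \<Rightarrow> bool" where
  "sub_pca app S \<longleftrightarrow>
     (\<forall>a \<in> S. \<forall>b \<in> S. \<forall>c. app a b = Some c \<longrightarrow> c \<in> S) \<and>
     (\<exists>k \<in> S. \<exists>s \<in> S. ks_combinators app k s)"

definition pairing_combinators :: "'a papp \<Rightarrow> 'a \<Rightarrow> 'a \<Rightarrow> 'a \<Rightarrow> bool" where
  "pairing_combinators app p p0 p1 \<longleftrightarrow>
     (\<forall>x y. \<exists>c. oapp app (app p x) (Some y) = Some c \<and> app p0 c = Some x \<and> app p1 c = Some y)"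

record 'a nested_pca =
  App :: "'a papp"
  Sharp :: "'a set"
  Pr :: 'a
  Pr0 :: 'a
  Pr1 :: 'a

definition is_nested_pca :: "'a nested_pca \<Rightarrow> bool" where
  "is_nested_pca D \<longleftrightarrow> pca (App D) \<and> sub_pca (App D) (Sharp D) \<and>
     Pr D \<in> Sharp D \<and> Pr0 D \<in> Sharp D \<and> Pr1 D \<in> Sharp D \<and>
     pairing_combinators (App D) (Pr D) (Pr0 D) (Pr1 D)"


section \<open>The nested realizability tripos\<close>

definition imp_set :: "'a nested_pca \<Rightarrow> 'a set \<Rightarrow> 'a set \<Rightarrow> 'a set" where
  "imp_set D A B = {a. \<forall>x \<in> A. \<exists>y \<in> B. App D a x = Some y}"

definition and_set :: "'a nested_pca \<Rightarrow> 'a set \<Rightarrow> 'a set \<Rightarrow> 'a set" where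
  "and_set D A B = {c. \<exists>x \<in> A. \<exists>y \<in> B. oapp (App D) (App D (Pr D) x) (Some y) = Some c}"

text \<open>A truth value is a pair (potential realizers, actual realizers).\<close>

type_synonym 'a tval = "'a set \<times> 'a set"

definition Sig :: "'a nested_pca \<Rightarrow> 'a tval set" where
  "Sig D = {(Ap, Aa). Aa \<subseteq> Sharp D \<and> Aa \<subseteq> Ap}"

definition top_tv :: "'a nested_pca \<Rightarrow> 'a tval" where
  "top_tv D = (UNIV, Sharp D)"

definition and_tv :: "'a nested_pca \<Rightarrow> 'a tval \<Rightarrow> 'a tval \<Rightarrow> 'a tval" where
  "and_tv D A B = (and_set D (fst A) (fst B), and_set D (snd A) (snd B))"

definition imp_tv :: "'a nested_pca \<Rightarrow> 'a tval \<Rightarrow> 'a tval \<Rightarrow> 'a tval" where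
  "imp_tv D A B = (imp_set D (fst A) (fst B),
     Sharp D \<inter> imp_set D (fst A) (fst B) \<inter> imp_set D (snd A) (snd B))"

definition iff_tv :: "'a nested_pca \<Rightarrow> 'a tval \<Rightarrow> 'a tval \<Rightarrow> 'a tval" where
  "iff_tv D A B = and_tv D (imp_tv D A B) (imp_tv D B A)"

text \<open>Left adjoint to reindexing along a projection with fibre \<open>Y\<close>.\<close>

definition ex_tv :: "'y set \<Rightarrow> ('y \<Rightarrow> 'a tval) \<Rightarrow> 'a tval" where
  "ex_tv Y \<phi> = (\<Union>y \<in> Y. fst (\<phi> y), \<Union>y \<in> Y. snd (\<phi> y))"

definition entails ::
  "'a nested_pca \<Rightarrow> 'i set \<Rightarrow> ('i \<Rightarrow> 'a tval) \<Rightarrow> ('i \<Rightarrow> 'a tval) \<Rightarrow> bool" where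
  "entails D I \<phi> \<psi> \<longleftrightarrow> (\<Inter>i \<in> I. snd (imp_tv D (\<phi> i) (\<psi> i))) \<noteq> {}"

definition local_operator :: "'a nested_pca \<Rightarrow> ('a tval \<Rightarrow> 'a tval) \<Rightarrow> bool" where
  "local_operator D j \<longleftrightarrow> j \<in> Sig D \<rightarrow> Sig D \<and>
     entails D (Sig D) (\<lambda>q. q) j \<and>
     entails D (Sig D) (\<lambda>q. j (j q)) j \<and>
     entails D (Sig D \<times> Sig D) (\<lambda>(q, r). imp_tv D q r) (\<lambda>(q, r). imp_tv D (j q) (j r))"


section \<open>The nested realizability topos\<close>

text \<open>The category of sets is represented by the subsets of a type \<open>'u\<close> of smaller cardinality
  than \<open>'u\<close>. If \<open>'u\<close> satisfies \<open>set_universe\<close>, these are closed, up to bijection, under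
  products, power sets and function sets.\<close>

definition strong_limit :: "'k rel \<Rightarrow> bool" where
  "strong_limit \<kappa> \<longleftrightarrow> (\<forall>X. X \<subseteq> Field \<kappa> \<and> |X| <o \<kappa> \<longrightarrow> |Pow X| <o \<kappa>)"

definition strongly_inaccessible :: "'k rel \<Rightarrow> bool" where
  "strongly_inaccessible \<kappa> \<longleftrightarrow>
     Card_order \<kappa> \<and> natLeq <o \<kappa> \<and> regularCard \<kappa> \<and> strong_limit \<kappa>"

definition set_universe :: "'u itself \<Rightarrow> bool" where
  "set_universe _ \<longleftrightarrow> infinite (UNIV :: 'u set) \<and> strong_limit |UNIV :: 'u set|"

type_synonym ('u, 'a) rt_obj = "'u set \<times> ('u \<Rightarrow> 'u \<Rightarrow> 'a tval)"
type_synonym ('u, 'a) rt_rel = "'u \<Rightarrow> 'u \<Rightarrow> 'a tval"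
type_synonym ('u, 'a) rt_arr = "('u, 'a) rt_obj \<times> ('u, 'a) rt_obj \<times> ('u, 'a) rt_rel set"

definition is_per :: "'a nested_pca \<Rightarrow> ('u, 'a) rt_obj \<Rightarrow> bool" where
  "is_per D = (\<lambda>(X, E).
     (\<forall>x \<in> X. \<forall>y \<in> X. E x y \<in> Sig D) \<and>
     entails D (X \<times> X) (\<lambda>(x, y). E x y) (\<lambda>(x, y). E y x) \<and>
     entails D (X \<times> X \<times> X) (\<lambda>(x, y, z). and_tv D (E x y) (E y z)) (\<lambda>(x, y, z). E x z))"

text \<open>The conditions are, in order: strictness, extensionality, single-valuedness, totality.\<close>

definition functional_rel ::
  "'a nested_pca \<Rightarrow> ('u, 'a) rt_obj \<Rightarrow> ('u, 'a) rt_obj \<Rightarrow> ('u, 'a) rt_rel \<Rightarrow> bool" where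
  "functional_rel D = (\<lambda>(X, E) (Y, E') F.
     (\<forall>x \<in> X. \<forall>y \<in> Y. F x y \<in> Sig D) \<and>
     entails D (X \<times> Y) (\<lambda>(x, y). F x y) (\<lambda>(x, y). and_tv D (E x x) (E' y y)) \<and>
     entails D ((X \<times> X) \<times> (Y \<times> Y))
       (\<lambda>((x, x'), (y, y')). and_tv D (F x y) (and_tv D (E x x') (E' y y')))
       (\<lambda>((x, x'), (y, y')). F x' y') \<and>
     entails D (X \<times> Y \<times> Y) (\<lambda>(x, y, y'). and_tv D (F x y) (F x y')) (\<lambda>(x, y, y'). E' y y') \<and>
     entails D X (\<lambda>x. E x x) (\<lambda>x. ex_tv Y (F x)))"

definition rel_class ::
  "'a nested_pca \<Rightarrow> ('u, 'a) rt_obj \<Rightarrow> ('u, 'a) rt_obj \<Rightarrow> ('u, 'a) rt_rel \<Rightarrow> ('u, 'a) rt_rel set"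
  where
  "rel_class D A B F = {G. functional_rel D A B G \<and>
     entails D (fst A \<times> fst B) (\<lambda>(x, y). F x y) (\<lambda>(x, y). G x y) \<and>
     entails D (fst A \<times> fst B) (\<lambda>(x, y). G x y) (\<lambda>(x, y). F x y)}"

definition rt_arrow ::
  "'a nested_pca \<Rightarrow> ('u, 'a) rt_obj \<Rightarrow> ('u, 'a) rt_obj \<Rightarrow> ('u, 'a) rt_rel \<Rightarrow> ('u, 'a) rt_arr" where
  "rt_arrow D A B F = (A, B, rel_class D A B F)"

definition rel_comp ::
  "'a nested_pca \<Rightarrow> 'u set \<Rightarrow> ('u, 'a) rt_rel \<Rightarrow> ('u, 'a) rt_rel \<Rightarrow> ('u, 'a) rt_rel" where
  "rel_comp D Y G F = (\<lambda>x z. ex_tv Y (\<lambda>y. and_tv D (F x y) (G y z)))"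

definition rt_objects :: "'a nested_pca \<Rightarrow> ('u, 'a) rt_obj set" where
  "rt_objects D = {A. |fst A| <o |UNIV :: 'u set| \<and> is_per D A}"

definition RT :: "'a nested_pca \<Rightarrow> (('u, 'a) rt_obj, ('u, 'a) rt_arr) category" where
  "RT D = \<lparr>
     Obj = rt_objects D,
     Arr = {rt_arrow D A B F | A B F.
              A \<in> rt_objects D \<and> B \<in> rt_objects D \<and> functional_rel D A B F},
     Src = (\<lambda>(A, B, c). A),
     Trg = (\<lambda>(A, B, c). B),
     Idn = (\<lambda>A. rt_arrow D A A (snd A)),
     Cmp = (\<lambda>(B', C, d) (A, B, c).
              (A, C, \<Union>F \<in> c. \<Union>G \<in> d. rel_class D A C (rel_comp D (fst B) G F)))\<rparr>"

definition rt_one :: "'a nested_pca \<Rightarrow> ('u, 'a) rt_obj" where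
  "rt_one D = ({undefined}, \<lambda>_ _. top_tv D)"

text \<open>The subobject classifier is the set of truth values with bi-implication as equality. An
  arbitrary injection transfers it to \<open>'u\<close>; one exists as soon as some strong limit cardinal
  lies above the cardinality of the pca and below that of \<open>'u\<close>.\<close>

definition tv_code :: "'a nested_pca \<Rightarrow> 'a tval \<Rightarrow> 'u" where
  "tv_code D = (SOME e. inj_on e (Sig D))"

definition tv_decode :: "'a nested_pca \<Rightarrow> 'u \<Rightarrow> 'a tval" where
  "tv_decode D = inv_into (Sig D) (tv_code D)"

definition rt_omega :: "'a nested_pca \<Rightarrow> ('u, 'a) rt_obj" where
  "rt_omega D = (tv_code D ` Sig D, \<lambda>u v. iff_tv D (tv_decode D u) (tv_decode D v))"

definition rt_true :: "'a nested_pca \<Rightarrow> ('u, 'a) rt_arr" where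
  "rt_true D = rt_arrow D (rt_one D) (rt_omega D) (\<lambda>_ v. iff_tv D (top_tv D) (tv_decode D v))"

definition rt_topology :: "'a nested_pca \<Rightarrow> ('a tval \<Rightarrow> 'a tval) \<Rightarrow> ('u, 'a) rt_arr" where
  "rt_topology D j = rt_arrow D (rt_omega D) (rt_omega D)
     (\<lambda>u v. iff_tv D (j (tv_decode D u)) (tv_decode D v))"

definition subtopos ::
  "'a nested_pca \<Rightarrow> ('a tval \<Rightarrow> 'a tval) \<Rightarrow> (('u, 'a) rt_obj, ('u, 'a) rt_arr) category" where
  "subtopos D j = sheaf_category (RT D) (rt_true D) (rt_topology D j)"

end

theory Submission
  imports Defs
begin

text \<open>Truth in the tripos is tested at stages. A stage is a family of points, each carrying a
  realizer \<open>rho\<close> and a flag \<open>fl\<close> which tells whether actual or only potential realizers count at this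
  point; a family of truth values holds at a stage if a single element of the sub-pca maps every \<open>rho\<close>
  to a realizer of the right kind. Entailment is preservation of truth at all stages, so the topos and
  its internal logic can be described by forcing clauses for generalized elements.

  The model is the Friedman--McCarty universe of names relative to \<open>j\<close>. A name is a set of fewer than
  \<open>\<kappa>\<close> pairs of a name and a truth value. The truth value of \<open>u \<in> y\<close> is \<open>j\<close> of ``some entry of \<open>y\<close>
  equals \<open>u\<close>'', and equality is mutual inclusion, by recursion on names. Equality is
  \<open>j\<close>-closed, which makes the object of names separated. An existential quantifier over names can be
  restricted to fewer than \<open>\<kappa>\<close> witnesses without changing its realizers, as each realizer needs just one.
  Hence a singleton predicate can be glued to a name, the union of its witnesses, so that the object of
  names is even a sheaf, and for the same reason Collection holds. The set existence axioms hold because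
  the inaccessible \<open>\<kappa>\<close> makes names closed under the cumulative constructions, and \<open>\<in>\<close>-induction is
  realized by a fixed point combinator.\<close>

datatype ('c, 'a) stage = Stage (st_dom: "'c set") (rho: "'c \<Rightarrow> 'a") (fl: "'c \<Rightarrow> bool")

locale nested =
  fixes D :: "'a nested_pca"
  assumes nested_pca: "is_nested_pca D"
begin

abbreviation ap2 :: "'a option \<Rightarrow> 'a option \<Rightarrow> 'a option" (infixl "\<cdot>" 75) where
  "u \<cdot> v \<equiv> oapp (App D) u v"

lemma oapp_Some [simp]: "Some x \<cdot> Some y = App D x y" "Some x \<cdot> v = Option.bind v (App D x)"
  by (simp_all add: oapp_def)

definition kk where "kk = (SOME k. k \<in> Sharp D \<and> (\<exists>s \<in> Sharp D. ks_combinators (App D) k s))"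
definition ss where "ss = (SOME s. s \<in> Sharp D \<and> ks_combinators (App D) kk s)"

lemma kk_ss: "kk \<in> Sharp D" "ss \<in> Sharp D" "ks_combinators (App D) kk ss"
proof -
  have "\<exists>k. k \<in> Sharp D \<and> (\<exists>s \<in> Sharp D. ks_combinators (App D) k s)"
    using nested_pca by (auto simp: is_nested_pca_def sub_pca_def)
  then have k: "kk \<in> Sharp D \<and> (\<exists>s \<in> Sharp D. ks_combinators (App D) kk s)"
    unfolding kk_def by (rule someI_ex)
  then have "\<exists>s. s \<in> Sharp D \<and> ks_combinators (App D) kk s" by blast
  then have "ss \<in> Sharp D \<and> ks_combinators (App D) kk ss" unfolding ss_def by (rule someI_ex)
  with k show "kk \<in> Sharp D" "ss \<in> Sharp D" "ks_combinators (App D) kk ss" by auto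
qed

lemma Sharp_app: "a \<in> Sharp D \<Longrightarrow> b \<in> Sharp D \<Longrightarrow> App D a b = Some m \<Longrightarrow> m \<in> Sharp D"
  using nested_pca unfolding is_nested_pca_def sub_pca_def by blast

lemma ex_const: "\<exists>m. App D kk a = Some m \<and> (a \<in> Sharp D \<longrightarrow> m \<in> Sharp D) \<and> (\<forall>x. App D m x = Some a)"
proof -
  have *: "\<And>y. App D kk a \<cdot> Some y = Some a" using kk_ss(3) by (simp add: ks_combinators_def)
  then obtain m where m: "App D kk a = Some m" by (cases "App D kk a") (auto simp: oapp_def)
  have "\<And>x. App D m x = Some a" using *[unfolded m] by simp
  with m show ?thesis using Sharp_app[OF kk_ss(1) _ m] by blast
qed

lemma ex_scomb:
  "\<exists>m d. App D ss a = Some d \<and> App D d b = Some m \<and> (a \<in> Sharp D \<longrightarrow> b \<in> Sharp D \<longrightarrow> m \<in> Sharp D)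
     \<and> (\<forall>x. App D m x = App D a x \<cdot> App D b x)"
proof -
  have 1: "App D ss a \<cdot> Some b \<noteq> None" and 2: "\<And>z. App D ss a \<cdot> Some b \<cdot> Some z = App D a z \<cdot> App D b z"
    using kk_ss(3) by (auto simp: ks_combinators_def)
  from 1 obtain d where d: "App D ss a = Some d" by (cases "App D ss a") (auto simp: oapp_def)
  from 1 d obtain m where m: "App D d b = Some m" by (cases "App D d b") auto
  have "a \<in> Sharp D \<longrightarrow> b \<in> Sharp D \<longrightarrow> m \<in> Sharp D"
    using Sharp_app[OF kk_ss(2) _ d] Sharp_app[OF _ _ m] by blast
  with d m 2 show ?thesis by simp
qed

lemma ex_scomb':
  "\<exists>m. (a \<in> Sharp D \<longrightarrow> b \<in> Sharp D \<longrightarrow> m \<in> Sharp D) \<and> (\<forall>x. App D m x = App D a x \<cdot> App D b x)"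
  using ex_scomb[of a b] by blast

lemma ex_const': "\<exists>m. (a \<in> Sharp D \<longrightarrow> m \<in> Sharp D) \<and> (\<forall>x. App D m x = Some a)"
  using ex_const[of a] by blast

lemma ex_id: "\<exists>m \<in> Sharp D. \<forall>x. App D m x = Some x"
proof -
  obtain m where m: "kk \<in> Sharp D \<longrightarrow> kk \<in> Sharp D \<longrightarrow> m \<in> Sharp D" "\<And>x. App D m x = App D kk x \<cdot> App D kk x"
    using ex_scomb'[of kk kk] by blast
  have "App D m x = Some x" for x
    using ex_const[of x] by (auto simp: m(2))
  with m(1) kk_ss show ?thesis by blast
qed

lemma ex_comp:
  assumes "f \<in> Sharp D" "g \<in> Sharp D"
  shows "\<exists>m \<in> Sharp D. \<forall>x. App D m x = Some g \<cdot> App D f x"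
proof -
  obtain h where h: "g \<in> Sharp D \<longrightarrow> h \<in> Sharp D" "\<And>x. App D h x = Some g" using ex_const' by blast
  obtain m where m: "h \<in> Sharp D \<longrightarrow> f \<in> Sharp D \<longrightarrow> m \<in> Sharp D" "\<And>x. App D m x = App D h x \<cdot> App D f x"
    using ex_scomb' by blast
  show ?thesis using m h assms by auto
qed

definition is_pair where "is_pair x y z \<longleftrightarrow> App D (Pr D) x \<cdot> Some y = Some z"

lemma pairing: "Pr D \<in> Sharp D" "Pr0 D \<in> Sharp D" "Pr1 D \<in> Sharp D"
  "pairing_combinators (App D) (Pr D) (Pr0 D) (Pr1 D)"
  using nested_pca unfolding is_nested_pca_def by blast+

lemma is_pair_ex: "\<exists>z. is_pair x y z"
  using pairing(4) unfolding pairing_combinators_def is_pair_def by blast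

lemma is_pair_proj: "is_pair x y z \<Longrightarrow> App D (Pr0 D) z = Some x \<and> App D (Pr1 D) z = Some y"
  using pairing(4) unfolding pairing_combinators_def is_pair_def by (metis option.inject)

lemma Pr_partial: "\<exists>m. App D (Pr D) x = Some m \<and> (x \<in> Sharp D \<longrightarrow> m \<in> Sharp D)"
proof -
  obtain z where "is_pair x x z" using is_pair_ex by blast
  then obtain m where "App D (Pr D) x = Some m"
    by (cases "App D (Pr D) x") (auto simp: is_pair_def oapp_def)
  then show ?thesis using Sharp_app pairing(1) by blast
qed

lemma is_pair_Sharp: "x \<in> Sharp D \<Longrightarrow> y \<in> Sharp D \<Longrightarrow> is_pair x y z \<Longrightarrow> z \<in> Sharp D"
  using Pr_partial[of x] Sharp_app by (metis is_pair_def oapp_Some(1))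

lemma ex_pair:
  assumes "f \<in> Sharp D" "g \<in> Sharp D"
  shows "\<exists>m \<in> Sharp D. \<forall>x y z. App D f x = Some y \<longrightarrow> App D g x = Some z \<longrightarrow>
    (\<exists>w. App D m x = Some w \<and> is_pair y z w)"
proof -
  obtain h where h: "h \<in> Sharp D" "\<And>x. App D h x = Some (Pr D) \<cdot> App D f x"
    using ex_comp[OF assms(1) pairing(1)] by blast
  obtain m where m: "h \<in> Sharp D \<longrightarrow> g \<in> Sharp D \<longrightarrow> m \<in> Sharp D" "\<And>x. App D m x = App D h x \<cdot> App D g x"
    using ex_scomb' by blast
  have "\<exists>w. App D m x = Some w \<and> is_pair y z w" if "App D f x = Some y" "App D g x = Some z" for x y z
    using is_pair_ex[of y z] that by (simp add: m(2) h(2) is_pair_def)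
  moreover have "m \<in> Sharp D" using m(1) h(1) assms(2) by blast
  ultimately show ?thesis by blast
qed

lemma ex_curry:
  assumes "t \<in> Sharp D"
  shows "\<exists>m \<in> Sharp D. \<forall>x. \<exists>c'. App D m x = Some c' \<and> (x \<in> Sharp D \<longrightarrow> c' \<in> Sharp D) \<and>
     (\<forall>a. \<exists>w. is_pair x a w \<and> App D c' a = App D t w)"
proof -
  obtain h where h: "h \<in> Sharp D" "\<And>x. App D h x = Some t" using ex_const'[of t] assms by blast
  obtain f where f: "App D ss h = Some f" using ex_scomb[of h h] by blast
  have fS: "f \<in> Sharp D" using f h kk_ss Sharp_app by blast
  obtain m where m: "m \<in> Sharp D" "\<And>x. App D m x = Some f \<cdot> App D (Pr D) x"
    using ex_comp[OF pairing(1) fS] by blast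
  have "\<exists>c'. App D m x = Some c' \<and> (x \<in> Sharp D \<longrightarrow> c' \<in> Sharp D) \<and>
     (\<forall>a. \<exists>w. is_pair x a w \<and> App D c' a = App D t w)" for x
  proof -
    obtain q where q: "App D (Pr D) x = Some q" "x \<in> Sharp D \<longrightarrow> q \<in> Sharp D" using Pr_partial by blast
    obtain c' where c': "App D f q = Some c'" "\<And>a. App D c' a = App D h a \<cdot> App D q a"
      using ex_scomb[of h q] f by auto
    have "App D m x = Some c'" using m q c' by simp
    moreover have "x \<in> Sharp D \<longrightarrow> c' \<in> Sharp D" using c' q fS Sharp_app by blast
    moreover have "\<exists>w. is_pair x a w \<and> App D c' a = App D t w" for a
      using is_pair_ex[of x a] by (auto simp: is_pair_def q c' h)
    ultimately show "\<exists>c'. App D m x = Some c' \<and> (x \<in> Sharp D \<longrightarrow> c' \<in> Sharp D) \<and>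
     (\<forall>a. \<exists>w. is_pair x a w \<and> App D c' a = App D t w)" by blast
  qed
  with m(1) show ?thesis by blast
qed

lemma ex_fixpoint:
  assumes "f \<in> Sharp D"
  shows "\<exists>F \<in> Sharp D. \<forall>u. App D F u = App D f F"
proof -
  obtain h where h: "h \<in> Sharp D" "\<And>x. App D h x = Some f" using ex_const'[of f] assms by blast
  obtain sh where sh: "App D ss h = Some sh" using ex_scomb[of h h] by blast
  have shS: "sh \<in> Sharp D" using sh h kk_ss Sharp_app by blast
  obtain sk where sk: "sk \<in> Sharp D" "\<And>x. App D sk x = Some ss \<cdot> App D kk x"
    using ex_comp[OF kk_ss(1,2)] by blast
  obtain d where d: "d \<in> Sharp D" "\<And>x. App D d x = App D sk x \<cdot> App D kk x"
    using ex_scomb'[of sk kk] sk kk_ss by blast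
  obtain W where W: "W \<in> Sharp D" "\<And>x. App D W x = Some sh \<cdot> App D d x" using ex_comp[OF d(1) shS] by blast
  have dw: "\<exists>e. App D d w = Some e \<and> (\<forall>u. App D e u = App D w w)" for w
  proof -
    obtain kw where kw: "App D kk w = Some kw" "\<And>x. App D kw x = Some w" using ex_const[of w] by blast
    obtain r e where r: "App D ss kw = Some r" "App D r kw = Some e" "\<And>x. App D e x = App D kw x \<cdot> App D kw x"
      using ex_scomb[of kw kw] by blast
    show ?thesis using kw r by (simp add: d sk)
  qed
  obtain e where e: "App D d W = Some e" "\<And>u. App D e u = App D W W" using dw by blast
  obtain F where F: "App D sh e = Some F" "\<And>x. App D F x = App D h x \<cdot> App D e x"
    using ex_scomb[of h e] sh by auto
  have WW: "App D W W = Some F" using W e F by simp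
  have "App D F u = App D f F" for u using F(2)[of u] by (simp add: h e WW)
  moreover have "F \<in> Sharp D" using WW W Sharp_app by blast
  ultimately show ?thesis by blast
qed

subsection \<open>Truth values\<close>

definition all_tv :: "'y set \<Rightarrow> ('y \<Rightarrow> 'a tval) \<Rightarrow> 'a tval" where
  "all_tv Y \<phi> = (\<Inter>y\<in>Y. fst (imp_tv D (top_tv D) (\<phi> y)),
     Sharp D \<inter> (\<Inter>y\<in>Y. snd (imp_tv D (top_tv D) (\<phi> y))))"

definition or_tv :: "'a tval \<Rightarrow> 'a tval \<Rightarrow> 'a tval" where
  "or_tv A B = all_tv (Sig D) (\<lambda>C. imp_tv D (imp_tv D A C) (imp_tv D (imp_tv D B C) C))"

definition bot_tv :: "'a tval" where "bot_tv = ({}, {})"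

lemma SigI: "snd A \<subseteq> Sharp D \<Longrightarrow> snd A \<subseteq> fst A \<Longrightarrow> A \<in> Sig D"
  by (cases A) (auto simp: Sig_def)

lemma SigD: "A \<in> Sig D \<Longrightarrow> a \<in> snd A \<Longrightarrow> a \<in> Sharp D" "A \<in> Sig D \<Longrightarrow> a \<in> snd A \<Longrightarrow> a \<in> fst A"
  by (auto simp: Sig_def)

lemma Sig_top [simp, intro]: "top_tv D \<in> Sig D" by (auto simp: top_tv_def Sig_def)
lemma Sig_bot [simp, intro]: "bot_tv \<in> Sig D" by (auto simp: bot_tv_def Sig_def)
lemma Sig_imp [simp, intro]: "imp_tv D A B \<in> Sig D" by (auto simp: imp_tv_def Sig_def)
lemma and_set_is_pair: "and_set D A B = {m. \<exists>x\<in>A. \<exists>y\<in>B. is_pair x y m}"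
  by (simp add: and_set_def is_pair_def)
lemma Sig_and [simp, intro]: "A \<in> Sig D \<Longrightarrow> B \<in> Sig D \<Longrightarrow> and_tv D A B \<in> Sig D"
proof (rule SigI)
  assume A: "A \<in> Sig D" and B: "B \<in> Sig D"
  show "snd (and_tv D A B) \<subseteq> Sharp D"
    using A B is_pair_Sharp SigD(1) unfolding and_tv_def and_set_is_pair snd_conv by blast
  show "snd (and_tv D A B) \<subseteq> fst (and_tv D A B)"
    using SigD(2)[OF A] SigD(2)[OF B] unfolding and_tv_def and_set_is_pair snd_conv fst_conv by blast
qed
lemma Sig_iff [simp, intro]: "iff_tv D A B \<in> Sig D" by (auto simp: iff_tv_def)
lemma Sig_ex [simp, intro]: "(\<And>y. y \<in> Y \<Longrightarrow> P y \<in> Sig D) \<Longrightarrow> ex_tv Y P \<in> Sig D"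
  unfolding ex_tv_def by (rule SigI; unfold fst_conv snd_conv; blast dest: SigD)
lemma Sig_all [simp, intro]: "all_tv Y P \<in> Sig D"
  unfolding all_tv_def by (rule SigI; unfold fst_conv snd_conv; blast dest: SigD(2)[OF Sig_imp])
lemma Sig_or [simp, intro]: "or_tv A B \<in> Sig D" unfolding or_tv_def by auto

subsection \<open>Truth at a stage\<close>

definition rs :: "bool \<Rightarrow> 'a tval \<Rightarrow> 'a set" where "rs b A = (if b then snd A else fst A)"

definition dm :: "('c, 'a) stage \<Rightarrow> 'c set" where
  "dm s = {c \<in> st_dom s. fl s c \<longrightarrow> rho s c \<in> Sharp D}"

definition T :: "('c, 'a) stage \<Rightarrow> ('c \<Rightarrow> 'a tval) \<Rightarrow> bool" where
  "T s P \<longleftrightarrow> (\<exists>t \<in> Sharp D. \<forall>c \<in> dm s. \<exists>y \<in> rs (fl s c) (P c). App D t (rho s c) = Some y)"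

definition sub :: "('d \<Rightarrow> 'c) \<Rightarrow> ('d, 'a) stage \<Rightarrow>
    ('c, 'a) stage \<Rightarrow> bool" where
  "sub \<pi> s' s \<longleftrightarrow> (\<forall>c \<in> dm s'. \<pi> c \<in> dm s \<and> (fl s' c \<longrightarrow> fl s (\<pi> c))) \<and>
     (\<exists>m \<in> Sharp D. \<forall>c \<in> dm s'. App D m (rho s' c) = Some (rho s (\<pi> c)))"

lemma dm_fl: "c \<in> dm s \<Longrightarrow> fl s c \<Longrightarrow> rho s c \<in> Sharp D" by (simp add: dm_def)

lemma T_cong: "(\<And>c. c \<in> dm s \<Longrightarrow> P c = Q c) \<Longrightarrow> T s P \<longleftrightarrow> T s Q"
  unfolding T_def by simp

lemma T_mono:
  assumes "T s P" "\<And>c. c \<in> dm s \<Longrightarrow> fst (P c) \<subseteq> fst (Q c) \<and> snd (P c) \<subseteq> snd (Q c)"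
  shows "T s Q"
proof -
  have "\<And>c. c \<in> dm s \<Longrightarrow> rs (fl s c) (P c) \<subseteq> rs (fl s c) (Q c)"
    using assms(2) by (auto simp: rs_def)
  then show ?thesis using assms(1) unfolding T_def by blast
qed

lemma T_top: "T s (\<lambda>c. top_tv D)"
proof -
  obtain m where m: "m \<in> Sharp D" "\<forall>x. App D m x = Some x" using ex_id by blast
  have "\<exists>y\<in>rs (fl s c) (top_tv D). App D m (rho s c) = Some y" if "c \<in> dm s" for c
    using dm_fl[OF that] m(2) by (auto simp: rs_def top_tv_def)
  with m(1) show ?thesis unfolding T_def by blast
qed

lemma rs_and: "rs b (and_tv D A B) = and_set D (rs b A) (rs b B)"
  by (simp add: rs_def and_tv_def)

lemma T_and: "T s (\<lambda>c. and_tv D (P c) (Q c)) \<longleftrightarrow> T s P \<and> T s Q"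
proof
  assume "T s (\<lambda>c. and_tv D (P c) (Q c))"
  then obtain t where t: "t \<in> Sharp D"
    "\<And>c. c \<in> dm s \<Longrightarrow> \<exists>y z w. y \<in> rs (fl s c) (P c) \<and> z \<in> rs (fl s c) (Q c) \<and> is_pair y z w \<and> App D t (rho s c) = Some w"
    unfolding T_def rs_and and_set_is_pair by blast
  obtain m where m: "m \<in> Sharp D" "\<forall>x. App D m x = Some (Pr0 D) \<cdot> App D t x" using ex_comp[OF t(1) pairing(2)] by blast
  obtain d where d: "d \<in> Sharp D" "\<forall>x. App D d x = Some (Pr1 D) \<cdot> App D t x" using ex_comp[OF t(1) pairing(3)] by blast
  have "\<exists>y\<in>rs (fl s c) (P c). App D m (rho s c) = Some y" if "c \<in> dm s" for c
    using t(2)[OF that] by (auto simp: m dest!: is_pair_proj)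
  moreover have "\<exists>y\<in>rs (fl s c) (Q c). App D d (rho s c) = Some y" if "c \<in> dm s" for c
    using t(2)[OF that] by (auto simp: d dest!: is_pair_proj)
  ultimately show "T s P \<and> T s Q" using m(1) d(1) unfolding T_def by blast
next
  assume "T s P \<and> T s Q"
  then obtain t u where t: "t \<in> Sharp D" "\<forall>c \<in> dm s. \<exists>y \<in> rs (fl s c) (P c). App D t (rho s c) = Some y"
    and u: "u \<in> Sharp D" "\<forall>c \<in> dm s. \<exists>y \<in> rs (fl s c) (Q c). App D u (rho s c) = Some y"
    unfolding T_def by blast
  obtain m where m: "m \<in> Sharp D" "\<And>x y z. App D t x = Some y \<Longrightarrow> App D u x = Some z \<Longrightarrow>
      \<exists>w. App D m x = Some w \<and> is_pair y z w"
    using ex_pair[OF t(1) u(1)] by blast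
  have "\<exists>w\<in>rs (fl s c) (and_tv D (P c) (Q c)). App D m (rho s c) = Some w" if k: "c \<in> dm s" for c
  proof -
    obtain y z where yz: "y \<in> rs (fl s c) (P c)" "App D t (rho s c) = Some y"
      "z \<in> rs (fl s c) (Q c)" "App D u (rho s c) = Some z" using t(2) u(2) k by blast
    show ?thesis using m(2)[OF yz(2,4)] yz(1,3) unfolding rs_and and_set_is_pair by blast
  qed
  then show "T s (\<lambda>c. and_tv D (P c) (Q c))" using m(1) unfolding T_def by blast
qed

lemma T_ex: "T s (\<lambda>c. ex_tv (Y c) (P c)) \<longleftrightarrow> (\<exists>y. (\<forall>c\<in>dm s. y c \<in> Y c) \<and> T s (\<lambda>c. P c (y c)))"
proof -
  have rs_ex: "rs b (ex_tv Y' P') = (\<Union>y\<in>Y'. rs b (P' y))" for b and Y' and P' :: "_ \<Rightarrow> 'a tval"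
    by (simp add: rs_def ex_tv_def)
  show ?thesis
  proof
    assume "T s (\<lambda>c. ex_tv (Y c) (P c))"
    then obtain t where t: "t \<in> Sharp D"
      "\<forall>c\<in>dm s. \<exists>y. y \<in> Y c \<and> (\<exists>z\<in>rs (fl s c) (P c y). App D t (rho s c) = Some z)"
      unfolding T_def rs_ex by blast
    from bchoice[OF t(2)] obtain y where
      y: "\<forall>c\<in>dm s. y c \<in> Y c \<and> (\<exists>z\<in>rs (fl s c) (P c (y c)). App D t (rho s c) = Some z)" ..
    then have "T s (\<lambda>c. P c (y c))" unfolding T_def using t(1) by (intro bexI[of _ t]) auto
    with y show "\<exists>y. (\<forall>c\<in>dm s. y c \<in> Y c) \<and> T s (\<lambda>c. P c (y c))"
      by (intro exI[of _ y]) simp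
  next
    assume "\<exists>y. (\<forall>c\<in>dm s. y c \<in> Y c) \<and> T s (\<lambda>c. P c (y c))"
    then obtain y where y: "\<forall>c\<in>dm s. y c \<in> Y c" "T s (\<lambda>c. P c (y c))" by blast
    from y(2) show "T s (\<lambda>c. ex_tv (Y c) (P c))"
      by (rule T_mono) (use y(1) in \<open>auto simp: ex_tv_def\<close>)
  qed
qed

lemma T_exI: "(\<And>c. c \<in> dm s \<Longrightarrow> y c \<in> Y c) \<Longrightarrow> T s (\<lambda>c. P c (y c)) \<Longrightarrow> T s (\<lambda>c. ex_tv (Y c) (P c))"
  by (subst T_ex) (intro exI[of _ y], simp)

lemma T_exE:
  assumes "T s (\<lambda>c. ex_tv (Y c) (P c))"
  obtains y where "\<And>c. c \<in> dm s \<Longrightarrow> y c \<in> Y c" "T s (\<lambda>c. P c (y c))"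
proof -
  from assms have "\<exists>y. (\<forall>c\<in>dm s. y c \<in> Y c) \<and> T s (\<lambda>c. P c (y c))" by (subst (asm) T_ex)
  with that show ?thesis by auto
qed

lemma T_mp:
  assumes "T s (\<lambda>c. imp_tv D (P c) (Q c))" "T s P"
  shows "T s Q"
proof -
  obtain t u where t: "t \<in> Sharp D"
     "\<forall>c \<in> dm s. \<exists>y \<in> rs (fl s c) (imp_tv D (P c) (Q c)). App D t (rho s c) = Some y"
    and u: "u \<in> Sharp D" "\<forall>c \<in> dm s. \<exists>y \<in> rs (fl s c) (P c). App D u (rho s c) = Some y"
    using assms unfolding T_def by blast
  obtain m where m: "m \<in> Sharp D" "\<And>x. App D m x = App D t x \<cdot> App D u x"
    using ex_scomb'[of t u] t u by blast
  have "\<exists>y\<in>rs (fl s c) (Q c). App D m (rho s c) = Some y" if k: "c \<in> dm s" for c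
  proof -
    obtain f a where "f \<in> rs (fl s c) (imp_tv D (P c) (Q c))" "App D t (rho s c) = Some f"
      "a \<in> rs (fl s c) (P c)" "App D u (rho s c) = Some a" using t u k by blast
    then show ?thesis
      by (cases "fl s c") (auto simp: m rs_def imp_tv_def imp_set_def)
  qed
  then show ?thesis using m(1) unfolding T_def by blast
qed

lemma T_allE:
  assumes "T s (\<lambda>c. all_tv (Y c) (P c))" "\<And>c. c \<in> dm s \<Longrightarrow> y c \<in> Y c"
  shows "T s (\<lambda>c. P c (y c))"
proof -
  have "T s (\<lambda>c. imp_tv D (top_tv D) (P c (y c)))"
    using assms(1) by (rule T_mono) (use assms(2) in \<open>auto simp: all_tv_def\<close>)
  then show ?thesis using T_top by (rule T_mp)
qed

lemma T_sub:
  assumes "sub \<pi> s' s" "T s P" "\<And>c. c \<in> dm s \<Longrightarrow> P c \<in> Sig D"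
  shows "T s' (\<lambda>c. P (\<pi> c))"
proof -
  obtain t where t: "t \<in> Sharp D"
     "\<forall>c \<in> dm s. \<exists>y \<in> rs (fl s c) (P c). App D t (rho s c) = Some y"
    using assms unfolding T_def by blast
  obtain m where m: "m \<in> Sharp D" "\<forall>c \<in> dm s'. App D m (rho s' c) = Some (rho s (\<pi> c))"
    using assms(1) unfolding sub_def by blast
  obtain d where d: "d \<in> Sharp D" "\<And>x. App D d x = Some t \<cdot> App D m x" using ex_comp[OF m(1) t(1)] by blast
  have "\<exists>y\<in>rs (fl s' c) (P (\<pi> c)). App D d (rho s' c) = Some y" if k: "c \<in> dm s'" for c
  proof -
    have k': "\<pi> c \<in> dm s" and f: "fl s' c \<longrightarrow> fl s (\<pi> c)" using assms(1) k unfolding sub_def by auto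
    obtain y where "y \<in> rs (fl s (\<pi> c)) (P (\<pi> c))" "App D t (rho s (\<pi> c)) = Some y" using t(2) k' by blast
    moreover have "rs (fl s (\<pi> c)) (P (\<pi> c)) \<subseteq> rs (fl s' c) (P (\<pi> c))"
      using f SigD(2)[OF assms(3)[OF k']] by (auto simp: rs_def split: if_splits)
    ultimately show ?thesis using m(2) k by (auto simp: d)
  qed
  then show ?thesis using d(1) unfolding T_def by blast
qed

lemma sub_dm: "sub \<pi> s' s \<Longrightarrow> c \<in> dm s' \<Longrightarrow> \<pi> c \<in> dm s"
  by (simp add: sub_def)

lemma T_entails:
  assumes "entails D I \<phi> \<psi>" "\<And>c. c \<in> dm s \<Longrightarrow> x c \<in> I" "T s (\<lambda>c. \<phi> (x c))"
  shows "T s (\<lambda>c. \<psi> (x c))"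
proof (cases "I = {}")
  case True
  then show ?thesis using assms(2) kk_ss(1) unfolding T_def by auto
next
  case False
  obtain a where a: "\<And>i. i \<in> I \<Longrightarrow> a \<in> snd (imp_tv D (\<phi> i) (\<psi> i))"
    using assms(1) unfolding entails_def by blast
  have aS: "a \<in> Sharp D" using a False by (auto simp: imp_tv_def)
  obtain t where t: "t \<in> Sharp D"
     "\<forall>c \<in> dm s. \<exists>y \<in> rs (fl s c) (\<phi> (x c)). App D t (rho s c) = Some y"
    using assms(3) unfolding T_def by blast
  obtain m where m: "m \<in> Sharp D" "\<And>x. App D m x = Some a \<cdot> App D t x" using ex_comp[OF t(1) aS] by blast
  have "\<exists>y\<in>rs (fl s c) (\<psi> (x c)). App D m (rho s c) = Some y" if k: "c \<in> dm s" for c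
  proof -
    obtain y where "y \<in> rs (fl s c) (\<phi> (x c))" "App D t (rho s c) = Some y" using t k by blast
    then show ?thesis using a[OF assms(2)[OF k]]
      by (cases "fl s c") (auto simp: m rs_def imp_tv_def imp_set_def)
  qed
  then show ?thesis using m(1) unfolding T_def by blast
qed

end

locale universe = nested D for D :: "'a nested_pca" +
  fixes pr :: "'u \<Rightarrow> 'u \<Rightarrow> 'u" and pf ps :: "'u \<Rightarrow> 'u"
  assumes pr_simps [simp]: "pf (pr x y) = x" "ps (pr x y) = y" "pr (pf u) (ps u) = u"
    and universe: "set_universe TYPE('u)"
    and card_pca: "|UNIV :: 'a set| <o |UNIV :: 'u set|"
begin

lemma pr_eq_iff [simp]: "pr x y = pr x' y' \<longleftrightarrow> x = x' \<and> y = y'"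
  by (metis pr_simps(1,2))

lemma emb_stage:
  fixes s' :: "('c, 'a) stage" and g :: "'c \<Rightarrow> 'd"
  assumes "inj_on g (dm s')"
  shows "\<exists>(s :: ('d, 'a) stage) h. sub h s s' \<and> (\<forall>P. T s (\<lambda>c. P (h c)) \<longrightarrow> T s' P)"
proof -
  define h where "h = inv_into (dm s') g"
  define s where "s = Stage (g ` dm s') (rho s' \<circ> h) (fl s' \<circ> h)"
  have h: "h (g c) = c" if "c \<in> dm s'" for c
    using that assms by (simp add: h_def)
  have dm: "dm s = g ` dm s'"
    using dm_fl[of _ s'] by (auto simp: s_def dm_def[of "Stage _ _ _"] h)
  obtain m where m: "m \<in> Sharp D" "\<forall>x. App D m x = Some x" using ex_id by blast
  have "sub h s s'"
    unfolding sub_def dm using m by (intro conjI ballI bexI[of _ m]) (auto simp: h s_def)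
  moreover have "T s' P" if "T s (\<lambda>c. P (h c))" for P
  proof -
    from that obtain t where t: "t \<in> Sharp D"
      "\<forall>c\<in>dm s. \<exists>y\<in>rs (fl s c) (P (h c)). App D t (rho s c) = Some y" unfolding T_def by blast
    have "\<exists>y\<in>rs (fl s' c) (P c). App D t (rho s' c) = Some y" if "c \<in> dm s'" for c
      using t(2)[unfolded dm, rule_format, OF imageI[OF that]] by (simp add: h[OF that] s_def)
    with t(1) show ?thesis unfolding T_def by (intro bexI[of _ t]) auto
  qed
  ultimately show ?thesis by (intro exI[of _ s] exI[of _ h]) simp
qed

lemma sub_trans: 
  assumes "sub p s2 s1" "sub q s1 s0"
  shows "sub (\<lambda>c. q (p c)) s2 s0"
proof -
  obtain m d where m: "m \<in> Sharp D" "\<forall>c \<in> dm s2. App D m (rho s2 c) = Some (rho s1 (p c))"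
    and d: "d \<in> Sharp D" "\<forall>c \<in> dm s1. App D d (rho s1 c) = Some (rho s0 (q c))"
    using assms unfolding sub_def by blast
  obtain e where e: "e \<in> Sharp D" "\<forall>x. App D e x = Some d \<cdot> App D m x" using ex_comp[OF m(1) d(1)] by blast
  have "\<forall>c \<in> dm s2. App D e (rho s2 c) = Some (rho s0 (q (p c)))"
    using m(2) d(2) sub_dm[OF assms(1)] by (simp add: e)
  then show ?thesis using assms e(1) unfolding sub_def by blast
qed

lemma emb_pca: "\<exists>i :: 'a \<Rightarrow> 'u. inj i"
  using card_pca card_of_ordLeq[of "UNIV :: 'a set" "UNIV :: 'u set"] ordLess_imp_ordLeq by blast

lemma two_points: "\<exists>a b :: 'u. a \<noteq> b"
proof (rule ccontr)
  assume "\<not> ?thesis"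
  then have "UNIV = {undefined :: 'u}" by auto
  then have "finite (UNIV :: 'u set)" by (metis finite.emptyI finite.insertI)
  with universe show False by (simp add: set_universe_def)
qed

lemma emb_ext:
  fixes g :: "'i \<Rightarrow> 'u"
  assumes "inj_on g I"
  shows "\<exists>h :: 'i \<times> bool \<times> 'a \<Rightarrow> 'u. inj_on h (I \<times> UNIV)"
proof -
  obtain i :: "'a \<Rightarrow> 'u" where i: "inj i" using emb_pca by blast
  obtain a b :: 'u where ab: "a \<noteq> b" using two_points by blast
  define h where "h = (\<lambda>(k, f, x). pr (g k) (pr (if f then a else b) (i x)))"
  have "inj_on h (I \<times> UNIV)"
  proof (rule inj_onI)
    fix p q assume p: "p \<in> I \<times> UNIV" and q: "q \<in> I \<times> UNIV" and e: "h p = h q"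
    obtain k f x k' f' x' where pq: "p = (k, f, x)" "q = (k', f', x')" by (metis prod_cases3)
    have "pf (h p) = pf (h q)" "pf (ps (h p)) = pf (ps (h q))" "ps (ps (h p)) = ps (ps (h q))"
      using e by simp_all
    then have "g k = g k'" "f = f'" "i x = i x'"
      using ab by (simp_all add: h_def pq split: if_splits)
    then show "p = q" using p q assms i by (simp add: pq inj_on_eq_iff inj_eq)
  qed
  then show ?thesis by blast
qed

text \<open>It suffices to test an implication at the generic stage over \<open>s\<close>, whose points are the points
  of \<open>s\<close> paired with the realizers of the premise, one copy for each flag.\<close>

lemma T_impI:
  fixes s :: "('u, 'a) stage"
  assumes Sg: "\<And>c. c \<in> dm s \<Longrightarrow> P c \<in> Sig D"
    and st: "\<And>(s' :: ('u, 'a) stage) \<pi>. sub \<pi> s' s \<Longrightarrow> T s' (\<lambda>c. P (\<pi> c)) \<Longrightarrow> T s' (\<lambda>c. Q (\<pi> c))"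
  shows "T s (\<lambda>c. imp_tv D (P c) (Q c))"
proof -
  define w where "w x y = (SOME z. is_pair x y z)" for x y
  have w: "is_pair x y (w x y)" for x y unfolding w_def by (rule someI_ex[OF is_pair_ex])
  define s1 :: "('u \<times> bool \<times> 'a, 'a) stage" where "s1 = Stage {(c, b, a). c \<in> dm s \<and> (b \<longrightarrow> fl s c) \<and> a \<in> rs b (P c)}
    (\<lambda>(c, b, a). w (rho s c) a) (\<lambda>(c, b, a). b)"
  have dm1: "dm s1 = {(c, b, a). c \<in> dm s \<and> (b \<longrightarrow> fl s c) \<and> a \<in> rs b (P c)}"
  proof -
    have "w (rho s c) a \<in> Sharp D" if "c \<in> dm s" "fl s c" "a \<in> snd (P c)" for c a
      using is_pair_Sharp[OF dm_fl[OF that(1,2)] SigD(1)[OF Sg[OF that(1)] that(3)] w] .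
    then show ?thesis unfolding s1_def dm_def[of "Stage _ _ _"] by (auto simp: rs_def)
  qed
  have rho1: "rho s1 (c, b, a) = w (rho s c) a" and fl1: "fl s1 (c, b, a) = b" for c b a
    by (simp_all add: s1_def)
  have sub1: "sub fst s1 s"
    unfolding sub_def dm1 using pairing(2) is_pair_proj[OF w]
    by (intro conjI ballI bexI[of _ "Pr0 D"]) (auto simp: rho1 fl1)
  have "T s1 (\<lambda>c. P (fst c))"
    unfolding T_def dm1 using pairing(3) is_pair_proj[OF w]
    by (intro bexI[of _ "Pr1 D"]) (auto simp: rho1 fl1)
  moreover obtain g :: "'u \<times> bool \<times> 'a \<Rightarrow> 'u" where "inj_on g (UNIV \<times> UNIV)" using emb_ext[of id UNIV] by auto
  then have "inj_on g (dm s1)" by (rule inj_on_subset) simp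
  from emb_stage[OF this] obtain s2 :: "('u, 'a) stage" and h
    where h: "sub h s2 s1" "\<And>P. T s2 (\<lambda>c. P (h c)) \<Longrightarrow> T s1 P"
    by blast
  ultimately have "T s2 (\<lambda>c. P (fst (h c)))"
    using T_sub[OF h(1), of "\<lambda>c. P (fst c)"] Sg dm1 by auto
  then have "T s2 (\<lambda>c. Q (fst (h c)))" using sub_trans[OF h(1) sub1] by (intro st)
  then have "T s1 (\<lambda>c. Q (fst c))" by (rule h(2))
  then obtain t where t: "t \<in> Sharp D" "\<forall>c\<in>dm s1. \<exists>y\<in>rs (fl s1 c) (Q (fst c)). App D t (rho s1 c) = Some y"
    unfolding T_def by blast
  have t': "\<exists>y\<in>rs b (Q c). App D t (w (rho s c) a) = Some y"
    if "c \<in> dm s" "b \<longrightarrow> fl s c" "a \<in> rs b (P c)" for c b a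
    using t(2)[rule_format, of "(c, b, a)"] that unfolding dm1 by (simp add: rho1 fl1)
  obtain m where m: "m \<in> Sharp D" "\<And>x. \<exists>c'. App D m x = Some c' \<and> (x \<in> Sharp D \<longrightarrow> c' \<in> Sharp D) \<and>
     (\<forall>a. \<exists>w. is_pair x a w \<and> App D c' a = App D t w)" using ex_curry[OF t(1)] by blast
  have "\<exists>y\<in>rs (fl s c) (imp_tv D (P c) (Q c)). App D m (rho s c) = Some y" if k: "c \<in> dm s" for c
  proof -
    obtain c' where c': "App D m (rho s c) = Some c'" "rho s c \<in> Sharp D \<longrightarrow> c' \<in> Sharp D"
      "\<And>a. \<exists>w. is_pair (rho s c) a w \<and> App D c' a = App D t w" using m(2) by blast
    have app: "App D c' a = App D t (w (rho s c) a)" for a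
      using c'(3)[of a] w[of "rho s c" a] by (auto simp: is_pair_def)
    have "c' \<in> imp_set D (rs b (P c)) (rs b (Q c))" if "b \<longrightarrow> fl s c" for b
      using t'[OF k that] by (simp add: imp_set_def app)
    from this[of True] this[of False] have "c' \<in> rs (fl s c) (imp_tv D (P c) (Q c))"
      using c'(2) dm_fl[OF k] by (auto simp: rs_def imp_tv_def)
    with c'(1) show ?thesis by blast
  qed
  then show ?thesis unfolding T_def using m(1) by (intro bexI[of _ m]) auto
qed

lemma T_allI:
  fixes s :: "('u, 'a) stage" and g :: "'y \<Rightarrow> 'u"
  assumes g: "inj_on g (\<Union>c\<in>dm s. Y c)"
    and Sg: "\<And>c y. c \<in> dm s \<Longrightarrow> y \<in> Y c \<Longrightarrow> P c y \<in> Sig D"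
    and st: "\<And>(s' :: ('u, 'a) stage) \<pi> y. sub \<pi> s' s \<Longrightarrow>
      (\<And>c. c \<in> dm s' \<Longrightarrow> y c \<in> Y (\<pi> c)) \<Longrightarrow> T s' (\<lambda>c. P (\<pi> c) (y c))"
  shows "T s (\<lambda>c. all_tv (Y c) (P c))"
proof -
  define s1 :: "('u \<times> 'y, 'a) stage" where "s1 = Stage (SIGMA c:dm s. Y c) (rho s \<circ> fst) (fl s \<circ> fst)"
  have dm1: "dm s1 = (SIGMA c:dm s. Y c)"
    unfolding s1_def dm_def[of "Stage _ _ _"] using dm_fl[of _ s] by auto
  have dmY: "snd k \<in> Y (fst k)" if "k \<in> dm s1" for k using that unfolding dm1 by auto
  have rho1: "rho s1 k = rho s (fst k)" and fl1: "fl s1 k = fl s (fst k)" for k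
    by (simp_all add: s1_def)
  obtain i where i: "i \<in> Sharp D" "\<forall>x. App D i x = Some x" using ex_id by blast
  have sub1: "sub fst s1 s"
    unfolding sub_def dm1 using i by (intro conjI ballI bexI[of _ i]) (auto simp: rho1 fl1)
  have "inj_on (\<lambda>k. pr (fst k) (g (snd k))) (dm s1)"
  proof (rule inj_onI)
    fix k l assume k: "k \<in> dm s1" "l \<in> dm s1" and e: "pr (fst k) (g (snd k)) = pr (fst l) (g (snd l))"
    have "fst k = fst l" "g (snd k) = g (snd l)"
      using arg_cong[OF e, of pf] arg_cong[OF e, of ps] by simp_all
    moreover have "snd k \<in> (\<Union>c\<in>dm s. Y c)" "snd l \<in> (\<Union>c\<in>dm s. Y c)" using k dm1 by auto
    ultimately show "k = l" using g by (simp add: prod_eq_iff inj_on_eq_iff)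
  qed
  from emb_stage[OF this] obtain s2 :: "('u, 'a) stage" and h
    where h: "sub h s2 s1" "\<And>P. T s2 (\<lambda>c. P (h c)) \<Longrightarrow> T s1 P"
    by blast
  have "T s2 (\<lambda>c. P (fst (h c)) (snd (h c)))"
    by (intro st[OF sub_trans[OF h(1) sub1]]) (rule dmY[OF sub_dm[OF h(1)]])
  then have "T s1 (\<lambda>c. P (fst c) (snd c))" by (rule h(2))
  then obtain t where t: "t \<in> Sharp D" "\<forall>c\<in>dm s1. \<exists>y\<in>rs (fl s1 c) (P (fst c) (snd c)). App D t (rho s1 c) = Some y"
    unfolding T_def by blast
  have t': "\<exists>z\<in>rs (fl s c) (P c y). App D t (rho s c) = Some z"
    if "c \<in> dm s" "y \<in> Y c" for c y
    using t(2)[rule_format, of "(c, y)"] that unfolding dm1 by (simp add: rho1 fl1)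
  obtain u where u: "u \<in> Sharp D" "\<And>x. App D u x = Some t \<cdot> App D (Pr0 D) x"
    using ex_comp[OF pairing(2) t(1)] by blast
  obtain m where m: "m \<in> Sharp D" "\<And>x. \<exists>c'. App D m x = Some c' \<and> (x \<in> Sharp D \<longrightarrow> c' \<in> Sharp D) \<and>
     (\<forall>a. \<exists>w. is_pair x a w \<and> App D c' a = App D u w)" using ex_curry[OF u(1)] by blast
  have "\<exists>y\<in>rs (fl s c) (all_tv (Y c) (P c)). App D m (rho s c) = Some y" if k: "c \<in> dm s" for c
  proof -
    obtain c' where c': "App D m (rho s c) = Some c'" "rho s c \<in> Sharp D \<longrightarrow> c' \<in> Sharp D"
      "\<And>a. \<exists>w. is_pair (rho s c) a w \<and> App D c' a = App D u w" using m(2) by blast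
    have app: "App D c' a = App D t (rho s c)" for a
      using c'(3)[of a] is_pair_proj by (auto simp: u)
    have z: "\<exists>z. z \<in> rs (fl s c) (P c y) \<and> z \<in> fst (P c y) \<and> App D t (rho s c) = Some z" if "y \<in> Y c" for y
      using t'[OF k that] SigD(2)[OF Sg[OF k that]] by (auto simp: rs_def split: if_splits)
    have "c' \<in> rs (fl s c) (imp_tv D (top_tv D) (P c y))" if "y \<in> Y c" for y
      using z[OF that] c'(2) dm_fl[OF k] unfolding imp_tv_def imp_set_def rs_def by (auto simp: app)
    then have "c' \<in> rs (fl s c) (all_tv (Y c) (P c))"
      using c'(2) dm_fl[OF k] by (auto simp: rs_def all_tv_def)
    with c'(1) show ?thesis by blast
  qed
  then show ?thesis unfolding T_def using m(1) by (intro bexI[of _ m]) auto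
qed

lemma entailsI:
  fixes g :: "'i \<Rightarrow> 'u"
  assumes g: "inj_on g I" and Sg: "\<And>i. i \<in> I \<Longrightarrow> \<phi> i \<in> Sig D"
    and st: "\<And>(s :: ('u, 'a) stage) x. (\<And>c. c \<in> dm s \<Longrightarrow> x c \<in> I) \<Longrightarrow>
      T s (\<lambda>c. \<phi> (x c)) \<Longrightarrow> T s (\<lambda>c. \<psi> (x c))"
  shows "entails D I \<phi> \<psi>"
proof -
  define s1 :: "('i \<times> bool \<times> 'a, 'a) stage" where "s1 = Stage {(i, b, a). i \<in> I \<and> a \<in> rs b (\<phi> i)} (\<lambda>(i, b, a). a) (\<lambda>(i, b, a). b)"
  have dm1: "dm s1 = {(i, b, a). i \<in> I \<and> a \<in> rs b (\<phi> i)}"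
    unfolding s1_def dm_def[of "Stage _ _ _"] using SigD(1)[OF Sg] by (auto simp: rs_def)
  have rho1: "rho s1 (i, b, a) = a" and fl1: "fl s1 (i, b, a) = b" for i b a
    by (simp_all add: s1_def)
  have dmI: "fst k \<in> I" if "k \<in> dm s1" for k using that unfolding dm1 by auto
  obtain m where m: "m \<in> Sharp D" "\<forall>x. App D m x = Some x" using ex_id by blast
  have T1: "T s1 (\<lambda>c. \<phi> (fst c))"
    unfolding T_def dm1 using m by (intro bexI[of _ m]) (auto simp: rho1 fl1)
  obtain g' :: "'i \<times> bool \<times> 'a \<Rightarrow> 'u" where "inj_on g' (I \<times> UNIV)" using emb_ext[OF g] by auto
  then have "inj_on g' (dm s1)" by (rule inj_on_subset) (auto simp: dm1)
  from emb_stage[OF this] obtain s2 :: "('u, 'a) stage" and h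
    where h: "sub h s2 s1" "\<And>P. T s2 (\<lambda>c. P (h c)) \<Longrightarrow> T s1 P"
    by blast
  have "T s2 (\<lambda>c. \<phi> (fst (h c)))"
    by (rule T_sub[OF h(1) T1]) (rule Sg[OF dmI])
  then have "T s2 (\<lambda>c. \<psi> (fst (h c)))" by (intro st) (rule dmI[OF sub_dm[OF h(1)]])
  then have "T s1 (\<lambda>c. \<psi> (fst c))" by (rule h(2))
  then obtain t where t: "t \<in> Sharp D" "\<forall>c\<in>dm s1. \<exists>y\<in>rs (fl s1 c) (\<psi> (fst c)). App D t (rho s1 c) = Some y"
    unfolding T_def by blast
  have t': "\<exists>y\<in>rs b (\<psi> i). App D t a = Some y" if "i \<in> I" "a \<in> rs b (\<phi> i)" for i b a
    using t(2)[rule_format, of "(i, b, a)"] that unfolding dm1 by (simp add: rho1 fl1)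
  have "t \<in> snd (imp_tv D (\<phi> i) (\<psi> i))" if "i \<in> I" for i
    using t'[OF that, of _ False] t'[OF that, of _ True] t(1)
    by (simp add: imp_tv_def imp_set_def rs_def)
  then show ?thesis unfolding entails_def by blast
qed

subsection \<open>Objects and arrows at a stage\<close>

definition el :: "('u, 'a) stage \<Rightarrow> 'u set \<Rightarrow> ('u \<Rightarrow> 'u) set" where
  "el s X = {x. \<forall>c \<in> dm s. x c \<in> X}"

definition rl :: "('u, 'a) stage \<Rightarrow> ('u, 'a) rt_obj \<Rightarrow> ('u, 'a) rt_obj \<Rightarrow> ('u, 'a) rt_rel \<Rightarrow>
    ('u \<Rightarrow> 'u) \<Rightarrow> ('u \<Rightarrow> 'u) \<Rightarrow> bool" where
  "rl s A B F x y \<longleftrightarrow> x \<in> el s (fst A) \<and> y \<in> el s (fst B) \<and> T s (\<lambda>c. F (x c) (y c))"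

definition eqv :: "('u, 'a) stage \<Rightarrow> ('u, 'a) rt_obj \<Rightarrow> ('u \<Rightarrow> 'u) \<Rightarrow> ('u \<Rightarrow> 'u) \<Rightarrow> bool" where
  "eqv s A x y \<longleftrightarrow> x \<in> el s (fst A) \<and> y \<in> el s (fst A) \<and> T s (\<lambda>c. snd A (x c) (y c))"

lemma elD: "x \<in> el s X \<Longrightarrow> c \<in> dm s \<Longrightarrow> x c \<in> X" by (simp add: el_def)

lemma el_sub: "sub \<pi> s' s \<Longrightarrow> x \<in> el s X \<Longrightarrow> (\<lambda>c. x (\<pi> c)) \<in> el s' X"
  by (simp add: el_def sub_def)

definition sig2 where "sig2 X Y F \<longleftrightarrow> (\<forall>x\<in>X. \<forall>y\<in>Y. F x y \<in> Sig D)"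

lemma sig2D: "sig2 X Y F \<Longrightarrow> x \<in> X \<Longrightarrow> y \<in> Y \<Longrightarrow> F x y \<in> Sig D" by (simp add: sig2_def)

lemma rl_sub:
  assumes "sub \<pi> s' s" "sig2 (fst A) (fst B) F" "rl s A B F x y"
  shows "rl s' A B F (\<lambda>c. x (\<pi> c)) (\<lambda>c. y (\<pi> c))"
proof -
  have "T s' (\<lambda>c. F (x (\<pi> c)) (y (\<pi> c)))"
    by (rule T_sub[OF assms(1)]) (use assms(3) in \<open>auto simp: rl_def dest: elD intro: sig2D[OF assms(2)]\<close>)
  then show ?thesis using assms el_sub by (simp add: rl_def)
qed

lemma inj_pr: "inj_on (\<lambda>(x, y). pr x y) S"
  by (auto simp: inj_on_def)

lemma inj_pr3: "inj_on (\<lambda>(x, y, z). pr x (pr y z)) S"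
  by (auto simp: inj_on_def)

lemma inj_pr4: "inj_on (\<lambda>((x, y), (z, w)). pr (pr x y) (pr z w)) S"
  by (auto simp: inj_on_def)

lemma T_entails2:
  assumes "entails D (X \<times> Y) (\<lambda>(x, y). \<phi> x y) (\<lambda>(x, y). \<psi> x y)" "x \<in> el s X" "y \<in> el s Y"
    "T s (\<lambda>c. \<phi> (x c) (y c))"
  shows "T s (\<lambda>c. \<psi> (x c) (y c))"
proof -
  have "T s (\<lambda>c. (\<lambda>(x, y). \<psi> x y) (x c, y c))"
    by (rule T_entails[OF assms(1)]) (use assms(2-) in \<open>simp_all add: el_def\<close>)
  then show ?thesis by simp
qed

lemma T_entails3:
  assumes "entails D (X \<times> Y \<times> Z) (\<lambda>(x, y, z). \<phi> x y z) (\<lambda>(x, y, z). \<psi> x y z)"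
    "x \<in> el s X" "y \<in> el s Y" "z \<in> el s Z" "T s (\<lambda>c. \<phi> (x c) (y c) (z c))"
  shows "T s (\<lambda>c. \<psi> (x c) (y c) (z c))"
proof -
  have "T s (\<lambda>c. (\<lambda>(x, y, z). \<psi> x y z) (x c, y c, z c))"
    by (rule T_entails[OF assms(1)]) (use assms(2-) in \<open>simp_all add: el_def\<close>)
  then show ?thesis by simp
qed

lemma T_entails4:
  assumes "entails D ((X \<times> Y) \<times> (Z \<times> W)) (\<lambda>((x, y), (z, w)). \<phi> x y z w) (\<lambda>((x, y), (z, w)). \<psi> x y z w)"
    "x \<in> el s X" "y \<in> el s Y" "z \<in> el s Z" "w \<in> el s W" "T s (\<lambda>c. \<phi> (x c) (y c) (z c) (w c))"
  shows "T s (\<lambda>c. \<psi> (x c) (y c) (z c) (w c))"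
proof -
  have "T s (\<lambda>c. (\<lambda>((x, y), (z, w)). \<psi> x y z w) ((x c, y c), (z c, w c)))"
    by (rule T_entails[OF assms(1)]) (use assms(2-) in \<open>simp_all add: el_def\<close>)
  then show ?thesis by simp
qed

lemma entails2I:
  assumes sg: "\<And>x y. x \<in> X \<Longrightarrow> y \<in> Y \<Longrightarrow> \<phi> x y \<in> Sig D"
    and st: "\<And>s x y. x \<in> el s X \<Longrightarrow> y \<in> el s Y \<Longrightarrow> T s (\<lambda>c. \<phi> (x c) (y c)) \<Longrightarrow> T s (\<lambda>c. \<psi> (x c) (y c))"
  shows "entails D (X \<times> Y) (\<lambda>(x, y). \<phi> x y) (\<lambda>(x, y). \<psi> x y)"
proof (rule entailsI[OF inj_pr])
  fix s :: "('u, 'a) stage" and k :: "'u \<Rightarrow> 'u \<times> 'u"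
  assume k: "\<And>c. c \<in> dm s \<Longrightarrow> k c \<in> X \<times> Y" "T s (\<lambda>c. case k c of (x, y) \<Rightarrow> \<phi> x y)"
  show "T s (\<lambda>c. case k c of (x, y) \<Rightarrow> \<psi> x y)"
    using st[of "\<lambda>c. fst (k c)" s "\<lambda>c. snd (k c)"] k by (simp add: case_prod_unfold el_def mem_Times_iff)
qed (use sg in auto)

lemma entails3I:
  assumes sg: "\<And>x y z. x \<in> X \<Longrightarrow> y \<in> Y \<Longrightarrow> z \<in> Z \<Longrightarrow> \<phi> x y z \<in> Sig D"
    and st: "\<And>s x y z. x \<in> el s X \<Longrightarrow> y \<in> el s Y \<Longrightarrow> z \<in> el s Z \<Longrightarrow>
      T s (\<lambda>c. \<phi> (x c) (y c) (z c)) \<Longrightarrow> T s (\<lambda>c. \<psi> (x c) (y c) (z c))"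
  shows "entails D (X \<times> Y \<times> Z) (\<lambda>(x, y, z). \<phi> x y z) (\<lambda>(x, y, z). \<psi> x y z)"
proof (rule entailsI[OF inj_pr3])
  fix s :: "('u, 'a) stage" and k :: "'u \<Rightarrow> 'u \<times> 'u \<times> 'u"
  assume k: "\<And>c. c \<in> dm s \<Longrightarrow> k c \<in> X \<times> Y \<times> Z" "T s (\<lambda>c. case k c of (x, y, z) \<Rightarrow> \<phi> x y z)"
  show "T s (\<lambda>c. case k c of (x, y, z) \<Rightarrow> \<psi> x y z)"
    using st[of "\<lambda>c. fst (k c)" s "\<lambda>c. fst (snd (k c))" "\<lambda>c. snd (snd (k c))"] k
    by (simp add: case_prod_unfold el_def mem_Times_iff)
qed (use sg in auto)

lemma entails4I:
  assumes sg: "\<And>x y z w. x \<in> X \<Longrightarrow> y \<in> Y \<Longrightarrow> z \<in> Z \<Longrightarrow> w \<in> W \<Longrightarrow> \<phi> x y z w \<in> Sig D"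
    and st: "\<And>s x y z w. x \<in> el s X \<Longrightarrow> y \<in> el s Y \<Longrightarrow> z \<in> el s Z \<Longrightarrow> w \<in> el s W \<Longrightarrow>
      T s (\<lambda>c. \<phi> (x c) (y c) (z c) (w c)) \<Longrightarrow> T s (\<lambda>c. \<psi> (x c) (y c) (z c) (w c))"
  shows "entails D ((X \<times> Y) \<times> (Z \<times> W)) (\<lambda>((x, y), (z, w)). \<phi> x y z w) (\<lambda>((x, y), (z, w)). \<psi> x y z w)"
proof (rule entailsI[OF inj_pr4])
  fix s :: "('u, 'a) stage" and k :: "'u \<Rightarrow> ('u \<times> 'u) \<times> ('u \<times> 'u)"
  assume k: "\<And>c. c \<in> dm s \<Longrightarrow> k c \<in> (X \<times> Y) \<times> (Z \<times> W)" "T s (\<lambda>c. (\<lambda>((x, y), (z, w)). \<phi> x y z w) (k c))"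
  show "T s (\<lambda>c. (\<lambda>((x, y), (z, w)). \<psi> x y z w) (k c))"
    using st[of "\<lambda>c. fst (fst (k c))" s "\<lambda>c. snd (fst (k c))" "\<lambda>c. fst (snd (k c))" "\<lambda>c. snd (snd (k c))"] k
    by (simp add: case_prod_unfold el_def mem_Times_iff)
qed (use sg in auto)

lemma is_per_iff:
  "is_per D A \<longleftrightarrow> sig2 (fst A) (fst A) (snd A) \<and>
     (\<forall>s x y. eqv s A x y \<longrightarrow> eqv s A y x) \<and>
     (\<forall>s x y z. eqv s A x y \<longrightarrow> eqv s A y z \<longrightarrow> eqv s A x z)" (is "?L \<longleftrightarrow> ?R")
proof -
  obtain X E where A: "A = (X, E)" by (cases A)
  show ?thesis
  proof
    assume L: ?L
    then have sg: "sig2 X X E"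
      and sy: "entails D (X \<times> X) (\<lambda>(x, y). E x y) (\<lambda>(x, y). E y x)"
      and tr: "entails D (X \<times> X \<times> X) (\<lambda>(x, y, z). and_tv D (E x y) (E y z)) (\<lambda>(x, y, z). E x z)"
      unfolding is_per_def A sig2_def by auto
    have "eqv s A y x" if "eqv s A x y" for s x y
      using T_entails2[OF sy, of x s y] that by (simp add: eqv_def A)
    moreover have "eqv s A x z" if "eqv s A x y" "eqv s A y z" for s x y z
      using T_entails3[OF tr, of x s y z] that by (simp add: eqv_def A T_and)
    ultimately show ?R using sg unfolding A fst_conv snd_conv by blast
  next
    assume R: ?R
    then have sg: "sig2 X X E" by (simp add: A)
    have "entails D (X \<times> X) (\<lambda>(x, y). E x y) (\<lambda>(x, y). E y x)"
    proof (rule entails2I)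
      fix s x y assume "x \<in> el s X" "y \<in> el s X" "T s (\<lambda>c. E (x c) (y c))"
      then have "eqv s A x y" by (simp add: eqv_def A)
      then have "eqv s A y x" using R by blast
      then show "T s (\<lambda>c. E (y c) (x c))" by (simp add: eqv_def A)
    qed (rule sig2D[OF sg])
    moreover have "entails D (X \<times> X \<times> X) (\<lambda>(x, y, z). and_tv D (E x y) (E y z)) (\<lambda>(x, y, z). E x z)"
    proof (rule entails3I)
      fix s x y z assume "x \<in> el s X" "y \<in> el s X" "z \<in> el s X"
        "T s (\<lambda>c. and_tv D (E (x c) (y c)) (E (y c) (z c)))"
      then have "eqv s A x y" "eqv s A y z" by (simp_all add: eqv_def A T_and)
      then have "eqv s A x z" using R by blast
      then show "T s (\<lambda>c. E (x c) (z c))" by (simp add: eqv_def A)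
    qed (simp add: sig2D[OF sg])
    ultimately show ?L using sg unfolding is_per_def A sig2_def by auto
  qed
qed

definition sfr :: "('u, 'a) rt_obj \<Rightarrow> ('u, 'a) rt_obj \<Rightarrow> ('u, 'a) rt_rel \<Rightarrow> bool" where
  "sfr A B F \<longleftrightarrow> sig2 (fst A) (fst B) F \<and>
     (\<forall>s x y. rl s A B F x y \<longrightarrow> eqv s A x x \<and> eqv s B y y) \<and>
     (\<forall>s x y x' y'. rl s A B F x y \<longrightarrow> eqv s A x x' \<longrightarrow> eqv s B y y' \<longrightarrow> rl s A B F x' y') \<and>
     (\<forall>s x y y'. rl s A B F x y \<longrightarrow> rl s A B F x y' \<longrightarrow> eqv s B y y') \<and>
     (\<forall>s x. eqv s A x x \<longrightarrow> (\<exists>y. rl s A B F x y))"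

lemma sfr_sig: "sfr A B F \<Longrightarrow> sig2 (fst A) (fst B) F"
  by (simp add: sfr_def)

lemma functional_rel_iff:
  assumes "is_per D A" "is_per D B"
  shows "functional_rel D A B F \<longleftrightarrow> sfr A B F"
proof -
  obtain X E where A: "A = (X, E)" by (cases A)
  obtain Y E' where B: "B = (Y, E')" by (cases B)
  have sE: "sig2 X X E" and sE': "sig2 Y Y E'" using assms is_per_iff by (auto simp: A B)
  show ?thesis
  proof
    assume L: "functional_rel D A B F"
    have sg: "sig2 X Y F"
     and 1: "entails D (X \<times> Y) (\<lambda>(x, y). F x y) (\<lambda>(x, y). and_tv D (E x x) (E' y y))"
     and 2: "entails D ((X \<times> X) \<times> (Y \<times> Y))
       (\<lambda>((x, x'), (y, y')). and_tv D (F x y) (and_tv D (E x x') (E' y y')))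
       (\<lambda>((x, x'), (y, y')). F x' y')"
     and 3: "entails D (X \<times> Y \<times> Y) (\<lambda>(x, y, y'). and_tv D (F x y) (F x y')) (\<lambda>(x, y, y'). E' y y')"
     and 4: "entails D X (\<lambda>x. E x x) (\<lambda>x. ex_tv Y (F x))"
      using L unfolding functional_rel_def A B sig2_def by auto
    have "eqv s A x x \<and> eqv s B y y" if "rl s A B F x y" for s x y
      using T_entails2[OF 1, of x s y] that by (simp add: rl_def eqv_def A B T_and)
    moreover have "rl s A B F x' y'" if "rl s A B F x y" "eqv s A x x'" "eqv s B y y'" for s x y x' y'
      using T_entails4[OF 2, of x s x' y y'] that by (simp add: rl_def eqv_def A B T_and)
    moreover have "eqv s B y y'" if "rl s A B F x y" "rl s A B F x y'" for s x y y'
      using T_entails3[OF 3, of x s y y'] that by (simp add: rl_def eqv_def A B T_and)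
    moreover have "\<exists>y. rl s A B F x y" if "eqv s A x x" for s x
    proof -
      have "T s (\<lambda>c. ex_tv Y (F (x c)))"
        using T_entails[OF 4, of s x] that unfolding eqv_def A by (auto simp: el_def)
      then obtain y where "\<And>c. c \<in> dm s \<Longrightarrow> y c \<in> Y" "T s (\<lambda>c. F (x c) (y c))"
        using T_exE[of s "\<lambda>_. Y" "\<lambda>c. F (x c)"] by blast
      then have "rl s A B F x y" using that by (auto simp: rl_def eqv_def A B el_def)
      then show ?thesis by blast
    qed
    ultimately show "sfr A B F" unfolding sfr_def using sg unfolding A B fst_conv snd_conv by blast
  next
    assume R: "sfr A B F"
    have sg: "sig2 X Y F"
     and 1: "\<And>s x y. rl s A B F x y \<Longrightarrow> eqv s A x x \<and> eqv s B y y"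
     and 2: "\<And>s x y x' y'. rl s A B F x y \<Longrightarrow> eqv s A x x' \<Longrightarrow> eqv s B y y' \<Longrightarrow> rl s A B F x' y'"
     and 3: "\<And>s x y y'. rl s A B F x y \<Longrightarrow> rl s A B F x y' \<Longrightarrow> eqv s B y y'"
     and 4: "\<And>s x. eqv s A x x \<Longrightarrow> \<exists>y. rl s A B F x y"
      using R[unfolded sfr_def] unfolding A B fst_conv snd_conv by blast+
    have "entails D (X \<times> Y) (\<lambda>(x, y). F x y) (\<lambda>(x, y). and_tv D (E x x) (E' y y))"
    proof (rule entails2I)
      fix s x y assume "x \<in> el s X" "y \<in> el s Y" "T s (\<lambda>c. F (x c) (y c))"
      then have "rl s A B F x y" by (simp add: rl_def A B)
      from 1[OF this] show "T s (\<lambda>c. and_tv D (E (x c) (x c)) (E' (y c) (y c)))"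
        by (simp add: eqv_def A B T_and)
    qed (rule sig2D[OF sg])
    moreover have "entails D ((X \<times> X) \<times> (Y \<times> Y))
       (\<lambda>((x, x'), (y, y')). and_tv D (F x y) (and_tv D (E x x') (E' y y')))
       (\<lambda>((x, x'), (y, y')). F x' y')"
    proof (rule entails4I)
      fix s x x' y y' assume "x \<in> el s X" "x' \<in> el s X" "y \<in> el s Y" "y' \<in> el s Y"
        "T s (\<lambda>c. and_tv D (F (x c) (y c)) (and_tv D (E (x c) (x' c)) (E' (y c) (y' c))))"
      then have "rl s A B F x y" "eqv s A x x'" "eqv s B y y'" by (simp_all add: rl_def eqv_def A B T_and)
      from 2[OF this] show "T s (\<lambda>c. F (x' c) (y' c))" by (simp add: rl_def)
    qed (simp add: sig2D[OF sg] sig2D[OF sE] sig2D[OF sE'])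
    moreover have "entails D (X \<times> Y \<times> Y) (\<lambda>(x, y, y'). and_tv D (F x y) (F x y')) (\<lambda>(x, y, y'). E' y y')"
    proof (rule entails3I)
      fix s x y y' assume "x \<in> el s X" "y \<in> el s Y" "y' \<in> el s Y"
        "T s (\<lambda>c. and_tv D (F (x c) (y c)) (F (x c) (y' c)))"
      then have "rl s A B F x y" "rl s A B F x y'" by (simp_all add: rl_def A B T_and)
      from 3[OF this] show "T s (\<lambda>c. E' (y c) (y' c))" by (simp add: eqv_def B)
    qed (simp add: sig2D[OF sg])
    moreover have "entails D X (\<lambda>x. E x x) (\<lambda>x. ex_tv Y (F x))"
    proof (rule entailsI[of "\<lambda>x. x"])
      fix s :: "('u, 'a) stage" and k assume k: "\<And>c. c \<in> dm s \<Longrightarrow> k c \<in> X" "T s (\<lambda>c. E (k c) (k c))"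
      then have "eqv s A k k" by (auto simp: eqv_def A el_def)
      from 4[OF this] obtain y where "rl s A B F k y" ..
      then show "T s (\<lambda>c. ex_tv Y (F (k c)))"
        by (intro T_exI[of s y]) (auto simp: rl_def B el_def)
    qed (use sig2D[OF sE] in \<open>auto simp: inj_on_def\<close>)
    ultimately show "functional_rel D A B F" using sg unfolding functional_rel_def A B sig2_def by auto
  qed
qed

abbreviation ob :: "('u, 'a) rt_obj set" where "ob \<equiv> rt_objects D"
abbreviation RTc :: "(('u, 'a) rt_obj, ('u, 'a) rt_arr) category" where "RTc \<equiv> RT D"

lemma ob_iff: "A \<in> ob \<longleftrightarrow> |fst A| <o |UNIV :: 'u set| \<and> sig2 (fst A) (fst A) (snd A) \<and>
     (\<forall>s x y. eqv s A x y \<longrightarrow> eqv s A y x) \<and>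
     (\<forall>s x y z. eqv s A x y \<longrightarrow> eqv s A y z \<longrightarrow> eqv s A x z)"
  by (simp add: rt_objects_def is_per_iff)

lemma ob_per: "A \<in> ob \<Longrightarrow> is_per D A" by (simp add: rt_objects_def)

lemma eqv_sym: "A \<in> ob \<Longrightarrow> eqv s A x y \<Longrightarrow> eqv s A y x" unfolding ob_iff by blast
lemma eqv_trans: "A \<in> ob \<Longrightarrow> eqv s A x y \<Longrightarrow> eqv s A y z \<Longrightarrow> eqv s A x z" unfolding ob_iff by blast
lemma eqv_refl1: "A \<in> ob \<Longrightarrow> eqv s A x y \<Longrightarrow> eqv s A x x" by (meson eqv_sym eqv_trans)
lemma eqv_refl2: "A \<in> ob \<Longrightarrow> eqv s A x y \<Longrightarrow> eqv s A y y" by (meson eqv_sym eqv_trans)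
lemma eqv_rl: "eqv s A x y \<longleftrightarrow> rl s A A (snd A) x y" by (simp add: eqv_def rl_def)
lemma eqv_sub: "A \<in> ob \<Longrightarrow> sub \<pi> s' s \<Longrightarrow> eqv s A x y \<Longrightarrow> eqv s' A (\<lambda>c. x (\<pi> c)) (\<lambda>c. y (\<pi> c))"
  unfolding eqv_rl by (erule rl_sub) (simp_all add: ob_iff)
lemma ob_sig: "A \<in> ob \<Longrightarrow> sig2 (fst A) (fst A) (snd A)" by (simp add: ob_iff)

lemma entails_rl:
  assumes "sig2 (fst A) (fst B) F"
  shows "entails D (fst A \<times> fst B) (\<lambda>(x, y). F x y) (\<lambda>(x, y). G x y) \<longleftrightarrow>
    (\<forall>s x y. rl s A B F x y \<longrightarrow> rl s A B G x y)"
proof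
  assume L: "entails D (fst A \<times> fst B) (\<lambda>(x, y). F x y) (\<lambda>(x, y). G x y)"
  show "\<forall>s x y. rl s A B F x y \<longrightarrow> rl s A B G x y"
  proof (intro allI impI)
    fix s x y assume "rl s A B F x y"
    then show "rl s A B G x y"
      using T_entails2[OF L, of x s y] by (simp add: rl_def)
  qed
next
  assume R: "\<forall>s x y. rl s A B F x y \<longrightarrow> rl s A B G x y"
  show "entails D (fst A \<times> fst B) (\<lambda>(x, y). F x y) (\<lambda>(x, y). G x y)"
  proof (rule entails2I)
    fix s x y assume "x \<in> el s (fst A)" "y \<in> el s (fst B)" "T s (\<lambda>c. F (x c) (y c))"
    then have "rl s A B F x y" by (simp add: rl_def)
    with R have "rl s A B G x y" by blast
    then show "T s (\<lambda>c. G (x c) (y c))" by (simp add: rl_def)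
  qed (rule sig2D[OF assms])
qed

lemma rel_class_iff:
  assumes "A \<in> ob" "B \<in> ob" "sig2 (fst A) (fst B) F"
  shows "rel_class D A B F = {G. sfr A B G \<and> (\<forall>s x y. rl s A B F x y \<longleftrightarrow> rl s A B G x y)}"
proof -
  have "G \<in> rel_class D A B F \<longleftrightarrow> sfr A B G \<and> (\<forall>s x y. rl s A B F x y \<longleftrightarrow> rl s A B G x y)" for G
  proof (cases "sfr A B G")
    case True
    then have "sig2 (fst A) (fst B) G" by (simp add: sfr_def)
    from entails_rl[OF this, of F] entails_rl[OF assms(3), of G] True show ?thesis
      by (simp only: rel_class_def functional_rel_iff[OF assms(1,2)[THEN ob_per]] mem_Collect_eq) blast
  qed (simp add: rel_class_def functional_rel_iff[OF assms(1,2)[THEN ob_per]])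
  then show ?thesis by blast
qed

definition rep :: "('u, 'a) rt_arr \<Rightarrow> ('u, 'a) rt_rel" where "rep f = (SOME F. F \<in> snd (snd f))"

definition ap :: "('u, 'a) stage \<Rightarrow> ('u, 'a) rt_arr \<Rightarrow> ('u \<Rightarrow> 'u) \<Rightarrow> ('u \<Rightarrow> 'u) \<Rightarrow> bool" where
  "ap s f x y \<longleftrightarrow> rl s (fst f) (fst (snd f)) (rep f) x y"

lemma RT_simps: "Obj RTc = ob" "Src RTc f = fst f" "Trg RTc f = fst (snd f)"
  "Idn RTc A = rt_arrow D A A (snd A)"
  "Cmp RTc g f = (fst f, fst (snd g), \<Union>F \<in> snd (snd f). \<Union>G \<in> snd (snd g). rel_class D (fst f) (fst (snd g)) (rel_comp D (fst (fst (snd f))) G F))"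
  by (simp_all add: RT_def case_prod_unfold)

lemma Arr_RT: "Arr RTc = {rt_arrow D A B F | A B F. A \<in> ob \<and> B \<in> ob \<and> functional_rel D A B F}"
  by (simp add: RT_def)

lemma rt_arrow_hom: "A \<in> ob \<Longrightarrow> B \<in> ob \<Longrightarrow> sfr A B F \<Longrightarrow> rt_arrow D A B F \<in> hom RTc A B"
  unfolding hom_def Arr_RT mem_Collect_eq RT_simps
  by (intro conjI exI[of _ A] exI[of _ B] exI[of _ F]) (simp_all add: rt_arrow_def functional_rel_iff ob_per)

lemma rt_arrow_eq_iff:
  assumes "A \<in> ob" "B \<in> ob" "sfr A B F" "sfr A B G"
  shows "rt_arrow D A B F = rt_arrow D A B G \<longleftrightarrow> (\<forall>s x y. rl s A B F x y \<longleftrightarrow> rl s A B G x y)"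
proof -
  have "sig2 (fst A) (fst B) F" "sig2 (fst A) (fst B) G" using assms by (auto simp: sfr_def)
  then have *: "rel_class D A B F = {H. sfr A B H \<and> (\<forall>s x y. rl s A B F x y \<longleftrightarrow> rl s A B H x y)}"
    "rel_class D A B G = {H. sfr A B H \<and> (\<forall>s x y. rl s A B G x y \<longleftrightarrow> rl s A B H x y)}"
    using rel_class_iff[OF assms(1,2)] by blast+
  show ?thesis
  proof
    assume "rt_arrow D A B F = rt_arrow D A B G"
    then have "rel_class D A B F = rel_class D A B G" by (simp add: rt_arrow_def)
    moreover have "F \<in> rel_class D A B F" unfolding * using assms(3) by simp
    ultimately have "F \<in> rel_class D A B G" by simp
    then show "\<forall>s x y. rl s A B F x y \<longleftrightarrow> rl s A B G x y" unfolding * by simp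
  next
    assume "\<forall>s x y. rl s A B F x y \<longleftrightarrow> rl s A B G x y"
    then show "rt_arrow D A B F = rt_arrow D A B G" unfolding rt_arrow_def * by simp
  qed
qed

lemma hom_iff: "f \<in> hom RTc A B \<longleftrightarrow> A \<in> ob \<and> B \<in> ob \<and> sfr A B (rep f) \<and> f = rt_arrow D A B (rep f)"
proof
  assume "f \<in> hom RTc A B"
  then obtain F where F: "A \<in> ob" "B \<in> ob" "sfr A B F" "f = rt_arrow D A B F"
    unfolding hom_def Arr_RT mem_Collect_eq RT_simps by (auto simp: rt_arrow_def functional_rel_iff ob_per)
  have sg: "sig2 (fst A) (fst B) F" using F by (simp add: sfr_def)
  have ssf: "snd (snd f) = {G. sfr A B G \<and> (\<forall>s x y. rl s A B F x y \<longleftrightarrow> rl s A B G x y)}"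
    unfolding F(4) rt_arrow_def snd_conv by (rule rel_class_iff[OF F(1,2) sg])
  have "F \<in> snd (snd f)" unfolding ssf using F(3) by blast
  then have "rep f \<in> snd (snd f)" unfolding rep_def by (rule someI[of "\<lambda>F. F \<in> snd (snd f)"])
  then have r: "sfr A B (rep f)" "\<forall>s x y. rl s A B F x y \<longleftrightarrow> rl s A B (rep f) x y"
    unfolding ssf by blast+
  then have "rt_arrow D A B F = rt_arrow D A B (rep f)" using rt_arrow_eq_iff F by blast
  then have "f = rt_arrow D A B (rep f)" using F(4) by (rule trans[rotated])
  with F r show "A \<in> ob \<and> B \<in> ob \<and> sfr A B (rep f) \<and> f = rt_arrow D A B (rep f)" by blast
next
  assume f: "A \<in> ob \<and> B \<in> ob \<and> sfr A B (rep f) \<and> f = rt_arrow D A B (rep f)"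
  then have "rt_arrow D A B (rep f) \<in> hom RTc A B" using rt_arrow_hom by blast
  with f show "f \<in> hom RTc A B" by metis
qed

lemma homD:
  assumes "f \<in> hom RTc A B"
  shows "A \<in> ob" "B \<in> ob" "fst f = A" "fst (snd f) = B" "sfr A B (rep f)"
    "snd (snd f) = {G. sfr A B G \<and> (\<forall>s x y. ap s f x y \<longleftrightarrow> rl s A B G x y)}"
    "f \<in> Arr RTc" "Src RTc f = A" "Trg RTc f = B"
proof -
  show *: "A \<in> ob" "B \<in> ob" "sfr A B (rep f)" "f \<in> Arr RTc" "Src RTc f = A" "Trg RTc f = B"
    using assms hom_iff[of f A B] unfolding hom_def by blast+
  have f: "f = rt_arrow D A B (rep f)" using assms hom_iff by blast
  show fA: "fst f = A" by (subst f) (simp add: rt_arrow_def)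
  show fB: "fst (snd f) = B" by (subst f) (simp add: rt_arrow_def)
  have sg: "sig2 (fst A) (fst B) (rep f)" using * by (simp add: sfr_def)
  have "snd (snd f) = rel_class D A B (rep f)" by (subst f) (simp add: rt_arrow_def)
  then show "snd (snd f) = {G. sfr A B G \<and> (\<forall>s x y. ap s f x y \<longleftrightarrow> rl s A B G x y)}"
    by (simp only: rel_class_iff[OF *(1,2) sg] ap_def fA fB)
qed

lemma ap_rl: "f \<in> hom RTc A B \<Longrightarrow> ap s f x y \<longleftrightarrow> rl s A B (rep f) x y"
  using homD(3,4) by (simp add: ap_def)

lemma arr_hom: assumes "f \<in> Arr RTc" shows "f \<in> hom RTc (fst f) (fst (snd f))"
  using assms unfolding hom_def by (simp add: RT_simps)

lemma
  assumes f: "f \<in> hom RTc A B"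
  shows ap_dom: "ap s f x y \<Longrightarrow> eqv s A x x"
    and ap_cod: "ap s f x y \<Longrightarrow> eqv s B y y"
    and ap_cong: "ap s f x y \<Longrightarrow> eqv s A x x' \<Longrightarrow> eqv s B y y' \<Longrightarrow> ap s f x' y'"
    and ap_fun: "ap s f x y \<Longrightarrow> ap s f x y' \<Longrightarrow> eqv s B y y'"
    and ap_ex: "eqv s A x x \<Longrightarrow> \<exists>y. ap s f x y"
  using homD(5)[OF f] unfolding sfr_def ap_rl[OF f] by blast+

lemma ap_sub: "f \<in> hom RTc A B \<Longrightarrow> sub \<pi> s' s \<Longrightarrow> ap s f x y \<Longrightarrow> ap s' f (\<lambda>c. x (\<pi> c)) (\<lambda>c. y (\<pi> c))"
  using homD(5) by (simp add: ap_rl rl_sub sfr_def)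

lemma arr_eqI:
  assumes f: "f \<in> hom RTc A B" and g: "g \<in> hom RTc A B"
    and le: "\<And>s x y. ap s f x y \<Longrightarrow> ap s g x y"
  shows "f = g"
proof -
  have "ap s f x y" if "ap s g x y" for s x y
  proof -
    have x: "eqv s A x x" using ap_dom[OF g that] .
    then obtain y' where y': "ap s f x y'" using ap_ex[OF f] by blast
    have "eqv s B y' y" using ap_fun[OF g le[OF y'] that] .
    then show ?thesis using ap_cong[OF f y' x] by blast
  qed
  then have "\<forall>s x y. rl s A B (rep f) x y \<longleftrightarrow> rl s A B (rep g) x y"
    using le ap_rl[OF f] ap_rl[OF g] by blast
  then have "rt_arrow D A B (rep f) = rt_arrow D A B (rep g)"
    using rt_arrow_eq_iff homD[OF f] homD[OF g] by blast
  moreover have "f = rt_arrow D A B (rep f)" "g = rt_arrow D A B (rep g)"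
    using f g hom_iff[of f A B] hom_iff[of g A B] by blast+
  ultimately show ?thesis by metis
qed

lemma arrI:
  assumes "A \<in> ob" "B \<in> ob" "sfr A B F"
  shows "rt_arrow D A B F \<in> hom RTc A B" "ap s (rt_arrow D A B F) x y \<longleftrightarrow> rl s A B F x y"
proof -
  show h: "rt_arrow D A B F \<in> hom RTc A B"
    using assms by (rule rt_arrow_hom)
  have sg: "sig2 (fst A) (fst B) F" using assms by (simp add: sfr_def)
  have "F \<in> snd (snd (rt_arrow D A B F))"
    unfolding rt_arrow_def snd_conv rel_class_iff[OF assms(1,2) sg] using assms(3) by blast
  then show "ap s (rt_arrow D A B F) x y \<longleftrightarrow> rl s A B F x y"
    using homD(6)[OF h] by blast
qed

lemma sig2_comp:
  "sig2 X Y F \<Longrightarrow> sig2 Y Z G \<Longrightarrow> sig2 X Z (rel_comp D Y G F)"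
  by (auto simp: sig2_def rel_comp_def)

lemma rl_comp: "rl s A C (rel_comp D (fst B) G F) x z \<longleftrightarrow> (\<exists>y. rl s A B F x y \<and> rl s B C G y z)"
  unfolding rl_def rel_comp_def T_ex T_and by (auto simp: el_def)

lemma comp_hom:
  assumes f: "f \<in> hom RTc A B" and g: "g \<in> hom RTc B C"
  shows "Cmp RTc g f \<in> hom RTc A C" "ap s (Cmp RTc g f) x z \<longleftrightarrow> (\<exists>y. ap s f x y \<and> ap s g y z)"
proof -
  let ?H = "rel_comp D (fst B) (rep g) (rep f)"
  have H: "rl s A C ?H x z \<longleftrightarrow> (\<exists>y. ap s f x y \<and> ap s g y z)" for s x z
    by (simp add: rl_comp ap_rl[OF f] ap_rl[OF g])
  have sH: "sfr A C ?H"
    unfolding sfr_def H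
  proof (intro conjI allI impI)
    show "sig2 (fst A) (fst C) ?H" by (rule sig2_comp[OF sfr_sig[OF homD(5)[OF f]] sfr_sig[OF homD(5)[OF g]]])
  next
    fix s x y assume "\<exists>ya. ap s f x ya \<and> ap s g ya y"
    then show "eqv s A x x" "eqv s C y y" using ap_dom[OF f] ap_cod[OF g] by blast+
  next
    fix s x y x' y' assume "\<exists>ya. ap s f x ya \<and> ap s g ya y" "eqv s A x x'" "eqv s C y y'"
    then show "\<exists>y. ap s f x' y \<and> ap s g y y'"
      using ap_cong[OF f] ap_cong[OF g] ap_cod[OF f] by blast
  next
    fix s x y y' assume "\<exists>ya. ap s f x ya \<and> ap s g ya y" "\<exists>y. ap s f x y \<and> ap s g y y'"
    then obtain v w where v: "ap s f x v" "ap s g v y" "ap s f x w" "ap s g w y'" by blast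
    have "ap s g w y" using ap_cong[OF g v(2) ap_fun[OF f v(1,3)]] ap_cod[OF g v(2)] by blast
    then show "eqv s C y y'" using ap_fun[OF g] v(4) by blast
  next
    fix s x assume "eqv s A x x"
    then show "\<exists>y ya. ap s f x ya \<and> ap s g ya y"
      using ap_ex[OF f] ap_ex[OF g] ap_cod[OF f] by meson
  qed
  have AC: "A \<in> ob" "C \<in> ob" using homD[OF f] homD[OF g] by auto
  have "Cmp RTc g f = rt_arrow D A C ?H"
  proof -
    have cl: "rel_class D A C (rel_comp D (fst B) G F) = rel_class D A C ?H"
      if F: "F \<in> snd (snd f)" and G: "G \<in> snd (snd g)" for F G
    proof -
      have "sfr A B F" "sfr B C G" and FG: "\<And>s x y. rl s A B F x y \<longleftrightarrow> ap s f x y" "\<And>s x y. rl s B C G x y \<longleftrightarrow> ap s g x y"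
        using F G homD(6)[OF f] homD(6)[OF g] by auto
      then have sg: "sig2 (fst A) (fst C) (rel_comp D (fst B) G F)" by (blast intro: sig2_comp sfr_sig)
      have sg': "sig2 (fst A) (fst C) ?H" using sH by (simp add: sfr_def)
      have "rl s A C (rel_comp D (fst B) G F) x y \<longleftrightarrow> rl s A C ?H x y" for s x y
        unfolding H by (simp add: rl_comp FG)
      then show ?thesis by (simp add: rel_class_iff[OF AC sg] rel_class_iff[OF AC sg'])
    qed
    have "rep f \<in> snd (snd f)" "rep g \<in> snd (snd g)"
      using homD(5,6)[OF f] homD(5,6)[OF g] ap_rl[OF f] ap_rl[OF g] by auto
    then have "(\<Union>F \<in> snd (snd f). \<Union>G \<in> snd (snd g). rel_class D A C (rel_comp D (fst B) G F)) = rel_class D A C ?H"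
      using cl by blast
    then show ?thesis by (simp add: RT_simps homD[OF f] homD[OF g] rt_arrow_def)
  qed
  then show "Cmp RTc g f \<in> hom RTc A C" "ap s (Cmp RTc g f) x z \<longleftrightarrow> (\<exists>y. ap s f x y \<and> ap s g y z)"
    using arrI[OF AC sH] H by auto
qed

lemma id_hom:
  assumes "A \<in> ob"
  shows "Idn RTc A \<in> hom RTc A A" "ap s (Idn RTc A) x y \<longleftrightarrow> eqv s A x y"
proof -
  have "sfr A A (snd A)"
    unfolding sfr_def eqv_rl[symmetric] using assms eqv_sym[OF assms] eqv_trans[OF assms]
    by (blast intro: ob_sig)
  from arrI[OF assms assms this] show "Idn RTc A \<in> hom RTc A A" "ap s (Idn RTc A) x y \<longleftrightarrow> eqv s A x y"
    by (auto simp: RT_simps eqv_rl)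
qed

subsection \<open>More rules for truth at a stage\<close>

lemma T_iff: "T s (\<lambda>c. iff_tv D (P c) (Q c)) \<longleftrightarrow>
    T s (\<lambda>c. imp_tv D (P c) (Q c)) \<and> T s (\<lambda>c. imp_tv D (Q c) (P c))"
  by (simp add: iff_tv_def T_and)

lemma T_impK:
  fixes s :: "('u, 'a) stage"
  assumes "\<And>c. c \<in> dm s \<Longrightarrow> P c \<in> Sig D" "\<And>c. c \<in> dm s \<Longrightarrow> Q c \<in> Sig D" "T s Q"
  shows "T s (\<lambda>c. imp_tv D (P c) (Q c))"
proof (rule T_impI[OF assms(1)])
  fix s' :: "('u, 'a) stage" and \<pi> assume "sub \<pi> s' s"
  from T_sub[OF this assms(3,2)] show "T s' (\<lambda>c. Q (\<pi> c))" .
qed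

lemma T_imp_refl:
  fixes s :: "('u, 'a) stage"
  assumes "\<And>c. c \<in> dm s \<Longrightarrow> P c \<in> Sig D"
  shows "T s (\<lambda>c. imp_tv D (P c) (P c))"
  by (rule T_impI[OF assms])

lemma T_imp_trans:
  fixes s :: "('u, 'a) stage"
  assumes "\<And>c. c \<in> dm s \<Longrightarrow> P c \<in> Sig D"
    and "T s (\<lambda>c. imp_tv D (P c) (Q c))" "T s (\<lambda>c. imp_tv D (Q c) (R c))"
  shows "T s (\<lambda>c. imp_tv D (P c) (R c))"
proof (rule T_impI[OF assms(1)])
  fix s' :: "('u, 'a) stage" and \<pi> assume sub: "sub \<pi> s' s" and P: "T s' (\<lambda>c. P (\<pi> c))"
  have "T s' (\<lambda>c. imp_tv D (P (\<pi> c)) (Q (\<pi> c)))" "T s' (\<lambda>c. imp_tv D (Q (\<pi> c)) (R (\<pi> c)))"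
    by (rule T_sub[OF sub assms(2)], simp, rule T_sub[OF sub assms(3)], simp)
  from T_mp[OF this(2) T_mp[OF this(1) P]] show "T s' (\<lambda>c. R (\<pi> c))" .
qed

subsection \<open>Subobjects given by predicates\<close>

definition tp :: "('u, 'a) stage \<Rightarrow> ('u \<Rightarrow> 'a tval) \<Rightarrow> ('u \<Rightarrow> 'u) \<Rightarrow> bool" where
  "tp s P x \<longleftrightarrow> T s (\<lambda>c. P (x c))"

definition pred :: "('u, 'a) rt_obj \<Rightarrow> ('u \<Rightarrow> 'a tval) \<Rightarrow> bool" where
  "pred A P \<longleftrightarrow> (\<forall>x\<in>fst A. P x \<in> Sig D) \<and>
     (\<forall>s x y. eqv s A x y \<longrightarrow> tp s P x \<longrightarrow> tp s P y)"

lemma predI: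
  assumes "\<And>x. x \<in> fst A \<Longrightarrow> P x \<in> Sig D"
    "\<And>s x y. eqv s A x y \<Longrightarrow> tp s P x \<Longrightarrow> tp s P y"
  shows "pred A P"
  unfolding pred_def using assms by blast

lemma pred_sig: "pred A P \<Longrightarrow> x \<in> fst A \<Longrightarrow> P x \<in> Sig D" by (simp add: pred_def)
lemma pred_sig_el: "pred A P \<Longrightarrow> x \<in> el s (fst A) \<Longrightarrow> c \<in> dm s \<Longrightarrow> P (x c) \<in> Sig D"
  by (simp add: pred_def el_def)
lemma pred_ext: "pred A P \<Longrightarrow> eqv s A x y \<Longrightarrow> tp s P x \<Longrightarrow> tp s P y"
  unfolding pred_def by blast

definition subo :: "('u, 'a) rt_obj \<Rightarrow> ('u \<Rightarrow> 'a tval) \<Rightarrow> ('u, 'a) rt_obj" where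
  "subo A P = (fst A, \<lambda>x y. and_tv D (snd A x y) (P x))"

definition incl :: "('u, 'a) rt_obj \<Rightarrow> ('u \<Rightarrow> 'a tval) \<Rightarrow> ('u, 'a) rt_arr" where
  "incl A P = rt_arrow D (subo A P) A (\<lambda>x y. and_tv D (snd A x y) (P x))"

lemma eqv_el: "eqv s A x y \<Longrightarrow> x \<in> el s (fst A)" "eqv s A x y \<Longrightarrow> y \<in> el s (fst A)"
  by (simp_all add: eqv_def)

lemma eqv_subo: "eqv s (subo A P) x y \<longleftrightarrow> eqv s A x y \<and> tp s P x"
  by (auto simp: eqv_def subo_def T_and tp_def)

lemma fst_subo [simp]: "fst (subo A P) = fst A" by (simp add: subo_def)

lemma subo_ob:
  assumes A: "A \<in> ob" and P: "pred A P"
  shows "subo A P \<in> ob"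
  unfolding ob_iff eqv_subo
proof (intro conjI allI impI)
  show "|fst (subo A P)| <o |UNIV :: 'u set|" using A by (simp add: ob_iff)
  show "sig2 (fst (subo A P)) (fst (subo A P)) (snd (subo A P))"
    using ob_sig[OF A] pred_sig[OF P] by (simp add: sig2_def subo_def)
next
  fix s x y assume "eqv s A x y \<and> tp s P x"
  then show "eqv s A y x" "tp s P y" using eqv_sym[OF A] pred_ext[OF P] by blast+
next
  fix s x y z assume "eqv s A x y \<and> tp s P x" "eqv s A y z \<and> tp s P y"
  then show "eqv s A x z" "tp s P x" using eqv_trans[OF A] by blast+
qed

lemma incl_arr:
  assumes A: "A \<in> ob" and P: "pred A P"
  shows incl_hom: "incl A P \<in> hom RTc (subo A P) A"
    and ap_incl: "ap s (incl A P) x y \<longleftrightarrow> eqv s A x y \<and> tp s P x"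
proof -
  let ?F = "\<lambda>x y. and_tv D (snd A x y) (P x)"
  have rl: "rl s (subo A P) A ?F x y \<longleftrightarrow> eqv s A x y \<and> tp s P x" for s x y
    by (auto simp: rl_def eqv_def T_and tp_def)
  have "sfr (subo A P) A ?F"
    unfolding sfr_def rl eqv_subo
  proof (intro conjI allI impI)
    show "sig2 (fst (subo A P)) (fst A) ?F"
      using ob_sig[OF A] pred_sig[OF P] by (simp add: sig2_def)
  next
    fix s x y assume "eqv s A x y \<and> tp s P x"
    then show "eqv s A x x" "eqv s A y y" "tp s P x"
      using eqv_refl1[OF A] eqv_refl2[OF A] by blast+
  next
    fix s x y x' y' assume "eqv s A x y \<and> tp s P x" "eqv s A x x' \<and> tp s P x" "eqv s A y y'"
    then show "eqv s A x' y'" "tp s P x'"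
      using eqv_sym[OF A] eqv_trans[OF A] pred_ext[OF P] by metis+
  next
    fix s x y y' assume "eqv s A x y \<and> tp s P x" "eqv s A x y' \<and> tp s P x"
    then show "eqv s A y y'" using eqv_sym[OF A] eqv_trans[OF A] by metis
  next
    fix s x assume "eqv s A x x \<and> tp s P x"
    then show "\<exists>y. eqv s A x y \<and> tp s P x" by blast
  qed
  from arrI[OF subo_ob[OF A P] A this] show "incl A P \<in> hom RTc (subo A P) A"
    and "ap s (incl A P) x y \<longleftrightarrow> eqv s A x y \<and> tp s P x"
    unfolding incl_def rl by blast+
qed

lemma factor:
  assumes f: "f \<in> hom RTc W A" and P: "pred A P"
    and fP: "\<And>s w x. ap s f w x \<Longrightarrow> tp s P x"
  shows "\<exists>k \<in> hom RTc W (subo A P). \<forall>s w x. ap s k w x \<longleftrightarrow> ap s f w x"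
proof -
  have W: "W \<in> ob" and A: "A \<in> ob" using homD[OF f] by auto
  have rl: "rl s W (subo A P) (rep f) w x \<longleftrightarrow> ap s f w x" for s w x
    by (simp add: ap_rl[OF f] rl_def)
  have "sfr W (subo A P) (rep f)"
    unfolding sfr_def rl eqv_subo
  proof (intro conjI allI impI)
    show "sig2 (fst W) (fst (subo A P)) (rep f)" using sfr_sig[OF homD(5)[OF f]] by simp
  qed (use fP ap_dom[OF f] ap_cod[OF f] ap_cong[OF f] ap_fun[OF f] ap_ex[OF f] in metis)+
  from arrI[OF W subo_ob[OF A P] this] show ?thesis unfolding rl by blast
qed

lemma comp_eqI:
  assumes "f \<in> hom RTc A B" "g \<in> hom RTc B C" "f' \<in> hom RTc A B'" "g' \<in> hom RTc B' C"
    "\<And>s x y z. ap s f x y \<Longrightarrow> ap s g y z \<Longrightarrow> \<exists>y'. ap s f' x y' \<and> ap s g' y' z"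
  shows "Cmp RTc g f = Cmp RTc g' f'"
proof (rule arr_eqI[OF comp_hom(1)[OF assms(1,2)] comp_hom(1)[OF assms(3,4)]])
  fix s x z assume "ap s (Cmp RTc g f) x z"
  then show "ap s (Cmp RTc g' f') x z"
    using assms(5) unfolding comp_hom(2)[OF assms(1,2)] comp_hom(2)[OF assms(3,4)] by blast
qed

lemma comp_eqI1:
  assumes "f \<in> hom RTc A B" "g \<in> hom RTc B C" "h \<in> hom RTc A C"
    "\<And>s x y z. ap s f x y \<Longrightarrow> ap s g y z \<Longrightarrow> ap s h x z"
  shows "Cmp RTc g f = h"
  by (rule arr_eqI[OF comp_hom(1)[OF assms(1,2)] assms(3)])
    (use assms(4) in \<open>simp only: comp_hom(2)[OF assms(1,2)], blast\<close>)

lemma comp_eqD: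
  assumes "Cmp RTc g f = Cmp RTc g' f'" "f \<in> hom RTc A B" "g \<in> hom RTc B C" "f' \<in> hom RTc A B'" "g' \<in> hom RTc B' C"
    "ap s f x y" "ap s g y z"
  shows "\<exists>y'. ap s f' x y' \<and> ap s g' y' z"
  using comp_hom(2)[OF assms(2,3), of s x z] comp_hom(2)[OF assms(4,5), of s x z] assms(1,6,7) by auto

lemma comp_assoc:
  assumes f: "f \<in> hom RTc A B" and g: "g \<in> hom RTc B C" and h: "h \<in> hom RTc C E"
  shows "Cmp RTc h (Cmp RTc g f) = Cmp RTc (Cmp RTc h g) f"
proof (rule comp_eqI[OF comp_hom(1)[OF f g] h f comp_hom(1)[OF g h]])
  fix s x y z assume "ap s (Cmp RTc g f) x y" "ap s h y z"
  then show "\<exists>y'. ap s f x y' \<and> ap s (Cmp RTc h g) y' z"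
    unfolding comp_hom(2)[OF f g] comp_hom(2)[OF g h] by blast
qed

definition imono :: "('u, 'a) rt_arr \<Rightarrow> bool" where
  "imono m \<longleftrightarrow> m \<in> Arr RTc \<and> (\<forall>s a a' x. ap s m a x \<longrightarrow> ap s m a' x \<longrightarrow> eqv s (fst m) a a')"

lemma imonoD: "imono m \<Longrightarrow> m \<in> hom RTc A B \<Longrightarrow> ap s m a x \<Longrightarrow> ap s m a' x \<Longrightarrow> eqv s A a a'"
  unfolding imono_def using homD(3) by blast

lemma imono_cancel:
  assumes m: "imono m" "m \<in> hom RTc A B" and f: "f \<in> hom RTc W A" and g: "g \<in> hom RTc W A"
    and e: "Cmp RTc m f = Cmp RTc m g"
  shows "f = g"
proof (rule arr_eqI[OF f g])
  fix s w a assume fa: "ap s f w a"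
  obtain x where x: "ap s m a x" using ap_ex[OF m(2)] ap_cod[OF f fa] by blast
  obtain a' where a': "ap s g w a'" "ap s m a' x" using comp_eqD[OF e f m(2) g m(2) fa x] by blast
  show "ap s g w a" using ap_cong[OF g a'(1) ap_dom[OF g a'(1)] imonoD[OF m a'(2) x]] .
qed

lemma imono_mono: "imono m \<Longrightarrow> mono_arr RTc m"
  unfolding mono_arr_def
proof (intro conjI ballI impI)
  assume m: "imono m"
  then show a: "m \<in> Arr RTc" by (simp add: imono_def)
  fix W f g assume "f \<in> hom RTc W (Src RTc m)" "g \<in> hom RTc W (Src RTc m)" "Cmp RTc m f = Cmp RTc m g"
  then show "f = g" using imono_cancel[OF m arr_hom[OF a]] by (simp add: RT_simps)
qed

lemma imono_incl: "A \<in> ob \<Longrightarrow> pred A P \<Longrightarrow> imono (incl A P)"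
proof -
  assume A: "A \<in> ob" and P: "pred A P"
  have h: "incl A P \<in> hom RTc (subo A P) A" using incl_hom[OF A P] .
  show ?thesis
    unfolding imono_def ap_incl[OF A P] homD(3)[OF h] eqv_subo
    using homD(7)[OF h] eqv_sym[OF A] eqv_trans[OF A] by blast
qed

definition tru :: "('u, 'a) stage \<Rightarrow> ('u, 'a) rt_arr \<Rightarrow> ('u \<Rightarrow> 'u) \<Rightarrow> bool" where
  "tru s m x \<longleftrightarrow> (\<exists>a. ap s m a x)"

definition Pm :: "('u, 'a) rt_arr \<Rightarrow> 'u \<Rightarrow> 'a tval" where
  "Pm m = (\<lambda>x. ex_tv (fst (fst m)) (\<lambda>a. rep m a x))"

lemma T_Pm:
  assumes m: "m \<in> hom RTc A B" and x: "x \<in> el s (fst B)"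
  shows "tp s (Pm m) x \<longleftrightarrow> tru s m x"
proof -
  have "tp s (Pm m) x \<longleftrightarrow> (\<exists>a. (\<forall>c\<in>dm s. a c \<in> fst A) \<and> T s (\<lambda>c. rep m (a c) (x c)))"
    unfolding tp_def Pm_def homD(3)[OF m] by (rule T_ex)
  then show ?thesis using x by (simp add: tru_def ap_rl[OF m] rl_def el_def)
qed

lemma pred_Pm: assumes m: "m \<in> hom RTc A B" shows "pred B (Pm m)"
proof (rule predI)
  fix x assume "x \<in> fst B"
  then show "Pm m x \<in> Sig D" unfolding Pm_def
    using sig2D[OF sfr_sig[OF homD(5)[OF m]]] homD(3)[OF m] by (intro Sig_ex) simp
next
  fix s x y assume e: "eqv s B x y" and "tp s (Pm m) x"
  then obtain a where "ap s m a x" using T_Pm[OF m eqv_el(1)[OF e]] unfolding tru_def by blast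
  then have "ap s m a y" using ap_cong[OF m] ap_dom[OF m] e by blast
  then show "tp s (Pm m) y" using T_Pm[OF m eqv_el(2)[OF e]] unfolding tru_def by blast
qed

lemma tru_incl:
  assumes "A \<in> ob" "pred A P"
  shows "tru s (incl A P) x \<longleftrightarrow> eqv s A x x \<and> tp s P x"
  unfolding tru_def ap_incl[OF assms]
  using pred_ext[OF assms(2)] eqv_refl2[OF assms(1)] by blast

lemma tru_eqv: "m \<in> hom RTc A B \<Longrightarrow> tru s m x \<Longrightarrow> eqv s B x x"
  unfolding tru_def using ap_cod by blast

lemma tru_sub: "m \<in> hom RTc A B \<Longrightarrow> sub \<pi> s' s \<Longrightarrow> tru s m x \<Longrightarrow> tru s' m (\<lambda>c. x (\<pi> c))"
  unfolding tru_def using ap_sub by blast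

lemma image_le:
  assumes m: "m \<in> hom RTc A X" and n: "n \<in> hom RTc B X" and im: "imono n"
    and le: "\<And>s x. tru s m x \<Longrightarrow> tru s n x"
  shows "\<exists>h \<in> hom RTc A B. m = Cmp RTc n h"
proof -
  let ?F = "\<lambda>a b. ex_tv (fst X) (\<lambda>x. and_tv D (rep m a x) (rep n b x))"
  have A: "A \<in> ob" and B: "B \<in> ob" using homD[OF m] homD[OF n] by auto
  have sm: "sig2 (fst A) (fst X) (rep m)" and sn: "sig2 (fst B) (fst X) (rep n)"
    using sfr_sig[OF homD(5)] m n by auto
  have rl: "rl s A B ?F a b \<longleftrightarrow> (\<exists>x. ap s m a x \<and> ap s n b x)" for s a b
    unfolding rl_def T_ex T_and ap_rl[OF m] ap_rl[OF n] by (auto simp: el_def)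
  have F: "sfr A B ?F"
    unfolding sfr_def rl
  proof (intro conjI allI impI)
    show "sig2 (fst A) (fst B) ?F" using sm sn by (simp add: sig2_def)
  next
    fix s a b assume "\<exists>x. ap s m a x \<and> ap s n b x"
    then show "eqv s A a a" "eqv s B b b" using ap_dom[OF m] ap_dom[OF n] by blast+
  next
    fix s a b a' b' assume "\<exists>x. ap s m a x \<and> ap s n b x" "eqv s A a a'" "eqv s B b b'"
    then show "\<exists>x. ap s m a' x \<and> ap s n b' x"
      using ap_cong[OF m] ap_cong[OF n] ap_cod[OF m] by blast
  next
    fix s a b b' assume "\<exists>x. ap s m a x \<and> ap s n b x" "\<exists>x. ap s m a x \<and> ap s n b' x"
    then obtain x y where x: "ap s m a x" "ap s n b x" "ap s m a y" "ap s n b' y" by blast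
    have "ap s n b y" using ap_cong[OF n x(2) ap_dom[OF n x(2)] ap_fun[OF m x(1,3)]] .
    then show "eqv s B b b'" using imonoD[OF im n] x(4) by blast
  next
    fix s a assume "eqv s A a a"
    then obtain x where x: "ap s m a x" using ap_ex[OF m] by blast
    then have "tru s n x" using le unfolding tru_def by blast
    then show "\<exists>b x. ap s m a x \<and> ap s n b x" using x unfolding tru_def by blast
  qed
  have h: "rt_arrow D A B ?F \<in> hom RTc A B" using arrI[OF A B F] by blast
  have "Cmp RTc n (rt_arrow D A B ?F) = m"
  proof (rule comp_eqI1[OF h n m])
    fix s a b x assume "ap s (rt_arrow D A B ?F) a b" and b: "ap s n b x"
    then obtain y where y: "ap s m a y" "ap s n b y" unfolding arrI(2)[OF A B F] rl by blast
    show "ap s m a x" using ap_cong[OF m y(1) ap_dom[OF m y(1)] ap_fun[OF n y(2) b]] .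
  qed
  then show ?thesis by (intro bexI[OF _ h]) (rule sym)
qed

lemma image_le_conv:
  assumes m: "m \<in> hom RTc A X" and n: "n \<in> hom RTc B X" and im: "imono n"
  shows "(\<exists>h \<in> hom RTc A B. m = Cmp RTc n h) \<longleftrightarrow> (\<forall>s x. tru s m x \<longrightarrow> tru s n x)"
proof
  assume "\<exists>h \<in> hom RTc A B. m = Cmp RTc n h"
  then obtain h where h: "h \<in> hom RTc A B" "m = Cmp RTc n h" by blast
  show "\<forall>s x. tru s m x \<longrightarrow> tru s n x"
    unfolding tru_def h(2) comp_hom(2)[OF h(1) n] by blast
next
  assume "\<forall>s x. tru s m x \<longrightarrow> tru s n x"
  then show "\<exists>h \<in> hom RTc A B. m = Cmp RTc n h" by (intro image_le[OF m n im]) blast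
qed

subsection \<open>Products\<close>

definition prd :: "('u, 'a) rt_obj \<Rightarrow> ('u, 'a) rt_obj \<Rightarrow> ('u, 'a) rt_obj" where
  "prd A B = ({u. pf u \<in> fst A \<and> ps u \<in> fst B}, \<lambda>u v. and_tv D (snd A (pf u) (pf v)) (snd B (ps u) (ps v)))"

lemma eqv_prd: "eqv s (prd A B) u v \<longleftrightarrow> eqv s A (\<lambda>c. pf (u c)) (\<lambda>c. pf (v c)) \<and> eqv s B (\<lambda>c. ps (u c)) (\<lambda>c. ps (v c))"
  by (auto simp: eqv_def prd_def el_def T_and)

lemma el_prd: "u \<in> el s (fst (prd A B)) \<longleftrightarrow> (\<lambda>c. pf (u c)) \<in> el s (fst A) \<and> (\<lambda>c. ps (u c)) \<in> el s (fst B)"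
  by (auto simp: prd_def el_def)

lemma infinite_u: "infinite (UNIV :: 'u set)"
  using universe by (simp add: set_universe_def)

lemma finite_less_u: "finite X \<Longrightarrow> |X| <o |UNIV :: 'u set|"
  using finite_ordLess_infinite[OF card_of_Well_order card_of_Well_order, of X "UNIV :: 'u set"] infinite_u
  by (simp add: Field_card_of)

lemma card_Times_less:
  assumes "|X| <o |UNIV :: 'u set|" "|Y| <o |UNIV :: 'u set|"
  shows "|X \<times> Y| <o |UNIV :: 'u set|"
proof (cases "finite X \<and> finite Y")
  case True
  then show ?thesis by (simp add: finite_less_u)
next
  case False
  consider "X = {} \<or> Y = {}" | "infinite X" "Y \<noteq> {}" "|Y| \<le>o |X|" | "infinite Y" "X \<noteq> {}" "|X| \<le>o |Y|"
    using False ordLeq_total[OF card_of_Well_order card_of_Well_order, of X Y]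
      card_of_ordLeq_infinite[of X Y] card_of_ordLeq_infinite[of Y X] by blast
  then show ?thesis
  proof cases
    case 1
    then have "finite (X \<times> Y)" by auto
    then show ?thesis by (simp add: finite_less_u)
  next
    case 2
    then show ?thesis using card_of_Times_infinite[of X Y] assms(1) ordIso_ordLess_trans by blast
  next
    case 3
    then show ?thesis using card_of_Times_infinite[of Y X] assms(2) ordIso_ordLess_trans by blast
  qed
qed

lemma prd_ob:
  assumes A: "A \<in> ob" and B: "B \<in> ob"
  shows "prd A B \<in> ob"
  unfolding ob_iff eqv_prd
proof (intro conjI allI impI)
  have "|fst (prd A B)| \<le>o |fst A \<times> fst B|"
    unfolding card_of_ordLeq[symmetric]
  proof (intro exI conjI)
    show "inj_on (\<lambda>u. (pf u, ps u)) (fst (prd A B))"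
      by (rule inj_onI) (metis prod.inject pr_simps(3))
    show "(\<lambda>u. (pf u, ps u)) ` fst (prd A B) \<subseteq> fst A \<times> fst B" by (auto simp: prd_def)
  qed
  moreover have "|fst A \<times> fst B| <o |UNIV :: 'u set|"
    using A B by (intro card_Times_less) (simp_all add: ob_iff)
  ultimately show "|fst (prd A B)| <o |UNIV :: 'u set|" by (rule ordLeq_ordLess_trans)
  show "sig2 (fst (prd A B)) (fst (prd A B)) (snd (prd A B))"
    using ob_sig[OF A] ob_sig[OF B] by (simp add: sig2_def prd_def)
qed (use eqv_sym[OF A] eqv_sym[OF B] eqv_trans[OF A] eqv_trans[OF B] in metis)+

definition p1 :: "('u, 'a) rt_obj \<Rightarrow> ('u, 'a) rt_obj \<Rightarrow> ('u, 'a) rt_arr" where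
  "p1 A B = rt_arrow D (prd A B) A (\<lambda>u x. and_tv D (snd A (pf u) x) (snd B (ps u) (ps u)))"
definition p2 :: "('u, 'a) rt_obj \<Rightarrow> ('u, 'a) rt_obj \<Rightarrow> ('u, 'a) rt_arr" where
  "p2 A B = rt_arrow D (prd A B) B (\<lambda>u x. and_tv D (snd B (ps u) x) (snd A (pf u) (pf u)))"

lemma p1_arr:
  assumes A: "A \<in> ob" and B: "B \<in> ob"
  shows p1_hom: "p1 A B \<in> hom RTc (prd A B) A"
    and ap_p1: "ap s (p1 A B) u x \<longleftrightarrow> eqv s A (\<lambda>c. pf (u c)) x \<and> eqv s B (\<lambda>c. ps (u c)) (\<lambda>c. ps (u c))"
proof -
  let ?F = "\<lambda>u x. and_tv D (snd A (pf u) x) (snd B (ps u) (ps u))"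
  have rl: "rl s (prd A B) A ?F u x \<longleftrightarrow> eqv s A (\<lambda>c. pf (u c)) x \<and> eqv s B (\<lambda>c. ps (u c)) (\<lambda>c. ps (u c))" for s u x
    by (auto simp: rl_def eqv_def T_and el_prd)
  have "sfr (prd A B) A ?F"
    unfolding sfr_def rl eqv_prd
  proof (intro conjI allI impI)
    show "sig2 (fst (prd A B)) (fst A) ?F"
      using ob_sig[OF A] ob_sig[OF B] by (simp add: sig2_def prd_def)
  qed (use eqv_sym[OF A] eqv_trans[OF A] eqv_refl1[OF A] eqv_refl2[OF A] eqv_refl2[OF B] in metis)+
  from arrI[OF prd_ob[OF A B] A this] show "p1 A B \<in> hom RTc (prd A B) A"
    and "ap s (p1 A B) u x \<longleftrightarrow> eqv s A (\<lambda>c. pf (u c)) x \<and> eqv s B (\<lambda>c. ps (u c)) (\<lambda>c. ps (u c))"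
    unfolding p1_def rl by blast+
qed

lemma p2_arr:
  assumes A: "A \<in> ob" and B: "B \<in> ob"
  shows p2_hom: "p2 A B \<in> hom RTc (prd A B) B"
    and ap_p2: "ap s (p2 A B) u x \<longleftrightarrow> eqv s B (\<lambda>c. ps (u c)) x \<and> eqv s A (\<lambda>c. pf (u c)) (\<lambda>c. pf (u c))"
proof -
  let ?F = "\<lambda>u x. and_tv D (snd B (ps u) x) (snd A (pf u) (pf u))"
  have rl: "rl s (prd A B) B ?F u x \<longleftrightarrow> eqv s B (\<lambda>c. ps (u c)) x \<and> eqv s A (\<lambda>c. pf (u c)) (\<lambda>c. pf (u c))" for s u x
    by (auto simp: rl_def eqv_def T_and el_prd)
  have "sfr (prd A B) B ?F"
    unfolding sfr_def rl eqv_prd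
  proof (intro conjI allI impI)
    show "sig2 (fst (prd A B)) (fst B) ?F"
      using ob_sig[OF A] ob_sig[OF B] by (simp add: sig2_def prd_def)
  qed (use eqv_sym[OF B] eqv_trans[OF B] eqv_refl1[OF B] eqv_refl2[OF B] eqv_refl2[OF A] in metis)+
  from arrI[OF prd_ob[OF A B] B this] show "p2 A B \<in> hom RTc (prd A B) B"
    and "ap s (p2 A B) u x \<longleftrightarrow> eqv s B (\<lambda>c. ps (u c)) x \<and> eqv s A (\<lambda>c. pf (u c)) (\<lambda>c. pf (u c))"
    unfolding p2_def rl by blast+
qed

lemma tuple:
  assumes f: "f \<in> hom RTc W A" and g: "g \<in> hom RTc W B"
  shows "\<exists>h \<in> hom RTc W (prd A B). (\<forall>s w u. ap s h w u \<longleftrightarrow> ap s f w (\<lambda>c. pf (u c)) \<and> ap s g w (\<lambda>c. ps (u c)))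
     \<and> Cmp RTc (p1 A B) h = f \<and> Cmp RTc (p2 A B) h = g"
proof -
  let ?F = "\<lambda>w u. and_tv D (rep f w (pf u)) (rep g w (ps u))"
  have W: "W \<in> ob" and A: "A \<in> ob" and B: "B \<in> ob" using homD[OF f] homD[OF g] by auto
  have rl: "rl s W (prd A B) ?F w u \<longleftrightarrow> ap s f w (\<lambda>c. pf (u c)) \<and> ap s g w (\<lambda>c. ps (u c))" for s w u
    unfolding ap_rl[OF f] ap_rl[OF g] by (auto simp: rl_def T_and el_prd)
  have F: "sfr W (prd A B) ?F"
    unfolding sfr_def rl eqv_prd
  proof (intro conjI allI impI)
    show "sig2 (fst W) (fst (prd A B)) ?F"
      using sfr_sig[OF homD(5)[OF f]] sfr_sig[OF homD(5)[OF g]] by (simp add: sig2_def prd_def)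
  next
    fix s w assume w: "eqv s W w w"
    obtain x y where "ap s f w x" "ap s g w y" using ap_ex[OF f w] ap_ex[OF g w] by blast
    then show "\<exists>u. ap s f w (\<lambda>c. pf (u c)) \<and> ap s g w (\<lambda>c. ps (u c))"
      by (intro exI[of _ "\<lambda>c. pr (x c) (y c)"]) simp
  qed (use ap_dom[OF f] ap_cod[OF f] ap_cod[OF g] ap_cong[OF f] ap_cong[OF g] ap_fun[OF f] ap_fun[OF g] in metis)+
  define h where "h = rt_arrow D W (prd A B) ?F"
  note arr = arrI[OF W prd_ob[OF A B] F, folded h_def, unfolded rl]
  have "Cmp RTc (p1 A B) h = f"
    by (rule comp_eqI1[OF arr(1) p1_hom[OF A B] f]) (use arr(2) ap_p1[OF A B] ap_cong[OF f] ap_dom[OF f] in metis)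
  moreover have "Cmp RTc (p2 A B) h = g"
    by (rule comp_eqI1[OF arr(1) p2_hom[OF A B] g]) (use arr(2) ap_p2[OF A B] ap_cong[OF g] ap_dom[OF g] in metis)
  ultimately show ?thesis using arr by (intro bexI[of _ h]) blast+
qed

lemma prd_arr_eqI:
  assumes A: "A \<in> ob" and B: "B \<in> ob" and h: "h \<in> hom RTc W (prd A B)" "h' \<in> hom RTc W (prd A B)"
    and e1: "Cmp RTc (p1 A B) h = Cmp RTc (p1 A B) h'" and e2: "Cmp RTc (p2 A B) h = Cmp RTc (p2 A B) h'"
  shows "h = h'"
proof (rule arr_eqI[OF h])
  fix s w u assume u: "ap s h w u"
  have eu: "eqv s A (\<lambda>c. pf (u c)) (\<lambda>c. pf (u c))" "eqv s B (\<lambda>c. ps (u c)) (\<lambda>c. ps (u c))"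
    using ap_cod[OF h(1) u] by (simp_all add: eqv_prd)
  obtain v where v: "ap s h' w v" "eqv s A (\<lambda>c. pf (v c)) (\<lambda>c. pf (u c))"
    using comp_eqD[OF e1 h(1) p1_hom[OF A B] h(2) p1_hom[OF A B] u, of "\<lambda>c. pf (u c)"] eu
    unfolding ap_p1[OF A B] by blast
  obtain v' where v': "ap s h' w v'" "eqv s B (\<lambda>c. ps (v' c)) (\<lambda>c. ps (u c))"
    using comp_eqD[OF e2 h(1) p2_hom[OF A B] h(2) p2_hom[OF A B] u, of "\<lambda>c. ps (u c)"] eu
    unfolding ap_p2[OF A B] by blast
  have "eqv s (prd A B) v v'" using ap_fun[OF h(2) v(1) v'(1)] .
  then have "eqv s (prd A B) v u" using v v' eqv_trans[OF B] unfolding eqv_prd by blast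
  then show "ap s h' w u" using ap_cong[OF h(2) v(1) ap_dom[OF h(2) v(1)]] by blast
qed

lemma prd_is_product:
  assumes A: "A \<in> ob" and B: "B \<in> ob"
  shows "is_product RTc A B (prd A B) (p1 A B) (p2 A B)"
  unfolding is_product_def
proof (intro conjI ballI)
  show "prd A B \<in> Obj RTc" using prd_ob[OF A B] by (simp add: RT_simps)
  show "p1 A B \<in> hom RTc (prd A B) A" "p2 A B \<in> hom RTc (prd A B) B" using p1_hom[OF A B] p2_hom[OF A B] .
  fix W f g assume f: "f \<in> hom RTc W A" and g: "g \<in> hom RTc W B"
  show "\<exists>!h. h \<in> hom RTc W (prd A B) \<and> Cmp RTc (p1 A B) h = f \<and> Cmp RTc (p2 A B) h = g"
  proof (rule ex_ex1I)
    show "\<exists>h. h \<in> hom RTc W (prd A B) \<and> Cmp RTc (p1 A B) h = f \<and> Cmp RTc (p2 A B) h = g"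
      using tuple[OF f g] by blast
    fix h h' assume "h \<in> hom RTc W (prd A B) \<and> Cmp RTc (p1 A B) h = f \<and> Cmp RTc (p2 A B) h = g"
      "h' \<in> hom RTc W (prd A B) \<and> Cmp RTc (p1 A B) h' = f \<and> Cmp RTc (p2 A B) h' = g"
    then have "h \<in> hom RTc W (prd A B)" "h' \<in> hom RTc W (prd A B)"
      "Cmp RTc (p1 A B) h = Cmp RTc (p1 A B) h'" "Cmp RTc (p2 A B) h = Cmp RTc (p2 A B) h'" by (blast, blast, metis, metis)
    then show "h = h'" by (rule prd_arr_eqI[OF A B])
  qed
qed

lemma kernel_pair:
  assumes m: "m \<in> hom RTc A X"
  defines "Q \<equiv> \<lambda>u. ex_tv (fst X) (\<lambda>x. and_tv D (rep m (pf u) x) (rep m (ps u) x))"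
  shows "pred (prd A A) Q"
    and "tp s Q u \<and> u \<in> el s (fst (prd A A)) \<longleftrightarrow> (\<exists>x. ap s m (\<lambda>c. pf (u c)) x \<and> ap s m (\<lambda>c. ps (u c)) x)"
proof -
  have A: "A \<in> ob" using homD[OF m] by simp
  have TQ: "tp s Q u \<and> u \<in> el s (fst (prd A A)) \<longleftrightarrow> (\<exists>x. ap s m (\<lambda>c. pf (u c)) x \<and> ap s m (\<lambda>c. ps (u c)) x)" for s u
    unfolding tp_def Q_def T_ex T_and ap_rl[OF m] rl_def el_prd by (auto simp: el_def)
  then show "tp s Q u \<and> u \<in> el s (fst (prd A A)) \<longleftrightarrow> (\<exists>x. ap s m (\<lambda>c. pf (u c)) x \<and> ap s m (\<lambda>c. ps (u c)) x)" .
  show "pred (prd A A) Q"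
  proof (rule predI)
    fix u assume "u \<in> fst (prd A A)"
    then show "Q u \<in> Sig D" using sfr_sig[OF homD(5)[OF m]] unfolding Q_def by (simp add: prd_def sig2_def)
  next
    fix s u v assume e: "eqv s (prd A A) u v" and "tp s Q u"
    then have "\<exists>x. ap s m (\<lambda>c. pf (u c)) x \<and> ap s m (\<lambda>c. ps (u c)) x" using TQ eqv_el(1) by blast
    then have "\<exists>x. ap s m (\<lambda>c. pf (v c)) x \<and> ap s m (\<lambda>c. ps (v c)) x"
      using e ap_cong[OF m] ap_cod[OF m] unfolding eqv_prd by blast
    then show "tp s Q v" using TQ by blast
  qed
qed

lemma kernel_imono:
  assumes m: "m \<in> hom RTc A X"
    and K: "\<And>f g. f \<in> hom RTc (subo (prd A A) (\<lambda>u. ex_tv (fst X) (\<lambda>x. and_tv D (rep m (pf u) x) (rep m (ps u) x)))) A \<Longrightarrow>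
      g \<in> hom RTc (subo (prd A A) (\<lambda>u. ex_tv (fst X) (\<lambda>x. and_tv D (rep m (pf u) x) (rep m (ps u) x)))) A \<Longrightarrow>
      Cmp RTc m f = Cmp RTc m g \<Longrightarrow> f = g"
  shows "imono m"
proof -
  define Q where "Q = (\<lambda>u. ex_tv (fst X) (\<lambda>x. and_tv D (rep m (pf u) x) (rep m (ps u) x)))"
  note Q = kernel_pair[OF m, folded Q_def]
  have A: "A \<in> ob" using homD[OF m] by simp
  have AA: "prd A A \<in> ob" using prd_ob[OF A A] .
  define f where "f = Cmp RTc (p1 A A) (incl (prd A A) Q)"
  define g where "g = Cmp RTc (p2 A A) (incl (prd A A) Q)"
  note i = incl_hom[OF AA Q(1)]
  have f: "f \<in> hom RTc (subo (prd A A) Q) A" and g: "g \<in> hom RTc (subo (prd A A) Q) A"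
    unfolding f_def g_def using comp_hom(1)[OF i] p1_hom[OF A A] p2_hom[OF A A] by blast+
  have af: "ap s f u a \<Longrightarrow> eqv s A (\<lambda>c. pf (u c)) a \<and> tp s Q u" for s u a
    unfolding f_def comp_hom(2)[OF i p1_hom[OF A A]] ap_incl[OF AA Q(1)] ap_p1[OF A A] eqv_prd
    using eqv_trans[OF A] by blast
  have ag: "eqv s (prd A A) u u \<Longrightarrow> tp s Q u \<Longrightarrow> ap s g u (\<lambda>c. ps (u c))" for s u
    unfolding g_def comp_hom(2)[OF i p2_hom[OF A A]] ap_incl[OF AA Q(1)] ap_p2[OF A A] eqv_prd
    by blast
  have af': "eqv s (prd A A) u u \<Longrightarrow> tp s Q u \<Longrightarrow> ap s f u (\<lambda>c. pf (u c))" for s u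
    unfolding f_def comp_hom(2)[OF i p1_hom[OF A A]] ap_incl[OF AA Q(1)] ap_p1[OF A A] eqv_prd
    by blast
  have "Cmp RTc m f = Cmp RTc m g"
  proof (rule comp_eqI[OF f m g m])
    fix s u a x assume a: "ap s f u a" and x: "ap s m a x"
    have uu: "eqv s (prd A A) u u" using ap_dom[OF f a] by (simp add: eqv_subo)
    have e: "eqv s A (\<lambda>c. pf (u c)) a" and q: "tp s Q u" using af[OF a] by auto
    obtain y where y: "ap s m (\<lambda>c. pf (u c)) y" "ap s m (\<lambda>c. ps (u c)) y"
      using Q(2)[of s u] q eqv_el(1)[OF uu] by blast
    have "ap s m a y" using ap_cong[OF m y(1) e ap_cod[OF m y(1)]] .
    then have "eqv s X y x" using ap_fun[OF m] x by blast
    then have "ap s m (\<lambda>c. ps (u c)) x" using ap_cong[OF m y(2) ap_dom[OF m y(2)]] by blast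
    then show "\<exists>a'. ap s g u a' \<and> ap s m a' x" using ag[OF uu q] by blast
  qed
  then have fg: "f = g" using K[folded Q_def] f g by blast
  show ?thesis
    unfolding imono_def homD(3)[OF m]
  proof (intro conjI allI impI)
    show "m \<in> Arr RTc" using homD(7)[OF m] .
    fix s a a' x assume x: "ap s m a x" "ap s m a' x"
    define u where "u = (\<lambda>c. pr (a c) (a' c))"
    have uu: "eqv s (prd A A) u u" using ap_dom[OF m x(1)] ap_dom[OF m x(2)] by (simp add: eqv_prd u_def)
    have q: "tp s Q u" using Q(2)[of s u] x by (auto simp: u_def)
    show "eqv s A a a'"
      using ap_fun[OF f af'[OF uu q]] ag[OF uu q] by (simp add: fg u_def)
  qed
qed

lemma mono_imono:
  assumes "mono_arr RTc m" "m \<in> hom RTc A X"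
  shows "imono m"
proof (rule kernel_imono[OF assms(2)])
  let ?K = "subo (prd A A) (\<lambda>u. ex_tv (fst X) (\<lambda>x. and_tv D (rep m (pf u) x) (rep m (ps u) x)))"
  fix f g assume f: "f \<in> hom RTc ?K A" and "g \<in> hom RTc ?K A" "Cmp RTc m f = Cmp RTc m g"
  then show "f = g"
    using assms(1) homD(1)[OF f] unfolding mono_arr_def homD(8)[OF assms(2)] RT_simps(1) by blast
qed

subsection \<open>The terminal object and the subobject classifier\<close>

lemma card_Pow_less:
  fixes X :: "'x set"
  assumes "|X| <o |UNIV :: 'u set|"
  shows "|Pow X| <o |UNIV :: 'u set|"
proof -
  obtain g :: "'x \<Rightarrow> 'u" where g: "inj_on g X"
    using assms ordLess_imp_ordLeq card_of_ordLeq[of X "UNIV :: 'u set"] by blast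
  have "|g ` X| \<le>o |X|" by (rule card_of_image)
  then have "|g ` X| <o |UNIV :: 'u set|" using assms by (rule ordLeq_ordLess_trans)
  then have "|Pow (g ` X)| <o |UNIV :: 'u set|"
    using universe unfolding set_universe_def strong_limit_def by (simp add: Field_card_of)
  moreover have "|Pow X| \<le>o |Pow (g ` X)|"
    unfolding card_of_ordLeq[symmetric]
    using inj_on_image_Pow[OF g] by (intro exI[of _ "(`) g"]) auto
  ultimately show ?thesis using ordLeq_ordLess_trans by blast
qed

lemma card_Sig: "|Sig D| <o |UNIV :: 'u set|"
proof -
  have "|Sig D| \<le>o |Pow (UNIV :: 'a set) \<times> Pow (UNIV :: 'a set)|"
    by (rule card_of_mono1) auto
  moreover have "|Pow (UNIV :: 'a set) \<times> Pow (UNIV :: 'a set)| <o |UNIV :: 'u set|"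
    by (intro card_Times_less card_Pow_less card_pca)
  ultimately show ?thesis by (rule ordLeq_ordLess_trans)
qed

abbreviation code :: "'a tval \<Rightarrow> 'u" where "code \<equiv> tv_code D"
abbreviation dec :: "'u \<Rightarrow> 'a tval" where "dec \<equiv> tv_decode D"
abbreviation One :: "('u, 'a) rt_obj" where "One \<equiv> rt_one D"
abbreviation Om :: "('u, 'a) rt_obj" where "Om \<equiv> rt_omega D"
abbreviation tt :: "('u, 'a) rt_arr" where "tt \<equiv> rt_true D"

lemma inj_code: "inj_on code (Sig D)"
proof -
  have "\<exists>e :: 'a tval \<Rightarrow> 'u. inj_on e (Sig D)"
    using card_Sig ordLess_imp_ordLeq card_of_ordLeq[of "Sig D" "UNIV :: 'u set"] by blast
  then show ?thesis unfolding tv_code_def by (rule someI_ex)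
qed

lemma dec_code [simp]: "A \<in> Sig D \<Longrightarrow> dec (code A) = A"
  unfolding tv_decode_def using inj_code by (rule inv_into_f_f)

lemma fst_Om: "fst Om = code ` Sig D" by (simp add: rt_omega_def)

lemma dec_Sig: "u \<in> fst Om \<Longrightarrow> dec u \<in> Sig D" by (auto simp: fst_Om)

lemma dec_Sig_el: "u \<in> el s (fst Om) \<Longrightarrow> c \<in> dm s \<Longrightarrow> dec (u c) \<in> Sig D"
  by (simp add: dec_Sig el_def)

lemma code_el: "(\<And>c. c \<in> dm s \<Longrightarrow> P c \<in> Sig D) \<Longrightarrow> (\<lambda>c. code (P c)) \<in> el s (fst Om)"
  by (simp add: el_def fst_Om)

lemma fst_One: "fst One = {undefined}" by (simp add: rt_one_def)

lemma eqv_One: "eqv s One x y \<longleftrightarrow> x \<in> el s (fst One) \<and> y \<in> el s (fst One)"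
  by (simp add: eqv_def rt_one_def T_top)

lemma One_ob: "One \<in> ob"
  unfolding ob_iff eqv_One by (auto simp: fst_One finite_less_u sig2_def) (simp add: rt_one_def)

lemma One_el: "(\<lambda>c. undefined) \<in> el s (fst One)" by (simp add: el_def fst_One)

definition bang :: "('u, 'a) rt_obj \<Rightarrow> ('u, 'a) rt_arr" where
  "bang W = rt_arrow D W One (\<lambda>w x. snd W w w)"

lemma bang_arr:
  assumes W: "W \<in> ob"
  shows bang_hom: "bang W \<in> hom RTc W One"
    and ap_bang: "ap s (bang W) w x \<longleftrightarrow> eqv s W w w \<and> x \<in> el s (fst One)"
proof -
  let ?F = "\<lambda>w x :: 'u. snd W w w"
  have rl: "rl s W One ?F w x \<longleftrightarrow> eqv s W w w \<and> x \<in> el s (fst One)" for s w x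
    by (auto simp: rl_def eqv_def)
  have "sfr W One ?F"
    unfolding sfr_def rl eqv_One
  proof (intro conjI allI impI)
    show "sig2 (fst W) (fst One) ?F" using ob_sig[OF W] by (simp add: sig2_def)
  next
    fix s w assume "eqv s W w w"
    then show "\<exists>y. eqv s W w w \<and> y \<in> el s (fst One)" using One_el by blast
  qed (use eqv_refl2[OF W] in metis)+
  from arrI[OF W One_ob this] show "bang W \<in> hom RTc W One"
    and "ap s (bang W) w x \<longleftrightarrow> eqv s W w w \<and> x \<in> el s (fst One)"
    unfolding bang_def rl by blast+
qed

lemma to_One_unique:
  assumes f: "f \<in> hom RTc W One" and g: "g \<in> hom RTc W One"
  shows "f = g"
proof (rule arr_eqI[OF f g])
  fix s w x assume x: "ap s f w x"
  obtain y where y: "ap s g w y" using ap_ex[OF g ap_dom[OF f x]] by blast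
  have "eqv s One y x" using ap_cod[OF f x] ap_cod[OF g y] by (simp add: eqv_One)
  then show "ap s g w x" using ap_cong[OF g y ap_dom[OF g y]] by blast
qed

lemma eqv_Om: "eqv s Om u v \<longleftrightarrow> u \<in> el s (fst Om) \<and> v \<in> el s (fst Om) \<and>
    T s (\<lambda>c. imp_tv D (dec (u c)) (dec (v c))) \<and> T s (\<lambda>c. imp_tv D (dec (v c)) (dec (u c)))"
  by (auto simp: eqv_def rt_omega_def T_iff)

lemma Om_ob: "Om \<in> ob"
  unfolding ob_iff eqv_Om
proof (intro conjI allI impI)
  show "|fst Om| <o |UNIV :: 'u set|"
    unfolding fst_Om using card_of_image card_Sig by (rule ordLeq_ordLess_trans)
  show "sig2 (fst Om) (fst Om) (snd Om)" by (simp add: sig2_def rt_omega_def)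
next
  fix s x y z
  assume 1: "x \<in> el s (fst Om) \<and> y \<in> el s (fst Om) \<and>
       T s (\<lambda>c. imp_tv D (dec (x c)) (dec (y c))) \<and> T s (\<lambda>c. imp_tv D (dec (y c)) (dec (x c)))"
   and 2: "y \<in> el s (fst Om) \<and> z \<in> el s (fst Om) \<and>
       T s (\<lambda>c. imp_tv D (dec (y c)) (dec (z c))) \<and> T s (\<lambda>c. imp_tv D (dec (z c)) (dec (y c)))"
  show "x \<in> el s (fst Om)" "z \<in> el s (fst Om)" using 1 2 by blast+
  show "T s (\<lambda>c. imp_tv D (dec (x c)) (dec (z c)))"
    by (rule T_imp_trans[where Q = "\<lambda>c. dec (y c)"]) (use 1 2 dec_Sig_el in blast)+
  show "T s (\<lambda>c. imp_tv D (dec (z c)) (dec (x c)))"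
    by (rule T_imp_trans[where Q = "\<lambda>c. dec (y c)"]) (use 1 2 dec_Sig_el in blast)+
qed blast+

lemma pred_imp:
  assumes A: "A \<in> ob" and P: "pred A P" and e: "eqv s A x y"
  shows "T s (\<lambda>c. imp_tv D (P (x c)) (P (y c)))"
proof (rule T_impI)
  fix c assume "c \<in> dm s"
  then show "P (x c) \<in> Sig D" using pred_sig_el[OF P eqv_el(1)[OF e]] by blast
next
  fix s' :: "('u, 'a) stage" and \<pi> assume sub: "sub \<pi> s' s" and 1: "T s' (\<lambda>c. P (x (\<pi> c)))"
  show "T s' (\<lambda>c. P (y (\<pi> c)))"
    using pred_ext[OF P eqv_sub[OF A sub e]] 1 by (simp add: tp_def)
qed

definition chi :: "('u, 'a) rt_obj \<Rightarrow> ('u \<Rightarrow> 'a tval) \<Rightarrow> ('u, 'a) rt_arr" where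
  "chi B P = rt_arrow D B Om (\<lambda>b v. and_tv D (snd B b b) (iff_tv D (P b) (dec v)))"

lemma rel_to_Om:
  assumes B: "B \<in> ob" and P: "pred B P"
  defines "F \<equiv> \<lambda>b v. and_tv D (snd B b b) (iff_tv D (P b) (dec v))"
  shows "sfr B Om F"
    and "rl s B Om F b v \<longleftrightarrow> eqv s B b b \<and> v \<in> el s (fst Om) \<and>
      T s (\<lambda>c. imp_tv D (P (b c)) (dec (v c))) \<and> T s (\<lambda>c. imp_tv D (dec (v c)) (P (b c)))"
proof -
  have rl: "rl s B Om F b v \<longleftrightarrow> eqv s B b b \<and> v \<in> el s (fst Om) \<and>
      T s (\<lambda>c. imp_tv D (P (b c)) (dec (v c))) \<and> T s (\<lambda>c. imp_tv D (dec (v c)) (P (b c)))" for s b v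
    unfolding F_def by (auto simp: rl_def eqv_def T_and T_iff)
  then show "rl s B Om F b v \<longleftrightarrow> eqv s B b b \<and> v \<in> el s (fst Om) \<and>
      T s (\<lambda>c. imp_tv D (P (b c)) (dec (v c))) \<and> T s (\<lambda>c. imp_tv D (dec (v c)) (P (b c)))" .
  show "sfr B Om F"
    unfolding sfr_def
  proof (intro conjI allI impI)
    show "sig2 (fst B) (fst Om) F" unfolding F_def using ob_sig[OF B] by (simp add: sig2_def)
  next
    fix s b v assume r: "rl s B Om F b v"
    then show "eqv s B b b" unfolding rl by blast
    from r have v: "v \<in> el s (fst Om)" unfolding rl by blast
    then have "T s (\<lambda>c. imp_tv D (dec (v c)) (dec (v c)))" by (intro T_imp_refl) (rule dec_Sig_el)
    with v show "eqv s Om v v" unfolding eqv_Om by blast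
  next
    fix s b v b' v' assume r: "rl s B Om F b v" and b: "eqv s B b b'" and v: "eqv s Om v v'"
    note r = r[unfolded rl] and v = v[unfolded eqv_Om]
    have b': "eqv s B b' b'" "eqv s B b' b" using b eqv_refl2[OF B] eqv_sym[OF B] by blast+
    have "T s (\<lambda>c. imp_tv D (P (b' c)) (dec (v c)))"
      by (rule T_imp_trans[where Q = "\<lambda>c. P (b c)"])
        (use pred_sig_el[OF P eqv_el(1)[OF b'(1)]] pred_imp[OF B P b'(2)] r in blast)+
    then have 1: "T s (\<lambda>c. imp_tv D (P (b' c)) (dec (v' c)))"
      by (rule T_imp_trans[rotated]) (use pred_sig_el[OF P eqv_el(1)[OF b'(1)]] v in blast)+
    have "T s (\<lambda>c. imp_tv D (dec (v' c)) (P (b c)))"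
      by (rule T_imp_trans[where Q = "\<lambda>c. dec (v c)"]) (use dec_Sig_el v r in blast)+
    then have 2: "T s (\<lambda>c. imp_tv D (dec (v' c)) (P (b' c)))"
      by (rule T_imp_trans[rotated]) (use dec_Sig_el v pred_imp[OF B P b] in blast)+
    show "rl s B Om F b' v'" unfolding rl using b' v 1 2 by blast
  next
    fix s b v v' assume r: "rl s B Om F b v" and r': "rl s B Om F b v'"
    note r = r[unfolded rl] and r' = r'[unfolded rl]
    have "T s (\<lambda>c. imp_tv D (dec (v c)) (dec (v' c)))"
      by (rule T_imp_trans[where Q = "\<lambda>c. P (b c)"]) (use dec_Sig_el r r' in blast)+
    moreover have "T s (\<lambda>c. imp_tv D (dec (v' c)) (dec (v c)))"
      by (rule T_imp_trans[where Q = "\<lambda>c. P (b c)"]) (use dec_Sig_el r r' in blast)+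
    ultimately show "eqv s Om v v'" unfolding eqv_Om using r r' by blast
  next
    fix s b assume b: "eqv s B b b"
    define v where "v = (\<lambda>c. code (P (b c)))"
    have sg: "\<And>c. c \<in> dm s \<Longrightarrow> P (b c) \<in> Sig D" using pred_sig_el[OF P eqv_el(1)[OF b]] by blast
    have refl: "T s (\<lambda>c. imp_tv D (P (b c)) (P (b c)))" by (rule T_imp_refl[OF sg])
    have "T s (\<lambda>c. imp_tv D (P (b c)) (dec (v c)))" "T s (\<lambda>c. imp_tv D (dec (v c)) (P (b c)))"
      by (subst T_cong[OF _ ], rule arg_cong2[where f = "imp_tv D"]; use refl sg in \<open>simp add: v_def\<close>)+
    moreover have "v \<in> el s (fst Om)" unfolding v_def by (rule code_el[OF sg])
    ultimately show "\<exists>v. rl s B Om F b v" unfolding rl using b by blast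
  qed
qed

lemma chi_arr:
  assumes B: "B \<in> ob" and P: "pred B P"
  shows chi_hom: "chi B P \<in> hom RTc B Om"
    and ap_chi: "ap s (chi B P) b v \<longleftrightarrow> eqv s B b b \<and> v \<in> el s (fst Om) \<and>
      T s (\<lambda>c. imp_tv D (P (b c)) (dec (v c))) \<and> T s (\<lambda>c. imp_tv D (dec (v c)) (P (b c)))"
  unfolding chi_def using arrI[OF B Om_ob rel_to_Om(1)[OF B P]] rel_to_Om(2)[OF B P] by simp_all

lemma rl_True: "rl s One Om (\<lambda>_ v. iff_tv D (top_tv D) (dec v)) x v \<longleftrightarrow>
    x \<in> el s (fst One) \<and> v \<in> el s (fst Om) \<and> tp s dec v"
proof -
  have "T s (\<lambda>c. imp_tv D (dec (v c)) (top_tv D))" if "v \<in> el s (fst Om)"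
    by (rule T_impK) (use dec_Sig_el[OF that] T_top in simp_all)
  moreover have "T s (\<lambda>c. imp_tv D (top_tv D) (dec (v c))) \<longleftrightarrow> tp s dec v" if "v \<in> el s (fst Om)"
  proof
    assume "T s (\<lambda>c. imp_tv D (top_tv D) (dec (v c)))"
    then show "tp s dec v" unfolding tp_def using T_top by (rule T_mp)
  next
    assume "tp s dec v"
    then show "T s (\<lambda>c. imp_tv D (top_tv D) (dec (v c)))"
      unfolding tp_def by (intro T_impK) (use dec_Sig_el[OF that] in simp_all)
  qed
  ultimately show ?thesis unfolding rl_def T_iff by blast
qed

lemma tp_dec_ext: "eqv s Om u v \<Longrightarrow> tp s dec u \<Longrightarrow> tp s dec v"
  unfolding eqv_Om tp_def using T_mp[of s "\<lambda>c. dec (u c)" "\<lambda>c. dec (v c)"] by blast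

lemma eqv_Om_true:
  assumes "u \<in> el s (fst Om)" "v \<in> el s (fst Om)" "tp s dec u" "tp s dec v"
  shows "eqv s Om u v"
  unfolding eqv_Om using assms(1,2) dec_Sig_el[OF assms(1)] dec_Sig_el[OF assms(2)] assms(3,4)[unfolded tp_def]
  by (auto intro: T_impK)

lemma tt_arr:
  shows tt_hom: "tt \<in> hom RTc One Om"
    and ap_tt: "ap s tt x v \<longleftrightarrow> x \<in> el s (fst One) \<and> v \<in> el s (fst Om) \<and> tp s dec v"
proof -
  have F: "sfr One Om (\<lambda>_ v. iff_tv D (top_tv D) (dec v))"
    unfolding sfr_def rl_True
  proof (intro conjI allI impI)
    fix s x assume "eqv s One x x"
    moreover have "tp s dec (\<lambda>c. code (top_tv D))" by (simp add: tp_def T_top)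
    moreover have "(\<lambda>c. code (top_tv D)) \<in> el s (fst Om)" by (rule code_el) simp
    ultimately show "\<exists>v. x \<in> el s (fst One) \<and> v \<in> el s (fst Om) \<and> tp s dec v" unfolding eqv_One by blast
  next
    fix s x v x' v' assume "x \<in> el s (fst One) \<and> v \<in> el s (fst Om) \<and> tp s dec v" "eqv s One x x'" "eqv s Om v v'"
    then show "x' \<in> el s (fst One)" "v' \<in> el s (fst Om)" "tp s dec v'"
      using tp_dec_ext eqv_el(2) by blast+
  qed (use eqv_Om_true eqv_One in \<open>blast | simp add: sig2_def\<close>)+
  note arr = arrI[OF One_ob Om_ob F]
  show "tt \<in> hom RTc One Om" unfolding rt_true_def by (rule arr(1))
  show "ap s tt x v \<longleftrightarrow> x \<in> el s (fst One) \<and> v \<in> el s (fst Om) \<and> tp s dec v"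
    unfolding rt_true_def arr(2) rl_True by (rule refl)
qed

end

subsection \<open>Local operators\<close>

locale local_op = universe D pr pf ps
  for D :: "'a nested_pca" and pr :: "'u \<Rightarrow> 'u \<Rightarrow> 'u" and pf ps :: "'u \<Rightarrow> 'u" +
  fixes j :: "'a tval \<Rightarrow> 'a tval"
  assumes local_operator: "local_operator D j"
begin

lemma j_Sig [simp]: "A \<in> Sig D \<Longrightarrow> j A \<in> Sig D"
  using local_operator by (auto simp: local_operator_def)

lemma T_jI: "(\<And>c. c \<in> dm s \<Longrightarrow> P c \<in> Sig D) \<Longrightarrow> T s P \<Longrightarrow> T s (\<lambda>c. j (P c))"
proof -
  assume P: "\<And>c. c \<in> dm s \<Longrightarrow> P c \<in> Sig D" and TP: "T s P"
  have "entails D (Sig D) (\<lambda>q. q) j" using local_operator by (simp add: local_operator_def)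
  from T_entails[OF this P TP] show ?thesis .
qed

lemma T_jj: "(\<And>c. c \<in> dm s \<Longrightarrow> P c \<in> Sig D) \<Longrightarrow> T s (\<lambda>c. j (j (P c))) \<Longrightarrow> T s (\<lambda>c. j (P c))"
proof -
  assume P: "\<And>c. c \<in> dm s \<Longrightarrow> P c \<in> Sig D" and TP: "T s (\<lambda>c. j (j (P c)))"
  have "entails D (Sig D) (\<lambda>q. j (j q)) j" using local_operator by (simp add: local_operator_def)
  from T_entails[OF this P TP] show ?thesis .
qed

lemma T_jimp:
  assumes "\<And>c. c \<in> dm s \<Longrightarrow> P c \<in> Sig D" "\<And>c. c \<in> dm s \<Longrightarrow> Q c \<in> Sig D"
    "T s (\<lambda>c. imp_tv D (P c) (Q c))"
  shows "T s (\<lambda>c. imp_tv D (j (P c)) (j (Q c)))"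
proof -
  have e: "entails D (Sig D \<times> Sig D) (\<lambda>(q, r). imp_tv D q r) (\<lambda>(q, r). imp_tv D (j q) (j r))"
    using local_operator by (simp add: local_operator_def)
  have "T s (\<lambda>c. (\<lambda>(q, r). imp_tv D (j q) (j r)) (P c, Q c))"
    by (rule T_entails[OF e]) (use assms in simp_all)
  then show ?thesis by simp
qed

lemma T_jmono:
  fixes s :: "('u, 'a) stage"
  assumes "T s (\<lambda>c. j (P c))" "\<And>c. c \<in> dm s \<Longrightarrow> P c \<in> Sig D" "\<And>c. c \<in> dm s \<Longrightarrow> Q c \<in> Sig D"
    and "\<And>(s' :: ('u, 'a) stage) \<pi>. sub \<pi> s' s \<Longrightarrow> T s' (\<lambda>c. P (\<pi> c)) \<Longrightarrow> T s' (\<lambda>c. Q (\<pi> c))"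
  shows "T s (\<lambda>c. j (Q c))"
  by (rule T_mp[OF T_jimp[OF assms(2,3) T_impI[OF assms(2,4)]] assms(1)])

lemma T_jbind:
  fixes s :: "('u, 'a) stage"
  assumes "T s (\<lambda>c. j (P c))" "\<And>c. c \<in> dm s \<Longrightarrow> P c \<in> Sig D" "\<And>c. c \<in> dm s \<Longrightarrow> Q c \<in> Sig D"
    and "\<And>(s' :: ('u, 'a) stage) \<pi>. sub \<pi> s' s \<Longrightarrow> T s' (\<lambda>c. P (\<pi> c)) \<Longrightarrow> T s' (\<lambda>c. j (Q (\<pi> c)))"
  shows "T s (\<lambda>c. j (Q c))"
  by (rule T_jj[OF assms(3)], assumption, rule T_jmono[OF assms(1,2) j_Sig[OF assms(3)] assms(4)])

abbreviation JJ :: "('u, 'a) rt_arr" where "JJ \<equiv> rt_topology D j"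

lemma pred_j_dec: "pred Om (\<lambda>u. j (dec u))"
proof (rule predI)
  fix u assume "u \<in> fst Om"
  then show "j (dec u) \<in> Sig D" by (simp add: dec_Sig)
next
  fix s u v assume e: "eqv s Om u v" and u: "tp s (\<lambda>u. j (dec u)) u"
  note e' = e[unfolded eqv_Om]
  have "T s (\<lambda>c. imp_tv D (j (dec (u c))) (j (dec (v c))))"
    by (rule T_jimp) (use e' dec_Sig_el in blast)+
  from T_mp[OF this] u show "tp s (\<lambda>u. j (dec u)) v" by (simp add: tp_def)
qed

lemma JJ_arr:
  shows JJ_hom: "JJ \<in> hom RTc Om Om"
    and ap_JJ: "ap s JJ u v \<longleftrightarrow> u \<in> el s (fst Om) \<and> v \<in> el s (fst Om) \<and>
      T s (\<lambda>c. imp_tv D (j (dec (u c))) (dec (v c))) \<and> T s (\<lambda>c. imp_tv D (dec (v c)) (j (dec (u c))))"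
proof -
  let ?F = "\<lambda>b v. and_tv D (snd Om b b) (iff_tv D (j (dec b)) (dec v))"
  let ?G = "\<lambda>b v. iff_tv D (j (dec b)) (dec v)"
  have refl: "u \<in> el s (fst Om) \<Longrightarrow> eqv s Om u u" for s u
    unfolding eqv_Om using T_imp_refl[of s "\<lambda>c. dec (u c)"] dec_Sig_el by blast
  have FG: "rl s Om Om ?G u v \<longleftrightarrow> rl s Om Om ?F u v" for s u v
    using refl[of u s] unfolding rl_def T_and eqv_def by blast
  have "sfr Om Om ?F" by (rule rel_to_Om(1)[OF Om_ob pred_j_dec])
  moreover have "sig2 (fst Om) (fst Om) ?G" by (simp add: sig2_def)
  ultimately have G: "sfr Om Om ?G" unfolding sfr_def FG by blast
  show "JJ \<in> hom RTc Om Om" unfolding rt_topology_def by (rule arrI(1)[OF Om_ob Om_ob G])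
  show "ap s JJ u v \<longleftrightarrow> u \<in> el s (fst Om) \<and> v \<in> el s (fst Om) \<and>
      T s (\<lambda>c. imp_tv D (j (dec (u c))) (dec (v c))) \<and> T s (\<lambda>c. imp_tv D (dec (v c)) (j (dec (u c))))"
    unfolding rt_topology_def arrI(2)[OF Om_ob Om_ob G] rl_def T_iff by (rule HOL.refl)
qed

lemma dense_internal:
  assumes dense: "dense_mono RTc tt JJ m" and m: "m \<in> hom RTc S B" and b: "eqv s B b b"
  shows "T s (\<lambda>c. j (Pm m (b c)))"
proof -
  obtain \<chi> q r where pb: "is_pullback RTc \<chi> tt m q" and r: "r \<in> hom RTc (Trg RTc m) (Src RTc tt)"
    and Jchi: "Cmp RTc JJ \<chi> = Cmp RTc tt r"
    using dense unfolding dense_mono_def by blast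
  have Bo: "B \<in> ob" using homD[OF m] by simp
  note tt = homD(8,9)[OF tt_hom]
  have chi: "\<chi> \<in> hom RTc B Om"
    using pb homD(9)[OF m] tt unfolding is_pullback_def hom_def by auto
  have r: "r \<in> hom RTc B One" using r homD(9)[OF m] tt by simp
  have true: "tru s m b" if v: "ap s \<chi> b v" and t: "tp s dec v" for s b v
  proof -
    define Q where "Q = (\<lambda>b. ex_tv (fst Om) (\<lambda>v. and_tv D (rep \<chi> b v) (dec v)))"
    have Q: "tp s Q b \<longleftrightarrow> (\<exists>v. ap s \<chi> b v \<and> tp s dec v)" if "b \<in> el s (fst B)" for s b
      using that unfolding tp_def Q_def T_ex T_and ap_rl[OF chi] rl_def by (auto simp: el_def)
    have pQ: "pred B Q"
    proof (rule predI)
      fix b assume "b \<in> fst B"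
      then show "Q b \<in> Sig D" unfolding Q_def using sig2D[OF sfr_sig[OF homD(5)[OF chi]]] dec_Sig by simp
    next
      fix s x y assume e: "eqv s B x y" and "tp s Q x"
      then obtain v where "ap s \<chi> x v" "tp s dec v" using Q eqv_el(1) by blast
      then have "ap s \<chi> y v" "tp s dec v" using ap_cong[OF chi _ e] ap_cod[OF chi] by blast+
      then show "tp s Q y" using Q eqv_el(2)[OF e] by blast
    qed
    have W: "subo B Q \<in> ob" using subo_ob[OF Bo pQ] .
    note i = incl_hom[OF Bo pQ] and k = bang_hom[OF W]
    have "Cmp RTc \<chi> (incl B Q) = Cmp RTc tt (bang (subo B Q))"
    proof (rule comp_eqI[OF i chi k tt_hom])
      fix s x y v assume x: "ap s (incl B Q) x y" and v: "ap s \<chi> y v"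
      have e: "eqv s B x y" and Qx: "tp s Q x" using x unfolding ap_incl[OF Bo pQ] by auto
      then obtain v' where v': "ap s \<chi> x v'" "tp s dec v'" using Q eqv_el(1) by blast
      have "ap s \<chi> y v'" using ap_cong[OF chi v'(1) e ap_cod[OF chi v'(1)]] .
      then have "eqv s Om v' v" using ap_fun[OF chi] v by blast
      then have "tp s dec v" using tp_dec_ext v' by blast
      then have "ap s tt (\<lambda>c. undefined) v" unfolding ap_tt using One_el eqv_el(1)[OF ap_cod[OF chi v]] by blast
      moreover have "ap s (bang (subo B Q)) x (\<lambda>c. undefined)"
        unfolding ap_bang[OF W] eqv_subo using One_el Qx eqv_refl1[OF Bo e] by blast
      ultimately show "\<exists>y'. ap s (bang (subo B Q)) x y' \<and> ap s tt y' v" by blast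
    qed
    then obtain h where h: "h \<in> hom RTc (subo B Q) S" "Cmp RTc m h = incl B Q"
      using pb i k W unfolding is_pullback_def homD(8)[OF chi] homD(8)[OF m] tt RT_simps(1) by metis
    have bb: "eqv s B b b" using ap_dom[OF chi v] .
    have "ap s (incl B Q) b b" unfolding ap_incl[OF Bo pQ] using bb Q[OF eqv_el(1)[OF bb]] v t by blast
    then have "\<exists>a. ap s h b a \<and> ap s m a b" unfolding h(2)[symmetric] comp_hom(2)[OF h(1) m] .
    then show ?thesis unfolding tru_def by blast
  qed
  obtain v where v: "ap s \<chi> b v" using ap_ex[OF chi b] by blast
  have vel: "v \<in> el s (fst Om)" using eqv_el(1)[OF ap_cod[OF chi v]] .
  obtain v' where v': "ap s JJ v v'" using ap_ex[OF JJ_hom ap_cod[OF chi v]] by blast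
  obtain y where "ap s tt y v'" using comp_eqD[OF Jchi chi JJ_hom r tt_hom v v'] by blast
  then have t: "T s (\<lambda>c. dec (v' c))" unfolding ap_tt tp_def by blast
  have "T s (\<lambda>c. imp_tv D (dec (v' c)) (j (dec (v c))))" using v' unfolding ap_JJ by blast
  from T_mp[OF this t] have jv: "T s (\<lambda>c. j (dec (v c)))" .
  show ?thesis
  proof (rule T_jmono[OF jv])
    fix c assume "c \<in> dm s"
    then show "dec (v c) \<in> Sig D" "Pm m (b c) \<in> Sig D"
      using dec_Sig_el[OF vel] pred_sig_el[OF pred_Pm[OF m] eqv_el(1)[OF b]] by blast+
  next
    fix s' :: "('u, 'a) stage" and \<pi> assume sub: "sub \<pi> s' s" and "T s' (\<lambda>c. dec (v (\<pi> c)))"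
    then have "tru s' m (\<lambda>c. b (\<pi> c))" using true[OF ap_sub[OF chi sub v]] by (simp add: tp_def)
    moreover have "(\<lambda>c. b (\<pi> c)) \<in> el s' (fst B)" using el_sub[OF sub eqv_el(1)[OF b]] .
    ultimately have "tp s' (Pm m) (\<lambda>c. b (\<pi> c))" using T_Pm[OF m] by blast
    then show "T s' (\<lambda>c. Pm m (b (\<pi> c)))" by (simp add: tp_def)
  qed
qed

lemma incl_dense:
  assumes B: "B \<in> ob" and P: "pred B P" and jP: "\<And>s b. eqv s B b b \<Longrightarrow> T s (\<lambda>c. j (P (b c)))"
  shows "dense_mono RTc tt JJ (incl B P)"
  unfolding dense_mono_def
proof (intro conjI exI)
  note i = incl_hom[OF B P] and im = imono_incl[OF B P] and chi = chi_hom[OF B P]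
  have W: "subo B P \<in> ob" using subo_ob[OF B P] .
  show "mono_arr RTc (incl B P)" using imono_mono[OF im] .
  show "bang B \<in> hom RTc (Trg RTc (incl B P)) (Src RTc tt)"
    unfolding homD(8)[OF tt_hom] homD(9)[OF i] by (rule bang_hom[OF B])
  show "Cmp RTc JJ (chi B P) = Cmp RTc tt (bang B)"
  proof (rule comp_eqI[OF chi JJ_hom bang_hom[OF B] tt_hom])
    fix s b v v' assume v: "ap s (chi B P) b v" and v': "ap s JJ v v'"
    note v = v[unfolded ap_chi[OF B P]] and v' = v'[unfolded ap_JJ]
    have b: "eqv s B b b" using v by blast
    have "T s (\<lambda>c. imp_tv D (j (P (b c))) (j (dec (v c))))"
      by (rule T_jimp) (use v dec_Sig_el pred_sig_el[OF P eqv_el(1)[OF b]] in blast)+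
    from T_mp[OF this jP[OF b]] have jv: "T s (\<lambda>c. j (dec (v c)))" .
    have "T s (\<lambda>c. imp_tv D (j (dec (v c))) (dec (v' c)))" using v' by blast
    from T_mp[OF this jv] have "tp s dec v'" by (simp add: tp_def)
    then have "ap s tt (\<lambda>c. undefined) v'" unfolding ap_tt using One_el v' by blast
    moreover have "ap s (bang B) b (\<lambda>c. undefined)" unfolding ap_bang[OF B] using One_el b by blast
    ultimately show "\<exists>y. ap s (bang B) b y \<and> ap s tt y v'" by blast
  qed
  show "is_pullback RTc (chi B P) tt (incl B P) (bang (subo B P))"
    unfolding is_pullback_def homD(8,9)[OF tt_hom] homD(8,9)[OF i] homD(8,9)[OF chi]
  proof (intro conjI ballI impI)
    show "chi B P \<in> Arr RTc" "tt \<in> Arr RTc" "incl B P \<in> Arr RTc" "bang (subo B P) \<in> hom RTc (subo B P) One"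
      "Om = Om" "B = B"
      using homD(7)[OF chi] homD(7)[OF tt_hom] homD(7)[OF i] bang_hom[OF W] by simp_all
    show "Cmp RTc (chi B P) (incl B P) = Cmp RTc tt (bang (subo B P))"
    proof (rule comp_eqI[OF i chi bang_hom[OF W] tt_hom])
      fix s x y v assume x: "ap s (incl B P) x y" and v: "ap s (chi B P) y v"
      have e: "eqv s B x y" and Px: "tp s P x" using x unfolding ap_incl[OF B P] by auto
      have Py: "T s (\<lambda>c. P (y c))" using pred_ext[OF P e Px] by (simp add: tp_def)
      note v = v[unfolded ap_chi[OF B P]]
      have "T s (\<lambda>c. imp_tv D (P (y c)) (dec (v c)))" using v by blast
      from T_mp[OF this Py] have "tp s dec v" by (simp add: tp_def)
      then have "ap s tt (\<lambda>c. undefined) v" unfolding ap_tt using One_el v by blast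
      moreover have "ap s (bang (subo B P)) x (\<lambda>c. undefined)"
        unfolding ap_bang[OF W] eqv_subo using One_el Px eqv_refl1[OF B e] by blast
      ultimately show "\<exists>y'. ap s (bang (subo B P)) x y' \<and> ap s tt y' v" by blast
    qed
    fix W' u w assume u: "u \<in> hom RTc W' B" and w: "w \<in> hom RTc W' One"
      and e: "Cmp RTc (chi B P) u = Cmp RTc tt w"
    have "tp s P b" if b: "ap s u x b" for s x b
    proof -
      obtain v where v: "ap s (chi B P) b v" using ap_ex[OF chi ap_cod[OF u b]] by blast
      obtain y where "ap s tt y v" using comp_eqD[OF e u chi w tt_hom b v] by blast
      then have t: "T s (\<lambda>c. dec (v c))" unfolding ap_tt tp_def by blast
      have "T s (\<lambda>c. imp_tv D (dec (v c)) (P (b c)))" using v unfolding ap_chi[OF B P] by blast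
      from T_mp[OF this t] show ?thesis by (simp add: tp_def)
    qed
    then obtain k where k: "k \<in> hom RTc W' (subo B P)" "\<And>s w x. ap s k w x \<longleftrightarrow> ap s u w x"
      using factor[OF u P] by blast
    have "Cmp RTc (incl B P) k = u"
      by (rule comp_eqI1[OF k(1) i u]) (use k(2) ap_incl[OF B P] ap_cong[OF u] ap_dom[OF u] in metis)
    moreover have "Cmp RTc (bang (subo B P)) k = w"
      by (rule to_One_unique[OF comp_hom(1)[OF k(1) bang_hom[OF W]] w])
    ultimately show "\<exists>!h. h \<in> hom RTc W' (subo B P) \<and> Cmp RTc (incl B P) h = u \<and> Cmp RTc (bang (subo B P)) h = w"
      using k(1) imono_cancel[OF im i _ k(1)] by (intro ex1I[of _ k]) blast+
  qed
qed

subsection \<open>Sheaves\<close>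

abbreviation sheaf :: "('u, 'a) rt_obj \<Rightarrow> bool" where "sheaf \<equiv> is_sheaf RTc tt JJ"
abbreviation dense :: "('u, 'a) rt_arr \<Rightarrow> bool" where "dense \<equiv> dense_mono RTc tt JJ"

lemma sheaf_ob: "sheaf X \<Longrightarrow> X \<in> ob" by (simp add: is_sheaf_def RT_simps(1))

lemma sheaf_extend:
  assumes "sheaf X" "dense m" "m \<in> hom RTc S B" "f \<in> hom RTc S X"
  shows "\<exists>g \<in> hom RTc B X. Cmp RTc g m = f"
  using assms(1,2,4) unfolding is_sheaf_def homD(8,9)[OF assms(3), symmetric] by blast

lemma sheaf_unique:
  assumes X: "sheaf X" and m: "dense m" "m \<in> hom RTc S B" and g: "g \<in> hom RTc B X" and g': "g' \<in> hom RTc B X"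
    and e: "Cmp RTc g m = Cmp RTc g' m"
  shows "g = g'"
proof -
  have "Cmp RTc g m \<in> hom RTc S X" using comp_hom(1)[OF m(2) g] .
  moreover have "\<forall>f \<in> hom RTc (Src RTc m) X. \<exists>!g. g \<in> hom RTc (Trg RTc m) X \<and> Cmp RTc g m = f"
    using X m(1) unfolding is_sheaf_def by blast
  ultimately have "\<exists>!h. h \<in> hom RTc B X \<and> Cmp RTc h m = Cmp RTc g m"
    unfolding homD(8,9)[OF m(2)] by blast
  then show ?thesis using g g' e by metis
qed

lemma sheafI:
  assumes X: "X \<in> ob"
    and ext: "\<And>m S B f. dense m \<Longrightarrow> m \<in> hom RTc S B \<Longrightarrow> f \<in> hom RTc S X \<Longrightarrow> \<exists>g \<in> hom RTc B X. Cmp RTc g m = f"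
    and uni: "\<And>m S B g g'. dense m \<Longrightarrow> m \<in> hom RTc S B \<Longrightarrow> g \<in> hom RTc B X \<Longrightarrow> g' \<in> hom RTc B X \<Longrightarrow>
      Cmp RTc g m = Cmp RTc g' m \<Longrightarrow> g = g'"
  shows "sheaf X"
  unfolding is_sheaf_def RT_simps(1)
proof (intro conjI allI impI ballI X)
  fix m f assume d: "dense m" and f: "f \<in> hom RTc (Src RTc m) X"
  have m: "m \<in> hom RTc (Src RTc m) (Trg RTc m)" using d by (simp add: dense_mono_def mono_arr_def hom_def)
  show "\<exists>!g. g \<in> hom RTc (Trg RTc m) X \<and> Cmp RTc g m = f"
    using ext[OF d m f] uni[OF d m] by (intro ex_ex1I) (blast, metis)
qed

definition cpred :: "('u, 'a) rt_obj \<Rightarrow> ('u \<Rightarrow> 'a tval) \<Rightarrow> bool" where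
  "cpred A P \<longleftrightarrow> pred A P \<and> (\<forall>s x. eqv s A x x \<longrightarrow> tp s (\<lambda>x. j (P x)) x \<longrightarrow> tp s P x)"

lemma cpred_pred: "cpred A P \<Longrightarrow> pred A P" by (simp add: cpred_def)
lemma cpredD: "cpred A P \<Longrightarrow> eqv s A x x \<Longrightarrow> tp s (\<lambda>x. j (P x)) x \<Longrightarrow> tp s P x"
  unfolding cpred_def by blast
lemma cpredI: "pred A P \<Longrightarrow> (\<And>s x. eqv s A x x \<Longrightarrow> tp s (\<lambda>x. j (P x)) x \<Longrightarrow> tp s P x) \<Longrightarrow> cpred A P"
  unfolding cpred_def by blast

lemma pred_subo:
  assumes "pred A P"
  shows "pred (subo A Q) P"
proof (rule predI)
  fix x assume "x \<in> fst (subo A Q)"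
  then show "P x \<in> Sig D" using pred_sig[OF assms] by simp
next
  fix s x y assume "eqv s (subo A Q) x y" "tp s P x"
  then show "tp s P y" using pred_ext[OF assms] unfolding eqv_subo by blast
qed

lemma pred_j:
  assumes A: "A \<in> ob" and P: "pred A P"
  shows "pred A (\<lambda>x. j (P x))"
proof (rule predI)
  fix x assume "x \<in> fst A"
  then show "j (P x) \<in> Sig D" using pred_sig[OF P] by simp
next
  fix s x y assume e: "eqv s A x y" and jx: "tp s (\<lambda>x. j (P x)) x"
  have "T s (\<lambda>c. imp_tv D (j (P (x c))) (j (P (y c))))"
    by (rule T_jimp[OF _ _ pred_imp[OF A P e]]) (use pred_sig_el[OF P] eqv_el[OF e] in blast)+
  from T_mp[OF this] jx show "tp s (\<lambda>x. j (P x)) y" by (simp add: tp_def)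
qed

lemma cpred_j:
  assumes A: "A \<in> ob" and P: "pred A P"
  shows "cpred A (\<lambda>x. j (P x))"
proof (rule cpredI[OF pred_j[OF A P]])
  fix s x assume e: "eqv s A x x" and jj: "tp s (\<lambda>x. j (j (P x))) x"
  show "tp s (\<lambda>x. j (P x)) x"
    unfolding tp_def
    by (rule T_jj[OF _ jj[unfolded tp_def]]) (use pred_sig_el[OF P eqv_el(1)[OF e]] in blast)
qed

lemma cpred_bind:
  assumes Q: "cpred B Q" and B: "B \<in> ob" and y: "eqv s B y y" and jP: "T s (\<lambda>c. j (P c))" and sg: "\<And>c. c \<in> dm s \<Longrightarrow> P c \<in> Sig D"
    and st: "\<And>(s' :: ('u, 'a) stage) \<pi>. sub \<pi> s' s \<Longrightarrow> T s' (\<lambda>c. P (\<pi> c)) \<Longrightarrow> tp s' Q (\<lambda>c. y (\<pi> c))"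
  shows "tp s Q y"
proof (rule cpredD[OF Q y])
  show "tp s (\<lambda>x. j (Q x)) y"
    unfolding tp_def by (rule T_jmono[OF jP sg])
      (use pred_sig_el[OF cpred_pred[OF Q] eqv_el(1)[OF y]] st in \<open>blast | simp add: tp_def\<close>)+
qed

lemma sheaf_separated:
  assumes X: "sheaf X" and xy: "eqv s X x x" "eqv s X y y" and jE: "T s (\<lambda>c. j (snd X (x c) (y c)))"
  shows "eqv s X x y"
proof -
  have Xo: "X \<in> ob" using sheaf_ob[OF X] .
  define Q where "Q = (\<lambda>u. snd X (pf u) (ps u))"
  have XX: "prd X X \<in> ob" using prd_ob[OF Xo Xo] .
  have TQ: "tp s Q u \<longleftrightarrow> eqv s X (\<lambda>c. pf (u c)) (\<lambda>c. ps (u c))" if "u \<in> el s (fst (prd X X))" for s u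
    using that by (simp add: tp_def Q_def eqv_def el_prd)
  have Q: "pred (prd X X) Q"
  proof (rule predI)
    fix u assume "u \<in> fst (prd X X)"
    then show "Q u \<in> Sig D" using ob_sig[OF Xo] by (simp add: Q_def prd_def sig2_def)
  next
    fix s u v assume e: "eqv s (prd X X) u v" and q: "tp s Q u"
    have "eqv s X (\<lambda>c. pf (u c)) (\<lambda>c. ps (u c))" using q TQ[OF eqv_el(1)[OF e]] by simp
    then have "eqv s X (\<lambda>c. pf (v c)) (\<lambda>c. ps (v c))"
      using e eqv_sym[OF Xo] eqv_trans[OF Xo] unfolding eqv_prd by metis
    then show "tp s Q v" using TQ[OF eqv_el(2)[OF e]] by simp
  qed
  define P where "P = (\<lambda>u. j (Q u))"
  have P: "pred (prd X X) P" unfolding P_def by (rule pred_j[OF XX Q])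
  define W where "W = subo (prd X X) P"
  have W: "W \<in> ob" unfolding W_def by (rule subo_ob[OF XX P])
  have QW: "pred W Q"
    unfolding W_def by (rule pred_subo[OF Q])
  have d: "dense (incl W Q)"
    by (rule incl_dense[OF W QW]) (simp add: W_def eqv_subo P_def tp_def)
  note i = incl_hom[OF W QW]
  note iP = incl_hom[OF XX P, folded W_def]
  define f where "f = Cmp RTc (p1 X X) (incl (prd X X) P)"
  define g where "g = Cmp RTc (p2 X X) (incl (prd X X) P)"
  have f: "f \<in> hom RTc W X" and g: "g \<in> hom RTc W X"
    unfolding f_def g_def using comp_hom(1)[OF iP] p1_hom[OF Xo Xo] p2_hom[OF Xo Xo] by blast+
  have af: "ap s f u a \<longleftrightarrow> eqv s W u u \<and> eqv s X (\<lambda>c. pf (u c)) a" for s u a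
    unfolding f_def comp_hom(2)[OF iP p1_hom[OF Xo Xo]] ap_incl[OF XX P] ap_p1[OF Xo Xo] W_def eqv_subo
    using eqv_refl1[OF XX] eqv_trans[OF Xo] eqv_refl1[OF Xo] unfolding eqv_prd by metis
  have ag: "ap s g u a \<longleftrightarrow> eqv s W u u \<and> eqv s X (\<lambda>c. ps (u c)) a" for s u a
    unfolding g_def comp_hom(2)[OF iP p2_hom[OF Xo Xo]] ap_incl[OF XX P] ap_p2[OF Xo Xo] W_def eqv_subo
    using eqv_refl1[OF XX] eqv_trans[OF Xo] eqv_refl1[OF Xo] unfolding eqv_prd by metis
  have "Cmp RTc f (incl W Q) = Cmp RTc g (incl W Q)"
  proof (rule comp_eqI[OF i f i g])
    fix s u v a assume u: "ap s (incl W Q) u v" and a: "ap s f v a"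
    have e: "eqv s W u v" and q: "tp s Q u" using u unfolding ap_incl[OF W QW] by auto
    have "tp s Q v" using pred_ext[OF QW e q] .
    moreover have "v \<in> el s (fst (prd X X))" using eqv_el(2)[OF e] by (simp add: W_def)
    ultimately have "eqv s X (\<lambda>c. pf (v c)) (\<lambda>c. ps (v c))" using TQ by blast
    then have "ap s g v a" using a unfolding af ag using eqv_sym[OF Xo] eqv_trans[OF Xo] by metis
    then show "\<exists>y'. ap s (incl W Q) u y' \<and> ap s g y' a" using u by blast
  qed
  then have fg: "f = g" by (rule sheaf_unique[OF X d i f g])
  define u where "u = (\<lambda>c. pr (x c) (y c))"
  have "eqv s W u u" unfolding W_def eqv_subo eqv_prd using xy jE by (simp add: u_def P_def Q_def tp_def)
  then have "ap s f u x" "ap s g u y" unfolding af ag using xy by (simp_all add: u_def)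
  then show ?thesis using ap_fun[OF f] fg by blast
qed

lemma dense_ext_eq:
  assumes d: "dense m" and m: "m \<in> hom RTc S B" and b: "eqv s B b b"
    and P: "cpred X P" "X \<in> ob" and x: "eqv s X x x"
    and st: "\<And>(s' :: ('u, 'a) stage) \<pi> a. sub \<pi> s' s \<Longrightarrow> ap s' m a (\<lambda>c. b (\<pi> c)) \<Longrightarrow> tp s' P (\<lambda>c. x (\<pi> c))"
  shows "tp s P x"
proof (rule cpred_bind[OF P x dense_internal[OF d m b]])
  fix c assume "c \<in> dm s"
  then show "Pm m (b c) \<in> Sig D" using pred_sig_el[OF pred_Pm[OF m] eqv_el(1)[OF b]] by blast
next
  fix s' :: "('u, 'a) stage" and \<pi> assume sub: "sub \<pi> s' s" and "T s' (\<lambda>c. Pm m (b (\<pi> c)))"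
  then have "tp s' (Pm m) (\<lambda>c. b (\<pi> c))" by (simp add: tp_def)
  then show "tp s' P (\<lambda>c. x (\<pi> c))"
    using T_Pm[OF m el_sub[OF sub eqv_el(1)[OF b]]] st[OF sub] unfolding tru_def by blast
qed

lemma sheaf_subo:
  assumes X: "sheaf X" and P: "cpred X P"
  shows "sheaf (subo X P)"
proof -
  have Xo: "X \<in> ob" using sheaf_ob[OF X] .
  note pP = cpred_pred[OF P]
  note i = incl_hom[OF Xo pP] and im = imono_incl[OF Xo pP]
  show ?thesis
  proof (rule sheafI)
    show "subo X P \<in> ob" by (rule subo_ob[OF Xo pP])
  next
    fix m S B f assume d: "dense m" and m: "m \<in> hom RTc S B" and f: "f \<in> hom RTc S (subo X P)"
    note fi = comp_hom(1)[OF f i]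
    obtain g where g: "g \<in> hom RTc B X" "Cmp RTc g m = Cmp RTc (incl X P) f"
      using sheaf_extend[OF X d m fi] by blast
    have "tp s P x" if bx: "ap s g b x" for s b x
    proof (rule dense_ext_eq[OF d m ap_dom[OF g(1) bx] P Xo ap_cod[OF g(1) bx]])
      fix s' :: "('u, 'a) stage" and \<pi> a assume sub: "sub \<pi> s' s" and a: "ap s' m a (\<lambda>c. b (\<pi> c))"
      obtain y where y: "ap s' (incl X P) y (\<lambda>c. x (\<pi> c))"
        using comp_eqD[OF g(2) m g(1) f i a ap_sub[OF g(1) sub bx]] by blast
      then show "tp s' P (\<lambda>c. x (\<pi> c))" unfolding ap_incl[OF Xo pP] using pred_ext[OF pP] by blast
    qed
    then obtain k where k: "k \<in> hom RTc B (subo X P)" "\<And>s w x. ap s k w x \<longleftrightarrow> ap s g w x"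
      using factor[OF g(1) pP] by blast
    have ik: "Cmp RTc (incl X P) k = g"
      by (rule comp_eqI1[OF k(1) i g(1)]) (use k(2) ap_incl[OF Xo pP] ap_cong[OF g(1)] ap_dom[OF g(1)] in metis)
    have "Cmp RTc (incl X P) (Cmp RTc k m) = Cmp RTc (incl X P) f"
      by (simp add: comp_assoc[OF m k(1) i] ik g(2))
    then have "Cmp RTc k m = f" by (rule imono_cancel[OF im i comp_hom(1)[OF m k(1)] f])
    then show "\<exists>g\<in>hom RTc B (subo X P). Cmp RTc g m = f" using k(1) by blast
  next
    fix m S B g g' assume d: "dense m" and m: "m \<in> hom RTc S B" and g: "g \<in> hom RTc B (subo X P)" "g' \<in> hom RTc B (subo X P)"
      and e: "Cmp RTc g m = Cmp RTc g' m"
    have "Cmp RTc (Cmp RTc (incl X P) g) m = Cmp RTc (Cmp RTc (incl X P) g') m"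
      using e by (simp add: comp_assoc[OF m g(1) i, symmetric] comp_assoc[OF m g(2) i, symmetric])
    then have "Cmp RTc (incl X P) g = Cmp RTc (incl X P) g'"
      by (rule sheaf_unique[OF X d m comp_hom(1)[OF g(1) i] comp_hom(1)[OF g(2) i]])
    then show "g = g'" by (rule imono_cancel[OF im i g])
  qed
qed

lemma sheaf_prd:
  assumes A: "sheaf A" and B: "sheaf B"
  shows "sheaf (prd A B)"
proof -
  have Ao: "A \<in> ob" and Bo: "B \<in> ob" using sheaf_ob A B by auto
  note p1 = p1_hom[OF Ao Bo] and p2 = p2_hom[OF Ao Bo]
  show ?thesis
  proof (rule sheafI)
    show "prd A B \<in> ob" by (rule prd_ob[OF Ao Bo])
  next
    fix m S Y f assume d: "dense m" and m: "m \<in> hom RTc S Y" and f: "f \<in> hom RTc S (prd A B)"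
    obtain g1 where g1: "g1 \<in> hom RTc Y A" "Cmp RTc g1 m = Cmp RTc (p1 A B) f"
      using sheaf_extend[OF A d m comp_hom(1)[OF f p1]] by blast
    obtain g2 where g2: "g2 \<in> hom RTc Y B" "Cmp RTc g2 m = Cmp RTc (p2 A B) f"
      using sheaf_extend[OF B d m comp_hom(1)[OF f p2]] by blast
    obtain h where h: "h \<in> hom RTc Y (prd A B)" "Cmp RTc (p1 A B) h = g1" "Cmp RTc (p2 A B) h = g2"
      using tuple[OF g1(1) g2(1)] by blast
    have "Cmp RTc h m = f"
      by (rule prd_arr_eqI[OF Ao Bo comp_hom(1)[OF m h(1)] f])
        (simp_all add: comp_assoc[OF m h(1) p1] comp_assoc[OF m h(1) p2] h(2,3) g1(2) g2(2))
    then show "\<exists>g\<in>hom RTc Y (prd A B). Cmp RTc g m = f" using h(1) by blast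
  next
    fix m S Y g g' assume d: "dense m" and m: "m \<in> hom RTc S Y" and g: "g \<in> hom RTc Y (prd A B)" "g' \<in> hom RTc Y (prd A B)"
      and e: "Cmp RTc g m = Cmp RTc g' m"
    show "g = g'"
    proof (rule prd_arr_eqI[OF Ao Bo g])
      show "Cmp RTc (p1 A B) g = Cmp RTc (p1 A B) g'"
        by (rule sheaf_unique[OF A d m comp_hom(1)[OF g(1) p1] comp_hom(1)[OF g(2) p1]])
          (simp add: comp_assoc[OF m g(1) p1, symmetric] comp_assoc[OF m g(2) p1, symmetric] e)
      show "Cmp RTc (p2 A B) g = Cmp RTc (p2 A B) g'"
        by (rule sheaf_unique[OF B d m comp_hom(1)[OF g(1) p2] comp_hom(1)[OF g(2) p2]])
          (simp add: comp_assoc[OF m g(1) p2, symmetric] comp_assoc[OF m g(2) p2, symmetric] e)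
    qed
  qed
qed

lemma sheaf_One: "sheaf One"
proof (rule sheafI[OF One_ob])
  fix m S B f assume m: "m \<in> hom RTc S B" and f: "f \<in> hom RTc S One"
  have B: "B \<in> ob" using homD[OF m] by simp
  have "Cmp RTc (bang B) m = f" by (rule to_One_unique[OF comp_hom(1)[OF m bang_hom[OF B]] f])
  then show "\<exists>g\<in>hom RTc B One. Cmp RTc g m = f" using bang_hom[OF B] by blast
qed (rule to_One_unique)

subsection \<open>The sheaf subtopos\<close>

abbreviation ST :: "(('u, 'a) rt_obj, ('u, 'a) rt_arr) category" where "ST \<equiv> subtopos D j"

lemma ST_simps: "Obj ST = {X. sheaf X}" "Src ST = Src RTc" "Trg ST = Trg RTc" "Cmp ST = Cmp RTc" "Idn ST = Idn RTc"
  by (auto simp: subtopos_def sheaf_category_def full_subcategory_def is_sheaf_def)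

lemma hom_ST: "f \<in> hom ST X Y \<longleftrightarrow> f \<in> hom RTc X Y \<and> sheaf X \<and> sheaf Y"
  by (auto simp: subtopos_def sheaf_category_def full_subcategory_def hom_def)

lemma Arr_ST: "f \<in> Arr ST \<longleftrightarrow> f \<in> Arr RTc \<and> sheaf (Src RTc f) \<and> sheaf (Trg RTc f)"
  by (auto simp: subtopos_def sheaf_category_def full_subcategory_def)

lemma product_ST:
  assumes "sheaf A" "sheaf B"
  shows "is_product ST A B (prd A B) (p1 A B) (p2 A B)"
  using prd_is_product[OF sheaf_ob[OF assms(1)] sheaf_ob[OF assms(2)]] assms sheaf_prd[OF assms] sheaf_ob
  unfolding is_product_def ST_simps Ball_def hom_ST RT_simps(1) mem_Collect_eq by blast

lemma terminal_ST: "terminal_obj ST One"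
  unfolding terminal_obj_def ST_simps mem_Collect_eq hom_ST
proof (intro conjI ballI sheaf_One)
  fix W assume "W \<in> {X. sheaf X}"
  then have W: "sheaf W" by simp
  show "\<exists>!f. f \<in> hom RTc W One \<and> sheaf W \<and> sheaf One"
    using bang_hom[OF sheaf_ob[OF W]] W sheaf_One to_One_unique by (intro ex_ex1I) blast+
qed

lemma subobj_ST: "m \<in> subobj ST X \<longleftrightarrow> (\<exists>A. m \<in> hom RTc A X \<and> sheaf A \<and> sheaf X \<and> imono m)"
proof
  assume "m \<in> subobj ST X"
  then have mono: "mono_arr ST m" and X: "Trg RTc m = X" by (auto simp: subobj_def ST_simps)
  define A where "A = Src RTc m"
  have "m \<in> Arr ST" using mono by (simp add: mono_arr_def)
  then have m: "m \<in> hom RTc A X" and A: "sheaf A" and sX: "sheaf X"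
    using X by (auto simp: Arr_ST hom_def A_def)
  have Ao: "A \<in> ob" and Xo: "X \<in> ob" using homD[OF m] by auto
  have cancel: "f = g" if "sheaf W" "f \<in> hom RTc W A" "g \<in> hom RTc W A" "Cmp RTc m f = Cmp RTc m g" for W f g
    using mono that A unfolding mono_arr_def ST_simps Ball_def mem_Collect_eq hom_ST A_def[symmetric] by blast
  let ?Q = "\<lambda>u. ex_tv (fst X) (\<lambda>x. and_tv D (rep m (pf u) x) (rep m (ps u) x))"
  have AA: "prd A A \<in> ob" using prd_ob[OF Ao Ao] .
  note Q = kernel_pair[OF m]
  have "cpred (prd A A) ?Q"
  proof (rule cpredI[OF Q(1)])
    fix s u assume u: "eqv s (prd A A) u u" and jQ: "tp s (\<lambda>u. j (?Q u)) u"
    obtain x y where x: "ap s m (\<lambda>c. pf (u c)) x" and y: "ap s m (\<lambda>c. ps (u c)) y"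
      using ap_ex[OF m] u unfolding eqv_prd by blast
    have "T s (\<lambda>c. j (snd X (x c) (y c)))"
    proof (rule T_jmono[OF jQ[unfolded tp_def]])
      fix c assume k: "c \<in> dm s"
      show "?Q (u c) \<in> Sig D" using pred_sig_el[OF Q(1) eqv_el(1)[OF u] k] .
      show "snd X (x c) (y c) \<in> Sig D"
        using sig2D[OF ob_sig[OF Xo]] elD[OF eqv_el(1)[OF ap_cod[OF m x]] k] elD[OF eqv_el(1)[OF ap_cod[OF m y]] k] .
    next
      fix s' :: "('u, 'a) stage" and \<pi> assume sub: "sub \<pi> s' s" and "T s' (\<lambda>c. ?Q (u (\<pi> c)))"
      then have "tp s' ?Q (\<lambda>c. u (\<pi> c))" by (simp add: tp_def)
      then obtain z where z: "ap s' m (\<lambda>c. pf (u (\<pi> c))) z" "ap s' m (\<lambda>c. ps (u (\<pi> c))) z"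
        using Q(2)[of s' "\<lambda>c. u (\<pi> c)"] el_sub[OF sub eqv_el(1)[OF u]] by blast
      have "eqv s' X z (\<lambda>c. y (\<pi> c))" using ap_fun[OF m z(2) ap_sub[OF m sub y]] .
      with ap_fun[OF m ap_sub[OF m sub x] z(1)] have "eqv s' X (\<lambda>c. x (\<pi> c)) (\<lambda>c. y (\<pi> c))" by (rule eqv_trans[OF Xo])
      then show "T s' (\<lambda>c. snd X (x (\<pi> c)) (y (\<pi> c)))" by (simp add: eqv_def)
    qed
    then have "eqv s X x y" by (rule sheaf_separated[OF sX ap_cod[OF m x] ap_cod[OF m y]])
    then have "ap s m (\<lambda>c. pf (u c)) y" using ap_cong[OF m x ap_dom[OF m x]] by blast
    then show "tp s ?Q u" using Q(2)[of s u] y by blast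
  qed
  then have "sheaf (subo (prd A A) ?Q)" by (rule sheaf_subo[OF sheaf_prd[OF A A]])
  then have "imono m" by (intro kernel_imono[OF m]) (rule cancel)
  then show "\<exists>A. m \<in> hom RTc A X \<and> sheaf A \<and> sheaf X \<and> imono m" using m A sX by blast
next
  assume "\<exists>A. m \<in> hom RTc A X \<and> sheaf A \<and> sheaf X \<and> imono m"
  then obtain A where m: "m \<in> hom RTc A X" "sheaf A" "sheaf X" "imono m" by blast
  show "m \<in> subobj ST X"
    unfolding subobj_def mono_arr_def mem_Collect_eq ST_simps Arr_ST Ball_def hom_ST homD(8,9)[OF m(1)]
    using m(2,3) homD(7)[OF m(1)] imono_cancel[OF m(4,1)] by blast
qed

lemma sub_le_ST:
  assumes "m \<in> subobj ST X" "n \<in> subobj ST X"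
  shows "sub_le ST m n \<longleftrightarrow> (\<forall>s x. tru s m x \<longrightarrow> tru s n x)"
proof -
  obtain A B where m: "m \<in> hom RTc A X" "sheaf A" and n: "n \<in> hom RTc B X" "sheaf B" "imono n"
    using assms unfolding subobj_ST by blast
  show ?thesis
    unfolding sub_le_def ST_simps homD(8)[OF m(1)] homD(8)[OF n(1)] image_le_conv[OF m(1) n(1,3), symmetric]
    using m(2) n(2) hom_ST by blast
qed

lemma incl_subobj:
  assumes "sheaf X" "cpred X P"
  shows "incl X P \<in> subobj ST X"
  unfolding subobj_ST using incl_hom[OF sheaf_ob[OF assms(1)] cpred_pred[OF assms(2)]]
    imono_incl[OF sheaf_ob[OF assms(1)] cpred_pred[OF assms(2)]] sheaf_subo[OF assms] assms(1) by blast

lemma cpred_Pm: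
  assumes "m \<in> subobj ST X"
  shows "cpred X (Pm m)"
proof -
  obtain A where m: "m \<in> hom RTc A X" and A: "sheaf A" and X: "sheaf X" and im: "imono m"
    using assms unfolding subobj_ST by blast
  have Xo: "X \<in> ob" using homD[OF m] by simp
  define P where "P = Pm m"
  have P: "pred X P" unfolding P_def by (rule pred_Pm[OF m])
  have jP: "cpred X (\<lambda>x. j (P x))" by (rule cpred_j[OF Xo P])
  note pjP = cpred_pred[OF jP]
  define W where "W = subo X (\<lambda>x. j (P x))"
  have W: "W \<in> ob" unfolding W_def by (rule subo_ob[OF Xo pjP])
  have PW: "pred W P" unfolding W_def by (rule pred_subo[OF P])
  have d: "dense (incl W P)"
    by (rule incl_dense[OF W PW]) (simp add: W_def eqv_subo tp_def)
  note i = incl_hom[OF W PW] and ij = incl_hom[OF Xo pjP, folded W_def]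
  define e where "e = Cmp RTc (incl X (\<lambda>x. j (P x))) (incl W P)"
  have e: "e \<in> hom RTc (subo W P) X" unfolding e_def by (rule comp_hom(1)[OF i ij])
  have "\<exists>f\<in>hom RTc (subo W P) A. e = Cmp RTc m f"
  proof (rule image_le[OF e m im])
    fix s x assume "tru s e x"
    then obtain w y where w: "ap s (incl W P) w y" "ap s (incl X (\<lambda>x. j (P x))) y x"
      unfolding tru_def e_def comp_hom(2)[OF i ij] by blast
    then have "eqv s W w y" "tp s P w" "eqv s X y x" unfolding ap_incl[OF W PW] ap_incl[OF Xo pjP] by auto
    then have "tp s P x" "x \<in> el s (fst X)"
      using pred_ext[OF P] eqv_el(2) unfolding W_def eqv_subo by blast+
    then show "tru s m x" using T_Pm[OF m] by (simp add: P_def)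
  qed
  then obtain f where f: "f \<in> hom RTc (subo W P) A" "e = Cmp RTc m f" by blast
  obtain g where g: "g \<in> hom RTc W A" "Cmp RTc g (incl W P) = f" using sheaf_extend[OF A d i f(1)] by blast
  have "Cmp RTc m g = incl X (\<lambda>x. j (P x))"
  proof (rule sheaf_unique[OF X d i comp_hom(1)[OF g(1) m] ij])
    show "Cmp RTc (Cmp RTc m g) (incl W P) = Cmp RTc (incl X (\<lambda>x. j (P x))) (incl W P)"
      by (simp add: comp_assoc[OF i g(1) m, symmetric] g(2) f(2)[symmetric] e_def)
  qed
  note mg = this
  show ?thesis
  proof (rule cpredI[OF pred_Pm[OF m]])
    fix s x assume x: "eqv s X x x" and "tp s (\<lambda>x. j (Pm m x)) x"
    then have "tp s (\<lambda>x. j (P x)) x" by (simp add: P_def)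
    with x have "ap s (incl X (\<lambda>x. j (P x))) x x" unfolding ap_incl[OF Xo pjP] by blast
    then have "tru s m x" unfolding mg[symmetric] comp_hom(2)[OF g(1) m] tru_def by blast
    then show "tp s (Pm m) x" using T_Pm[OF m eqv_el(1)[OF x]] by blast
  qed
qed

lemma tru_closed:
  assumes n: "n \<in> subobj ST X" and x: "eqv s X x x" and jP: "T s (\<lambda>c. j (P c))" and sg: "\<And>c. c \<in> dm s \<Longrightarrow> P c \<in> Sig D"
    and st: "\<And>(s' :: ('u, 'a) stage) \<pi>. sub \<pi> s' s \<Longrightarrow> T s' (\<lambda>c. P (\<pi> c)) \<Longrightarrow> tru s' n (\<lambda>c. x (\<pi> c))"
  shows "tru s n x"
proof -
  obtain B where h: "n \<in> hom RTc B X" using n unfolding subobj_ST by blast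
  have "tp s (Pm n) x"
  proof (rule cpred_bind[OF cpred_Pm[OF n] homD(2)[OF h] x jP sg])
    fix s' :: "('u, 'a) stage" and \<pi> assume sub: "sub \<pi> s' s" and "T s' (\<lambda>c. P (\<pi> c))"
    from st[OF this] show "tp s' (Pm n) (\<lambda>c. x (\<pi> c))" using T_Pm[OF h el_sub[OF sub eqv_el(1)[OF x]]] by blast
  qed
  then show ?thesis using T_Pm[OF h eqv_el(1)[OF x]] by blast
qed

lemma inverse_image_tru:
  assumes ii: "inverse_image ST f n n'" and f: "f \<in> hom RTc X Y" and X: "sheaf X" and n: "n \<in> subobj ST Y"
  shows "n' \<in> subobj ST X"
    and "tru s n' x \<longleftrightarrow> (\<exists>y. ap s f x y \<and> tru s n y)"
proof -
  obtain q where n': "n' \<in> subobj ST X" and pb: "is_pullback ST f n n' q"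
    using ii homD(8)[OF f] unfolding inverse_image_def ST_simps by auto
  obtain B where B: "n \<in> hom RTc B Y" "sheaf B" "sheaf Y" "imono n" using n unfolding subobj_ST by blast
  obtain A where A: "n' \<in> hom RTc A X" "sheaf A" "imono n'" using n' unfolding subobj_ST by blast
  have q: "q \<in> hom RTc A B" and e: "Cmp RTc f n' = Cmp RTc n q"
    and univ: "\<And>W u v. sheaf W \<Longrightarrow> u \<in> hom RTc W X \<Longrightarrow> v \<in> hom RTc W B \<Longrightarrow> Cmp RTc f u = Cmp RTc n v \<Longrightarrow>
       \<exists>h. h \<in> hom RTc W A \<and> Cmp RTc n' h = u"
    using pb X B(2,3) A(2) unfolding is_pullback_def ST_simps Ball_def mem_Collect_eq hom_ST homD(8,9)[OF f] homD(8,9)[OF B(1)] homD(8,9)[OF A(1)]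
    by blast+
  have Xo: "X \<in> ob" and Yo: "Y \<in> ob" using homD[OF f] by auto
  show "n' \<in> subobj ST X" by (rule n')
  have 1: "\<exists>y. ap s f x y \<and> tru s n y" if x: "tru s n' x" for s x
  proof -
    obtain a where a: "ap s n' a x" using x unfolding tru_def by blast
    obtain y where y: "ap s f x y" using ap_ex[OF f ap_cod[OF A(1) a]] by blast
    show ?thesis using comp_eqD[OF e A(1) f q B(1) a y] y unfolding tru_def by blast
  qed
  have 2: "tru s n' x" if xy: "ap s f x y" "tru s n y" for s x y
  proof -
    define P where "P = (\<lambda>x. ex_tv (fst Y) (\<lambda>y. and_tv D (rep f x y) (Pm n y)))"
    have TP: "tp s P x \<longleftrightarrow> (\<exists>y. ap s f x y \<and> tru s n y)" if "x \<in> el s (fst X)" for s x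
    proof -
      have "tp s P x \<longleftrightarrow> (\<exists>y. (\<forall>c\<in>dm s. y c \<in> fst Y) \<and> T s (\<lambda>c. rep f (x c) (y c)) \<and> tp s (Pm n) y)"
        unfolding tp_def P_def T_ex T_and by (rule refl)
      also have "\<dots> \<longleftrightarrow> (\<exists>y. ap s f x y \<and> tru s n y)"
        using T_Pm[OF B(1)] that unfolding ap_rl[OF f] rl_def el_def by blast
      finally show ?thesis .
    qed
    have pP: "pred X P"
    proof (rule predI)
      fix x assume "x \<in> fst X"
      then show "P x \<in> Sig D" unfolding P_def
        using sig2D[OF sfr_sig[OF homD(5)[OF f]]] pred_sig[OF pred_Pm[OF B(1)]] by simp
    next
      fix s x y assume e: "eqv s X x y" and "tp s P x"
      then obtain z where "ap s f x z" "tru s n z" using TP eqv_el(1) by blast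
      then have "ap s f y z" "tru s n z" using ap_cong[OF f _ e] ap_cod[OF f] by blast+
      then show "tp s P y" using TP eqv_el(2)[OF e] by blast
    qed
    have cP: "cpred X P"
    proof (rule cpredI[OF pP])
      fix s x assume x: "eqv s X x x" and jP: "tp s (\<lambda>x. j (P x)) x"
      obtain y where y: "ap s f x y" using ap_ex[OF f x] by blast
      have "tru s n y"
      proof (rule tru_closed[OF n ap_cod[OF f y] jP[unfolded tp_def]])
        fix c assume "c \<in> dm s"
        then show "P (x c) \<in> Sig D" using pred_sig_el[OF pP eqv_el(1)[OF x]] by blast
      next
        fix s' :: "('u, 'a) stage" and \<pi> assume sub: "sub \<pi> s' s" and "T s' (\<lambda>c. P (x (\<pi> c)))"
        then have "tp s' P (\<lambda>c. x (\<pi> c))" by (simp add: tp_def)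
        then obtain z where z: "ap s' f (\<lambda>c. x (\<pi> c)) z" "tru s' n z"
          using TP[OF el_sub[OF sub eqv_el(1)[OF x]]] by blast
        obtain b where b: "ap s' n b z" using z(2) unfolding tru_def by blast
        show "tru s' n (\<lambda>c. y (\<pi> c))"
          using ap_cong[OF B(1) b ap_dom[OF B(1) b] ap_fun[OF f z(1) ap_sub[OF f sub y]]] unfolding tru_def by blast
      qed
      then show "tp s P x" using TP[OF eqv_el(1)[OF x]] y by blast
    qed
    note i = incl_hom[OF Xo pP]
    have W: "sheaf (subo X P)" by (rule sheaf_subo[OF X cP])
    have fe: "Cmp RTc f (incl X P) \<in> hom RTc (subo X P) Y" by (rule comp_hom(1)[OF i f])
    obtain v where v: "v \<in> hom RTc (subo X P) B" "Cmp RTc f (incl X P) = Cmp RTc n v"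
    proof -
      have "\<exists>v\<in>hom RTc (subo X P) B. Cmp RTc f (incl X P) = Cmp RTc n v"
      proof (rule image_le[OF fe B(1,4)])
        fix s y assume "tru s (Cmp RTc f (incl X P)) y"
        then obtain w x where w: "eqv s X w x" "tp s P w" "ap s f x y"
          unfolding tru_def comp_hom(2)[OF i f] ap_incl[OF Xo pP] by blast
        obtain z where z: "ap s f x z" "tru s n z" using TP[OF eqv_el(2)[OF w(1)]] pred_ext[OF pP w(1,2)] by blast
        obtain b where b: "ap s n b z" using z(2) unfolding tru_def by blast
        show "tru s n y" using ap_cong[OF B(1) b ap_dom[OF B(1) b] ap_fun[OF f z(1) w(3)]] unfolding tru_def by blast
      qed
      then show thesis using that by blast
    qed
    obtain h where h: "h \<in> hom RTc (subo X P) A" "Cmp RTc n' h = incl X P" using univ[OF W i v] by blast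
    have xx: "eqv s X x x" using ap_dom[OF f xy(1)] .
    have "ap s (incl X P) x x" unfolding ap_incl[OF Xo pP] using xx TP[OF eqv_el(1)[OF xx]] xy by blast
    then show ?thesis unfolding h(2)[symmetric] comp_hom(2)[OF h(1) A(1)] tru_def by blast
  qed
  show "tru s n' x \<longleftrightarrow> (\<exists>y. ap s f x y \<and> tru s n y)" using 1 2 by blast
qed

lemma ap_factor_incl:
  assumes u: "u \<in> hom RTc W X" and P: "pred X P" and uP: "\<And>s w x. ap s u w x \<Longrightarrow> tp s P x"
  shows "\<exists>k \<in> hom RTc W (subo X P). Cmp RTc (incl X P) k = u"
proof -
  have X: "X \<in> ob" using homD[OF u] by simp
  obtain k where k: "k \<in> hom RTc W (subo X P)" "\<And>s w x. ap s k w x \<longleftrightarrow> ap s u w x"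
    using factor[OF u P] uP by blast
  have "Cmp RTc (incl X P) k = u"
    by (rule comp_eqI1[OF k(1) incl_hom[OF X P] u]) (use k(2) ap_incl[OF X P] ap_cong[OF u] ap_dom[OF u] in metis)
  with k(1) show ?thesis by blast
qed

lemma inverse_image_incl:
  assumes f: "f \<in> hom RTc X Y" and X: "sheaf X" and Y: "sheaf Y" and P: "cpred X P" and Q: "cpred Y Q"
    and PQ: "\<And>s x y. ap s f x y \<Longrightarrow> tp s P x \<longleftrightarrow> tp s Q y"
  shows "inverse_image ST f (incl Y Q) (incl X P)"
proof -
  have Xo: "X \<in> ob" and Yo: "Y \<in> ob" using homD[OF f] by auto
  note pP = cpred_pred[OF P] and pQ = cpred_pred[OF Q]
  note iX = incl_hom[OF Xo pP] and iY = incl_hom[OF Yo pQ]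
  note mX = imono_incl[OF Xo pP] and mY = imono_incl[OF Yo pQ]
  note fi = comp_hom(1)[OF iX f]
  have sX: "sheaf (subo X P)" and sY: "sheaf (subo Y Q)" using sheaf_subo X Y P Q by blast+
  obtain q where q: "q \<in> hom RTc (subo X P) (subo Y Q)" "Cmp RTc (incl Y Q) q = Cmp RTc f (incl X P)"
  proof -
    have "\<exists>q \<in> hom RTc (subo X P) (subo Y Q). Cmp RTc (incl Y Q) q = Cmp RTc f (incl X P)"
    proof (rule ap_factor_incl[OF fi pQ])
      fix s w y assume "ap s (Cmp RTc f (incl X P)) w y"
      then show "tp s Q y" unfolding comp_hom(2)[OF iX f] ap_incl[OF Xo pP] using PQ pred_ext[OF pP] by blast
    qed
    then show thesis using that by blast
  qed
  have "is_pullback ST f (incl Y Q) (incl X P) q"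
    unfolding is_pullback_def ST_simps homD(8,9)[OF f] homD(8,9)[OF iX] homD(8,9)[OF iY] Arr_ST Ball_def hom_ST mem_Collect_eq
  proof (intro conjI allI impI)
    fix W u v assume W: "sheaf W" and u: "u \<in> hom RTc W X \<and> sheaf W \<and> sheaf X"
      and v: "v \<in> hom RTc W (subo Y Q) \<and> sheaf W \<and> sheaf (subo Y Q)" and e: "Cmp RTc f u = Cmp RTc (incl Y Q) v"
    have u: "u \<in> hom RTc W X" and v: "v \<in> hom RTc W (subo Y Q)" using u v by blast+
    have "tp s P x" if x: "ap s u w x" for s w x
    proof -
      obtain y where y: "ap s f x y" using ap_ex[OF f ap_cod[OF u x]] by blast
      obtain z where "ap s (incl Y Q) z y" using comp_eqD[OF e u f v iY x y] by blast
      then have "tp s Q y" unfolding ap_incl[OF Yo pQ] using pred_ext[OF pQ] by blast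
      then show ?thesis using PQ[OF y] by blast
    qed
    then obtain k where k: "k \<in> hom RTc W (subo X P)" "Cmp RTc (incl X P) k = u"
      using ap_factor_incl[OF u pP] by blast
    have "Cmp RTc (incl Y Q) (Cmp RTc q k) = Cmp RTc (incl Y Q) v"
      by (simp add: comp_assoc[OF k(1) q(1) iY] q(2) comp_assoc[OF k(1) iX f, symmetric] k(2) e)
    then have "Cmp RTc q k = v" by (rule imono_cancel[OF mY iY comp_hom(1)[OF k(1) q(1)] v])
    then show "\<exists>!h. (h \<in> hom RTc W (subo X P) \<and> sheaf W \<and> sheaf (subo X P)) \<and> Cmp RTc (incl X P) h = u \<and> Cmp RTc q h = v"
      using k W sX imono_cancel[OF mX iX _ k(1)] by (intro ex1I[of _ k]) (blast, metis)
  qed (use f X Y sX sY q homD(7)[OF f] homD(7)[OF iX] homD(7)[OF iY] in \<open>simp_all\<close>)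
  then show ?thesis
    unfolding inverse_image_def ST_simps homD(8)[OF f] using incl_subobj[OF X P] by blast
qed

end

context universe
begin

lemma T_orI:
  fixes s :: "('u, 'a) stage"
  assumes P: "\<And>c. c \<in> dm s \<Longrightarrow> P c \<in> Sig D" "\<And>c. c \<in> dm s \<Longrightarrow> Q c \<in> Sig D"
    and T: "T s P \<or> T s Q"
  shows "T s (\<lambda>c. or_tv (P c) (Q c))"
  unfolding or_tv_def
proof (rule T_allI[of code])
  show "inj_on code (\<Union>c\<in>dm s. Sig D)" by (rule inj_on_subset[OF inj_code]) auto
next
  fix s1 :: "('u, 'a) stage" and \<pi> R assume sub1: "sub \<pi> s1 s" and R: "\<And>c. c \<in> dm s1 \<Longrightarrow> R c \<in> Sig D"
  show "T s1 (\<lambda>c. imp_tv D (imp_tv D (P (\<pi> c)) (R c)) (imp_tv D (imp_tv D (Q (\<pi> c)) (R c)) (R c)))"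
  proof (rule T_impI, simp)
    fix s2 :: "('u, 'a) stage" and \<rho> assume sub2: "sub \<rho> s2 s1" and 2: "T s2 (\<lambda>c. imp_tv D (P (\<pi> (\<rho> c))) (R (\<rho> c)))"
    show "T s2 (\<lambda>c. imp_tv D (imp_tv D (Q (\<pi> (\<rho> c))) (R (\<rho> c))) (R (\<rho> c)))"
    proof (rule T_impI, simp)
      fix s3 :: "('u, 'a) stage" and \<sigma> assume sub3: "sub \<sigma> s3 s2"
        and 3: "T s3 (\<lambda>c. imp_tv D (Q (\<pi> (\<rho> (\<sigma> c)))) (R (\<rho> (\<sigma> c))))"
      have 4: "T s3 (\<lambda>c. imp_tv D (P (\<pi> (\<rho> (\<sigma> c)))) (R (\<rho> (\<sigma> c))))" by (rule T_sub[OF sub3 2]) simp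
      note sub = sub_trans[OF sub3 sub_trans[OF sub2 sub1]]
      from T show "T s3 (\<lambda>c. R (\<rho> (\<sigma> c)))"
      proof
        assume "T s P"
        from T_sub[OF sub this P(1)] show ?thesis by (rule T_mp[OF 4])
      next
        assume "T s Q"
        from T_sub[OF sub this P(2)] show ?thesis by (rule T_mp[OF 3])
      qed
    qed
  qed
qed simp

lemma T_orE:
  fixes s :: "('u, 'a) stage"
  assumes PQ: "T s (\<lambda>c. or_tv (P c) (Q c))"
    and sg: "\<And>c. c \<in> dm s \<Longrightarrow> P c \<in> Sig D" "\<And>c. c \<in> dm s \<Longrightarrow> Q c \<in> Sig D" "\<And>c. c \<in> dm s \<Longrightarrow> R c \<in> Sig D"
    and st: "\<And>(s' :: ('u, 'a) stage) \<pi>. sub \<pi> s' s \<Longrightarrow> T s' (\<lambda>c. P (\<pi> c)) \<Longrightarrow> T s' (\<lambda>c. R (\<pi> c))"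
      "\<And>(s' :: ('u, 'a) stage) \<pi>. sub \<pi> s' s \<Longrightarrow> T s' (\<lambda>c. Q (\<pi> c)) \<Longrightarrow> T s' (\<lambda>c. R (\<pi> c))"
  shows "T s R"
proof -
  have "T s (\<lambda>c. imp_tv D (imp_tv D (P c) (R c)) (imp_tv D (imp_tv D (Q c) (R c)) (R c)))"
    using PQ unfolding or_tv_def by (rule T_allE[where y = R]) (rule sg(3))
  from T_mp[OF T_mp[OF this T_impI[OF sg(1) st(1)]] T_impI[OF sg(2) st(2)]] show ?thesis .
qed

lemma T_botE: "T s (\<lambda>c. bot_tv) \<Longrightarrow> T s P"
  by (erule T_mono) (simp add: bot_tv_def)

end

locale set_struct = local_op D pr pf ps j
  for D :: "'a nested_pca" and pr :: "'u \<Rightarrow> 'u \<Rightarrow> 'u" and pf ps :: "'u \<Rightarrow> 'u" and j :: "'a tval \<Rightarrow> 'a tval" +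
  fixes VO :: "('u, 'a) rt_obj" and memV :: "'u \<Rightarrow> 'u \<Rightarrow> 'a tval"
  assumes VO: "is_sheaf (RT D) (rt_true D) (rt_topology D j) VO"
    and VO_refl: "x \<in> el s (fst VO) \<Longrightarrow> eqv s VO x x"
    and memV: "cpred (prd VO VO) (\<lambda>u. memV (pf u) (ps u))"
begin

subsection \<open>Contexts and truth values of formulas\<close>

primrec val :: "fm \<Rightarrow> (nat \<Rightarrow> 'u) \<Rightarrow> 'a tval" where
  "val (Mem i k) e = memV (e i) (e k)"
| "val (Eq i k) e = snd VO (e i) (e k)"
| "val Bot e = j bot_tv"
| "val (And \<phi> \<psi>) e = and_tv D (val \<phi> e) (val \<psi> e)"
| "val (Or \<phi> \<psi>) e = j (or_tv (val \<phi> e) (val \<psi> e))"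
| "val (Imp \<phi> \<psi>) e = imp_tv D (val \<phi> e) (val \<psi> e)"
| "val (Forall \<phi>) e = all_tv (fst VO) (\<lambda>v. val \<phi> (case_nat v e))"
| "val (Exists \<phi>) e = j (ex_tv (fst VO) (\<lambda>v. val \<phi> (case_nat v e)))"

definition env :: "nat \<Rightarrow> (nat \<Rightarrow> 'u) set" where "env n = {e. \<forall>i<n. e i \<in> fst VO}"

definition enve :: "nat \<Rightarrow> ('u, 'a) stage \<Rightarrow> ('u \<Rightarrow> nat \<Rightarrow> 'u) \<Rightarrow> ('u \<Rightarrow> nat \<Rightarrow> 'u) \<Rightarrow> bool" where
  "enve n s x y \<longleftrightarrow> (\<forall>i<n. eqv s VO (\<lambda>c. x c i) (\<lambda>c. y c i))"

lemma VO_ob: "VO \<in> ob" by (rule sheaf_ob[OF VO])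

lemma env_case: "v \<in> fst VO \<Longrightarrow> e \<in> env n \<Longrightarrow> case_nat v e \<in> env (Suc n)"
  by (auto simp: env_def split: nat.split)

lemma memV_Sig: "x \<in> fst VO \<Longrightarrow> y \<in> fst VO \<Longrightarrow> memV x y \<in> Sig D"
  using pred_sig[OF cpred_pred[OF memV], of "pr x y"] by (simp add: prd_def)

lemma val_Sig: "vars_below n \<phi> \<Longrightarrow> e \<in> env n \<Longrightarrow> val \<phi> e \<in> Sig D"
proof (induction \<phi> arbitrary: n e)
  case (Mem i k)
  then show ?case by (simp add: memV_Sig env_def)
next
  case (Eq i k)
  then show ?case using sig2D[OF ob_sig[OF VO_ob]] by (simp add: env_def)
next
  case (Exists \<phi>)
  then have "\<And>v. v \<in> fst VO \<Longrightarrow> val \<phi> (case_nat v e) \<in> Sig D" using env_case by simp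
  then show ?case by simp
qed auto

lemma enve_env: "enve n s x y \<Longrightarrow> c \<in> dm s \<Longrightarrow> x c \<in> env n" "enve n s x y \<Longrightarrow> c \<in> dm s \<Longrightarrow> y c \<in> env n"
  by (auto simp: enve_def env_def eqv_def el_def)

lemma enve_refl: "(\<And>c. c \<in> dm s \<Longrightarrow> x c \<in> env n) \<Longrightarrow> enve n s x x"
  unfolding enve_def by (auto intro!: VO_refl simp: el_def env_def)

lemma enve_sym: "enve n s x y \<Longrightarrow> enve n s y x"
  unfolding enve_def using eqv_sym[OF VO_ob] by blast

lemma enve_sub: "sub \<pi> s' s \<Longrightarrow> enve n s x y \<Longrightarrow> enve n s' (\<lambda>c. x (\<pi> c)) (\<lambda>c. y (\<pi> c))"
  unfolding enve_def using eqv_sub[OF VO_ob] by blast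

lemma enve_case:
  assumes v: "eqv s VO v w" and xy: "enve n s x y"
  shows "enve (Suc n) s (\<lambda>c. case_nat (v c) (x c)) (\<lambda>c. case_nat (w c) (y c))"
  unfolding enve_def
proof (intro allI impI)
  fix i assume "i < Suc n"
  then show "eqv s VO (\<lambda>c. case_nat (v c) (x c) i) (\<lambda>c. case_nat (w c) (y c) i)"
    using v xy by (cases i) (simp_all add: enve_def)
qed

lemma inj_id: "inj_on (\<lambda>x :: 'u. x) S" by (simp add: inj_on_def)

lemma val_allI:
  fixes s :: "('u, 'a) stage"
  assumes b: "vars_below (Suc n) \<phi>" and x: "\<And>c. c \<in> dm s \<Longrightarrow> x c \<in> env n"
    and st: "\<And>s' \<pi> v. sub \<pi> s' s \<Longrightarrow> v \<in> el s' (fst VO) \<Longrightarrow> T s' (\<lambda>c. val \<phi> (case_nat (v c) (x (\<pi> c))))"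
  shows "T s (\<lambda>c. val (Forall \<phi>) (x c))"
  unfolding val.simps
proof (rule T_allI[OF inj_id])
  fix c v assume "c \<in> dm s" "v \<in> fst VO"
  then show "val \<phi> (case_nat v (x c)) \<in> Sig D" using val_Sig[OF b] env_case x by blast
next
  fix s' :: "('u, 'a) stage" and \<pi> v assume sub: "sub \<pi> s' s" and v: "\<And>c. c \<in> dm s' \<Longrightarrow> v c \<in> fst VO"
  show "T s' (\<lambda>c. val \<phi> (case_nat (v c) (x (\<pi> c))))" using st[OF sub] v by (simp add: el_def)
qed

lemma val_allE:
  assumes "T s (\<lambda>c. val (Forall \<phi>) (x c))" "v \<in> el s (fst VO)"
  shows "T s (\<lambda>c. val \<phi> (case_nat (v c) (x c)))"
  using assms(1) unfolding val.simps by (rule T_allE) (rule elD[OF assms(2)])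

lemma val_sub:
  assumes "sub \<pi> s' s" "T s (\<lambda>c. val \<phi> (x c))" "vars_below n \<phi>" "\<And>c. c \<in> dm s \<Longrightarrow> x c \<in> env n"
  shows "T s' (\<lambda>c. val \<phi> (x (\<pi> c)))"
  by (rule T_sub[OF assms(1,2)]) (rule val_Sig[OF assms(3,4)])

lemma val_ext:
  assumes "vars_below n \<phi>" "enve n s x y" "T s (\<lambda>c. val \<phi> (x c))"
  shows "T s (\<lambda>c. val \<phi> (y c))"
  using assms
proof (induction \<phi> arbitrary: n s x y)
  case (Mem i k)
  then have "eqv s (prd VO VO) (\<lambda>c. pr (x c i) (x c k)) (\<lambda>c. pr (y c i) (y c k))"
    by (simp add: eqv_prd enve_def)
  from pred_ext[OF cpred_pred[OF memV] this] Mem(3) show ?case by (simp add: tp_def)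
next
  case (Eq i k)
  then have e: "eqv s VO (\<lambda>c. x c i) (\<lambda>c. y c i)" "eqv s VO (\<lambda>c. x c k) (\<lambda>c. y c k)" by (simp_all add: enve_def)
  then have "eqv s VO (\<lambda>c. x c i) (\<lambda>c. x c k)" using Eq(3) by (simp add: eqv_def)
  then have "eqv s VO (\<lambda>c. y c i) (\<lambda>c. y c k)" using e eqv_sym[OF VO_ob] eqv_trans[OF VO_ob] by metis
  then show ?case by (simp add: eqv_def)
next
  case (And \<phi> \<psi>)
  then have "T s (\<lambda>c. val \<phi> (x c))" "T s (\<lambda>c. val \<psi> (x c))" by (simp_all add: T_and)
  moreover have "vars_below n \<phi>" "vars_below n \<psi>" using And.prems(1) by auto
  ultimately show ?case using And.IH(1)[OF _ And.prems(2)] And.IH(2)[OF _ And.prems(2)] by (simp add: T_and)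
next
  case (Or \<phi> \<psi>)
  note b = Or.prems(1) and e = Or.prems(2)
  have b1: "vars_below n \<phi>" and b2: "vars_below n \<psi>" using b by auto
  show ?case unfolding val.simps
  proof (rule T_jmono)
    show "T s (\<lambda>c. j (or_tv (val \<phi> (x c)) (val \<psi> (x c))))" using Or.prems(3) by simp
    fix s' :: "('u, 'a) stage" and \<pi> assume sub: "sub \<pi> s' s" and T: "T s' (\<lambda>c. or_tv (val \<phi> (x (\<pi> c))) (val \<psi> (x (\<pi> c))))"
    note e' = enve_sub[OF sub e]
    show "T s' (\<lambda>c. or_tv (val \<phi> (y (\<pi> c))) (val \<psi> (y (\<pi> c))))"
    proof (rule T_orE[OF T])
      fix s'' :: "('u, 'a) stage" and \<rho> assume sub': "sub \<rho> s'' s'" and T': "T s'' (\<lambda>c. val \<phi> (x (\<pi> (\<rho> c))))"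
      note e'' = enve_sub[OF sub' e']
      show "T s'' (\<lambda>c. or_tv (val \<phi> (y (\<pi> (\<rho> c)))) (val \<psi> (y (\<pi> (\<rho> c)))))"
        by (rule T_orI) (use Or.IH(1)[OF b1 e'' T'] val_Sig[OF b1] val_Sig[OF b2] enve_env(2)[OF e''] in blast)+
    next
      fix s'' :: "('u, 'a) stage" and \<rho> assume sub': "sub \<rho> s'' s'" and T': "T s'' (\<lambda>c. val \<psi> (x (\<pi> (\<rho> c))))"
      note e'' = enve_sub[OF sub' e']
      show "T s'' (\<lambda>c. or_tv (val \<phi> (y (\<pi> (\<rho> c)))) (val \<psi> (y (\<pi> (\<rho> c)))))"
        by (rule T_orI) (use Or.IH(2)[OF b2 e'' T'] val_Sig[OF b1] val_Sig[OF b2] enve_env(2)[OF e''] in blast)+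
    qed (use val_Sig[OF b1] val_Sig[OF b2] enve_env(1)[OF e'] in \<open>blast | simp\<close>)+
  qed simp_all
next
  case (Imp \<phi> \<psi>)
  note b = Imp.prems(1) and e = Imp.prems(2)
  have b1: "vars_below n \<phi>" and b2: "vars_below n \<psi>" using b by auto
  show ?case unfolding val.simps
  proof (rule T_impI)
    fix c assume "c \<in> dm s"
    then show "val \<phi> (y c) \<in> Sig D" using val_Sig[OF b1] enve_env(2)[OF e] by blast
  next
    fix s' :: "('u, 'a) stage" and \<pi> assume sub: "sub \<pi> s' s" and T: "T s' (\<lambda>c. val \<phi> (y (\<pi> c)))"
    note e' = enve_sub[OF sub e]
    have 1: "T s' (\<lambda>c. val \<phi> (x (\<pi> c)))" by (rule Imp.IH(1)[OF b1 enve_sym[OF e'] T])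
    have "T s' (\<lambda>c. imp_tv D (val \<phi> (x (\<pi> c))) (val \<psi> (x (\<pi> c))))"
      using T_sub[OF sub Imp.prems(3)] by simp
    from T_mp[OF this 1] have "T s' (\<lambda>c. val \<psi> (x (\<pi> c)))" .
    then show "T s' (\<lambda>c. val \<psi> (y (\<pi> c)))" by (rule Imp.IH(2)[OF b2 e'])
  qed
next
  case (Forall \<phi>)
  note e = Forall.prems(2)
  have b: "vars_below (Suc n) \<phi>" using Forall.prems(1) by simp
  show ?case
  proof (rule val_allI[OF b enve_env(2)[OF e]])
    fix s' \<pi> v assume sub: "sub \<pi> s' s" and v: "v \<in> el s' (fst VO)"
    have "T s' (\<lambda>c. val (Forall \<phi>) (x (\<pi> c)))"
      by (rule val_sub[OF sub Forall.prems(3,1) enve_env(1)[OF e]])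
    from val_allE[OF this v] show "T s' (\<lambda>c. val \<phi> (case_nat (v c) (y (\<pi> c))))"
      by (rule Forall.IH[OF b enve_case[OF VO_refl[OF v] enve_sub[OF sub e]]])
  qed
next
  case (Exists \<phi>)
  note e = Exists.prems(2)
  have b: "vars_below (Suc n) \<phi>" using Exists.prems(1) by simp
  have sg: "ex_tv (fst VO) (\<lambda>v. val \<phi> (case_nat v z)) \<in> Sig D" if "z \<in> env n" for z
    using val_Sig[OF b] env_case that by blast
  show ?case unfolding val.simps
  proof (rule T_jmono)
    show "T s (\<lambda>c. j (ex_tv (fst VO) (\<lambda>v. val \<phi> (case_nat v (x c)))))" using Exists.prems(3) by simp
    show "ex_tv (fst VO) (\<lambda>v. val \<phi> (case_nat v (x c))) \<in> Sig D"
      "ex_tv (fst VO) (\<lambda>v. val \<phi> (case_nat v (y c))) \<in> Sig D" if "c \<in> dm s" for c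
      using sg[OF enve_env(1)[OF e that]] sg[OF enve_env(2)[OF e that]] .
    fix s' :: "('u, 'a) stage" and \<pi> assume sub: "sub \<pi> s' s" and T: "T s' (\<lambda>c. ex_tv (fst VO) (\<lambda>v. val \<phi> (case_nat v (x (\<pi> c)))))"
    obtain v where v: "\<And>c. c \<in> dm s' \<Longrightarrow> v c \<in> fst VO" "T s' (\<lambda>c. val \<phi> (case_nat (v c) (x (\<pi> c))))"
      using T_exE[OF T] by blast
    have v': "v \<in> el s' (fst VO)" using v(1) by (simp add: el_def)
    have "T s' (\<lambda>c. val \<phi> (case_nat (v c) (y (\<pi> c))))"
      by (rule Exists.IH[OF b enve_case[OF VO_refl[OF v'] enve_sub[OF sub e]] v(2)])
    then show "T s' (\<lambda>c. ex_tv (fst VO) (\<lambda>v. val \<phi> (case_nat v (y (\<pi> c)))))"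
      using v(1) by (intro T_exI)
  qed
qed simp_all

lemma val_closed:
  fixes s :: "('u, 'a) stage"
  assumes "vars_below n \<phi>" "\<And>c. c \<in> dm s \<Longrightarrow> x c \<in> env n" "T s (\<lambda>c. j (val \<phi> (x c)))"
  shows "T s (\<lambda>c. val \<phi> (x c))"
  using assms
proof (induction \<phi> arbitrary: n s x)
  case (Mem i k)
  then have ik: "(\<lambda>c. x c i) \<in> el s (fst VO)" "(\<lambda>c. x c k) \<in> el s (fst VO)" by (auto simp: env_def el_def)
  then have "eqv s (prd VO VO) (\<lambda>c. pr (x c i) (x c k)) (\<lambda>c. pr (x c i) (x c k))"
    by (simp add: eqv_prd VO_refl)
  from cpredD[OF memV this] Mem(3) show ?case by (simp add: tp_def)
next
  case (Eq i k)
  then have ik: "(\<lambda>c. x c i) \<in> el s (fst VO)" "(\<lambda>c. x c k) \<in> el s (fst VO)" by (auto simp: env_def el_def)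
  have "eqv s VO (\<lambda>c. x c i) (\<lambda>c. x c k)"
    by (rule sheaf_separated[OF VO VO_refl[OF ik(1)] VO_refl[OF ik(2)]]) (use Eq(3) in simp)
  then show ?case by (simp add: eqv_def)
next
  case Bot
  then show ?case using T_jj[of s "\<lambda>_. bot_tv"] by simp
next
  case (And \<phi> \<psi>)
  have b: "vars_below n \<phi>" "vars_below n \<psi>" using And.prems(1) by auto
  note sg = val_Sig[OF b(1) And.prems(2)] val_Sig[OF b(2) And.prems(2)]
  have "T s (\<lambda>c. j (val \<phi> (x c)))"
    by (rule T_jmono[OF And.prems(3)]) (use sg in \<open>simp_all add: T_and\<close>)
  moreover have "T s (\<lambda>c. j (val \<psi> (x c)))"
    by (rule T_jmono[OF And.prems(3)]) (use sg in \<open>simp_all add: T_and\<close>)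
  ultimately show ?case unfolding val.simps T_and
    using And.IH(1)[OF b(1), of s x] And.IH(2)[OF b(2), of s x] And.prems(2) by simp
next
  case (Or \<phi> \<psi>)
  then show ?case unfolding val.simps by (intro T_jj[where P = "\<lambda>c. or_tv (val \<phi> (x c)) (val \<psi> (x c))"]) simp_all
next
  case (Imp \<phi> \<psi>)
  have b: "vars_below n \<phi>" "vars_below n \<psi>" using Imp.prems(1) by auto
  note sg = val_Sig[OF b(1) Imp.prems(2)] val_Sig[OF b(2) Imp.prems(2)]
  show ?case unfolding val.simps
  proof (rule T_impI[OF sg(1)])
    fix s' :: "('u, 'a) stage" and \<pi> assume sub: "sub \<pi> s' s" and T: "T s' (\<lambda>c. val \<phi> (x (\<pi> c)))"
    have x': "\<And>c. c \<in> dm s' \<Longrightarrow> x (\<pi> c) \<in> env n" using Imp.prems(2) sub_dm[OF sub] by blast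
    have jT: "T s' (\<lambda>c. j (imp_tv D (val \<phi> (x (\<pi> c))) (val \<psi> (x (\<pi> c)))))"
      using T_sub[OF sub Imp.prems(3)] by simp
    have "T s' (\<lambda>c. j (val \<psi> (x (\<pi> c))))"
    proof (rule T_jmono[OF jT])
      fix s'' :: "('u, 'a) stage" and \<rho> assume sub': "sub \<rho> s'' s'"
        and i: "T s'' (\<lambda>c. imp_tv D (val \<phi> (x (\<pi> (\<rho> c)))) (val \<psi> (x (\<pi> (\<rho> c)))))"
      show "T s'' (\<lambda>c. val \<psi> (x (\<pi> (\<rho> c))))" by (rule T_mp[OF i val_sub[OF sub' T b(1) x']])
    qed (use val_Sig[OF b(2) x'] in simp_all)
    with Imp.IH(2)[OF b(2), of s' "\<lambda>c. x (\<pi> c)"] x' show "T s' (\<lambda>c. val \<psi> (x (\<pi> c)))" by simp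
  qed
next
  case (Forall \<phi>)
  have b: "vars_below (Suc n) \<phi>" using Forall.prems(1) by simp
  show ?case
  proof (rule val_allI[OF b Forall.prems(2)])
    fix s' \<pi> v assume sub: "sub \<pi> s' s" and v: "v \<in> el s' (fst VO)"
    have x': "\<And>c. c \<in> dm s' \<Longrightarrow> x (\<pi> c) \<in> env n" using Forall.prems(2) sub_dm[OF sub] by blast
    have cx: "\<And>c. c \<in> dm s' \<Longrightarrow> case_nat (v c) (x (\<pi> c)) \<in> env (Suc n)" using env_case elD[OF v] x' by blast
    have jT: "T s' (\<lambda>c. j (val (Forall \<phi>) (x (\<pi> c))))"
      by (rule T_sub[OF sub Forall.prems(3)]) simp
    have "T s' (\<lambda>c. j (val \<phi> (case_nat (v c) (x (\<pi> c)))))"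
    proof (rule T_jmono[OF jT])
      fix s'' :: "('u, 'a) stage" and \<rho> assume sub': "sub \<rho> s'' s'" and a: "T s'' (\<lambda>c. val (Forall \<phi>) (x (\<pi> (\<rho> c))))"
      show "T s'' (\<lambda>c. val \<phi> (case_nat (v (\<rho> c)) (x (\<pi> (\<rho> c)))))" by (rule val_allE[OF a el_sub[OF sub' v]])
    qed (use val_Sig[OF b cx] in simp_all)
    with Forall.IH[OF b, of s' "\<lambda>c. case_nat (v c) (x (\<pi> c))"] cx
    show "T s' (\<lambda>c. val \<phi> (case_nat (v c) (x (\<pi> c))))" by simp
  qed
next
  case (Exists \<phi>)
  have b: "vars_below (Suc n) \<phi>" using Exists.prems(1) by simp
  have "\<And>c. c \<in> dm s \<Longrightarrow> ex_tv (fst VO) (\<lambda>v. val \<phi> (case_nat v (x c))) \<in> Sig D"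
    using val_Sig[OF b] env_case Exists.prems(2) by blast
  from T_jj[OF this] Exists.prems(3) show ?case by simp
qed

subsection \<open>The interpretation of formulas in the subtopos\<close>

primrec ctx :: "nat \<Rightarrow> ('u, 'a) rt_obj" where
  "ctx 0 = One"
| "ctx (Suc n) = prd (ctx n) VO"

definition cm :: "'u \<Rightarrow> nat \<Rightarrow> 'u" where "cm u i = ps ((pf ^^ i) u)"

lemma cm_pr: "cm (pr x v) = case_nat v (cm x)"
  by (rule ext) (simp add: cm_def funpow_swap1 split: nat.split)

lemma cm_split: "cm u = case_nat (ps u) (cm (pf u))"
  using cm_pr[of "pf u" "ps u"] by simp

lemma sheaf_ctx: "sheaf (ctx n)"
  by (induction n) (simp_all add: sheaf_One sheaf_prd VO)

lemma ctx_ob: "ctx n \<in> ob" by (rule sheaf_ob[OF sheaf_ctx])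

lemma cm_env: "u \<in> fst (ctx n) \<Longrightarrow> cm u \<in> env n"
proof (induction n arbitrary: u)
  case (Suc n)
  then have "pf u \<in> fst (ctx n)" "ps u \<in> fst VO" by (auto simp: prd_def)
  then show ?case using Suc.IH env_case by (subst cm_split) blast
qed (simp add: env_def)

lemma cm_enve: "eqv s (ctx n) x y \<Longrightarrow> enve n s (\<lambda>c. cm (x c)) (\<lambda>c. cm (y c))"
proof (induction n arbitrary: x y)
  case (Suc n)
  then have "eqv s (ctx n) (\<lambda>c. pf (x c)) (\<lambda>c. pf (y c))" "eqv s VO (\<lambda>c. ps (x c)) (\<lambda>c. ps (y c))"
    by (simp_all add: eqv_prd)
  from enve_case[OF this(2) Suc.IH[OF this(1)]] show ?case
    by (simp add: cm_split[symmetric])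
qed (simp add: enve_def)

lemma ctx_refl: "x \<in> el s (fst (ctx n)) \<Longrightarrow> eqv s (ctx n) x x"
proof (induction n arbitrary: x)
  case (Suc n)
  then have "(\<lambda>c. pf (x c)) \<in> el s (fst (ctx n))" "(\<lambda>c. ps (x c)) \<in> el s (fst VO)" by (simp_all add: el_prd)
  with Suc.IH VO_refl show ?case by (simp add: eqv_prd)
qed (simp add: eqv_One)

lemma cm_env_el: "x \<in> el s (fst (ctx n)) \<Longrightarrow> c \<in> dm s \<Longrightarrow> cm (x c) \<in> env n"
  by (rule cm_env) (rule elD)

abbreviation pv :: "fm \<Rightarrow> 'u \<Rightarrow> 'a tval" where "pv \<phi> \<equiv> \<lambda>u. val \<phi> (cm u)"

lemma cpred_val: "vars_below n \<phi> \<Longrightarrow> cpred (ctx n) (pv \<phi>)"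
proof (intro cpredI predI)
  assume b: "vars_below n \<phi>"
  show "x \<in> fst (ctx n) \<Longrightarrow> pv \<phi> x \<in> Sig D" for x using val_Sig[OF b cm_env] .
  show "tp s (pv \<phi>) y" if "eqv s (ctx n) x y" "tp s (pv \<phi>) x" for s x y
    using val_ext[OF b cm_enve[OF that(1)]] that(2) by (simp add: tp_def)
  show "tp s (pv \<phi>) x" if "eqv s (ctx n) x x" "tp s (\<lambda>x. j (pv \<phi> x)) x" for s x
    using val_closed[OF b cm_env_el[OF eqv_el(1)[OF that(1)]]] that(2) by (simp add: tp_def)
qed

definition im :: "nat \<Rightarrow> fm \<Rightarrow> ('u, 'a) rt_arr" where "im n \<phi> = incl (ctx n) (pv \<phi>)"

lemma im_subobj: "vars_below n \<phi> \<Longrightarrow> im n \<phi> \<in> subobj ST (ctx n)"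
  unfolding im_def by (rule incl_subobj[OF sheaf_ctx cpred_val])

lemma tru_im: "vars_below n \<phi> \<Longrightarrow> tru s (im n \<phi>) x \<longleftrightarrow> x \<in> el s (fst (ctx n)) \<and> T s (\<lambda>c. val \<phi> (cm (x c)))"
  unfolding im_def tru_incl[OF ctx_ob cpred_pred[OF cpred_val]] using ctx_refl eqv_el(1) unfolding tp_def by blast

primrec vars :: "nat \<Rightarrow> ('u, 'a) rt_arr list" where
  "vars 0 = []"
| "vars (Suc n) = p2 (ctx n) VO # map (\<lambda>a. Cmp ST a (p1 (ctx n) VO)) (vars n)"

lemma length_vars [simp]: "length (vars n) = n" by (induction n) simp_all

lemma vars_nth:
  "i < n \<Longrightarrow> vars n ! i \<in> hom RTc (ctx n) VO \<and> (\<forall>s x v. ap s (vars n ! i) x v \<longleftrightarrow> x \<in> el s (fst (ctx n)) \<and> eqv s VO (\<lambda>c. cm (x c) i) v)"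
proof (induction n arbitrary: i)
  case (Suc n)
  have cms: "cm u 0 = ps u" "cm u (Suc i) = cm (pf u) i" for u i
    using cm_split[of u] by simp_all
  show ?case
  proof (cases i)
    case 0
    then show ?thesis using p2_hom[OF ctx_ob VO_ob]
      by (auto simp: ap_p2[OF ctx_ob VO_ob] cms el_prd dest: eqv_el intro: ctx_refl)
  next
    case (Suc k)
    then have k: "k < n" using Suc.prems by simp
    have i: "vars (Suc n) ! i = Cmp RTc (vars n ! k) (p1 (ctx n) VO)"
      using k by (simp add: Suc ST_simps)
    note p = p1_hom[OF ctx_ob VO_ob, of n]
    have h: "vars n ! k \<in> hom RTc (ctx n) VO" using Suc.IH[OF k] by blast
    have "ap s (Cmp RTc (vars n ! k) (p1 (ctx n) VO)) x v \<longleftrightarrow> x \<in> el s (fst (ctx (Suc n))) \<and> eqv s VO (\<lambda>c. cm (x c) i) v" for s x v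
    proof -
      have "ap s (Cmp RTc (vars n ! k) (p1 (ctx n) VO)) x v \<longleftrightarrow> (\<exists>y. (eqv s (ctx n) (\<lambda>c. pf (x c)) y \<and>
          eqv s VO (\<lambda>c. ps (x c)) (\<lambda>c. ps (x c))) \<and> ap s (vars n ! k) y v)"
        unfolding comp_hom(2)[OF p h] ap_p1[OF ctx_ob VO_ob] by (rule refl)
      also have "\<dots> \<longleftrightarrow> eqv s VO (\<lambda>c. ps (x c)) (\<lambda>c. ps (x c)) \<and> ap s (vars n ! k) (\<lambda>c. pf (x c)) v"
        using ap_cong[OF h] ap_dom[OF h] ap_cod[OF h] eqv_sym[OF ctx_ob] by blast
      also have "\<dots> \<longleftrightarrow> x \<in> el s (fst (ctx (Suc n))) \<and> eqv s VO (\<lambda>c. cm (x c) i) v"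
        using Suc.IH[OF k] by (auto simp: cms Suc el_prd dest: eqv_el intro: VO_refl)
      finally show ?thesis .
    qed
    then show ?thesis unfolding i using comp_hom(1)[OF p h] by simp
  qed
qed simp

definition M :: "(('u, 'a) rt_obj, ('u, 'a) rt_arr) rel_structure" where
  "M = \<lparr>Univ = VO, Sqr = prd VO VO, Proj1 = p1 VO VO, Proj2 = p2 VO VO,
     Eps = incl (prd VO VO) (\<lambda>u. memV (pf u) (ps u))\<rparr>"

lemma M_simps [simp]: "Univ M = VO" "Sqr M = prd VO VO" "Proj1 M = p1 VO VO" "Proj2 M = p2 VO VO"
  "Eps M = incl (prd VO VO) (\<lambda>u. memV (pf u) (ps u))"
  by (simp_all add: M_def)

lemma is_rel_structure_M: "is_rel_structure ST M"
  unfolding is_rel_structure_def M_simps ST_simps(1) mem_Collect_eq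
  using VO product_ST[OF VO VO] incl_subobj[OF sheaf_prd[OF VO VO] memV] by blast

lemma interp_Mem:
  assumes "i < n" "k < n"
  shows "interp ST M (Mem i k) (ctx n) (vars n) (im n (Mem i k))"
proof -
  have b: "vars_below n (Mem i k)" using assms by simp
  note vi = vars_nth[OF assms(1)] and vk = vars_nth[OF assms(2)]
  obtain h where h: "h \<in> hom RTc (ctx n) (prd VO VO)"
    "\<And>s w u. ap s h w u \<longleftrightarrow> ap s (vars n ! i) w (\<lambda>c. pf (u c)) \<and> ap s (vars n ! k) w (\<lambda>c. ps (u c))"
    "Cmp RTc (p1 VO VO) h = vars n ! i" "Cmp RTc (p2 VO VO) h = vars n ! k"
    using tuple[OF conjunct1[OF vi] conjunct1[OF vk]] by blast
  have "inverse_image ST h (incl (prd VO VO) (\<lambda>u. memV (pf u) (ps u))) (incl (ctx n) (pv (Mem i k)))"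
  proof (rule inverse_image_incl[OF h(1) sheaf_ctx sheaf_prd[OF VO VO] cpred_val[OF b] memV])
    fix s x u assume "ap s h x u"
    then have "eqv s (prd VO VO) (\<lambda>c. pr (cm (x c) i) (cm (x c) k)) u"
      unfolding h(2) using vi vk by (simp add: eqv_prd)
    then show "tp s (pv (Mem i k)) x \<longleftrightarrow> tp s (\<lambda>u. memV (pf u) (ps u)) u"
      using pred_ext[OF cpred_pred[OF memV]] eqv_sym[OF prd_ob[OF VO_ob VO_ob]] unfolding tp_def by fastforce
  qed
  moreover have "h \<in> hom ST (ctx n) (prd VO VO)" unfolding hom_ST using h(1) sheaf_ctx sheaf_prd[OF VO VO] by blast
  ultimately show ?thesis unfolding interp.simps M_simps im_def ST_simps using h(3,4) by blast
qed

lemma interp_Eq: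
  assumes "i < n" "k < n"
  shows "interp ST M (Eq i k) (ctx n) (vars n) (im n (Eq i k))"
proof -
  have b: "vars_below n (Eq i k)" using assms by simp
  note vi = vars_nth[OF assms(1)] and vk = vars_nth[OF assms(2)]
  have f: "vars n ! i \<in> hom RTc (ctx n) VO" and g: "vars n ! k \<in> hom RTc (ctx n) VO" using vi vk by blast+
  have pP: "pred (ctx n) (pv (Eq i k))" by (rule cpred_pred[OF cpred_val[OF b]])
  note inc = incl_hom[OF ctx_ob pP] and mono = imono_incl[OF ctx_ob pP]
  have sub: "sheaf (subo (ctx n) (pv (Eq i k)))" by (rule sheaf_subo[OF sheaf_ctx cpred_val[OF b]])
  have TE: "tp s (pv (Eq i k)) x \<longleftrightarrow> eqv s VO (\<lambda>c. cm (x c) i) (\<lambda>c. cm (x c) k)" if "x \<in> el s (fst (ctx n))" for s x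
    using cm_env_el[OF that] assms by (simp add: tp_def eqv_def el_def env_def)
  have "is_equalizer ST (vars n ! i) (vars n ! k) (incl (ctx n) (pv (Eq i k)))"
    unfolding is_equalizer_def ST_simps Arr_ST Ball_def hom_ST mem_Collect_eq homD(8,9)[OF f] homD(8,9)[OF inc]
  proof (intro conjI allI impI)
    show "Cmp RTc (vars n ! i) (incl (ctx n) (pv (Eq i k))) = Cmp RTc (vars n ! k) (incl (ctx n) (pv (Eq i k)))"
    proof (rule comp_eqI[OF inc f inc g])
      fix s w x v assume w: "ap s (incl (ctx n) (pv (Eq i k))) w x" and v: "ap s (vars n ! i) x v"
      have "tp s (pv (Eq i k)) x" using w unfolding ap_incl[OF ctx_ob pP] using pred_ext[OF pP] by blast
      then have "ap s (vars n ! k) x v" using v vi vk TE eqv_sym[OF VO_ob] eqv_trans[OF VO_ob] by metis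
      then show "\<exists>y. ap s (incl (ctx n) (pv (Eq i k))) w y \<and> ap s (vars n ! k) y v" using w by blast
    qed
  next
    fix W u assume W: "sheaf W" and u: "u \<in> hom RTc W (ctx n) \<and> sheaf W \<and> sheaf (ctx n)"
      and e: "Cmp RTc (vars n ! i) u = Cmp RTc (vars n ! k) u"
    have u: "u \<in> hom RTc W (ctx n)" using u by blast
    have "tp s (pv (Eq i k)) x" if x: "ap s u w x" for s w x
    proof -
      have xe: "x \<in> el s (fst (ctx n))" using eqv_el(1)[OF ap_cod[OF u x]] .
      have "(\<lambda>c. cm (x c) i) \<in> el s (fst VO)" using cm_env_el[OF xe] assms by (simp add: el_def env_def)
      then have "ap s (vars n ! i) x (\<lambda>c. cm (x c) i)" using vi xe VO_refl by blast
      from comp_eqD[OF e u f u g x this] obtain y where y: "ap s u w y" "ap s (vars n ! k) y (\<lambda>c. cm (x c) i)" by blast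
      have "ap s (vars n ! k) x (\<lambda>c. cm (x c) i)"
        using ap_cong[OF g y(2) ap_fun[OF u y(1) x] ap_cod[OF g y(2)]] .
      then show ?thesis using vk TE[OF xe] eqv_sym[OF VO_ob] by blast
    qed
    then obtain h where h: "h \<in> hom RTc W (subo (ctx n) (pv (Eq i k)))" "Cmp RTc (incl (ctx n) (pv (Eq i k))) h = u"
      using ap_factor_incl[OF u pP] by blast
    then show "\<exists>!h. (h \<in> hom RTc W (subo (ctx n) (pv (Eq i k))) \<and> sheaf W \<and> sheaf (subo (ctx n) (pv (Eq i k)))) \<and> Cmp RTc (incl (ctx n) (pv (Eq i k))) h = u"
      using W sub imono_cancel[OF mono inc _ h(1)] by (intro ex1I[of _ h]) (blast, metis)
  qed (use f g sheaf_ctx VO sub homD(7)[OF f] homD(7)[OF inc] in simp_all)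
  then show ?thesis unfolding interp.simps using im_subobj[OF b] by (simp add: im_def)
qed

lemma inverse_image_p1:
  assumes "inverse_image ST (p1 (ctx n) VO) m m'" "m \<in> subobj ST (ctx n)"
  shows "m' \<in> subobj ST (ctx (Suc n))"
    and "tru s m' u \<longleftrightarrow> u \<in> el s (fst (ctx (Suc n))) \<and> tru s m (\<lambda>c. pf (u c))"
proof -
  note p = p1_hom[OF ctx_ob VO_ob, of n]
  have s: "sheaf (prd (ctx n) VO)" by (rule sheaf_prd[OF sheaf_ctx VO])
  note ii = inverse_image_tru[OF assms(1) p s assms(2)]
  show "m' \<in> subobj ST (ctx (Suc n))" using ii(1) by simp
  obtain B where B: "m \<in> hom RTc B (ctx n)" using assms(2) unfolding subobj_ST by blast
  show "tru s m' u \<longleftrightarrow> u \<in> el s (fst (ctx (Suc n))) \<and> tru s m (\<lambda>c. pf (u c))"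
  proof
    assume "tru s m' u"
    then obtain y where y: "eqv s (ctx n) (\<lambda>c. pf (u c)) y" "eqv s VO (\<lambda>c. ps (u c)) (\<lambda>c. ps (u c))" "tru s m y"
      unfolding ii(2) ap_p1[OF ctx_ob VO_ob] by blast
    obtain b where b: "ap s m b y" using y(3) unfolding tru_def by blast
    have "ap s m b (\<lambda>c. pf (u c))" using ap_cong[OF B b ap_dom[OF B b] eqv_sym[OF ctx_ob y(1)]] .
    then show "u \<in> el s (fst (ctx (Suc n))) \<and> tru s m (\<lambda>c. pf (u c))"
      using eqv_el(1)[OF y(1)] eqv_el(1)[OF y(2)] unfolding tru_def by (auto simp: el_prd)
  next
    assume "u \<in> el s (fst (ctx (Suc n))) \<and> tru s m (\<lambda>c. pf (u c))"
    then show "tru s m' u"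
      unfolding ii(2) ap_p1[OF ctx_ob VO_ob] using ctx_refl VO_refl by (auto simp: el_prd)
  qed
qed

lemma interp_val: "vars_below n \<phi> \<Longrightarrow> interp ST M \<phi> (ctx n) (vars n) (im n \<phi>)"
proof (induction \<phi> arbitrary: n)
  case (Mem i k)
  then show ?case using interp_Mem by simp
next
  case (Eq i k)
  then show ?case using interp_Eq by simp
next
  case Bot
  note b = im_subobj[OF Bot]
  have "sub_le ST (im n Bot) m" if m: "m \<in> subobj ST (ctx n)" for m
    unfolding sub_le_ST[OF b m] tru_im[OF Bot]
  proof (intro allI impI)
    fix s x assume x: "x \<in> el s (fst (ctx n)) \<and> T s (\<lambda>c. val Bot (cm (x c)))"
    show "tru s m x"
    proof (rule tru_closed[OF m ctx_refl])
      show "x \<in> el s (fst (ctx n))" "T s (\<lambda>c. j bot_tv)" using x by simp_all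
      fix s' :: "('u, 'a) stage" and \<pi> assume sub: "sub \<pi> s' s" and "T s' (\<lambda>c. bot_tv)"
      then have "T s' (\<lambda>c. Pm m (x (\<pi> c)))" using T_botE by blast
      moreover obtain B where "m \<in> hom RTc B (ctx n)" using m unfolding subobj_ST by blast
      ultimately show "tru s' m (\<lambda>c. x (\<pi> c))" using T_Pm el_sub[OF sub] x unfolding tp_def by blast
    qed simp
  qed
  then show ?case using b by simp
next
  case (And \<phi> \<psi>)
  have b: "vars_below n \<phi>" "vars_below n \<psi>" using And.prems by auto
  have "sub_le ST m (im n (And \<phi> \<psi>)) \<longleftrightarrow> sub_le ST m (im n \<phi>) \<and> sub_le ST m (im n \<psi>)"
    if m: "m \<in> subobj ST (ctx n)" for m
    unfolding sub_le_ST[OF m im_subobj[OF And.prems]] sub_le_ST[OF m im_subobj[OF b(1)]] sub_le_ST[OF m im_subobj[OF b(2)]]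
      tru_im[OF And.prems] tru_im[OF b(1)] tru_im[OF b(2)] val.simps T_and by blast
  then show ?case using And.IH(1)[OF b(1)] And.IH(2)[OF b(2)] im_subobj[OF And.prems] unfolding interp.simps by blast
next
  case (Or \<phi> \<psi>)
  have b: "vars_below n \<phi>" "vars_below n \<psi>" using Or.prems by auto
  have "sub_le ST (im n (Or \<phi> \<psi>)) m \<longleftrightarrow> sub_le ST (im n \<phi>) m \<and> sub_le ST (im n \<psi>) m"
    if m: "m \<in> subobj ST (ctx n)" for m
    unfolding sub_le_ST[OF im_subobj[OF Or.prems] m] sub_le_ST[OF im_subobj[OF b(1)] m] sub_le_ST[OF im_subobj[OF b(2)] m]
      tru_im[OF Or.prems] tru_im[OF b(1)] tru_im[OF b(2)] val.simps
  proof (intro iffI conjI allI impI)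
    fix s x assume le: "\<forall>s x. x \<in> el s (fst (ctx n)) \<and> T s (\<lambda>c. j (or_tv (val \<phi> (cm (x c))) (val \<psi> (cm (x c))))) \<longrightarrow> tru s m x"
    note sg = val_Sig[OF b(1) cm_env_el] val_Sig[OF b(2) cm_env_el]
    have "T s (\<lambda>c. j (or_tv (val \<phi> (cm (x c))) (val \<psi> (cm (x c)))))"
      if "x \<in> el s (fst (ctx n))" "T s (\<lambda>c. val \<phi> (cm (x c))) \<or> T s (\<lambda>c. val \<psi> (cm (x c)))"
      by (rule T_jI[OF Sig_or T_orI[OF sg(1)[OF that(1)] sg(2)[OF that(1)] that(2)]])
    then show "x \<in> el s (fst (ctx n)) \<and> T s (\<lambda>c. val \<phi> (cm (x c))) \<Longrightarrow> tru s m x"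
      "x \<in> el s (fst (ctx n)) \<and> T s (\<lambda>c. val \<psi> (cm (x c))) \<Longrightarrow> tru s m x" using le by blast+
  next
    fix s x assume le: "(\<forall>s x. x \<in> el s (fst (ctx n)) \<and> T s (\<lambda>c. val \<phi> (cm (x c))) \<longrightarrow> tru s m x) \<and>
       (\<forall>s x. x \<in> el s (fst (ctx n)) \<and> T s (\<lambda>c. val \<psi> (cm (x c))) \<longrightarrow> tru s m x)"
      and x: "x \<in> el s (fst (ctx n)) \<and> T s (\<lambda>c. j (or_tv (val \<phi> (cm (x c))) (val \<psi> (cm (x c)))))"
    obtain B where B: "m \<in> hom RTc B (ctx n)" using m unfolding subobj_ST by blast
    show "tru s m x"
    proof (rule tru_closed[OF m ctx_refl conjunct2[OF x]])
      fix s' :: "('u, 'a) stage" and \<pi> assume sub: "sub \<pi> s' s" and o: "T s' (\<lambda>c. or_tv (val \<phi> (cm (x (\<pi> c)))) (val \<psi> (cm (x (\<pi> c)))))"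
      have x': "(\<lambda>c. x (\<pi> c)) \<in> el s' (fst (ctx n))" using el_sub[OF sub] x by blast
      have "T s' (\<lambda>c. Pm m (x (\<pi> c)))"
      proof (rule T_orE[OF o])
        fix c assume k: "c \<in> dm s'"
        show "val \<phi> (cm (x (\<pi> c))) \<in> Sig D" "val \<psi> (cm (x (\<pi> c))) \<in> Sig D" "Pm m (x (\<pi> c)) \<in> Sig D"
          using val_Sig[OF b(1) cm_env_el[OF x' k]] val_Sig[OF b(2) cm_env_el[OF x' k]] pred_sig_el[OF pred_Pm[OF B] x' k] .
      next
        fix s'' :: "('u, 'a) stage" and \<rho> assume sub': "sub \<rho> s'' s'" and 1: "T s'' (\<lambda>c. val \<phi> (cm (x (\<pi> (\<rho> c)))))"
        then have "tru s'' m (\<lambda>c. x (\<pi> (\<rho> c)))" using le el_sub[OF sub' x'] by blast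
        then show "T s'' (\<lambda>c. Pm m (x (\<pi> (\<rho> c))))" using T_Pm[OF B el_sub[OF sub' x']] by (simp add: tp_def)
      next
        fix s'' :: "('u, 'a) stage" and \<rho> assume sub': "sub \<rho> s'' s'" and 1: "T s'' (\<lambda>c. val \<psi> (cm (x (\<pi> (\<rho> c)))))"
        then have "tru s'' m (\<lambda>c. x (\<pi> (\<rho> c)))" using le el_sub[OF sub' x'] by blast
        then show "T s'' (\<lambda>c. Pm m (x (\<pi> (\<rho> c))))" using T_Pm[OF B el_sub[OF sub' x']] by (simp add: tp_def)
      qed
      then show "tru s' m (\<lambda>c. x (\<pi> c))" using T_Pm[OF B x'] by (simp add: tp_def)
    qed (use x in simp_all)
  qed
  then show ?case using Or.IH(1)[OF b(1)] Or.IH(2)[OF b(2)] im_subobj[OF Or.prems] unfolding interp.simps by blast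
next
  case (Imp \<phi> \<psi>)
  have b: "vars_below n \<phi>" "vars_below n \<psi>" using Imp.prems by auto
  have "sub_le ST m (im n (Imp \<phi> \<psi>)) \<longleftrightarrow> (\<forall>l \<in> subobj ST (ctx n). sub_le ST l m \<and> sub_le ST l (im n \<phi>) \<longrightarrow> sub_le ST l (im n \<psi>))"
    if m: "m \<in> subobj ST (ctx n)" for m
  proof
    assume "sub_le ST m (im n (Imp \<phi> \<psi>))"
    then have le: "\<And>s x. tru s m x \<Longrightarrow> T s (\<lambda>c. imp_tv D (val \<phi> (cm (x c))) (val \<psi> (cm (x c))))"
      unfolding sub_le_ST[OF m im_subobj[OF Imp.prems]] tru_im[OF Imp.prems] val.simps by blast
    show "\<forall>l \<in> subobj ST (ctx n). sub_le ST l m \<and> sub_le ST l (im n \<phi>) \<longrightarrow> sub_le ST l (im n \<psi>)"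
    proof (intro ballI impI)
      fix l assume l: "l \<in> subobj ST (ctx n)" and lm: "sub_le ST l m \<and> sub_le ST l (im n \<phi>)"
      show "sub_le ST l (im n \<psi>)"
        unfolding sub_le_ST[OF l im_subobj[OF b(2)]] tru_im[OF b(2)]
      proof (intro allI impI)
        fix s x assume "tru s l x"
        then have 1: "tru s m x" and 2: "x \<in> el s (fst (ctx n))" "T s (\<lambda>c. val \<phi> (cm (x c)))"
          using lm unfolding sub_le_ST[OF l m] sub_le_ST[OF l im_subobj[OF b(1)]] tru_im[OF b(1)] by blast+
        show "x \<in> el s (fst (ctx n)) \<and> T s (\<lambda>c. val \<psi> (cm (x c)))"
          using 2(1) T_mp[OF le[OF 1] 2(2)] by blast
      qed
    qed
  next
    assume R: "\<forall>l \<in> subobj ST (ctx n). sub_le ST l m \<and> sub_le ST l (im n \<phi>) \<longrightarrow> sub_le ST l (im n \<psi>)"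
    obtain B where B: "m \<in> hom RTc B (ctx n)" using m unfolding subobj_ST by blast
    define Q where "Q = (\<lambda>u. and_tv D (Pm m u) (pv \<phi> u))"
    have TQ: "tp s Q x \<longleftrightarrow> tp s (Pm m) x \<and> tp s (pv \<phi>) x" for s x
      by (simp add: tp_def Q_def T_and)
    have pQ: "pred (ctx n) Q"
    proof (rule predI)
      show "Q x \<in> Sig D" if "x \<in> fst (ctx n)" for x
        using that pred_sig[OF pred_Pm[OF B]] val_Sig[OF b(1) cm_env] by (simp add: Q_def)
      show "tp s Q y" if "eqv s (ctx n) x y" "tp s Q x" for s x y
        using that pred_ext[OF pred_Pm[OF B]] pred_ext[OF cpred_pred[OF cpred_val[OF b(1)]]] unfolding TQ by blast
    qed
    have cQ: "cpred (ctx n) Q"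
    proof (rule cpredI[OF pQ])
      fix s x assume x: "eqv s (ctx n) x x" and jQ: "tp s (\<lambda>x. j (Q x)) x"
      have sg: "c \<in> dm s \<Longrightarrow> Q (x c) \<in> Sig D" for c by (rule pred_sig_el[OF pQ eqv_el(1)[OF x]])
      have "tp s (Pm m) x"
        by (rule cpred_bind[OF cpred_Pm[OF m] ctx_ob x jQ[unfolded tp_def] sg]) (simp_all add: Q_def T_and tp_def)
      moreover have "tp s (pv \<phi>) x"
        by (rule cpred_bind[OF cpred_val[OF b(1)] ctx_ob x jQ[unfolded tp_def] sg]) (simp_all add: Q_def T_and tp_def)
      ultimately show "tp s Q x" unfolding TQ by blast
    qed
    define l where "l = incl (ctx n) Q"
    have l: "l \<in> subobj ST (ctx n)" unfolding l_def by (rule incl_subobj[OF sheaf_ctx cQ])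
    have tl: "tru s l x \<longleftrightarrow> tru s m x \<and> tru s (im n \<phi>) x" for s x
      unfolding l_def tru_incl[OF ctx_ob pQ] TQ tru_im[OF b(1)] using T_Pm[OF B] tru_eqv[OF B] eqv_el(1) ctx_refl
      unfolding tp_def by blast
    have "sub_le ST l m" "sub_le ST l (im n \<phi>)"
      unfolding sub_le_ST[OF l m] sub_le_ST[OF l im_subobj[OF b(1)]] tl by blast+
    then have le: "sub_le ST l (im n \<psi>)" using R l by blast
    show "sub_le ST m (im n (Imp \<phi> \<psi>))"
      unfolding sub_le_ST[OF m im_subobj[OF Imp.prems]] tru_im[OF Imp.prems] val.simps
    proof (intro allI impI)
      fix s x assume x: "tru s m x"
      have xe: "x \<in> el s (fst (ctx n))" using eqv_el(1)[OF tru_eqv[OF B x]] .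
      have "T s (\<lambda>c. imp_tv D (val \<phi> (cm (x c))) (val \<psi> (cm (x c))))"
      proof (rule T_impI[OF val_Sig[OF b(1) cm_env_el[OF xe]]])
        fix s' :: "('u, 'a) stage" and \<pi> assume sub: "sub \<pi> s' s" and 1: "T s' (\<lambda>c. val \<phi> (cm (x (\<pi> c))))"
        have "tru s' (im n \<phi>) (\<lambda>c. x (\<pi> c))" unfolding tru_im[OF b(1)] using el_sub[OF sub xe] 1 by blast
        then have "tru s' l (\<lambda>c. x (\<pi> c))" unfolding tl using tru_sub[OF B sub x] by blast
        then show "T s' (\<lambda>c. val \<psi> (cm (x (\<pi> c))))"
          using le unfolding sub_le_ST[OF l im_subobj[OF b(2)]] tru_im[OF b(2)] by blast
      qed
      with xe show "x \<in> el s (fst (ctx n)) \<and> T s (\<lambda>c. imp_tv D (val \<phi> (cm (x c))) (val \<psi> (cm (x c))))" by blast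
    qed
  qed
  then show ?case using Imp.IH(1)[OF b(1)] Imp.IH(2)[OF b(2)] im_subobj[OF Imp.prems] unfolding interp.simps by blast
next
  case (Forall \<phi>)
  have b: "vars_below (Suc n) \<phi>" using Forall.prems by simp
  have "sub_le ST m (im n (Forall \<phi>)) \<longleftrightarrow> sub_le ST m' (im (Suc n) \<phi>)"
    if m: "m \<in> subobj ST (ctx n)" and ii: "inverse_image ST (p1 (ctx n) VO) m m'" for m m'
    unfolding sub_le_ST[OF m im_subobj[OF Forall.prems]] sub_le_ST[OF inverse_image_p1(1)[OF ii m] im_subobj[OF b]]
      tru_im[OF Forall.prems] tru_im[OF b] inverse_image_p1(2)[OF ii m]
  proof (intro iffI allI impI)
    fix s u assume le: "\<forall>s x. tru s m x \<longrightarrow> x \<in> el s (fst (ctx n)) \<and> T s (\<lambda>c. val (Forall \<phi>) (cm (x c)))"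
      and u: "u \<in> el s (fst (ctx (Suc n))) \<and> tru s m (\<lambda>c. pf (u c))"
    have 1: "(\<lambda>c. ps (u c)) \<in> el s (fst VO)" using u by (simp add: el_prd)
    have "T s (\<lambda>c. val (Forall \<phi>) (cm (pf (u c))))" using le u by blast
    from val_allE[OF this 1] have "T s (\<lambda>c. val \<phi> (case_nat (ps (u c)) (cm (pf (u c)))))" .
    then show "u \<in> el s (fst (ctx (Suc n))) \<and> T s (\<lambda>c. val \<phi> (cm (u c)))" using u by (simp add: cm_split[symmetric])
  next
    fix s x assume le: "\<forall>s u. u \<in> el s (fst (ctx (Suc n))) \<and> tru s m (\<lambda>c. pf (u c)) \<longrightarrow>
        u \<in> el s (fst (ctx (Suc n))) \<and> T s (\<lambda>c. val \<phi> (cm (u c)))" and x: "tru s m x"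
    obtain B where B: "m \<in> hom RTc B (ctx n)" using m unfolding subobj_ST by blast
    have xe: "x \<in> el s (fst (ctx n))" using eqv_el(1)[OF tru_eqv[OF B x]] .
    have "T s (\<lambda>c. val (Forall \<phi>) (cm (x c)))"
    proof (rule val_allI[OF b cm_env_el[OF xe]])
      fix s' \<pi> v assume sub: "sub \<pi> s' s" and v: "v \<in> el s' (fst VO)"
      have "(\<lambda>c. pr (x (\<pi> c)) (v c)) \<in> el s' (fst (ctx (Suc n)))" using v el_sub[OF sub xe] by (simp add: el_prd)
      moreover have "tru s' m (\<lambda>c. x (\<pi> c))" by (rule tru_sub[OF B sub x])
      ultimately have "T s' (\<lambda>c. val \<phi> (cm (pr (x (\<pi> c)) (v c))))"
        using le[rule_format, of "\<lambda>c. pr (x (\<pi> c)) (v c)" s'] by simp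
      then show "T s' (\<lambda>c. val \<phi> (case_nat (v c) (cm (x (\<pi> c)))))" by (simp add: cm_pr)
    qed
    with xe show "x \<in> el s (fst (ctx n)) \<and> T s (\<lambda>c. val (Forall \<phi>) (cm (x c)))" by blast
  qed
  moreover have "interp ST M \<phi> (prd (ctx n) VO) (p2 (ctx n) VO # map (\<lambda>a. Cmp ST a (p1 (ctx n) VO)) (vars n)) (im (Suc n) \<phi>)"
    using Forall.IH[OF b] by simp
  ultimately show ?case
    unfolding interp.simps M_simps using im_subobj[OF Forall.prems] product_ST[OF sheaf_ctx VO] by blast
next
  case (Exists \<phi>)
  have b: "vars_below (Suc n) \<phi>" using Exists.prems by simp
  have "sub_le ST (im n (Exists \<phi>)) m \<longleftrightarrow> sub_le ST (im (Suc n) \<phi>) m'"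
    if m: "m \<in> subobj ST (ctx n)" and ii: "inverse_image ST (p1 (ctx n) VO) m m'" for m m'
    unfolding sub_le_ST[OF im_subobj[OF Exists.prems] m] sub_le_ST[OF im_subobj[OF b] inverse_image_p1(1)[OF ii m]]
      tru_im[OF Exists.prems] tru_im[OF b] inverse_image_p1(2)[OF ii m]
  proof (intro iffI allI impI)
    fix s u assume le: "\<forall>s x. x \<in> el s (fst (ctx n)) \<and> T s (\<lambda>c. val (Exists \<phi>) (cm (x c))) \<longrightarrow> tru s m x"
      and u: "u \<in> el s (fst (ctx (Suc n))) \<and> T s (\<lambda>c. val \<phi> (cm (u c)))"
    have ue: "(\<lambda>c. pf (u c)) \<in> el s (fst (ctx n))" "(\<lambda>c. ps (u c)) \<in> el s (fst VO)" using u by (simp_all add: el_prd)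
    have "T s (\<lambda>c. ex_tv (fst VO) (\<lambda>v. val \<phi> (case_nat v (cm (pf (u c))))))"
      by (rule T_exI[of s "\<lambda>c. ps (u c)"]) (use ue u in \<open>simp_all add: el_def cm_split[symmetric]\<close>)
    then have "T s (\<lambda>c. val (Exists \<phi>) (cm (pf (u c))))"
      unfolding val.simps by (rule T_jI[rotated]) (use val_Sig[OF b env_case] cm_env_el[OF ue(1)] in blast)
    then show "u \<in> el s (fst (ctx (Suc n))) \<and> tru s m (\<lambda>c. pf (u c))" using le ue u by blast
  next
    fix s x assume le: "\<forall>s u. u \<in> el s (fst (ctx (Suc n))) \<and> T s (\<lambda>c. val \<phi> (cm (u c))) \<longrightarrow>
        u \<in> el s (fst (ctx (Suc n))) \<and> tru s m (\<lambda>c. pf (u c))"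
      and x: "x \<in> el s (fst (ctx n)) \<and> T s (\<lambda>c. val (Exists \<phi>) (cm (x c)))"
    show "tru s m x"
    proof (rule tru_closed[OF m ctx_refl conjunct2[OF x, unfolded val.simps]])
      show "x \<in> el s (fst (ctx n))" using x by blast
      fix c assume "c \<in> dm s"
      then show "ex_tv (fst VO) (\<lambda>v. val \<phi> (case_nat v (cm (x c)))) \<in> Sig D"
        using val_Sig[OF b env_case] cm_env_el x by blast
    next
      fix s' :: "('u, 'a) stage" and \<pi> assume sub: "sub \<pi> s' s" and T: "T s' (\<lambda>c. ex_tv (fst VO) (\<lambda>v. val \<phi> (case_nat v (cm (x (\<pi> c))))))"
      obtain v where v: "\<And>c. c \<in> dm s' \<Longrightarrow> v c \<in> fst VO" "T s' (\<lambda>c. val \<phi> (case_nat (v c) (cm (x (\<pi> c)))))"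
        using T_exE[OF T] by blast
      have "v \<in> el s' (fst VO)" using v(1) by (simp add: el_def)
      then have "(\<lambda>c. pr (x (\<pi> c)) (v c)) \<in> el s' (fst (ctx (Suc n)))"
        using el_sub[OF sub conjunct1[OF x]] by (simp add: el_prd)
      then show "tru s' m (\<lambda>c. x (\<pi> c))"
        using le[rule_format, of "\<lambda>c. pr (x (\<pi> c)) (v c)" s'] v(2) by (simp add: cm_pr)
    qed
  qed
  moreover have "interp ST M \<phi> (prd (ctx n) VO) (p2 (ctx n) VO # map (\<lambda>a. Cmp ST a (p1 (ctx n) VO)) (vars n)) (im (Suc n) \<phi>)"
    using Exists.IH[OF b] by simp
  ultimately show ?case
    unfolding interp.simps M_simps using im_subobj[OF Exists.prems] product_ST[OF sheaf_ctx VO] by blast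
qed

lemma holdsI:
  assumes b: "vars_below 0 \<phi>" and T: "\<And>(s :: ('u, 'a) stage) x. T s (\<lambda>c. val \<phi> (x c))"
  shows "holds ST M \<phi>"
proof -
  have i: "interp ST M \<phi> One [] (im 0 \<phi>)" using interp_val[OF b] by simp
  obtain A where A: "im 0 \<phi> \<in> hom RTc A One" "sheaf A" "imono (im 0 \<phi>)" using im_subobj[OF b] unfolding subobj_ST by auto
  note id = id_hom[OF One_ob]
  have "\<exists>h \<in> hom RTc One A. Idn RTc One = Cmp RTc (im 0 \<phi>) h"
  proof (rule image_le[OF id(1) A(1,3)])
    fix s x assume "tru s (Idn RTc One) x"
    then have "x \<in> el s (fst (ctx 0))" unfolding tru_def id(2) by (auto simp: eqv_One)
    then show "tru s (im 0 \<phi>) x" unfolding tru_im[OF b] using T[of s "\<lambda>c. cm (x c)"] by blast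
  qed
  then have "sub_le ST (Idn ST One) (im 0 \<phi>)"
    unfolding sub_le_def ST_simps homD(8)[OF id(1)] homD(8)[OF A(1)] using hom_ST sheaf_One A(2) by blast
  then show ?thesis unfolding holds_def using terminal_ST i by blast
qed

end

subsection \<open>Sets smaller than a strongly inaccessible cardinal\<close>

locale inaccessible =
  fixes \<kappa> :: "'k rel"
  assumes inaccessible: "strongly_inaccessible \<kappa>"
begin

definition small :: "'x set \<Rightarrow> bool" where "small S \<longleftrightarrow> |S| <o \<kappa>"

lemma Card_order: "Card_order \<kappa>" using inaccessible by (simp add: strongly_inaccessible_def)

lemma Cinfinite: "Cinfinite \<kappa>"
proof -
  have "natLeq \<le>o \<kappa>" using inaccessible ordLess_imp_ordLeq unfolding strongly_inaccessible_def by blast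
  moreover have "Cinfinite natLeq" by (simp add: natLeq_Cinfinite)
  ultimately show ?thesis using Card_order cinfinite_mono by blast
qed

lemma small_mono: "small T \<Longrightarrow> S \<subseteq> T \<Longrightarrow> small S"
  unfolding small_def using card_of_mono1 ordLeq_ordLess_trans by blast

lemma small_image: "small S \<Longrightarrow> small (f ` S)"
  unfolding small_def using card_of_image ordLeq_ordLess_trans by blast

lemma small_UN: "small I \<Longrightarrow> (\<And>i. i \<in> I \<Longrightarrow> small (A i)) \<Longrightarrow> small (\<Union>i\<in>I. A i)"
  unfolding small_def using inaccessible Cinfinite
  by (intro card_of_UNION_ordLess_infinite_Field_regularCard) (auto simp: strongly_inaccessible_def)

lemma small_nat: "small (UNIV :: nat set)"
proof -
  have "|UNIV :: nat set| =o natLeq" by (rule card_of_nat)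
  then show ?thesis
    unfolding small_def using inaccessible ordIso_ordLess_trans unfolding strongly_inaccessible_def by blast
qed

lemma small_finite: "finite S \<Longrightarrow> small S"
proof -
  assume "finite S"
  then obtain f :: "nat \<Rightarrow> _" and n where "S = f ` {i. i < n}"
    using finite_imp_nat_seg_image_inj_on by metis
  then show ?thesis using small_image small_mono[OF small_nat subset_UNIV] by metis
qed

lemma small_Un: "small S \<Longrightarrow> small T \<Longrightarrow> small (S \<union> T)"
proof -
  assume "small S" "small T"
  then have "small (\<Union>b\<in>(UNIV :: bool set). if b then S else T)"
    by (intro small_UN[OF small_finite]) simp_all
  moreover have "(\<Union>b\<in>(UNIV :: bool set). if b then S else T) = S \<union> T" by (auto split: if_splits)
  ultimately show ?thesis by simp
qed

lemma small_Times: "small S \<Longrightarrow> small T \<Longrightarrow> small (S \<times> T)"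
proof -
  assume "small S" "small T"
  then have "small (\<Union>x\<in>S. Pair x ` T)" by (intro small_UN small_image)
  moreover have "(\<Union>x\<in>S. Pair x ` T) = S \<times> T" by auto
  ultimately show ?thesis by simp
qed

lemma small_Pow:
  fixes S :: "'x set"
  assumes "small S"
  shows "small (Pow S)"
proof -
  have "|S| <o |Field \<kappa>|"
    using assms card_of_Field_ordIso[OF Card_order] ordIso_symmetric ordLess_ordIso_trans unfolding small_def by blast
  then obtain g where g: "inj_on g S" "g ` S \<subseteq> Field \<kappa>"
    using ordLess_imp_ordLeq card_of_ordLeq[of S "Field \<kappa>"] by blast
  have "small (g ` S)" using assms by (rule small_image)
  then have "small (Pow (g ` S))"
    using inaccessible g(2) unfolding strongly_inaccessible_def strong_limit_def small_def by blast
  moreover have "|Pow S| \<le>o |Pow (g ` S)|"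
    unfolding card_of_ordLeq[symmetric]
    using inj_on_image_Pow[OF g(1)] by (intro exI[of _ "(`) g"]) auto
  ultimately show ?thesis unfolding small_def using ordLeq_ordLess_trans by blast
qed

end

subsection \<open>Names\<close>

locale names = local_op D pr pf ps j + inaccessible \<kappa>
  for D :: "'a nested_pca" and pr :: "'u \<Rightarrow> 'u \<Rightarrow> 'u" and pf ps :: "'u \<Rightarrow> 'u" and j :: "'a tval \<Rightarrow> 'a tval"
    and \<kappa> :: "'k rel" +
  fixes V :: "'u set" and ent :: "'u \<Rightarrow> ('u \<times> 'a tval) set"
  assumes small_pca: "small (UNIV :: 'a set)"
    and card_V: "|V| <o |UNIV :: 'u set|"
    and ent_V: "x \<in> V \<Longrightarrow> ent x \<subseteq> V \<times> Sig D"
    and ent_small: "x \<in> V \<Longrightarrow> small (ent x)"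
    and ent_ex: "S \<subseteq> V \<times> Sig D \<Longrightarrow> small S \<Longrightarrow> \<exists>x \<in> V. ent x = S"
    and wf_ent: "wf {(z, x). x \<in> V \<and> z \<in> fst ` ent x}"
begin

lemma small_Sig: "small (Sig D)"
proof -
  have "small (Pow (UNIV :: 'a set) \<times> Pow (UNIV :: 'a set))" by (intro small_Times small_Pow small_pca)
  then show ?thesis by (rule small_mono) auto
qed

definition nm :: "('u \<times> 'a tval) set \<Rightarrow> 'u" where "nm S = (SOME x. x \<in> V \<and> ent x = S)"

lemma nm:
  assumes "S \<subseteq> V \<times> Sig D" "small S"
  shows "nm S \<in> V" "ent (nm S) = S"
proof -
  have "nm S \<in> V \<and> ent (nm S) = S"
    unfolding nm_def using ent_ex[OF assms] by (intro someI_ex[of "\<lambda>x. x \<in> V \<and> ent x = S"]) blast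
  then show "nm S \<in> V" "ent (nm S) = S" by auto
qed

lemma ent_fst: "x \<in> V \<Longrightarrow> p \<in> ent x \<Longrightarrow> fst p \<in> V" using ent_V by force
lemma ent_snd: "x \<in> V \<Longrightarrow> p \<in> ent x \<Longrightarrow> snd p \<in> Sig D" using ent_V by force

text \<open>Truth values of equality and membership. The recursion is on the first argument of \<open>eqV\<close>
  only, which is why the second conjunct of \<open>eqV_eq\<close> is not a membership statement; symmetry is
  proved afterwards.\<close>

definition eqV :: "'u \<Rightarrow> 'u \<Rightarrow> 'a tval" where
  "eqV = wfrec {(z, x). x \<in> V \<and> z \<in> fst ` ent x} (\<lambda>f x y. and_tv D
     (all_tv (ent x) (\<lambda>p. imp_tv D (snd p) (j (ex_tv (ent y) (\<lambda>q. and_tv D (snd q) (f (fst p) (fst q)))))))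
     (all_tv (ent y) (\<lambda>q. imp_tv D (snd q) (j (ex_tv (ent x) (\<lambda>p. and_tv D (snd p) (f (fst p) (fst q))))))))"

definition memV :: "'u \<Rightarrow> 'u \<Rightarrow> 'a tval" where
  "memV u y = j (ex_tv (ent y) (\<lambda>q. and_tv D (snd q) (eqV u (fst q))))"

lemma all_tv_cong: "(\<And>y. y \<in> Y \<Longrightarrow> P y = Q y) \<Longrightarrow> all_tv Y P = all_tv Y Q"
  by (simp add: all_tv_def)

lemma ex_tv_cong: "(\<And>y. y \<in> Y \<Longrightarrow> P y = Q y) \<Longrightarrow> ex_tv Y P = ex_tv Y Q"
  by (simp add: ex_tv_def)

lemma eqV_eq:
  assumes "x \<in> V"
  shows "eqV x y = and_tv D
     (all_tv (ent x) (\<lambda>p. imp_tv D (snd p) (memV (fst p) y)))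
     (all_tv (ent y) (\<lambda>q. imp_tv D (snd q) (j (ex_tv (ent x) (\<lambda>p. and_tv D (snd p) (eqV (fst p) (fst q)))))))"
proof -
  let ?R = "{(z, x). x \<in> V \<and> z \<in> fst ` ent x}"
  have cut: "cut eqV ?R x (fst p) = eqV (fst p)" if "p \<in> ent x" for p
    using assms that by (simp add: cut_def)
  have "eqV x y = and_tv D
     (all_tv (ent x) (\<lambda>p. imp_tv D (snd p) (j (ex_tv (ent y) (\<lambda>q. and_tv D (snd q) (cut eqV ?R x (fst p) (fst q)))))))
     (all_tv (ent y) (\<lambda>q. imp_tv D (snd q) (j (ex_tv (ent x) (\<lambda>p. and_tv D (snd p) (cut eqV ?R x (fst p) (fst q)))))))"
    unfolding eqV_def by (subst wfrec[OF wf_ent]) (rule refl)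
  also have "\<dots> = and_tv D
     (all_tv (ent x) (\<lambda>p. imp_tv D (snd p) (memV (fst p) y)))
     (all_tv (ent y) (\<lambda>q. imp_tv D (snd q) (j (ex_tv (ent x) (\<lambda>p. and_tv D (snd p) (eqV (fst p) (fst q)))))))"
    unfolding memV_def
    by (intro arg_cong2[where f = "and_tv D"] all_tv_cong arg_cong2[where f = "imp_tv D"] arg_cong[where f = j] ex_tv_cong refl)
      (simp_all add: cut)
  finally show ?thesis .
qed

lemma eqV_Sig [simp]: "x \<in> V \<Longrightarrow> eqV x y \<in> Sig D"
  by (simp add: eqV_eq)

lemma ex_ent_Sig: "y \<in> V \<Longrightarrow> u \<in> V \<Longrightarrow> ex_tv (ent y) (\<lambda>q. and_tv D (snd q) (eqV u (fst q))) \<in> Sig D"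
  by (rule Sig_ex) (simp add: ent_snd)

lemma ex_ent_Sig': "x \<in> V \<Longrightarrow> ex_tv (ent x) (\<lambda>p. and_tv D (snd p) (eqV (fst p) u)) \<in> Sig D"
  by (rule Sig_ex) (simp add: ent_snd ent_fst)

lemma memV_Sig [simp]: "y \<in> V \<Longrightarrow> u \<in> V \<Longrightarrow> memV u y \<in> Sig D"
  unfolding memV_def using ex_ent_Sig by simp

subsection \<open>Equality and membership at a stage\<close>

definition entel :: "('u, 'a) stage \<Rightarrow> ('u \<Rightarrow> 'u \<times> 'a tval) \<Rightarrow> ('u \<Rightarrow> 'u) \<Rightarrow> bool" where
  "entel s p x \<longleftrightarrow> x \<in> el s V \<and> (\<forall>c\<in>dm s. p c \<in> ent (x c)) \<and> T s (\<lambda>c. snd (p c))"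

definition EQ :: "('u, 'a) stage \<Rightarrow> ('u \<Rightarrow> 'u) \<Rightarrow> ('u \<Rightarrow> 'u) \<Rightarrow> bool" where
  "EQ s x y \<longleftrightarrow> x \<in> el s V \<and> y \<in> el s V \<and> T s (\<lambda>c. eqV (x c) (y c))"

definition ME :: "('u, 'a) stage \<Rightarrow> ('u \<Rightarrow> 'u) \<Rightarrow> ('u \<Rightarrow> 'u) \<Rightarrow> bool" where
  "ME s x y \<longleftrightarrow> x \<in> el s V \<and> y \<in> el s V \<and> T s (\<lambda>c. memV (x c) (y c))"

lemma entel_el: "entel s p x \<Longrightarrow> x \<in> el s V" "entel s p x \<Longrightarrow> (\<lambda>c. fst (p c)) \<in> el s V"
  unfolding entel_def el_def using ent_fst by blast+

lemma entel_sub: "sub \<pi> s' s \<Longrightarrow> entel s p x \<Longrightarrow> entel s' (\<lambda>c. p (\<pi> c)) (\<lambda>c. x (\<pi> c))"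
proof -
  assume sub: "sub \<pi> s' s" and e: "entel s p x"
  have "T s' (\<lambda>c. snd (p (\<pi> c)))"
    by (rule T_sub[OF sub]) (use e[unfolded entel_def] ent_snd elD[OF entel_el(1)[OF e]] in blast)+
  then show ?thesis using e el_sub[OF sub] sub_dm[OF sub] by (auto simp: entel_def)
qed

lemma EQ_sub: "sub \<pi> s' s \<Longrightarrow> EQ s x y \<Longrightarrow> EQ s' (\<lambda>c. x (\<pi> c)) (\<lambda>c. y (\<pi> c))"
  unfolding EQ_def using T_sub[of \<pi> s' s "\<lambda>c. eqV (x c) (y c)"] el_sub by (auto simp: el_def)

lemma ME_sub: "sub \<pi> s' s \<Longrightarrow> ME s x y \<Longrightarrow> ME s' (\<lambda>c. x (\<pi> c)) (\<lambda>c. y (\<pi> c))"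
  unfolding ME_def using T_sub[of \<pi> s' s "\<lambda>c. memV (x c) (y c)"] el_sub by (auto simp: el_def)

lemma inj_ent: "\<exists>g :: 'u \<times> 'a tval \<Rightarrow> 'u. inj_on g (V \<times> Sig D)"
proof (intro exI)
  show "inj_on (\<lambda>p. pr (fst p) (code (snd p))) (V \<times> Sig D)"
    using inj_code by (auto simp: inj_on_def)
qed

lemma T_ent_allI:
  fixes s :: "('u, 'a) stage"
  assumes x: "x \<in> el s V"
    and sg: "\<And>c p. c \<in> dm s \<Longrightarrow> p \<in> ent (x c) \<Longrightarrow> P c p \<in> Sig D"
    and st: "\<And>s' \<pi> p. sub \<pi> s' s \<Longrightarrow> entel s' p (\<lambda>c. x (\<pi> c)) \<Longrightarrow> T s' (\<lambda>c. P (\<pi> c) (p c))"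
  shows "T s (\<lambda>c. all_tv (ent (x c)) (\<lambda>p. imp_tv D (snd p) (P c p)))"
proof -
  obtain g :: "'u \<times> 'a tval \<Rightarrow> 'u" where g: "inj_on g (V \<times> Sig D)" using inj_ent by blast
  show ?thesis
  proof (rule T_allI)
    show "inj_on g (\<Union>c\<in>dm s. ent (x c))"
      by (rule inj_on_subset[OF g]) (use x ent_V in \<open>auto simp: el_def dest!: ent_V\<close>)
  next
    fix s' :: "('u, 'a) stage" and \<pi> p assume sub: "sub \<pi> s' s" and p: "\<And>c. c \<in> dm s' \<Longrightarrow> p c \<in> ent (x (\<pi> c))"
    have x': "(\<lambda>c. x (\<pi> c)) \<in> el s' V" using el_sub[OF sub x] .
    have sg': "\<And>c. c \<in> dm s' \<Longrightarrow> snd (p c) \<in> Sig D" using ent_snd elD[OF x'] p by blast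
    show "T s' (\<lambda>c. imp_tv D (snd (p c)) (P (\<pi> c) (p c)))"
    proof (rule T_impI[OF sg'])
      fix s'' :: "('u, 'a) stage" and \<rho> assume sub': "sub \<rho> s'' s'" and t: "T s'' (\<lambda>c. snd (p (\<rho> c)))"
      have "entel s'' (\<lambda>c. p (\<rho> c)) (\<lambda>c. x (\<pi> (\<rho> c)))"
        unfolding entel_def using t el_sub[OF sub' x'] p sub_dm[OF sub'] by blast
      from st[OF sub_trans[OF sub' sub] this] show "T s'' (\<lambda>c. P (\<pi> (\<rho> c)) (p (\<rho> c)))" .
    qed
  qed simp
qed

lemma T_ent_allE:
  assumes "T s (\<lambda>c. all_tv (ent (x c)) (\<lambda>p. imp_tv D (snd p) (P c p)))" "entel s p x"
  shows "T s (\<lambda>c. P c (p c))"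
proof -
  have "T s (\<lambda>c. imp_tv D (snd (p c)) (P c (p c)))"
    using assms(1) by (rule T_allE) (use assms(2) in \<open>simp add: entel_def\<close>)
  then show ?thesis by (rule T_mp) (use assms(2) in \<open>simp add: entel_def\<close>)
qed

lemma T_ent_exI:
  assumes "entel s p x" "T s (\<lambda>c. P c (p c))" "\<And>c. c \<in> dm s \<Longrightarrow> P c (p c) \<in> Sig D"
  shows "T s (\<lambda>c. ex_tv (ent (x c)) (\<lambda>p. and_tv D (snd p) (P c p)))"
  by (rule T_exI[of s p]) (use assms in \<open>simp_all add: entel_def T_and\<close>)

lemma T_ent_exE:
  assumes "T s (\<lambda>c. ex_tv (ent (x c)) (\<lambda>p. and_tv D (snd p) (P c p)))" "x \<in> el s V"
  obtains p where "entel s p x" "T s (\<lambda>c. P c (p c))"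
proof -
  obtain p where "\<And>c. c \<in> dm s \<Longrightarrow> p c \<in> ent (x c)" "T s (\<lambda>c. and_tv D (snd (p c)) (P c (p c)))"
    using T_exE[OF assms(1)] by blast
  then show thesis using that[of p] assms(2) by (simp add: entel_def T_and)
qed

lemma EQ_in1: "EQ s x y \<Longrightarrow> entel s p x \<Longrightarrow> ME s (\<lambda>c. fst (p c)) y"
proof -
  assume e: "EQ s x y" and p: "entel s p x"
  have "T s (\<lambda>c. eqV (x c) (y c))" using e by (simp add: EQ_def)
  then have "T s (\<lambda>c. and_tv D (all_tv (ent (x c)) (\<lambda>p. imp_tv D (snd p) (memV (fst p) (y c))))
     (all_tv (ent (y c)) (\<lambda>q. imp_tv D (snd q) (j (ex_tv (ent (x c)) (\<lambda>p. and_tv D (snd p) (eqV (fst p) (fst q))))))))"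
    by (rule T_cong[THEN iffD1, rotated]) (use e in \<open>simp add: EQ_def el_def eqV_eq\<close>)
  then have "T s (\<lambda>c. all_tv (ent (x c)) (\<lambda>p. imp_tv D (snd p) (memV (fst p) (y c))))" unfolding T_and by blast
  from T_ent_allE[OF this p] show ?thesis using e entel_el[OF p] by (simp add: ME_def EQ_def)
qed

lemma EQ_in2: "EQ s x y \<Longrightarrow> entel s q y \<Longrightarrow> T s (\<lambda>c. j (ex_tv (ent (x c)) (\<lambda>p. and_tv D (snd p) (eqV (fst p) (fst (q c))))))"
proof -
  assume e: "EQ s x y" and q: "entel s q y"
  have "T s (\<lambda>c. eqV (x c) (y c))" using e by (simp add: EQ_def)
  then have "T s (\<lambda>c. and_tv D (all_tv (ent (x c)) (\<lambda>p. imp_tv D (snd p) (memV (fst p) (y c))))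
     (all_tv (ent (y c)) (\<lambda>q. imp_tv D (snd q) (j (ex_tv (ent (x c)) (\<lambda>p. and_tv D (snd p) (eqV (fst p) (fst q))))))))"
    by (rule T_cong[THEN iffD1, rotated]) (use e in \<open>simp add: EQ_def el_def eqV_eq\<close>)
  then have "T s (\<lambda>c. all_tv (ent (y c)) (\<lambda>q. imp_tv D (snd q) (j (ex_tv (ent (x c)) (\<lambda>p. and_tv D (snd p) (eqV (fst p) (fst q)))))))"
    unfolding T_and by blast
  from T_ent_allE[OF this q] show ?thesis .
qed

lemma EQI0:
  fixes s :: "('u, 'a) stage"
  assumes x: "x \<in> el s V" and y: "y \<in> el s V"
    and 1: "\<And>s' \<pi> p. sub \<pi> s' s \<Longrightarrow> entel s' p (\<lambda>c. x (\<pi> c)) \<Longrightarrow> ME s' (\<lambda>c. fst (p c)) (\<lambda>c. y (\<pi> c))"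
    and 2: "\<And>s' \<pi> q. sub \<pi> s' s \<Longrightarrow> entel s' q (\<lambda>c. y (\<pi> c)) \<Longrightarrow>
      T s' (\<lambda>c. j (ex_tv (ent (x (\<pi> c))) (\<lambda>p. and_tv D (snd p) (eqV (fst p) (fst (q c))))))"
  shows "EQ s x y"
proof -
  have "T s (\<lambda>c. and_tv D (all_tv (ent (x c)) (\<lambda>p. imp_tv D (snd p) (memV (fst p) (y c))))
     (all_tv (ent (y c)) (\<lambda>q. imp_tv D (snd q) (j (ex_tv (ent (x c)) (\<lambda>p. and_tv D (snd p) (eqV (fst p) (fst q))))))))"
    unfolding T_and
  proof
    show "T s (\<lambda>c. all_tv (ent (x c)) (\<lambda>p. imp_tv D (snd p) (memV (fst p) (y c))))"
    proof (rule T_ent_allI[OF x])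
      fix c p assume "c \<in> dm s" "p \<in> ent (x c)"
      then show "memV (fst p) (y c) \<in> Sig D" using memV_Sig[OF elD[OF y] ent_fst[OF elD[OF x]]] by blast
    next
      fix s' \<pi> p assume "sub \<pi> s' s" "entel s' p (\<lambda>c. x (\<pi> c))"
      from 1[OF this] show "T s' (\<lambda>c. memV (fst (p c)) (y (\<pi> c)))" by (simp add: ME_def)
    qed
    show "T s (\<lambda>c. all_tv (ent (y c)) (\<lambda>q. imp_tv D (snd q) (j (ex_tv (ent (x c)) (\<lambda>p. and_tv D (snd p) (eqV (fst p) (fst q)))))))"
      by (rule T_ent_allI[OF y]) (use ex_ent_Sig' elD[OF x] 2 in simp_all)
  qed
  then have "T s (\<lambda>c. eqV (x c) (y c))"
    by (rule T_cong[THEN iffD1, rotated]) (use x in \<open>simp add: el_def eqV_eq\<close>)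
  then show ?thesis using x y by (simp add: EQ_def)
qed

lemma MEI:
  assumes "entel s q y" "EQ s u (\<lambda>c. fst (q c))"
  shows "ME s u y"
proof -
  have u: "u \<in> el s V" and y: "y \<in> el s V" using assms entel_el by (auto simp: EQ_def)
  have "T s (\<lambda>c. ex_tv (ent (y c)) (\<lambda>q. and_tv D (snd q) (eqV (u c) (fst q))))"
    by (rule T_ent_exI[OF assms(1)]) (use assms(2) elD[OF u] in \<open>simp_all add: EQ_def\<close>)
  then have "T s (\<lambda>c. memV (u c) (y c))"
    unfolding memV_def by (rule T_jI[rotated]) (use ex_ent_Sig elD[OF u] elD[OF y] in blast)
  with u y show ?thesis by (simp add: ME_def)
qed

lemma ME_bind:
  fixes s :: "('u, 'a) stage"
  assumes m: "ME s u y" and sg: "\<And>c. c \<in> dm s \<Longrightarrow> Q c \<in> Sig D"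
    and st: "\<And>s' \<pi> q. sub \<pi> s' s \<Longrightarrow> entel s' q (\<lambda>c. y (\<pi> c)) \<Longrightarrow> EQ s' (\<lambda>c. u (\<pi> c)) (\<lambda>c. fst (q c)) \<Longrightarrow>
      T s' (\<lambda>c. j (Q (\<pi> c)))"
  shows "T s (\<lambda>c. j (Q c))"
proof -
  have u: "u \<in> el s V" and y: "y \<in> el s V" using m by (auto simp: ME_def)
  have "T s (\<lambda>c. j (ex_tv (ent (y c)) (\<lambda>q. and_tv D (snd q) (eqV (u c) (fst q)))))"
    using m by (simp add: ME_def memV_def)
  then show ?thesis
  proof (rule T_jbind)
    fix s' :: "('u, 'a) stage" and \<pi> assume sub: "sub \<pi> s' s"
      and "T s' (\<lambda>c. ex_tv (ent (y (\<pi> c))) (\<lambda>q. and_tv D (snd q) (eqV (u (\<pi> c)) (fst q))))"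
    from T_ent_exE[OF this(2) el_sub[OF sub y]]
    obtain q where q: "entel s' q (\<lambda>c. y (\<pi> c))" "T s' (\<lambda>c. eqV (u (\<pi> c)) (fst (q c)))" .
    then have "EQ s' (\<lambda>c. u (\<pi> c)) (\<lambda>c. fst (q c))"
      using el_sub[OF sub u] entel_el(2)[OF q(1)] by (simp add: EQ_def)
    from st[OF sub q(1) this] show "T s' (\<lambda>c. j (Q (\<pi> c)))" .
  qed (use ex_ent_Sig elD[OF u] elD[OF y] sg in blast)+
qed

text \<open>The fixed point combinator provides a realizer which is the same for all names; that it
  realizes \<open>\<phi>\<close> is proved by well-founded induction on names.\<close>

lemma uniform_induct:
  fixes s :: "('u, 'a) stage"
  assumes sg: "\<And>x. x \<in> V \<Longrightarrow> \<phi> x \<in> Sig D"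
    and st: "\<And>(s :: ('u, 'a) stage) x. x \<in> el s V \<Longrightarrow> T s (\<lambda>c. all_tv (fst ` ent (x c)) \<phi>) \<Longrightarrow> T s (\<lambda>c. \<phi> (x c))"
    and x: "x \<in> el s V"
  shows "T s (\<lambda>c. \<phi> (x c))"
proof (cases "V = {}")
  case True
  then have "dm s = {}" using elD[OF x] by blast
  then show ?thesis unfolding T_def using kk_ss(1) by auto
next
  case False
  have "entails D V (\<lambda>x. all_tv (fst ` ent x) \<phi>) \<phi>"
    by (rule entailsI[of "\<lambda>x. x"]) (use st in \<open>auto simp: el_def inj_on_def\<close>)
  then obtain f where f: "\<And>x. x \<in> V \<Longrightarrow> f \<in> snd (imp_tv D (all_tv (fst ` ent x) \<phi>) (\<phi> x))"
    unfolding entails_def by blast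
  have fS: "f \<in> Sharp D" using f False by (auto simp: imp_tv_def)
  obtain F where F: "F \<in> Sharp D" "\<And>u. App D F u = App D f F" using ex_fixpoint[OF fS] by blast
  have "x \<in> V \<longrightarrow> F \<in> snd (imp_tv D (top_tv D) (\<phi> x))" for x
  proof (induction x rule: wf_induct_rule[OF wf_ent])
    case (1 x)
    show ?case
    proof
      assume x: "x \<in> V"
      have "F \<in> snd (imp_tv D (top_tv D) (\<phi> z))" if "z \<in> fst ` ent x" for z
        using 1[of z] that x ent_fst by auto
      then have "F \<in> snd (all_tv (fst ` ent x) \<phi>)"
        using F(1) by (simp add: all_tv_def)
      moreover then have "F \<in> fst (all_tv (fst ` ent x) \<phi>)" using SigD(2)[OF Sig_all] by blast
      ultimately have "\<exists>y\<in>snd (\<phi> x). App D f F = Some y" "\<exists>y\<in>fst (\<phi> x). App D f F = Some y"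
        using f[OF x] unfolding imp_tv_def imp_set_def by auto
      then show "F \<in> snd (imp_tv D (top_tv D) (\<phi> x))"
        using F by (simp add: imp_tv_def imp_set_def)
    qed
  qed
  then have Fx: "F \<in> snd (imp_tv D (top_tv D) (\<phi> (x c)))" if "c \<in> dm s" for c using elD[OF x that] by blast
  obtain d where d: "F \<in> Sharp D \<longrightarrow> d \<in> Sharp D" "\<And>u. App D d u = Some F" using ex_const'[of F] by blast
  have "T s (\<lambda>c. imp_tv D (top_tv D) (\<phi> (x c)))"
    unfolding T_def
  proof (rule bexI[of _ d], rule ballI)
    fix c assume k: "c \<in> dm s"
    show "\<exists>y\<in>rs (fl s c) (imp_tv D (top_tv D) (\<phi> (x c))). App D d (rho s c) = Some y"
      using Fx[OF k] SigD(2)[OF Sig_imp Fx[OF k]] d(2) by (simp add: rs_def)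
  qed (use d(1) F(1) in blast)
  then show ?thesis using T_top by (rule T_mp)
qed

lemma EQ_refl: "x \<in> el s V \<Longrightarrow> EQ s x x"
proof -
  assume x: "x \<in> el s V"
  have "T s (\<lambda>c. eqV (x c) (x c))"
  proof (rule uniform_induct[OF _ _ x, where \<phi> = "\<lambda>x. eqV x x"])
    fix s :: "('u, 'a) stage" and x assume x: "x \<in> el s V" and IH: "T s (\<lambda>c. all_tv (fst ` ent (x c)) (\<lambda>x. eqV x x))"
    have p: "EQ s' (\<lambda>c. fst (p c)) (\<lambda>c. fst (p c))" if sub: "sub \<pi> s' s" and p: "entel s' p (\<lambda>c. x (\<pi> c))" for s' \<pi> p
    proof -
      have "T s' (\<lambda>c. all_tv (fst ` ent (x (\<pi> c))) (\<lambda>x. eqV x x))" by (rule T_sub[OF sub IH]) simp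
      then have "T s' (\<lambda>c. eqV (fst (p c)) (fst (p c)))" by (rule T_allE) (use p in \<open>simp add: entel_def\<close>)
      then show ?thesis using entel_el(2)[OF p] by (simp add: EQ_def)
    qed
    have "EQ s x x"
    proof (rule EQI0[OF x x])
      fix s' :: "('u, 'a) stage" and \<pi> p assume sub: "sub \<pi> s' s" and q: "entel s' p (\<lambda>c. x (\<pi> c))"
      show "ME s' (\<lambda>c. fst (p c)) (\<lambda>c. x (\<pi> c))" by (rule MEI[OF q p[OF sub q]])
      have "T s' (\<lambda>c. ex_tv (ent (x (\<pi> c))) (\<lambda>q. and_tv D (snd q) (eqV (fst q) (fst (p c)))))"
        by (rule T_ent_exI[OF q]) (use p[OF sub q] in \<open>simp_all add: EQ_def el_def\<close>)
      then show "T s' (\<lambda>c. j (ex_tv (ent (x (\<pi> c))) (\<lambda>q. and_tv D (snd q) (eqV (fst q) (fst (p c))))))"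
        by (rule T_jI[rotated]) (use ex_ent_Sig' elD[OF el_sub[OF sub x]] in blast)
    qed
    then show "T s (\<lambda>c. eqV (x c) (x c))" by (simp add: EQ_def)
  qed simp
  with x show ?thesis by (simp add: EQ_def)
qed

lemma EQ_sym: 
  fixes s :: "('u, 'a) stage"
  assumes "EQ s x y" shows "EQ s y x"
proof -
  define \<phi> where "\<phi> = (\<lambda>x. all_tv V (\<lambda>y. imp_tv D (eqV x y) (eqV y x)))"
  have phiD: "EQ s y x" if "T s (\<lambda>c. \<phi> (x c))" "EQ s x y" for s :: "('u, 'a) stage" and x y
  proof -
    have "T s (\<lambda>c. imp_tv D (eqV (x c) (y c)) (eqV (y c) (x c)))"
      using that(1) unfolding \<phi>_def by (rule T_allE) (use that(2) in \<open>simp add: EQ_def el_def\<close>)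
    then have "T s (\<lambda>c. eqV (y c) (x c))" by (rule T_mp) (use that(2) in \<open>simp add: EQ_def\<close>)
    then show ?thesis using that(2) by (simp add: EQ_def)
  qed
  have x: "x \<in> el s V" using assms by (simp add: EQ_def)
  have "T s (\<lambda>c. \<phi> (x c))"
  proof (rule uniform_induct[OF _ _ x])
    fix s :: "('u, 'a) stage" and x assume x: "x \<in> el s V" and IH: "T s (\<lambda>c. all_tv (fst ` ent (x c)) \<phi>)"
    show "T s (\<lambda>c. \<phi> (x c))" unfolding \<phi>_def
    proof (rule T_allI[of "\<lambda>x. x"])
      fix s1 :: "('u, 'a) stage" and \<pi> y assume sub: "sub \<pi> s1 s" and "\<And>c. c \<in> dm s1 \<Longrightarrow> y c \<in> V"
      then have y: "y \<in> el s1 V" by (simp add: el_def)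
      have x1: "(\<lambda>c. x (\<pi> c)) \<in> el s1 V" by (rule el_sub[OF sub x])
      show "T s1 (\<lambda>c. imp_tv D (eqV (x (\<pi> c)) (y c)) (eqV (y c) (x (\<pi> c))))"
      proof (rule T_impI)
        fix s2 :: "('u, 'a) stage" and \<rho> assume sub1: "sub \<rho> s2 s1" and e: "T s2 (\<lambda>c. eqV (x (\<pi> (\<rho> c))) (y (\<rho> c)))"
        note sub2 = sub_trans[OF sub1 sub]
        have e: "EQ s2 (\<lambda>c. x (\<pi> (\<rho> c))) (\<lambda>c. y (\<rho> c))" using e el_sub[OF sub1 x1] el_sub[OF sub1 y] by (simp add: EQ_def)
        have IH': "EQ s' z (\<lambda>c. fst (p c))"
          if sub3: "sub \<sigma> s' s2" and p: "entel s' p (\<lambda>c. x (\<pi> (\<rho> (\<sigma> c))))" and e: "EQ s' (\<lambda>c. fst (p c)) z" for s' \<sigma> p z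
        proof -
          have "T s' (\<lambda>c. all_tv (fst ` ent (x (\<pi> (\<rho> (\<sigma> c))))) \<phi>)" by (rule T_sub[OF sub_trans[OF sub3 sub2] IH]) simp
          then have "T s' (\<lambda>c. \<phi> (fst (p c)))" by (rule T_allE) (use p in \<open>simp add: entel_def\<close>)
          from phiD[OF this e] show ?thesis .
        qed
        have "EQ s2 (\<lambda>c. y (\<rho> c)) (\<lambda>c. x (\<pi> (\<rho> c)))"
        proof (rule EQI0)
          show y2: "(\<lambda>c. y (\<rho> c)) \<in> el s2 V" and x2: "(\<lambda>c. x (\<pi> (\<rho> c))) \<in> el s2 V" using e by (simp_all add: EQ_def)
          fix s3 :: "('u, 'a) stage" and \<sigma> q assume sub3: "sub \<sigma> s3 s2" 
          note x3 = el_sub[OF sub3 x2] and e3 = EQ_sub[OF sub3 e]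
          { assume q: "entel s3 q (\<lambda>c. y (\<rho> (\<sigma> c)))"
          have "T s3 (\<lambda>c. memV (fst (q c)) (x (\<pi> (\<rho> (\<sigma> c)))))" unfolding memV_def
          proof (rule T_jmono[OF EQ_in2[OF e3 q]])
            fix s4 :: "('u, 'a) stage" and \<tau> assume sub4: "sub \<tau> s4 s3"
              and "T s4 (\<lambda>c. ex_tv (ent (x (\<pi> (\<rho> (\<sigma> (\<tau> c)))))) (\<lambda>p. and_tv D (snd p) (eqV (fst p) (fst (q (\<tau> c))))))"
            from T_ent_exE[OF this(2) el_sub[OF sub4 x3]]
            obtain p where p: "entel s4 p (\<lambda>c. x (\<pi> (\<rho> (\<sigma> (\<tau> c)))))" "T s4 (\<lambda>c. eqV (fst (p c)) (fst (q (\<tau> c))))" .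
            then have "EQ s4 (\<lambda>c. fst (p c)) (\<lambda>c. fst (q (\<tau> c)))"
              using entel_el(2)[OF p(1)] el_sub[OF sub4 entel_el(2)[OF q]] by (simp add: EQ_def)
            from IH'[OF sub_trans[OF sub4 sub3] p(1) this]
            show "T s4 (\<lambda>c. ex_tv (ent (x (\<pi> (\<rho> (\<sigma> (\<tau> c)))))) (\<lambda>p. and_tv D (snd p) (eqV (fst (q (\<tau> c))) (fst p))))"
              by (intro T_ent_exI[OF p(1)]) (simp_all add: EQ_def el_def)
          qed (use ex_ent_Sig ex_ent_Sig' elD[OF x3] elD[OF entel_el(2)[OF q]] in blast)+
          then show "ME s3 (\<lambda>c. fst (q c)) (\<lambda>c. x (\<pi> (\<rho> (\<sigma> c))))" using x3 entel_el(2)[OF q] by (simp add: ME_def)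
          }
          { assume p: "entel s3 q (\<lambda>c. x (\<pi> (\<rho> (\<sigma> c))))"
          show "T s3 (\<lambda>c. j (ex_tv (ent (y (\<rho> (\<sigma> c)))) (\<lambda>p. and_tv D (snd p) (eqV (fst p) (fst (q c))))))"
          proof (rule ME_bind[OF EQ_in1[OF e3 p]])
            fix c assume "c \<in> dm s3"
            then show "ex_tv (ent (y (\<rho> (\<sigma> c)))) (\<lambda>p. and_tv D (snd p) (eqV (fst p) (fst (q c)))) \<in> Sig D"
              using ex_ent_Sig' elD[OF el_sub[OF sub3 y2]] by blast
          next
            fix s4 :: "('u, 'a) stage" and \<tau> r assume sub4: "sub \<tau> s4 s3" and r: "entel s4 r (\<lambda>c. y (\<rho> (\<sigma> (\<tau> c))))"
              and e4: "EQ s4 (\<lambda>c. fst (q (\<tau> c))) (\<lambda>c. fst (r c))"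
            from IH'[OF sub_trans[OF sub4 sub3] entel_sub[OF sub4 p] e4]
            have "T s4 (\<lambda>c. ex_tv (ent (y (\<rho> (\<sigma> (\<tau> c))))) (\<lambda>p. and_tv D (snd p) (eqV (fst p) (fst (q (\<tau> c))))))"
              by (intro T_ent_exI[OF r]) (simp_all add: EQ_def el_def)
            then show "T s4 (\<lambda>c. j (ex_tv (ent (y (\<rho> (\<sigma> (\<tau> c))))) (\<lambda>p. and_tv D (snd p) (eqV (fst p) (fst (q (\<tau> c)))))))"
              by (rule T_jI[rotated]) (use ex_ent_Sig' elD[OF el_sub[OF sub4 el_sub[OF sub3 y2]]] in blast)
          qed
          }
        qed
        then show "T s2 (\<lambda>c. eqV (y (\<rho> c)) (x (\<pi> (\<rho> c))))" by (simp add: EQ_def)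
      qed (use elD[OF x1] in simp)
    qed (simp_all add: inj_on_def)
  qed (simp add: \<phi>_def)
  from phiD[OF this assms] show ?thesis .
qed

lemma EQI:
  fixes s :: "('u, 'a) stage"
  assumes x: "x \<in> el s V" and y: "y \<in> el s V"
    and 1: "\<And>s' \<pi> p. sub \<pi> s' s \<Longrightarrow> entel s' p (\<lambda>c. x (\<pi> c)) \<Longrightarrow> ME s' (\<lambda>c. fst (p c)) (\<lambda>c. y (\<pi> c))"
    and 2: "\<And>s' \<pi> q. sub \<pi> s' s \<Longrightarrow> entel s' q (\<lambda>c. y (\<pi> c)) \<Longrightarrow> ME s' (\<lambda>c. fst (q c)) (\<lambda>c. x (\<pi> c))"
  shows "EQ s x y"
proof (rule EQI0[OF x y 1])
  fix s' :: "('u, 'a) stage" and \<pi> q assume sub: "sub \<pi> s' s" and q: "entel s' q (\<lambda>c. y (\<pi> c))"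
  note x' = el_sub[OF sub x]
  show "T s' (\<lambda>c. j (ex_tv (ent (x (\<pi> c))) (\<lambda>p. and_tv D (snd p) (eqV (fst p) (fst (q c))))))"
  proof (rule ME_bind[OF 2[OF sub q]])
    fix s'' :: "('u, 'a) stage" and \<rho> p assume sub': "sub \<rho> s'' s'" and p: "entel s'' p (\<lambda>c. x (\<pi> (\<rho> c)))"
      and e: "EQ s'' (\<lambda>c. fst (q (\<rho> c))) (\<lambda>c. fst (p c))"
    have "T s'' (\<lambda>c. ex_tv (ent (x (\<pi> (\<rho> c)))) (\<lambda>p. and_tv D (snd p) (eqV (fst p) (fst (q (\<rho> c))))))"
      by (rule T_ent_exI[OF p]) (use EQ_sym[OF e] in \<open>simp_all add: EQ_def el_def\<close>)
    then show "T s'' (\<lambda>c. j (ex_tv (ent (x (\<pi> (\<rho> c)))) (\<lambda>p. and_tv D (snd p) (eqV (fst p) (fst (q (\<rho> c)))))))"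
      by (rule T_jI[rotated]) (use ex_ent_Sig' elD[OF el_sub[OF sub' x']] in blast)
  qed (use ex_ent_Sig' elD[OF x'] in blast)
qed

lemma ME_ent: "entel s p x \<Longrightarrow> ME s (\<lambda>c. fst (p c)) x"
  by (rule MEI[OF _ EQ_refl[OF entel_el(2)]])

lemma ME_bindM:
  fixes s :: "('u, 'a) stage"
  assumes m: "ME s u y" and v: "v \<in> el s V" "x \<in> el s V"
    and st: "\<And>s' \<pi> q. sub \<pi> s' s \<Longrightarrow> entel s' q (\<lambda>c. y (\<pi> c)) \<Longrightarrow> EQ s' (\<lambda>c. u (\<pi> c)) (\<lambda>c. fst (q c)) \<Longrightarrow>
      ME s' (\<lambda>c. v (\<pi> c)) (\<lambda>c. x (\<pi> c))"
  shows "ME s v x"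
proof -
  have "T s (\<lambda>c. j (ex_tv (ent (x c)) (\<lambda>q. and_tv D (snd q) (eqV (v c) (fst q)))))"
  proof (rule ME_bind[OF m])
    fix s' :: "('u, 'a) stage" and \<pi> q assume "sub \<pi> s' s" "entel s' q (\<lambda>c. y (\<pi> c))" "EQ s' (\<lambda>c. u (\<pi> c)) (\<lambda>c. fst (q c))"
    from st[OF this] show "T s' (\<lambda>c. j (ex_tv (ent (x (\<pi> c))) (\<lambda>q. and_tv D (snd q) (eqV (v (\<pi> c)) (fst q)))))"
      by (simp add: ME_def memV_def)
  qed (use ex_ent_Sig elD[OF v(1)] elD[OF v(2)] in blast)
  with v show ?thesis by (simp add: ME_def memV_def)
qed

lemma EQ_trans:
  fixes s :: "('u, 'a) stage"
  assumes xy: "EQ s x y" and yz: "EQ s y z" shows "EQ s x z"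
proof -
  define \<phi> where "\<phi> = (\<lambda>x. all_tv V (\<lambda>y. all_tv V (\<lambda>z. imp_tv D (eqV x y) (imp_tv D (eqV y z) (eqV x z)))))"
  have phiD: "EQ s x z" if "T s (\<lambda>c. \<phi> (x c))" "EQ s x y" "EQ s y z" for s :: "('u, 'a) stage" and x y z
  proof -
    have "T s (\<lambda>c. all_tv V (\<lambda>z. imp_tv D (eqV (x c) (y c)) (imp_tv D (eqV (y c) z) (eqV (x c) z))))"
      using that(1) unfolding \<phi>_def by (rule T_allE) (use that(2) in \<open>simp add: EQ_def el_def\<close>)
    then have "T s (\<lambda>c. imp_tv D (eqV (x c) (y c)) (imp_tv D (eqV (y c) (z c)) (eqV (x c) (z c))))"
      by (rule T_allE) (use that(3) in \<open>simp add: EQ_def el_def\<close>)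
    then have "T s (\<lambda>c. imp_tv D (eqV (y c) (z c)) (eqV (x c) (z c)))" by (rule T_mp) (use that(2) in \<open>simp add: EQ_def\<close>)
    then have "T s (\<lambda>c. eqV (x c) (z c))" by (rule T_mp) (use that(3) in \<open>simp add: EQ_def\<close>)
    then show ?thesis using that by (simp add: EQ_def)
  qed
  have x: "x \<in> el s V" using xy by (simp add: EQ_def)
  have "T s (\<lambda>c. \<phi> (x c))"
  proof (rule uniform_induct[OF _ _ x])
    fix s :: "('u, 'a) stage" and x assume x: "x \<in> el s V" and IH: "T s (\<lambda>c. all_tv (fst ` ent (x c)) \<phi>)"
    have main: "EQ s2 (\<lambda>c. x (\<pi> c)) z" if sub: "sub \<pi> s2 s" and xy: "EQ s2 (\<lambda>c. x (\<pi> c)) y" and yz: "EQ s2 y z"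
      for s2 :: "('u, 'a) stage" and \<pi> y z
    proof -
      have IH': "EQ s' (\<lambda>c. fst (p c)) w"
        if sub3: "sub \<sigma> s' s2" and p: "entel s' p (\<lambda>c. x (\<pi> (\<sigma> c)))" and e: "EQ s' (\<lambda>c. fst (p c)) v" "EQ s' v w" for s' \<sigma> p v w
      proof -
        have "T s' (\<lambda>c. all_tv (fst ` ent (x (\<pi> (\<sigma> c)))) \<phi>)" by (rule T_sub[OF sub_trans[OF sub3 sub] IH]) simp
        then have "T s' (\<lambda>c. \<phi> (fst (p c)))" by (rule T_allE) (use p in \<open>simp add: entel_def\<close>)
        from phiD[OF this e] show ?thesis .
      qed
      have x2: "(\<lambda>c. x (\<pi> c)) \<in> el s2 V" and z2: "z \<in> el s2 V" using xy yz by (simp_all add: EQ_def)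
      show ?thesis
      proof (rule EQI[OF x2 z2])
        fix s3 :: "('u, 'a) stage" and \<sigma> p assume sub3: "sub \<sigma> s3 s2" and p: "entel s3 p (\<lambda>c. x (\<pi> (\<sigma> c)))"
        note p3 = entel_el(2)[OF p] and z3 = el_sub[OF sub3 z2]
        show "ME s3 (\<lambda>c. fst (p c)) (\<lambda>c. z (\<sigma> c))"
        proof (rule ME_bindM[OF EQ_in1[OF EQ_sub[OF sub3 xy] p] p3 z3])
          fix s4 :: "('u, 'a) stage" and \<tau> q assume sub4: "sub \<tau> s4 s3" and q: "entel s4 q (\<lambda>c. y (\<sigma> (\<tau> c)))"
            and e4: "EQ s4 (\<lambda>c. fst (p (\<tau> c))) (\<lambda>c. fst (q c))"
          show "ME s4 (\<lambda>c. fst (p (\<tau> c))) (\<lambda>c. z (\<sigma> (\<tau> c)))"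
          proof (rule ME_bindM[OF EQ_in1[OF EQ_sub[OF sub4 EQ_sub[OF sub3 yz]] q] el_sub[OF sub4 p3] el_sub[OF sub4 z3]])
            fix s5 :: "('u, 'a) stage" and \<upsilon> r assume sub5: "sub \<upsilon> s5 s4" and r: "entel s5 r (\<lambda>c. z (\<sigma> (\<tau> (\<upsilon> c))))"
              and e5: "EQ s5 (\<lambda>c. fst (q (\<upsilon> c))) (\<lambda>c. fst (r c))"
            show "ME s5 (\<lambda>c. fst (p (\<tau> (\<upsilon> c)))) (\<lambda>c. z (\<sigma> (\<tau> (\<upsilon> c))))"
              by (rule MEI[OF r IH'[OF sub_trans[OF sub5 sub_trans[OF sub4 sub3]] entel_sub[OF sub5 entel_sub[OF sub4 p]] EQ_sub[OF sub5 e4] e5]])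
          qed
        qed
      next
        fix s3 :: "('u, 'a) stage" and \<sigma> r assume sub3: "sub \<sigma> s3 s2" and r: "entel s3 r (\<lambda>c. z (\<sigma> c))"
        note r3 = entel_el(2)[OF r] and x3 = el_sub[OF sub3 x2]
        show "ME s3 (\<lambda>c. fst (r c)) (\<lambda>c. x (\<pi> (\<sigma> c)))"
        proof (rule ME_bindM[OF EQ_in1[OF EQ_sym[OF EQ_sub[OF sub3 yz]] r] r3 x3])
          fix s4 :: "('u, 'a) stage" and \<tau> q assume sub4: "sub \<tau> s4 s3" and q: "entel s4 q (\<lambda>c. y (\<sigma> (\<tau> c)))"
            and e4: "EQ s4 (\<lambda>c. fst (r (\<tau> c))) (\<lambda>c. fst (q c))"
          show "ME s4 (\<lambda>c. fst (r (\<tau> c))) (\<lambda>c. x (\<pi> (\<sigma> (\<tau> c))))"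
          proof (rule ME_bindM[OF EQ_in1[OF EQ_sym[OF EQ_sub[OF sub4 EQ_sub[OF sub3 xy]]] q] el_sub[OF sub4 r3] el_sub[OF sub4 x3]])
            fix s5 :: "('u, 'a) stage" and \<upsilon> p assume sub5: "sub \<upsilon> s5 s4" and p: "entel s5 p (\<lambda>c. x (\<pi> (\<sigma> (\<tau> (\<upsilon> c)))))"
              and e5: "EQ s5 (\<lambda>c. fst (q (\<upsilon> c))) (\<lambda>c. fst (p c))"
            have "EQ s5 (\<lambda>c. fst (p c)) (\<lambda>c. fst (r (\<tau> (\<upsilon> c))))"
              by (rule IH'[OF sub_trans[OF sub5 sub_trans[OF sub4 sub3]] p EQ_sym[OF e5] EQ_sym[OF EQ_sub[OF sub5 e4]]])
            from MEI[OF p EQ_sym[OF this]] show "ME s5 (\<lambda>c. fst (r (\<tau> (\<upsilon> c)))) (\<lambda>c. x (\<pi> (\<sigma> (\<tau> (\<upsilon> c)))))" .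
          qed
        qed
      qed
    qed
    show "T s (\<lambda>c. \<phi> (x c))" unfolding \<phi>_def
    proof (rule T_allI[of "\<lambda>x. x"])
      fix s1 :: "('u, 'a) stage" and \<pi>1 y assume sub1: "sub \<pi>1 s1 s" and "\<And>c. c \<in> dm s1 \<Longrightarrow> y c \<in> V"
      then have y: "y \<in> el s1 V" by (simp add: el_def)
      note x1 = el_sub[OF sub1 x]
      show "T s1 (\<lambda>c. all_tv V (\<lambda>z. imp_tv D (eqV (x (\<pi>1 c)) (y c)) (imp_tv D (eqV (y c) z) (eqV (x (\<pi>1 c)) z))))"
      proof (rule T_allI[of "\<lambda>x. x"])
        fix s2 :: "('u, 'a) stage" and \<pi>2 z assume sub2: "sub \<pi>2 s2 s1" and "\<And>c. c \<in> dm s2 \<Longrightarrow> z c \<in> V"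
        then have z: "z \<in> el s2 V" by (simp add: el_def)
        note x2 = el_sub[OF sub2 x1] and y2 = el_sub[OF sub2 y]
        show "T s2 (\<lambda>c. imp_tv D (eqV (x (\<pi>1 (\<pi>2 c))) (y (\<pi>2 c))) (imp_tv D (eqV (y (\<pi>2 c)) (z c)) (eqV (x (\<pi>1 (\<pi>2 c))) (z c))))"
        proof (rule T_impI)
          fix s3 :: "('u, 'a) stage" and \<pi>3 assume sub3: "sub \<pi>3 s3 s2" and t: "T s3 (\<lambda>c. eqV (x (\<pi>1 (\<pi>2 (\<pi>3 c)))) (y (\<pi>2 (\<pi>3 c))))"
          have xy3: "EQ s3 (\<lambda>c. x (\<pi>1 (\<pi>2 (\<pi>3 c)))) (\<lambda>c. y (\<pi>2 (\<pi>3 c)))"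
            using t el_sub[OF sub3 x2] el_sub[OF sub3 y2] by (simp add: EQ_def)
          show "T s3 (\<lambda>c. imp_tv D (eqV (y (\<pi>2 (\<pi>3 c))) (z (\<pi>3 c))) (eqV (x (\<pi>1 (\<pi>2 (\<pi>3 c)))) (z (\<pi>3 c))))"
          proof (rule T_impI)
            fix s4 :: "('u, 'a) stage" and \<pi>4 assume sub4: "sub \<pi>4 s4 s3" and t: "T s4 (\<lambda>c. eqV (y (\<pi>2 (\<pi>3 (\<pi>4 c)))) (z (\<pi>3 (\<pi>4 c))))"
            have yz4: "EQ s4 (\<lambda>c. y (\<pi>2 (\<pi>3 (\<pi>4 c)))) (\<lambda>c. z (\<pi>3 (\<pi>4 c)))"
              using t el_sub[OF sub4 el_sub[OF sub3 y2]] el_sub[OF sub4 el_sub[OF sub3 z]] by (simp add: EQ_def)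
            from main[OF sub_trans[OF sub4 sub_trans[OF sub3 sub_trans[OF sub2 sub1]]] EQ_sub[OF sub4 xy3] yz4]
            show "T s4 (\<lambda>c. eqV (x (\<pi>1 (\<pi>2 (\<pi>3 (\<pi>4 c))))) (z (\<pi>3 (\<pi>4 c))))" by (simp add: EQ_def)
          qed (use elD[OF el_sub[OF sub3 y2]] in simp)
        qed (use elD[OF x2] in simp)
      qed (simp_all add: inj_on_def)
    qed (simp_all add: inj_on_def)
  qed (simp add: \<phi>_def)
  from phiD[OF this xy yz] show ?thesis .
qed

lemma ME_cong:
  fixes s :: "('u, 'a) stage"
  assumes m: "ME s u y" and u: "EQ s u u'" and y: "EQ s y y'"
  shows "ME s u' y'"
proof -
  have el: "u' \<in> el s V" "y' \<in> el s V" using u y by (simp_all add: EQ_def)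
  show ?thesis
  proof (rule ME_bindM[OF m el])
    fix s1 :: "('u, 'a) stage" and \<pi> q assume sub: "sub \<pi> s1 s" and q: "entel s1 q (\<lambda>c. y (\<pi> c))"
      and e: "EQ s1 (\<lambda>c. u (\<pi> c)) (\<lambda>c. fst (q c))"
    note el' = el_sub[OF sub el(1)] el_sub[OF sub el(2)]
    show "ME s1 (\<lambda>c. u' (\<pi> c)) (\<lambda>c. y' (\<pi> c))"
    proof (rule ME_bindM[OF EQ_in1[OF EQ_sub[OF sub y] q] el'])
      fix s2 :: "('u, 'a) stage" and \<rho> r assume sub2: "sub \<rho> s2 s1" and r: "entel s2 r (\<lambda>c. y' (\<pi> (\<rho> c)))"
        and e2: "EQ s2 (\<lambda>c. fst (q (\<rho> c))) (\<lambda>c. fst (r c))"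
      have "EQ s2 (\<lambda>c. u' (\<pi> (\<rho> c))) (\<lambda>c. fst (r c))"
        by (rule EQ_trans[OF EQ_sym[OF EQ_sub[OF sub2 EQ_sub[OF sub u]]] EQ_trans[OF EQ_sub[OF sub2 e] e2]])
      then show "ME s2 (\<lambda>c. u' (\<pi> (\<rho> c))) (\<lambda>c. y' (\<pi> (\<rho> c)))" by (rule MEI[OF r])
    qed
  qed
qed

lemma EQ_closed:
  fixes s :: "('u, 'a) stage"
  assumes x: "x \<in> el s V" and y: "y \<in> el s V" and jE: "T s (\<lambda>c. j (eqV (x c) (y c)))"
  shows "EQ s x y"
proof -
  have main: "ME s' (\<lambda>c. fst (p c)) (\<lambda>c. y (\<pi> c))"
    if x: "x \<in> el s V" and y: "y \<in> el s V" and jE: "T s (\<lambda>c. j (eqV (x c) (y c)))"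
    and sub: "sub \<pi> s' s" and p: "entel s' p (\<lambda>c. x (\<pi> c))" for x y s' \<pi> p
  proof -
    note p' = entel_el(2)[OF p] and y' = el_sub[OF sub y] and x' = el_sub[OF sub x]
    have "T s' (\<lambda>c. j (eqV (x (\<pi> c)) (y (\<pi> c))))" by (rule T_sub[OF sub jE]) (use elD[OF x] in simp)
    then have "T s' (\<lambda>c. memV (fst (p c)) (y (\<pi> c)))" unfolding memV_def
    proof (rule T_jbind)
      fix s2 :: "('u, 'a) stage" and \<rho> assume sub2: "sub \<rho> s2 s'" and "T s2 (\<lambda>c. eqV (x (\<pi> (\<rho> c))) (y (\<pi> (\<rho> c))))"
      then have "EQ s2 (\<lambda>c. x (\<pi> (\<rho> c))) (\<lambda>c. y (\<pi> (\<rho> c)))"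
        using el_sub[OF sub2 x'] el_sub[OF sub2 y'] by (simp add: EQ_def)
      from EQ_in1[OF this entel_sub[OF sub2 p]]
      show "T s2 (\<lambda>c. j (ex_tv (ent (y (\<pi> (\<rho> c)))) (\<lambda>q. and_tv D (snd q) (eqV (fst (p (\<rho> c))) (fst q)))))"
        by (simp add: ME_def memV_def)
    qed (use elD[OF x'] ex_ent_Sig elD[OF y'] elD[OF p'] in simp_all)
    then show ?thesis using p' y' by (simp add: ME_def)
  qed
  have "T s (\<lambda>c. j (eqV (y c) (x c)))"
  proof (rule T_jmono[OF jE])
    fix s2 :: "('u, 'a) stage" and \<rho> assume sub: "sub \<rho> s2 s" and "T s2 (\<lambda>c. eqV (x (\<rho> c)) (y (\<rho> c)))"
    then have "EQ s2 (\<lambda>c. x (\<rho> c)) (\<lambda>c. y (\<rho> c))" using el_sub[OF sub x] el_sub[OF sub y] by (simp add: EQ_def)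
    from EQ_sym[OF this] show "T s2 (\<lambda>c. eqV (y (\<rho> c)) (x (\<rho> c)))" by (simp add: EQ_def)
  qed (use elD[OF x] elD[OF y] in simp_all)
  then show ?thesis using main[OF x y jE] main[OF y x] by (intro EQI[OF x y])
qed

subsection \<open>The object of names is a sheaf\<close>

definition VO :: "('u, 'a) rt_obj" where "VO = (V, eqV)"

lemma VO_simps [simp]: "fst VO = V" "snd VO = eqV" by (simp_all add: VO_def)

lemma eqv_VO: "eqv s VO x y \<longleftrightarrow> EQ s x y" by (simp add: eqv_def EQ_def)

lemma VO_ob: "VO \<in> ob"
  unfolding ob_iff eqv_VO
proof (intro conjI allI impI)
  show "|fst VO| <o |UNIV :: 'u set|" using card_V by simp
  show "sig2 (fst VO) (fst VO) (snd VO)" by (simp add: sig2_def)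
qed (rule EQ_sym EQ_trans; assumption)+

lemma memV_cpred: "cpred (prd VO VO) (\<lambda>u. memV (pf u) (ps u))"
proof (rule cpredI[OF predI])
  fix u assume "u \<in> fst (prd VO VO)"
  then show "memV (pf u) (ps u) \<in> Sig D" by (simp add: prd_def)
next
  fix s u v assume e: "eqv s (prd VO VO) u v" and m: "tp s (\<lambda>u. memV (pf u) (ps u)) u"
  have e: "EQ s (\<lambda>c. pf (u c)) (\<lambda>c. pf (v c))" "EQ s (\<lambda>c. ps (u c)) (\<lambda>c. ps (v c))"
    using e by (simp_all add: eqv_prd eqv_VO)
  have "ME s (\<lambda>c. pf (u c)) (\<lambda>c. ps (u c))" using m e by (simp add: tp_def ME_def EQ_def)
  from ME_cong[OF this e] show "tp s (\<lambda>u. memV (pf u) (ps u)) v" by (simp add: tp_def ME_def)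
next
  fix s u assume e: "eqv s (prd VO VO) u u" and m: "tp s (\<lambda>u. j (memV (pf u) (ps u))) u"
  have el: "(\<lambda>c. pf (u c)) \<in> el s V" "(\<lambda>c. ps (u c)) \<in> el s V" using e by (simp_all add: eqv_prd eqv_VO EQ_def)
  show "tp s (\<lambda>u. memV (pf u) (ps u)) u"
    using m unfolding tp_def memV_def by (rule T_jj[rotated]) (use ex_ent_Sig elD[OF el(1)] elD[OF el(2)] in blast)
qed

lemma small_witness:
  fixes h :: "'u \<Rightarrow> 'a tval"
  shows "\<exists>W \<subseteq> V. small W \<and> ex_tv W h = ex_tv V h"
proof -
  define f where "f r = (SOME w. w \<in> V \<and> r \<in> fst (h w))" for r
  define g where "g r = (SOME w. w \<in> V \<and> r \<in> snd (h w))" for r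
  have f: "f r \<in> V \<and> r \<in> fst (h (f r))" if "\<exists>w. w \<in> V \<and> r \<in> fst (h w)" for r
    unfolding f_def by (rule someI_ex[OF that])
  have g: "g r \<in> V \<and> r \<in> snd (h (g r))" if "\<exists>w. w \<in> V \<and> r \<in> snd (h w)" for r
    unfolding g_def by (rule someI_ex[OF that])
  define W where "W = f ` {r. \<exists>w. w \<in> V \<and> r \<in> fst (h w)} \<union> g ` {r. \<exists>w. w \<in> V \<and> r \<in> snd (h w)}"
  have "W \<subseteq> V" unfolding W_def using f g by blast
  moreover have "small W" unfolding W_def by (intro small_Un small_image; rule small_mono[OF small_pca subset_UNIV])
  moreover have "(\<Union>y\<in>V. fst (h y)) \<subseteq> (\<Union>y\<in>W. fst (h y))"
  proof
    fix r assume "r \<in> (\<Union>y\<in>V. fst (h y))"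
    then have "\<exists>w. w \<in> V \<and> r \<in> fst (h w)" by blast
    with f[OF this] show "r \<in> (\<Union>y\<in>W. fst (h y))" unfolding W_def by blast
  qed
  moreover have "(\<Union>y\<in>V. snd (h y)) \<subseteq> (\<Union>y\<in>W. snd (h y))"
  proof
    fix r assume "r \<in> (\<Union>y\<in>V. snd (h y))"
    then have "\<exists>w. w \<in> V \<and> r \<in> snd (h w)" by blast
    with g[OF this] show "r \<in> (\<Union>y\<in>W. snd (h y))" unfolding W_def by blast
  qed
  ultimately show ?thesis unfolding ex_tv_def by (intro exI[of _ W]) auto
qed

definition wit :: "('u \<Rightarrow> 'a tval) \<Rightarrow> 'u set" where
  "wit h = (SOME W. W \<subseteq> V \<and> small W \<and> ex_tv W h = ex_tv V h)"

lemma wit: "wit h \<subseteq> V" "small (wit h)" "ex_tv (wit h) h = ex_tv V h"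
proof -
  have "wit h \<subseteq> V \<and> small (wit h) \<and> ex_tv (wit h) h = ex_tv V h"
    unfolding wit_def by (rule someI_ex[of "\<lambda>W. W \<subseteq> V \<and> small W \<and> ex_tv W h = ex_tv V h"]) (rule small_witness)
  then show "wit h \<subseteq> V" "small (wit h)" "ex_tv (wit h) h = ex_tv V h" by auto
qed

text \<open>The name described by a singleton predicate \<open>h\<close>: the union of its witnesses. Only few
  candidate elements are needed, since each realizer of \<open>\<exists>w. h w\<close> selects one witness.\<close>

definition glue :: "('u \<Rightarrow> 'a tval) \<Rightarrow> 'u" where
  "glue h = nm ((\<lambda>u. (u, ex_tv V (\<lambda>w. and_tv D (h w) (memV u w)))) ` (\<Union>w\<in>wit h. fst ` ent w))"

lemma glue:
  assumes "\<And>w. w \<in> V \<Longrightarrow> h w \<in> Sig D"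
  shows "glue h \<in> V"
    "ent (glue h) = (\<lambda>u. (u, ex_tv V (\<lambda>w. and_tv D (h w) (memV u w)))) ` (\<Union>w\<in>wit h. fst ` ent w)"
proof -
  have "u \<in> V" if "u \<in> (\<Union>w\<in>wit h. fst ` ent w)" for u using that wit(1)[of h] ent_fst by blast
  then have 1: "(\<lambda>u. (u, ex_tv V (\<lambda>w. and_tv D (h w) (memV u w)))) ` (\<Union>w\<in>wit h. fst ` ent w) \<subseteq> V \<times> Sig D"
    using assms by (intro image_subsetI SigmaI) (blast, simp)
  have 2: "small ((\<lambda>u. (u, ex_tv V (\<lambda>w. and_tv D (h w) (memV u w)))) ` (\<Union>w\<in>wit h. fst ` ent w))"
    by (intro small_image small_UN wit(2) ent_small) (use wit(1) in blast)
  show "glue h \<in> V" "ent (glue h) = (\<lambda>u. (u, ex_tv V (\<lambda>w. and_tv D (h w) (memV u w)))) ` (\<Union>w\<in>wit h. fst ` ent w)"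
    unfolding glue_def by (rule nm[OF 1 2])+
qed

lemma EQ_glue:
  fixes s :: "('u, 'a) stage"
  assumes sg: "\<And>c w. c \<in> dm s \<Longrightarrow> w \<in> V \<Longrightarrow> h c w \<in> Sig D"
    and sv: "\<And>s' \<pi> v w. sub \<pi> s' s \<Longrightarrow> v \<in> el s' V \<Longrightarrow> w \<in> el s' V \<Longrightarrow> T s' (\<lambda>c. h (\<pi> c) (v c)) \<Longrightarrow>
      T s' (\<lambda>c. h (\<pi> c) (w c)) \<Longrightarrow> EQ s' v w"
    and w: "w \<in> el s V" "T s (\<lambda>c. h c (w c))"
  shows "EQ s w (\<lambda>c. glue (h c))"
proof -
  obtain i where i: "sub i s s" "i = (\<lambda>c. c)"
    using ex_id unfolding sub_def by (metis (no_types, lifting))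
  have "T s (\<lambda>c. ex_tv V (h c))" by (rule T_exI[of s w]) (use w in \<open>simp_all add: el_def\<close>)
  then have "T s (\<lambda>c. ex_tv (wit (h c)) (h c))" by (simp add: wit(3))
  from T_exE[OF this] obtain v where v: "\<And>c. c \<in> dm s \<Longrightarrow> v c \<in> wit (h c)" "T s (\<lambda>c. h c (v c))" by blast
  have vV: "v \<in> el s V" using v(1) wit(1) by (auto simp: el_def)
  have gV: "(\<lambda>c. glue (h c)) \<in> el s V" using glue(1)[OF sg] by (simp add: el_def)
  have ent_glue: "ent (glue (h c)) = (\<lambda>u. (u, ex_tv V (\<lambda>w. and_tv D (h c w) (memV u w)))) ` (\<Union>w\<in>wit (h c). fst ` ent w)"
    if "c \<in> dm s" for c
    using glue(2)[of "h c"] sg[OF that] by blast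
  have hs: "T s' (\<lambda>c. h (\<pi> c) (v (\<pi> c)))" if "sub \<pi> s' s" for s' :: "('u, 'a) stage" and \<pi>
    by (rule T_sub[OF that v(2)]) (use sg elD[OF vV] in blast)
  have "EQ s v (\<lambda>c. glue (h c))"
  proof (rule EQI[OF vV gV])
    fix s' :: "('u, 'a) stage" and \<pi> p assume sub: "sub \<pi> s' s" and p: "entel s' p (\<lambda>c. v (\<pi> c))"
    note p' = entel_el(2)[OF p]
    define q where "q = (\<lambda>c. (fst (p c), ex_tv V (\<lambda>w. and_tv D (h (\<pi> c) w) (memV (fst (p c)) w))))"
    have "T s' (\<lambda>c. ex_tv V (\<lambda>w. and_tv D (h (\<pi> c) w) (memV (fst (p c)) w)))"
      by (rule T_exI[of s' "\<lambda>c. v (\<pi> c)"])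
        (use elD[OF el_sub[OF sub vV]] hs[OF sub] ME_ent[OF p] in \<open>simp_all add: T_and ME_def\<close>)
    moreover have "q c \<in> ent (glue (h (\<pi> c)))" if k: "c \<in> dm s'" for c
      unfolding ent_glue[OF sub_dm[OF sub k]] q_def
      by (rule imageI) (use v(1)[OF sub_dm[OF sub k]] p k in \<open>auto simp: entel_def\<close>)
    ultimately have "entel s' q (\<lambda>c. glue (h (\<pi> c)))" unfolding entel_def using el_sub[OF sub gV] by (simp add: q_def)
    from ME_ent[OF this] show "ME s' (\<lambda>c. fst (p c)) (\<lambda>c. glue (h (\<pi> c)))" by (simp add: q_def)
  next
    fix s' :: "('u, 'a) stage" and \<pi> q assume sub: "sub \<pi> s' s" and q: "entel s' q (\<lambda>c. glue (h (\<pi> c)))"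
    note q' = entel_el(2)[OF q] and v' = el_sub[OF sub vV]
    have "snd (q c) = ex_tv V (\<lambda>w. and_tv D (h (\<pi> c) w) (memV (fst (q c)) w))" if k: "c \<in> dm s'" for c
    proof -
      have "q c \<in> ent (glue (h (\<pi> c)))" using q k by (simp add: entel_def)
      then show ?thesis unfolding ent_glue[OF sub_dm[OF sub k]] by auto
    qed
    then have "T s' (\<lambda>c. ex_tv V (\<lambda>w. and_tv D (h (\<pi> c) w) (memV (fst (q c)) w)))"
      using q T_cong[of s' "\<lambda>c. snd (q c)"] unfolding entel_def by simp
    from T_exE[OF this] obtain x where x: "\<And>c. c \<in> dm s' \<Longrightarrow> x c \<in> V"
      "T s' (\<lambda>c. and_tv D (h (\<pi> c) (x c)) (memV (fst (q c)) (x c)))" by blast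
    have xV: "x \<in> el s' V" using x(1) by (simp add: el_def)
    have "EQ s' x (\<lambda>c. v (\<pi> c))" by (rule sv[OF sub xV v' _ hs[OF sub]]) (use x(2) in \<open>simp add: T_and\<close>)
    moreover have "ME s' (\<lambda>c. fst (q c)) x" using x(2) xV q' by (simp add: T_and ME_def)
    ultimately show "ME s' (\<lambda>c. fst (q c)) (\<lambda>c. v (\<pi> c))" using ME_cong EQ_refl[OF q'] by blast
  qed
  moreover have "EQ s w v" using sv[OF i(1) w(1) vV] w(2) v(2) by (simp add: i(2))
  ultimately show ?thesis using EQ_trans by blast
qed

lemma sheaf_VO: "sheaf VO"
proof (rule sheafI[OF VO_ob])
  fix m S B f assume d: "dense m" and m: "m \<in> hom RTc S B" and f: "f \<in> hom RTc S VO"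
  have B: "B \<in> ob" using homD[OF m] by simp
  have im: "imono m" using d mono_imono[OF _ m] by (simp add: dense_mono_def)
  define H where "H = (\<lambda>b x. ex_tv (fst S) (\<lambda>a. and_tv D (rep m a b) (rep f a x)))"
  have H: "T s (\<lambda>c. H (b c) (x c)) \<longleftrightarrow> (\<exists>a. ap s m a b \<and> ap s f a x)" if "b \<in> el s (fst B)" "x \<in> el s V" for s b x
    using that unfolding H_def T_ex T_and ap_rl[OF m] ap_rl[OF f] rl_def by (auto simp: el_def)
  have H_Sig: "H b x \<in> Sig D" if "b \<in> fst B" "x \<in> V" for b x
    unfolding H_def using sig2D[OF sfr_sig[OF homD(5)[OF m]]] sig2D[OF sfr_sig[OF homD(5)[OF f]]] that by simp
  have H_ext: "\<exists>a. ap s m a b' \<and> ap s f a x'" if "\<exists>a. ap s m a b \<and> ap s f a x" "eqv s B b b'" "EQ s x x'" for s b b' x x'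
    using that ap_cong[OF m] ap_cong[OF f] ap_dom[OF m] unfolding eqv_VO by blast
  have H_sv: "EQ s x x'" if h1: "\<exists>a. ap s m a b \<and> ap s f a x" and h2: "\<exists>a. ap s m a b \<and> ap s f a x'" for s b x x'
  proof -
    obtain a a' where a: "ap s m a b" "ap s f a x" "ap s m a' b" "ap s f a' x'" using h1 h2 by blast
    have "ap s f a' x" using ap_cong[OF f a(2) imonoD[OF im m a(1,3)] ap_cod[OF f a(2)]] .
    then show ?thesis using ap_fun[OF f] a(4) eqv_VO by blast
  qed
  define G where "G = (\<lambda>b x. and_tv D (snd B b b) (j (H b x)))"
  have rlG: "rl s B VO G b x \<longleftrightarrow> eqv s B b b \<and> x \<in> el s V \<and> T s (\<lambda>c. j (H (b c) (x c)))" for s b x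
    unfolding rl_def G_def T_and eqv_def by auto
  have jH_sv: "EQ s x x'" if b: "b \<in> el s (fst B)" and x: "x \<in> el s V" "x' \<in> el s V"
    and 1: "T s (\<lambda>c. j (H (b c) (x c)))" and 2: "T s (\<lambda>c. j (H (b c) (x' c)))" for s :: "('u, 'a) stage" and b x x'
  proof (rule EQ_closed[OF x])
    have sg: "\<And>c. c \<in> dm s \<Longrightarrow> H (b c) (x c) \<in> Sig D" "\<And>c. c \<in> dm s \<Longrightarrow> H (b c) (x' c) \<in> Sig D"
      using H_Sig elD[OF b] elD[OF x(1)] elD[OF x(2)] by blast+
    show "T s (\<lambda>c. j (eqV (x c) (x' c)))"
    proof (rule T_jbind[OF 1 sg(1)])
      fix s1 :: "('u, 'a) stage" and \<pi> assume s1: "sub \<pi> s1 s" and h: "T s1 (\<lambda>c. H (b (\<pi> c)) (x (\<pi> c)))"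
      have sg1: "\<And>c. c \<in> dm s1 \<Longrightarrow> H (b (\<pi> c)) (x (\<pi> c)) \<in> Sig D" "\<And>c. c \<in> dm s1 \<Longrightarrow> H (b (\<pi> c)) (x' (\<pi> c)) \<in> Sig D"
        using sg sub_dm[OF s1] by blast+
      have 2: "T s1 (\<lambda>c. j (H (b (\<pi> c)) (x' (\<pi> c))))" by (rule T_sub[OF s1 2]) (use sg in simp)
      show "T s1 (\<lambda>c. j (eqV (x (\<pi> c)) (x' (\<pi> c))))"
      proof (rule T_jmono[OF 2 sg1(2)])
        fix s2 :: "('u, 'a) stage" and \<rho> assume s2: "sub \<rho> s2 s1" and h': "T s2 (\<lambda>c. H (b (\<pi> (\<rho> c))) (x' (\<pi> (\<rho> c))))"
        have h2: "T s2 (\<lambda>c. H (b (\<pi> (\<rho> c))) (x (\<pi> (\<rho> c))))" by (rule T_sub[OF s2 h sg1(1)])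
        note e2 = el_sub[OF s2 el_sub[OF s1 b]] el_sub[OF s2 el_sub[OF s1 x(1)]] el_sub[OF s2 el_sub[OF s1 x(2)]]
        have "EQ s2 (\<lambda>c. x (\<pi> (\<rho> c))) (\<lambda>c. x' (\<pi> (\<rho> c)))"
          using H_sv h2 h' H[OF e2(1,2)] H[OF e2(1,3)] by blast
        then show "T s2 (\<lambda>c. eqV (x (\<pi> (\<rho> c))) (x' (\<pi> (\<rho> c))))" by (simp add: EQ_def)
      qed (assumption | rule eqV_Sig[OF elD[OF el_sub[OF s1 x(1)]]])+
    qed (assumption | rule eqV_Sig[OF elD[OF x(1)]])+
  qed
  have G: "sfr B VO G"
    unfolding sfr_def rlG eqv_VO
  proof (intro conjI allI impI)
    show "sig2 (fst B) (fst VO) G" using ob_sig[OF B] H_Sig by (simp add: sig2_def G_def)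
  next
    fix s b x assume "eqv s B b b \<and> x \<in> el s V \<and> T s (\<lambda>c. j (H (b c) (x c)))"
    then show "eqv s B b b" "EQ s x x" using EQ_refl by blast+
  next
    fix s b x b' x' assume 1: "eqv s B b b \<and> x \<in> el s V \<and> T s (\<lambda>c. j (H (b c) (x c)))"
      and b: "eqv s B b b'" and x: "EQ s x x'"
    show "eqv s B b' b'" "x' \<in> el s V" using eqv_refl2[OF B b] x by (simp_all add: EQ_def)
    note bel = eqv_el[OF b] and xel = x[unfolded EQ_def]
    show "T s (\<lambda>c. j (H (b' c) (x' c)))"
    proof (rule T_jmono)
      show "T s (\<lambda>c. j (H (b c) (x c)))" using 1 by blast
      fix s1 :: "('u, 'a) stage" and \<pi> assume s1: "sub \<pi> s1 s" and "T s1 (\<lambda>c. H (b (\<pi> c)) (x (\<pi> c)))"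
      then have "\<exists>a. ap s1 m a (\<lambda>c. b (\<pi> c)) \<and> ap s1 f a (\<lambda>c. x (\<pi> c))"
        using H el_sub[OF s1] bel xel by blast
      from H_ext[OF this eqv_sub[OF B s1 b] EQ_sub[OF s1 x]]
      show "T s1 (\<lambda>c. H (b' (\<pi> c)) (x' (\<pi> c)))" using H el_sub[OF s1] bel xel by blast
    qed (use H_Sig elD bel xel in blast)+
  next
    fix s b x x' assume "eqv s B b b \<and> x \<in> el s V \<and> T s (\<lambda>c. j (H (b c) (x c)))"
      "eqv s B b b \<and> x' \<in> el s V \<and> T s (\<lambda>c. j (H (b c) (x' c)))"
    then show "EQ s x x'" using jH_sv eqv_el(1) by blast
  next
    fix s b assume b: "eqv s B b b"
    note bel = eqv_el(1)[OF b]
    define x where "x = (\<lambda>c. glue (H (b c)))"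
    have x: "x \<in> el s V" unfolding x_def el_def using glue(1)[OF H_Sig] elD[OF bel] by simp
    have "T s (\<lambda>c. j (H (b c) (x c)))"
    proof (rule T_jmono[OF dense_internal[OF d m b]])
      fix c assume "c \<in> dm s"
      then show "Pm m (b c) \<in> Sig D" "H (b c) (x c) \<in> Sig D"
        using pred_sig_el[OF pred_Pm[OF m] bel] H_Sig elD[OF bel] elD[OF x] by blast+
    next
      fix s1 :: "('u, 'a) stage" and \<pi> assume s1: "sub \<pi> s1 s" and "T s1 (\<lambda>c. Pm m (b (\<pi> c)))"
      note b1 = el_sub[OF s1 bel] and x1 = el_sub[OF s1 x]
      have "tp s1 (Pm m) (\<lambda>c. b (\<pi> c))" using \<open>T s1 (\<lambda>c. Pm m (b (\<pi> c)))\<close> by (simp add: tp_def)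
      then obtain a where a: "ap s1 m a (\<lambda>c. b (\<pi> c))" using T_Pm[OF m b1] unfolding tru_def by blast
      obtain w where w: "ap s1 f a w" using ap_ex[OF f ap_dom[OF m a]] by blast
      have wV: "w \<in> el s1 V" using eqv_el(1)[OF ap_cod[OF f w]] by simp
      have "EQ s1 w (\<lambda>c. glue (H (b (\<pi> c))))"
      proof (rule EQ_glue[of s1 "\<lambda>c. H (b (\<pi> c))"])
        show "T s1 (\<lambda>c. H (b (\<pi> c)) (w c))" using H[OF b1 wV] a w by blast
        fix s2 :: "('u, 'a) stage" and \<rho> v u assume s2: "sub \<rho> s2 s1" and vu: "v \<in> el s2 V" "u \<in> el s2 V"
          and "T s2 (\<lambda>c. H (b (\<pi> (\<rho> c))) (v c))" "T s2 (\<lambda>c. H (b (\<pi> (\<rho> c))) (u c))"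
        then show "EQ s2 v u" using H_sv H[OF el_sub[OF s2 b1] vu(1)] H[OF el_sub[OF s2 b1] vu(2)] by blast
      qed (use H_Sig elD[OF b1] wV in blast)+
      then have "EQ s1 w (\<lambda>c. x (\<pi> c))" by (simp add: x_def)
      from H_ext[OF _ eqv_sub[OF B s1 b] this] show "T s1 (\<lambda>c. H (b (\<pi> c)) (x (\<pi> c)))"
        using H[OF b1 x1] a w by blast
    qed
    with b x show "\<exists>y. eqv s B b b \<and> y \<in> el s V \<and> T s (\<lambda>c. j (H (b c) (y c)))" by blast
  qed
  note g = arrI[OF B VO_ob G, unfolded rlG]
  have "Cmp RTc (rt_arrow D B VO G) m = f"
  proof (rule comp_eqI1[OF m g(1) f])
    fix s a b x assume a: "ap s m a b" and "ap s (rt_arrow D B VO G) b x"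
    then have x: "x \<in> el s V" "T s (\<lambda>c. j (H (b c) (x c)))" unfolding g(2) by blast+
    note bel = eqv_el(1)[OF ap_cod[OF m a]]
    obtain w where w: "ap s f a w" using ap_ex[OF f ap_dom[OF m a]] by blast
    have wV: "w \<in> el s V" using eqv_el(1)[OF ap_cod[OF f w]] by simp
    have "T s (\<lambda>c. j (H (b c) (w c)))"
      by (rule T_jI) (use H[OF bel wV] a w H_Sig elD[OF bel] elD[OF wV] in blast)+
    from jH_sv[OF bel wV x(1) this x(2)] show "ap s f a x" using ap_cong[OF f w ap_dom[OF f w]] eqv_VO by blast
  qed
  then show "\<exists>g\<in>hom RTc B VO. Cmp RTc g m = f" using g(1) by blast
next
  fix m S B g g' assume d: "dense m" and m: "m \<in> hom RTc S B" and g: "g \<in> hom RTc B VO" and g': "g' \<in> hom RTc B VO"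
    and e: "Cmp RTc g m = Cmp RTc g' m"
  show "g = g'"
  proof (rule arr_eqI[OF g g'])
    fix s b x assume x: "ap s g b x"
    have b: "eqv s B b b" using ap_dom[OF g x] .
    obtain y where y: "ap s g' b y" using ap_ex[OF g' b] by blast
    have el: "y \<in> el s V" "x \<in> el s V" using eqv_el(1)[OF ap_cod[OF g x]] eqv_el(1)[OF ap_cod[OF g' y]] by simp_all
    have "EQ s y x"
    proof (rule EQ_closed[OF el])
      show "T s (\<lambda>c. j (eqV (y c) (x c)))"
      proof (rule T_jmono[OF dense_internal[OF d m b]])
        fix c assume k: "c \<in> dm s"
        then show "Pm m (b c) \<in> Sig D" using pred_sig_el[OF pred_Pm[OF m] eqv_el(1)[OF b]] by blast
        show "eqV (y c) (x c) \<in> Sig D" using elD[OF el(1) k] by simp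
      next
        fix s1 :: "('u, 'a) stage" and \<pi> assume s1: "sub \<pi> s1 s" and "T s1 (\<lambda>c. Pm m (b (\<pi> c)))"
        then have "tp s1 (Pm m) (\<lambda>c. b (\<pi> c))" by (simp add: tp_def)
        then obtain a where a: "ap s1 m a (\<lambda>c. b (\<pi> c))"
          using T_Pm[OF m el_sub[OF s1 eqv_el(1)[OF b]]] unfolding tru_def by blast
        obtain b' where b': "ap s1 m a b'" "ap s1 g' b' (\<lambda>c. x (\<pi> c))"
          using comp_eqD[OF e m g m g' a ap_sub[OF g s1 x]] by blast
        have "ap s1 g' (\<lambda>c. b (\<pi> c)) (\<lambda>c. x (\<pi> c))"
          using ap_cong[OF g' b'(2) ap_fun[OF m b'(1) a] ap_cod[OF g' b'(2)]] .
        from ap_fun[OF g' ap_sub[OF g' s1 y] this] show "T s1 (\<lambda>c. eqV (y (\<pi> c)) (x (\<pi> c)))"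
          by (simp add: eqv_def)
      qed
    qed
    then show "ap s g' b x" using ap_cong[OF g' y b] eqv_VO by blast
  qed
qed

end

sublocale names \<subseteq> set_struct D pr pf ps j VO memV
  using sheaf_VO EQ_refl memV_cpred by unfold_locales (simp_all add: eqv_VO)

context names
begin

subsection \<open>Rules for satisfaction at a stage\<close>

abbreviation sat :: "('u, 'a) stage \<Rightarrow> fm \<Rightarrow> ('u \<Rightarrow> nat \<Rightarrow> 'u) \<Rightarrow> bool" where
  "sat s \<phi> x \<equiv> T s (\<lambda>c. val \<phi> (x c))"

definition envs :: "nat \<Rightarrow> ('u, 'a) stage \<Rightarrow> ('u \<Rightarrow> nat \<Rightarrow> 'u) \<Rightarrow> bool" where
  "envs n s x \<longleftrightarrow> (\<forall>c\<in>dm s. x c \<in> env n)"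

lemma envsD: "envs n s x \<Longrightarrow> i \<in> dm s \<Longrightarrow> x i \<in> env n" by (simp add: envs_def)

lemma envs_sub: "sub \<pi> s' s \<Longrightarrow> envs n s x \<Longrightarrow> envs n s' (\<lambda>c. x (\<pi> c))"
  unfolding envs_def by (auto dest: sub_dm)

lemma envs_case: "v \<in> el s V \<Longrightarrow> envs n s x \<Longrightarrow> envs (Suc n) s (\<lambda>c. case_nat (v c) (x c))"
  using env_case by (auto simp: envs_def el_def)

lemma envs_val_Sig: "vars_below n \<phi> \<Longrightarrow> envs n s x \<Longrightarrow> i \<in> dm s \<Longrightarrow> val \<phi> (x i) \<in> Sig D"
  using val_Sig envsD by blast

lemma envs_ext:
  assumes "vars_below (Suc n) \<phi>" "EQ s v w" "envs n s x" "sat s \<phi> (\<lambda>c. case_nat (v c) (x c))"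
  shows "sat s \<phi> (\<lambda>c. case_nat (w c) (x c))"
  by (rule val_ext[OF assms(1) enve_case assms(4)]) (use assms(2) eqv_VO in blast, rule enve_refl[OF envsD[OF assms(3)]])

lemma sat_impI:
  fixes s :: "('u, 'a) stage"
  assumes b: "vars_below n \<phi>" and x: "envs n s x"
    and st: "\<And>(s' :: ('u, 'a) stage) \<pi>. sub \<pi> s' s \<Longrightarrow> envs n s' (\<lambda>c. x (\<pi> c)) \<Longrightarrow>
      sat s' \<phi> (\<lambda>c. x (\<pi> c)) \<Longrightarrow> sat s' \<psi> (\<lambda>c. x (\<pi> c))"
  shows "sat s (Imp \<phi> \<psi>) x"
  unfolding val.simps
  by (rule T_impI[OF envs_val_Sig[OF b x]], assumption, rule st[OF _ envs_sub[OF _ x]])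

lemma sat_mp: "sat s (Imp \<phi> \<psi>) x \<Longrightarrow> sat s \<phi> x \<Longrightarrow> sat s \<psi> x"
  unfolding val.simps by (rule T_mp)

lemma sat_allI:
  fixes s :: "('u, 'a) stage"
  assumes b: "vars_below (Suc n) \<phi>" and x: "envs n s x"
    and st: "\<And>(s' :: ('u, 'a) stage) \<pi> v. sub \<pi> s' s \<Longrightarrow> envs n s' (\<lambda>c. x (\<pi> c)) \<Longrightarrow> v \<in> el s' V \<Longrightarrow>
      sat s' \<phi> (\<lambda>c. case_nat (v c) (x (\<pi> c)))"
  shows "sat s (Forall \<phi>) x"
  by (rule val_allI[OF b envsD[OF x]]; (assumption | (rule st[OF _ envs_sub[OF _ x]]; simp)))

lemma sat_allE: "sat s (Forall \<phi>) x \<Longrightarrow> v \<in> el s V \<Longrightarrow> sat s \<phi> (\<lambda>c. case_nat (v c) (x c))"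
  by (rule val_allE) simp_all

lemma sat_exI:
  assumes "vars_below (Suc n) \<phi>" "envs n s x" "v \<in> el s V" "sat s \<phi> (\<lambda>c. case_nat (v c) (x c))"
  shows "sat s (Exists \<phi>) x"
proof -
  have "T s (\<lambda>c. ex_tv V (\<lambda>v. val \<phi> (case_nat v (x c))))"
    using assms(4) by (intro T_exI[of s v]) (simp_all add: elD[OF assms(3)])
  then show ?thesis unfolding val.simps VO_simps
    by (rule T_jI[rotated]) (rule Sig_ex, rule val_Sig[OF assms(1)], rule env_case, simp, rule envsD[OF assms(2)])
qed

lemma T_jexE:
  fixes s :: "('u, 'a) stage"
  assumes ex: "T s (\<lambda>c. j (ex_tv (Y c) (h c)))"
    and h: "\<And>c y. c \<in> dm s \<Longrightarrow> y \<in> Y c \<Longrightarrow> h c y \<in> Sig D"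
    and R: "\<And>c. c \<in> dm s \<Longrightarrow> R c \<in> Sig D"
    and st: "\<And>(s' :: ('u, 'a) stage) \<pi> v. sub \<pi> s' s \<Longrightarrow> (\<And>c. c \<in> dm s' \<Longrightarrow> v c \<in> Y (\<pi> c)) \<Longrightarrow>
      T s' (\<lambda>c. h (\<pi> c) (v c)) \<Longrightarrow> T s' (\<lambda>c. j (R (\<pi> c)))"
  shows "T s (\<lambda>c. j (R c))"
proof (rule T_jbind[OF ex])
  fix s' :: "('u, 'a) stage" and \<pi> assume s: "sub \<pi> s' s" and "T s' (\<lambda>c. ex_tv (Y (\<pi> c)) (h (\<pi> c)))"
  from T_exE[OF this(2)] obtain v where "\<And>c. c \<in> dm s' \<Longrightarrow> v c \<in> Y (\<pi> c)" "T s' (\<lambda>c. h (\<pi> c) (v c))" by blast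
  from st[OF s this] show "T s' (\<lambda>c. j (R (\<pi> c)))" .
qed (use h R in blast)+

lemma ME_sat:
  fixes s :: "('u, 'a) stage"
  assumes m: "ME s u y" and b: "vars_below n \<phi>" and x: "envs n s x"
    and st: "\<And>(s' :: ('u, 'a) stage) \<pi> q. sub \<pi> s' s \<Longrightarrow> envs n s' (\<lambda>c. x (\<pi> c)) \<Longrightarrow> entel s' q (\<lambda>c. y (\<pi> c)) \<Longrightarrow>
      EQ s' (\<lambda>c. u (\<pi> c)) (\<lambda>c. fst (q c)) \<Longrightarrow> sat s' \<phi> (\<lambda>c. x (\<pi> c))"
  shows "sat s \<phi> x"
proof (rule val_closed[OF b envsD[OF x]])
  show "T s (\<lambda>c. j (val \<phi> (x c)))"
  proof (rule ME_bind[OF m])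
    fix s' :: "('u, 'a) stage" and \<pi> q assume 1: "sub \<pi> s' s" "entel s' q (\<lambda>c. y (\<pi> c))" "EQ s' (\<lambda>c. u (\<pi> c)) (\<lambda>c. fst (q c))"
    have x': "envs n s' (\<lambda>c. x (\<pi> c))" by (rule envs_sub[OF 1(1) x])
    show "T s' (\<lambda>c. j (val \<phi> (x (\<pi> c))))"
      by (rule T_jI[OF envs_val_Sig[OF b x'] st[OF 1(1) x' 1(2,3)]])
  qed (rule envs_val_Sig[OF b x])
qed

lemma ME_jbind:
  fixes s :: "('u, 'a) stage"
  assumes "ME s u y" and "\<And>c. c \<in> dm s \<Longrightarrow> Q c \<in> Sig D"
    and st: "\<And>(s' :: ('u, 'a) stage) \<pi> q. sub \<pi> s' s \<Longrightarrow> entel s' q (\<lambda>c. y (\<pi> c)) \<Longrightarrow>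
      EQ s' (\<lambda>c. u (\<pi> c)) (\<lambda>c. fst (q c)) \<Longrightarrow> T s' (\<lambda>c. Q (\<pi> c))"
  shows "T s (\<lambda>c. j (Q c))"
proof (rule ME_bind[OF assms(1,2)])
  fix s' :: "('u, 'a) stage" and \<pi> q assume 1: "sub \<pi> s' s" "entel s' q (\<lambda>c. y (\<pi> c))" "EQ s' (\<lambda>c. u (\<pi> c)) (\<lambda>c. fst (q c))"
  show "T s' (\<lambda>c. j (Q (\<pi> c)))"
    by (rule T_jI[OF assms(2) st[OF 1]]) (rule sub_dm[OF 1(1)])
qed

lemma val_lift: "val (lift d \<phi>) e = val \<phi> (\<lambda>i. e (lift_var d i))"
proof (induction \<phi> arbitrary: d e)
  case (Forall \<phi>)
  have "(\<lambda>i. case_nat v e (lift_var (Suc d) i)) = case_nat v (\<lambda>i. e (lift_var d i))" for v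
    by (rule ext) (simp add: lift_var_def split: nat.split)
  then show ?case by (simp add: Forall)
next
  case (Exists \<phi>)
  have "(\<lambda>i. case_nat v e (lift_var (Suc d) i)) = case_nat v (\<lambda>i. e (lift_var d i))" for v
    by (rule ext) (simp add: lift_var_def split: nat.split)
  then show ?case by (simp add: Exists)
qed simp_all

lemma val_lift1: "val (lift 1 \<phi>) (case_nat w (case_nat y e)) = val \<phi> (case_nat w e)"
proof -
  have "(\<lambda>i. case_nat w (case_nat y e) (lift_var 1 i)) = case_nat w e"
    by (rule ext) (simp add: lift_var_def split: nat.split)
  then show ?thesis by (simp add: val_lift)
qed

lemma val_lift2: "val (lift 2 \<phi>) (case_nat u (case_nat w (case_nat y e))) = val \<phi> (case_nat u (case_nat w e))"
proof -
  have "(\<lambda>i. case_nat u (case_nat w (case_nat y e)) (lift_var 2 i)) = case_nat u (case_nat w e)"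
    by (rule ext) (auto simp: lift_var_def less_Suc_eq numeral_2_eq_2 split: nat.split)
  then show ?thesis by (simp add: val_lift)
qed

lemma vars_below_lift: "vars_below n \<phi> \<Longrightarrow> vars_below (Suc n) (lift d \<phi>)"
  by (induction \<phi> arbitrary: n d) (auto simp: lift_var_def)

lemma vars_below_closure: "vars_below m ((Forall ^^ n) \<phi>) \<longleftrightarrow> vars_below (m + n) \<phi>"
  by (induction n arbitrary: \<phi>) (simp_all add: funpow_swap1)

lemma sat_closure:
  fixes s :: "('u, 'a) stage"
  assumes "vars_below (m + n) \<phi>" "\<And>(s :: ('u, 'a) stage) x. envs (m + n) s x \<Longrightarrow> sat s \<phi> x" "envs m s x"
  shows "sat s ((Forall ^^ n) \<phi>) x"
  using assms(1,2)
proof (induction n arbitrary: \<phi>)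
  case (Suc n)
  have "sat s ((Forall ^^ n) (Forall \<phi>)) x"
  proof (rule Suc.IH)
    fix s :: "('u, 'a) stage" and x assume x: "envs (m + n) s x"
    show "sat s (Forall \<phi>) x"
    proof (rule sat_allI[OF _ x])
      fix s' :: "('u, 'a) stage" and \<pi> v assume "envs (m + n) s' (\<lambda>c. x (\<pi> c))" "v \<in> el s' V"
      then show "sat s' \<phi> (\<lambda>c. case_nat (v c) (x (\<pi> c)))" using Suc.prems(2) envs_case by simp
    qed (use Suc.prems(1) in simp)
  qed (use Suc.prems(1) in simp)
  then show ?case by (simp add: funpow_swap1)
qed (use assms(3) in simp)

subsection \<open>Set existence\<close>

definition compr :: "fm \<Rightarrow> 'u set \<Rightarrow> (nat \<Rightarrow> 'u) \<Rightarrow> 'u" where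
  "compr \<psi> U e = nm ((\<lambda>u. (u, val \<psi> (case_nat u e))) ` U)"

lemma compr:
  assumes "vars_below (Suc n) \<psi>" "e \<in> env n" "U \<subseteq> V" "small U"
  shows "compr \<psi> U e \<in> V" "ent (compr \<psi> U e) = (\<lambda>u. (u, val \<psi> (case_nat u e))) ` U"
proof -
  have 1: "(\<lambda>u. (u, val \<psi> (case_nat u e))) ` U \<subseteq> V \<times> Sig D"
    using assms(3) val_Sig[OF assms(1) env_case[OF _ assms(2)]] by auto
  show "compr \<psi> U e \<in> V" "ent (compr \<psi> U e) = (\<lambda>u. (u, val \<psi> (case_nat u e))) ` U"
    unfolding compr_def by (rule nm[OF 1 small_image[OF assms(4)]])+
qed

text \<open>Every class bounded by a small set of names, as in a cumulative hierarchy, is a set. Pairing, union,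
  power set and separation, and the successors of the natural numbers, are instances.\<close>

lemma comprehension:
  fixes s :: "('u, 'a) stage"
  assumes b: "vars_below (Suc n) \<psi>" and x: "envs n s x"
    and U: "\<And>c. c \<in> dm s \<Longrightarrow> U c \<subseteq> V" "\<And>c. c \<in> dm s \<Longrightarrow> small (U c)"
    and bound: "\<And>(s' :: ('u, 'a) stage) \<pi> w. sub \<pi> s' s \<Longrightarrow> envs n s' (\<lambda>c. x (\<pi> c)) \<Longrightarrow> w \<in> el s' V \<Longrightarrow>
      sat s' \<psi> (\<lambda>c. case_nat (w c) (x (\<pi> c))) \<Longrightarrow> T s' (\<lambda>c. j (ex_tv (U (\<pi> c)) (eqV (w c))))"
  shows "(\<lambda>c. compr \<psi> (U c) (x c)) \<in> el s V"
    "sat s (Forall (Iff (Mem 0 1) (lift 1 \<psi>))) (\<lambda>c. case_nat (compr \<psi> (U c) (x c)) (x c))"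
proof -
  define y where "y = (\<lambda>c. compr \<psi> (U c) (x c))"
  note y0 = compr[OF b envsD[OF x] U]
  have y: "y \<in> el s V" unfolding y_def el_def using y0(1) by simp
  then show "(\<lambda>c. compr \<psi> (U c) (x c)) \<in> el s V" by (simp add: y_def)
  have ent_y: "ent (y c) = (\<lambda>u. (u, val \<psi> (case_nat u (x c)))) ` U c" if "c \<in> dm s" for c
    unfolding y_def using y0(2) that by blast
  have bl: "vars_below (Suc (Suc n)) (lift 1 \<psi>)" by (rule vars_below_lift[OF b])
  have "sat s (Forall (Iff (Mem 0 1) (lift 1 \<psi>))) (\<lambda>c. case_nat (y c) (x c))"
  proof (rule sat_allI[OF _ envs_case[OF y x]])
    fix s1 :: "('u, 'a) stage" and \<pi> w assume s1: "sub \<pi> s1 s" and w: "w \<in> el s1 V"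
      and yx1: "envs (Suc n) s1 (\<lambda>c. case_nat (y (\<pi> c)) (x (\<pi> c)))"
    note x1 = envs_sub[OF s1 x] and y1 = el_sub[OF s1 y]
    note e = envs_case[OF w yx1]
    show "sat s1 (Iff (Mem 0 1) (lift 1 \<psi>)) (\<lambda>c. case_nat (w c) (case_nat (y (\<pi> c)) (x (\<pi> c))))"
      unfolding Iff_def val.simps(4) T_and
    proof (intro conjI sat_impI[OF _ e])
      fix s2 :: "('u, 'a) stage" and \<rho> assume s2: "sub \<rho> s2 s1"
        and "sat s2 (Mem 0 1) (\<lambda>c. case_nat (w (\<rho> c)) (case_nat (y (\<pi> (\<rho> c))) (x (\<pi> (\<rho> c)))))"
      then have m: "ME s2 (\<lambda>c. w (\<rho> c)) (\<lambda>c. y (\<pi> (\<rho> c)))"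
        using el_sub[OF s2 w] el_sub[OF s2 y1] by (simp add: ME_def)
      have "sat s2 \<psi> (\<lambda>c. case_nat (w (\<rho> c)) (x (\<pi> (\<rho> c))))"
      proof (rule ME_sat[OF m b envs_case[OF el_sub[OF s2 w] envs_sub[OF s2 x1]]])
        fix s3 :: "('u, 'a) stage" and \<sigma> q assume s3: "sub \<sigma> s3 s2" and q: "entel s3 q (\<lambda>c. y (\<pi> (\<rho> (\<sigma> c))))"
          and eq: "EQ s3 (\<lambda>c. w (\<rho> (\<sigma> c))) (\<lambda>c. fst (q c))"
        have "snd (q c) = val \<psi> (case_nat (fst (q c)) (x (\<pi> (\<rho> (\<sigma> c)))))" if k: "c \<in> dm s3" for c
        proof -
          have "q c \<in> ent (y (\<pi> (\<rho> (\<sigma> c))))" using q k by (simp add: entel_def)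
          then show ?thesis unfolding ent_y[OF sub_dm[OF s1 sub_dm[OF s2 sub_dm[OF s3 k]]]] by auto
        qed
        then have "sat s3 \<psi> (\<lambda>c. case_nat (fst (q c)) (x (\<pi> (\<rho> (\<sigma> c)))))"
          using q T_cong[of s3 "\<lambda>c. snd (q c)"] unfolding entel_def by simp
        from envs_ext[OF b EQ_sym[OF eq] envs_sub[OF s3 envs_sub[OF s2 x1]] this]
        show "sat s3 \<psi> (\<lambda>c. case_nat (w (\<rho> (\<sigma> c))) (x (\<pi> (\<rho> (\<sigma> c)))))" .
      qed
      then show "sat s2 (lift 1 \<psi>) (\<lambda>c. case_nat (w (\<rho> c)) (case_nat (y (\<pi> (\<rho> c))) (x (\<pi> (\<rho> c)))))"
        unfolding val_lift1 .
    next
      fix s2 :: "('u, 'a) stage" and \<rho> assume s2: "sub \<rho> s2 s1"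
        and "sat s2 (lift 1 \<psi>) (\<lambda>c. case_nat (w (\<rho> c)) (case_nat (y (\<pi> (\<rho> c))) (x (\<pi> (\<rho> c)))))"
      then have h: "sat s2 \<psi> (\<lambda>c. case_nat (w (\<rho> c)) (x (\<pi> (\<rho> c))))" unfolding val_lift1 by simp
      note w2 = el_sub[OF s2 w] and x2 = envs_sub[OF s2 x1] and y2 = el_sub[OF s2 y1]
      have "T s2 (\<lambda>c. j (ex_tv (ent (y (\<pi> (\<rho> c)))) (\<lambda>q. and_tv D (snd q) (eqV (w (\<rho> c)) (fst q)))))"
      proof (rule T_jexE[OF bound[OF sub_trans[OF s2 s1] x2 w2 h]])
        fix c u assume "c \<in> dm s2"
        then show "eqV (w (\<rho> c)) u \<in> Sig D" using elD[OF w2] by simp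
      next
        fix c assume "c \<in> dm s2"
        then show "ex_tv (ent (y (\<pi> (\<rho> c)))) (\<lambda>q. and_tv D (snd q) (eqV (w (\<rho> c)) (fst q))) \<in> Sig D"
          using ex_ent_Sig elD[OF w2] elD[OF y2] by blast
      next
        fix s3 :: "('u, 'a) stage" and \<sigma> u assume s3: "sub \<sigma> s3 s2" and u: "\<And>c. c \<in> dm s3 \<Longrightarrow> u c \<in> U (\<pi> (\<rho> (\<sigma> c)))"
          and eq: "T s3 (\<lambda>c. eqV (w (\<rho> (\<sigma> c))) (u c))"
        have k: "\<pi> (\<rho> (\<sigma> c)) \<in> dm s" if "c \<in> dm s3" for c using sub_dm[OF s1 sub_dm[OF s2 sub_dm[OF s3 that]]] .
        have "EQ s3 (\<lambda>c. w (\<rho> (\<sigma> c))) u"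
          using eq el_sub[OF s3 w2] u U(1)[OF k] by (auto simp: EQ_def el_def)
        from envs_ext[OF b this envs_sub[OF s3 x2]]
        have "sat s3 \<psi> (\<lambda>c. case_nat (u c) (x (\<pi> (\<rho> (\<sigma> c)))))"
          using val_sub[OF s3 h b envsD[OF envs_case[OF w2 x2]]] by blast
        then have "entel s3 (\<lambda>c. (u c, val \<psi> (case_nat (u c) (x (\<pi> (\<rho> (\<sigma> c))))))) (\<lambda>c. y (\<pi> (\<rho> (\<sigma> c))))"
          unfolding entel_def using el_sub[OF s3 y2] u ent_y[OF k] by simp
        from MEI[OF this] \<open>EQ s3 (\<lambda>c. w (\<rho> (\<sigma> c))) u\<close>
        show "T s3 (\<lambda>c. j (ex_tv (ent (y (\<pi> (\<rho> (\<sigma> c))))) (\<lambda>q. and_tv D (snd q) (eqV (w (\<rho> (\<sigma> c))) (fst q)))))"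
          by (simp add: ME_def memV_def)
      qed
      then show "sat s2 (Mem 0 1) (\<lambda>c. case_nat (w (\<rho> c)) (case_nat (y (\<pi> (\<rho> c))) (x (\<pi> (\<rho> c)))))"
        by (simp add: memV_def)
    qed (use bl in simp_all)
  qed (use bl in \<open>simp add: Iff_def\<close>)
  then show "sat s (Forall (Iff (Mem 0 1) (lift 1 \<psi>))) (\<lambda>c. case_nat (compr \<psi> (U c) (x c)) (x c))"
    unfolding y_def .
qed

subsection \<open>The axioms of IZF\<close>

lemma envs_0: "envs 0 s x" by (simp add: envs_def env_def)

lemma ex_comprehension:
  fixes s :: "('u, 'a) stage"
  assumes b: "vars_below (Suc n) \<psi>" and x: "envs n s x"
    and U: "\<And>c. c \<in> dm s \<Longrightarrow> U c \<subseteq> V" "\<And>c. c \<in> dm s \<Longrightarrow> small (U c)"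
    and bound: "\<And>(s' :: ('u, 'a) stage) \<pi> w. sub \<pi> s' s \<Longrightarrow> envs n s' (\<lambda>c. x (\<pi> c)) \<Longrightarrow> w \<in> el s' V \<Longrightarrow>
      sat s' \<psi> (\<lambda>c. case_nat (w c) (x (\<pi> c))) \<Longrightarrow> T s' (\<lambda>c. j (ex_tv (U (\<pi> c)) (eqV (w c))))"
  shows "sat s (Exists (Forall (Iff (Mem 0 1) (lift 1 \<psi>)))) x"
  by (rule sat_exI[OF _ x comprehension[OF b x U bound]])
    (use vars_below_lift[OF b] in \<open>simp_all add: Iff_def\<close>)

lemma extensionality:
  fixes s :: "('u, 'a) stage"
  shows "sat s ax_extensionality e"
  unfolding ax_extensionality_def
proof (rule sat_allI[OF _ envs_0], goal_cases)
  case outer: (2 s1 \<pi> x)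
  have e1: "envs 1 s1 (\<lambda>c. case_nat (x c) (e (\<pi> c)))" using envs_case[OF outer(3,2)] by simp
  show ?case
  proof (rule sat_allI[OF _ e1], goal_cases)
    case (2 s2 \<rho> y)
    note x2 = el_sub[OF 2(1) outer(3)]
    have e2: "envs 2 s2 (\<lambda>c. case_nat (y c) (case_nat (x (\<rho> c)) (e (\<pi> (\<rho> c)))))"
      using envs_case[OF 2(3,2)] by (simp add: numeral_2_eq_2)
    show ?case
    proof (rule sat_impI[OF _ e2], goal_cases)
      case (2 s3 \<sigma>)
      note x3 = el_sub[OF 2(1) x2] and y3 = el_sub[OF 2(1) \<open>y \<in> el s2 V\<close>]
      have m: "T s4 (\<lambda>c. memV (u c) (x (\<rho> (\<sigma> (\<tau> c))))) \<longleftrightarrow> T s4 (\<lambda>c. memV (u c) (y (\<sigma> (\<tau> c))))"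
        if s4: "sub \<tau> s4 s3" and u: "u \<in> el s4 V" for s4 :: "('u, 'a) stage" and \<tau> u
      proof -
        have "sat s4 (Forall (Iff (Mem 0 2) (Mem 0 1))) (\<lambda>c. case_nat (y (\<sigma> (\<tau> c))) (case_nat (x (\<rho> (\<sigma> (\<tau> c)))) (e (\<pi> (\<rho> (\<sigma> (\<tau> c)))))))"
          by (rule val_sub[OF s4 2(3) _ envsD[OF 2(2)]]) (simp_all add: Iff_def)
        from sat_allE[OF this u] show ?thesis unfolding Iff_def val.simps(4) T_and
          using sat_mp[of s4 "Mem 0 2" "Mem 0 1" "\<lambda>c. case_nat (u c) (case_nat (y (\<sigma> (\<tau> c))) (case_nat (x (\<rho> (\<sigma> (\<tau> c)))) (e (\<pi> (\<rho> (\<sigma> (\<tau> c)))))))"]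
            sat_mp[of s4 "Mem 0 1" "Mem 0 2" "\<lambda>c. case_nat (u c) (case_nat (y (\<sigma> (\<tau> c))) (case_nat (x (\<rho> (\<sigma> (\<tau> c)))) (e (\<pi> (\<rho> (\<sigma> (\<tau> c)))))))"]
          by (auto simp: numeral_2_eq_2)
      qed
      have "EQ s3 (\<lambda>c. x (\<rho> (\<sigma> c))) (\<lambda>c. y (\<sigma> c))"
      proof (rule EQI[OF x3 y3])
        fix s4 :: "('u, 'a) stage" and \<tau> p assume s4: "sub \<tau> s4 s3" and p: "entel s4 p (\<lambda>c. x (\<rho> (\<sigma> (\<tau> c))))"
        show "ME s4 (\<lambda>c. fst (p c)) (\<lambda>c. y (\<sigma> (\<tau> c)))"
          using ME_ent[OF p] m[OF s4 entel_el(2)[OF p]] el_sub[OF s4 y3] by (simp add: ME_def)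
      next
        fix s4 :: "('u, 'a) stage" and \<tau> p assume s4: "sub \<tau> s4 s3" and p: "entel s4 p (\<lambda>c. y (\<sigma> (\<tau> c)))"
        show "ME s4 (\<lambda>c. fst (p c)) (\<lambda>c. x (\<rho> (\<sigma> (\<tau> c))))"
          using ME_ent[OF p] m[OF s4 entel_el(2)[OF p]] el_sub[OF s4 x3] by (simp add: ME_def)
      qed
      then show ?case by (simp add: EQ_def)
    qed (simp add: Iff_def)
  qed (simp add: Iff_def)
qed (simp add: Iff_def)

lemma T_memE:
  fixes s :: "('u, 'a) stage"
  assumes "ME s w a"
  shows "T s (\<lambda>c. j (ex_tv (fst ` ent (a c)) (eqV (w c))))"
proof (rule ME_jbind[OF assms])
  have el: "w \<in> el s V" "a \<in> el s V" using assms by (simp_all add: ME_def)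
  fix i assume i: "i \<in> dm s"
  show "ex_tv (fst ` ent (a i)) (eqV (w i)) \<in> Sig D" using elD[OF el(1) i] by (intro Sig_ex eqV_Sig)
next
  fix s' :: "('u, 'a) stage" and \<pi> q assume "entel s' q (\<lambda>c. a (\<pi> c))" "EQ s' (\<lambda>c. w (\<pi> c)) (\<lambda>c. fst (q c))"
  then show "T s' (\<lambda>c. ex_tv (fst ` ent (a (\<pi> c))) (eqV (w (\<pi> c))))"
    by (intro T_exI[of s' "\<lambda>c. fst (q c)"]) (simp_all add: entel_def EQ_def)
qed

lemma separation:
  fixes s :: "('u, 'a) stage"
  assumes b: "vars_below (n + 2) \<phi>" and e: "envs n s e"
  shows "sat s (ax_separation \<phi>) e"
  unfolding ax_separation_def
proof (rule sat_allI[OF _ e], goal_cases)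
  case (2 s1 \<pi> a)
  have lift: "And (Mem 0 2) (lift 1 \<phi>) = lift 1 (And (Mem 0 1) \<phi>)" by (simp add: lift_var_def)
  show ?case unfolding lift
  proof (rule ex_comprehension[OF _ envs_case[OF 2(3,2)]])
    fix i assume "i \<in> dm s1"
    then have "a i \<in> V" by (rule elD[OF 2(3)])
    then show "fst ` ent (a i) \<subseteq> V" "small (fst ` ent (a i))" using ent_fst small_image[OF ent_small] by auto
  next
    fix s2 :: "('u, 'a) stage" and \<rho> w assume s2: "sub \<rho> s2 s1" and w: "w \<in> el s2 V"
      and "sat s2 (And (Mem 0 1) \<phi>) (\<lambda>c. case_nat (w c) (case_nat (a (\<rho> c)) (e (\<pi> (\<rho> c)))))"
    then have "ME s2 w (\<lambda>c. a (\<rho> c))" using el_sub[OF s2 2(3)] by (simp add: T_and ME_def)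
    from T_memE[OF this] show "T s2 (\<lambda>c. j (ex_tv (fst ` ent (a (\<rho> c))) (eqV (w c))))" .
  qed (use b in simp_all)
qed (use vars_below_lift[OF b, of 1] in \<open>simp add: Iff_def\<close>)

lemma pairing_axiom:
  fixes s :: "('u, 'a) stage"
  shows "sat s ax_pairing e"
  unfolding ax_pairing_def
proof (rule sat_allI[OF _ envs_0], goal_cases)
  case outer: (2 s1 \<pi> x)
  show ?case
  proof (rule sat_allI[OF _ envs_case[OF outer(3,2)]], goal_cases)
    case (2 s2 \<rho> y)
    note x2 = el_sub[OF 2(1) outer(3)]
    have lift: "Or (Eq 0 3) (Eq 0 2) = lift 1 (Or (Eq 0 2) (Eq 0 1))" by (simp add: lift_var_def)
    show ?case unfolding lift
    proof (rule ex_comprehension[OF _ envs_case[OF 2(3,2)]])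
      fix i assume "i \<in> dm s2"
      then show "{x (\<rho> i), y i} \<subseteq> V" "small {x (\<rho> i), y i}"
        using elD[OF 2(3)] elD[OF x2] by (auto intro: small_finite)
    next
      fix s3 :: "('u, 'a) stage" and \<sigma> w assume s3: "sub \<sigma> s3 s2" and w: "w \<in> el s3 V"
        and "sat s3 (Or (Eq 0 2) (Eq 0 1)) (\<lambda>c. case_nat (w c) (case_nat (y (\<sigma> c)) (case_nat (x (\<rho> (\<sigma> c))) (e (\<pi> (\<rho> (\<sigma> c)))))))"
      then have "T s3 (\<lambda>c. j (or_tv (eqV (w c) (x (\<rho> (\<sigma> c)))) (eqV (w c) (y (\<sigma> c)))))"
        by (simp add: numeral_2_eq_2)
      then show "T s3 (\<lambda>c. j (ex_tv {x (\<rho> (\<sigma> c)), y (\<sigma> c)} (eqV (w c))))"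
      proof (rule T_jmono)
        fix s4 :: "('u, 'a) stage" and \<tau> assume s4: "sub \<tau> s4 s3"
          and or: "T s4 (\<lambda>c. or_tv (eqV (w (\<tau> c)) (x (\<rho> (\<sigma> (\<tau> c))))) (eqV (w (\<tau> c)) (y (\<sigma> (\<tau> c)))))"
        show "T s4 (\<lambda>c. ex_tv {x (\<rho> (\<sigma> (\<tau> c))), y (\<sigma> (\<tau> c))} (eqV (w (\<tau> c))))"
        proof (rule T_orE[OF or])
          fix s5 :: "('u, 'a) stage" and \<upsilon> assume "T s5 (\<lambda>c. eqV (w (\<tau> (\<upsilon> c))) (x (\<rho> (\<sigma> (\<tau> (\<upsilon> c))))))"
          then show "T s5 (\<lambda>c. ex_tv {x (\<rho> (\<sigma> (\<tau> (\<upsilon> c)))), y (\<sigma> (\<tau> (\<upsilon> c)))} (eqV (w (\<tau> (\<upsilon> c)))))"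
            by (intro T_exI[of s5 "\<lambda>c. x (\<rho> (\<sigma> (\<tau> (\<upsilon> c))))"]) simp_all
        next
          fix s5 :: "('u, 'a) stage" and \<upsilon> assume "T s5 (\<lambda>c. eqV (w (\<tau> (\<upsilon> c))) (y (\<sigma> (\<tau> (\<upsilon> c)))))"
          then show "T s5 (\<lambda>c. ex_tv {x (\<rho> (\<sigma> (\<tau> (\<upsilon> c)))), y (\<sigma> (\<tau> (\<upsilon> c)))} (eqV (w (\<tau> (\<upsilon> c)))))"
            by (intro T_exI[of s5 "\<lambda>c. y (\<sigma> (\<tau> (\<upsilon> c)))"]) simp_all
        qed (use elD[OF el_sub[OF s4 w]] in \<open>simp_all add: Sig_ex\<close>)
      qed (use elD[OF w] in \<open>simp_all add: Sig_ex\<close>)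
    qed simp
  qed (simp add: Iff_def)
qed (simp add: Iff_def)

lemma union:
  fixes s :: "('u, 'a) stage"
  shows "sat s ax_union e"
  unfolding ax_union_def
proof (rule sat_allI[OF _ envs_0], goal_cases)
  case outer: (2 s1 \<pi> a)
  have lift: "Exists (And (Mem 0 3) (Mem 1 0)) = lift 1 (Exists (And (Mem 0 2) (Mem 1 0)))"
    by (simp add: lift_var_def)
  show ?case unfolding lift
  proof (rule ex_comprehension[OF _ envs_case[OF outer(3,2)]])
    fix i assume "i \<in> dm s1"
    then have "a i \<in> V" by (rule elD[OF outer(3)])
    then show "(\<Union>p\<in>ent (a i). fst ` ent (fst p)) \<subseteq> V" "small (\<Union>p\<in>ent (a i). fst ` ent (fst p))"
      using ent_fst by (blast, intro small_UN small_image ent_small)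
  next
    fix s2 :: "('u, 'a) stage" and \<rho> w assume s2: "sub \<rho> s2 s1" and w: "w \<in> el s2 V"
      and "sat s2 (Exists (And (Mem 0 2) (Mem 1 0))) (\<lambda>c. case_nat (w c) (case_nat (a (\<rho> c)) (e (\<pi> (\<rho> c)))))"
    then have h: "T s2 (\<lambda>c. j (ex_tv V (\<lambda>v. and_tv D (memV v (a (\<rho> c))) (memV (w c) v))))"
      by (simp add: numeral_2_eq_2)
    note a2 = el_sub[OF s2 outer(3)]
    show "T s2 (\<lambda>c. j (ex_tv (\<Union>p\<in>ent (a (\<rho> c)). fst ` ent (fst p)) (eqV (w c))))"
    proof (rule T_jexE[OF h])
      fix s3 :: "('u, 'a) stage" and \<sigma> v assume s3: "sub \<sigma> s3 s2" and v: "\<And>c. c \<in> dm s3 \<Longrightarrow> v c \<in> V"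
        and t: "T s3 (\<lambda>c. and_tv D (memV (v c) (a (\<rho> (\<sigma> c)))) (memV (w (\<sigma> c)) (v c)))"
      note a3 = el_sub[OF s3 a2] and w3 = el_sub[OF s3 w]
      have me: "ME s3 v (\<lambda>c. a (\<rho> (\<sigma> c)))" "ME s3 (\<lambda>c. w (\<sigma> c)) v"
        using t v a3 w3 by (simp_all add: T_and ME_def el_def)
      show "T s3 (\<lambda>c. j (ex_tv (\<Union>p\<in>ent (a (\<rho> (\<sigma> c))). fst ` ent (fst p)) (eqV (w (\<sigma> c)))))"
      proof (rule ME_bind[OF me(1)])
        fix s4 :: "('u, 'a) stage" and \<tau> p assume s4: "sub \<tau> s4 s3" and p: "entel s4 p (\<lambda>c. a (\<rho> (\<sigma> (\<tau> c))))"
          and eq: "EQ s4 (\<lambda>c. v (\<tau> c)) (\<lambda>c. fst (p c))"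
        note w4 = el_sub[OF s4 w3]
        show "T s4 (\<lambda>c. j (ex_tv (\<Union>p\<in>ent (a (\<rho> (\<sigma> (\<tau> c)))). fst ` ent (fst p)) (eqV (w (\<sigma> (\<tau> c))))))"
        proof (rule T_jmono[OF T_memE[OF ME_cong[OF ME_sub[OF s4 me(2)] EQ_refl[OF w4] eq]]])
          fix s5 :: "('u, 'a) stage" and \<upsilon> assume s5: "sub \<upsilon> s5 s4"
            and t: "T s5 (\<lambda>c. ex_tv (fst ` ent (fst (p (\<upsilon> c)))) (eqV (w (\<sigma> (\<tau> (\<upsilon> c))))))"
          show "T s5 (\<lambda>c. ex_tv (\<Union>p\<in>ent (a (\<rho> (\<sigma> (\<tau> (\<upsilon> c))))). fst ` ent (fst p)) (eqV (w (\<sigma> (\<tau> (\<upsilon> c))))))"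
            by (rule T_mono[OF t]) (use entel_sub[OF s5 p] in \<open>auto simp: ex_tv_def entel_def intro!: bexI\<close>)
        qed (use elD[OF w4] in \<open>simp_all add: Sig_ex\<close>)
      qed (use elD[OF w3] in \<open>simp add: Sig_ex\<close>)
    qed (use elD[OF w] elD[OF a2] in \<open>simp_all add: Sig_ex\<close>)
  qed simp
qed (simp add: Iff_def)

lemma power_set:
  fixes s :: "('u, 'a) stage"
  shows "sat s ax_power_set e"
  unfolding ax_power_set_def
proof (rule sat_allI[OF _ envs_0], goal_cases)
  case outer: (2 s1 \<pi> a)
  have lift: "Forall (Imp (Mem 0 1) (Mem 0 3)) = lift 1 (Forall (Imp (Mem 0 1) (Mem 0 2)))"
    by (simp add: lift_var_def)
  have G: "nm G \<in> V \<and> ent (nm G) = G" if "i \<in> dm s1" "G \<subseteq> fst ` ent (a i) \<times> Sig D" for i G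
  proof -
    have a: "a i \<in> V" by (rule elD[OF outer(3) that(1)])
    then have "G \<subseteq> V \<times> Sig D" using that(2) ent_fst by blast
    moreover have "small G" by (rule small_mono[OF small_Times[OF small_image[OF ent_small[OF a]] small_Sig] that(2)])
    ultimately show ?thesis using nm by blast
  qed
  show ?case unfolding lift
  proof (rule ex_comprehension[OF _ envs_case[OF outer(3,2)]])
    fix i assume i: "i \<in> dm s1"
    then have "a i \<in> V" by (rule elD[OF outer(3)])
    then show "nm ` Pow (fst ` ent (a i) \<times> Sig D) \<subseteq> V" "small (nm ` Pow (fst ` ent (a i) \<times> Sig D))"
      using G[OF i] by (blast, intro small_image small_Pow small_Times ent_small small_Sig)
  next
    fix s2 :: "('u, 'a) stage" and \<rho> w assume s2: "sub \<rho> s2 s1" and w: "w \<in> el s2 V"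
      and e2: "envs (Suc 0) s2 (\<lambda>c. case_nat (a (\<rho> c)) (e (\<pi> (\<rho> c))))"
      and h: "sat s2 (Forall (Imp (Mem 0 1) (Mem 0 2))) (\<lambda>c. case_nat (w c) (case_nat (a (\<rho> c)) (e (\<pi> (\<rho> c)))))"
    note a2 = el_sub[OF s2 outer(3)]
    have k1: "\<rho> i \<in> dm s1" if "i \<in> dm s2" for i using sub_dm[OF s2 that] .
    define G' where "G' = (\<lambda>c. (\<lambda>v. (v, memV v (w c))) ` fst ` ent (a (\<rho> c)))"
    have G': "G' i \<subseteq> fst ` ent (a (\<rho> i)) \<times> Sig D" if "i \<in> dm s2" for i
      using elD[OF w that] elD[OF a2 that] ent_fst by (auto simp: G'_def)
    define u where "u = (\<lambda>c. nm (G' c))"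
    have u: "u \<in> el s2 V" unfolding u_def el_def using G[OF k1 G'] by simp
    have ent_u: "ent (u i) = G' i" if "i \<in> dm s2" for i unfolding u_def using G[OF k1 G'] that by simp
    have "EQ s2 w u"
    proof (rule EQI[OF w u])
      fix s3 :: "('u, 'a) stage" and \<sigma> p assume s3: "sub \<sigma> s3 s2" and p: "entel s3 p (\<lambda>c. w (\<sigma> c))"
      note p3 = entel_el(2)[OF p] and a3 = el_sub[OF s3 a2] and w3 = el_sub[OF s3 w] and u3 = el_sub[OF s3 u]
      have "sat s3 (Forall (Imp (Mem 0 1) (Mem 0 2))) (\<lambda>c. case_nat (w (\<sigma> c)) (case_nat (a (\<rho> (\<sigma> c))) (e (\<pi> (\<rho> (\<sigma> c))))))"
        by (rule val_sub[OF s3 h _ envsD[OF envs_case[OF w e2]]]) simp_all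
      from sat_mp[OF sat_allE[OF this p3]] ME_ent[OF p] have "ME s3 (\<lambda>c. fst (p c)) (\<lambda>c. a (\<rho> (\<sigma> c)))"
        using p3 a3 by (simp add: ME_def numeral_2_eq_2)
      then show "ME s3 (\<lambda>c. fst (p c)) (\<lambda>c. u (\<sigma> c))"
      proof (rule ME_bindM[OF _ p3 u3])
        fix s4 :: "('u, 'a) stage" and \<tau> q assume s4: "sub \<tau> s4 s3" and q: "entel s4 q (\<lambda>c. a (\<rho> (\<sigma> (\<tau> c))))"
          and eq: "EQ s4 (\<lambda>c. fst (p (\<tau> c))) (\<lambda>c. fst (q c))"
        have "ME s4 (\<lambda>c. fst (q c)) (\<lambda>c. w (\<sigma> (\<tau> c)))"
          by (rule ME_cong[OF ME_ent[OF entel_sub[OF s4 p]] eq EQ_refl[OF el_sub[OF s4 w3]]])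
        moreover have "(fst (q i), memV (fst (q i)) (w (\<sigma> (\<tau> i)))) \<in> ent (u (\<sigma> (\<tau> i)))" if "i \<in> dm s4" for i
          unfolding ent_u[OF sub_dm[OF s3 sub_dm[OF s4 that]]] G'_def using q that by (auto simp: entel_def)
        ultimately have "entel s4 (\<lambda>c. (fst (q c), memV (fst (q c)) (w (\<sigma> (\<tau> c))))) (\<lambda>c. u (\<sigma> (\<tau> c)))"
          unfolding entel_def using el_sub[OF s4 u3] by (simp add: ME_def)
        from MEI[OF this] eq show "ME s4 (\<lambda>c. fst (p (\<tau> c))) (\<lambda>c. u (\<sigma> (\<tau> c)))" by simp
      qed
    next
      fix s3 :: "('u, 'a) stage" and \<sigma> q assume s3: "sub \<sigma> s3 s2" and q: "entel s3 q (\<lambda>c. u (\<sigma> c))"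
      have "snd (q i) = memV (fst (q i)) (w (\<sigma> i))" if i: "i \<in> dm s3" for i
      proof -
        have "q i \<in> ent (u (\<sigma> i))" using q i by (simp add: entel_def)
        then show ?thesis unfolding ent_u[OF sub_dm[OF s3 i]] G'_def by auto
      qed
      then have "T s3 (\<lambda>c. memV (fst (q c)) (w (\<sigma> c)))"
        using q T_cong[of s3 "\<lambda>c. snd (q c)"] unfolding entel_def by simp
      then show "ME s3 (\<lambda>c. fst (q c)) (\<lambda>c. w (\<sigma> c))" using entel_el(2)[OF q] el_sub[OF s3 w] by (simp add: ME_def)
    qed
    then have "T s2 (\<lambda>c. ex_tv (nm ` Pow (fst ` ent (a (\<rho> c)) \<times> Sig D)) (eqV (w c)))"
      by (intro T_exI[of s2 u]) (use G' in \<open>auto simp: u_def EQ_def\<close>)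
    then show "T s2 (\<lambda>c. j (ex_tv (nm ` Pow (fst ` ent (a (\<rho> c)) \<times> Sig D)) (eqV (w c))))"
      by (rule T_jI[rotated]) (use elD[OF w] in \<open>simp add: Sig_ex\<close>)
  qed simp
qed (simp add: Iff_def)

text \<open>\<open>\<phi>\<close> depends on the stage, whereas \<open>uniform_induct\<close> applies to predicates that do not: quantify over
  all points of the stage, guarded by their realizers.\<close>

lemma uniform_induct_at:
  fixes s :: "('u, 'a) stage"
  assumes sg: "\<And>c z. c \<in> dm s \<Longrightarrow> z \<in> V \<Longrightarrow> \<phi> c z \<in> Sig D"
    and st: "\<And>(s' :: ('u, 'a) stage) \<pi> z. sub \<pi> s' s \<Longrightarrow> z \<in> el s' V \<Longrightarrow>
      T s' (\<lambda>c. all_tv (fst ` ent (z c)) (\<phi> (\<pi> c))) \<Longrightarrow> T s' (\<lambda>c. \<phi> (\<pi> c) (z c))"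
    and z: "z \<in> el s V"
  shows "T s (\<lambda>c. \<phi> c (z c))"
proof -
  define pt :: "'u \<Rightarrow> 'a tval" where "pt = (\<lambda>c. ({rho s c}, if fl s c then {rho s c} else {}))"
  have pt_Sig: "pt i \<in> Sig D" if "i \<in> dm s" for i
    using that by (auto simp: pt_def Sig_def dm_def)
  have pt_sub: "sub \<pi> s' s" if dms: "\<And>i. i \<in> dm s' \<Longrightarrow> \<pi> i \<in> dm s" and pt: "T s' (\<lambda>c. pt (\<pi> c))" for s' :: "('u, 'a) stage" and \<pi>
  proof -
    obtain t where t: "t \<in> Sharp D" "\<And>i. i \<in> dm s' \<Longrightarrow> \<exists>y\<in>rs (fl s' i) (pt (\<pi> i)). App D t (rho s' i) = Some y"
      using pt unfolding T_def by blast
    have "(fl s' i \<longrightarrow> fl s (\<pi> i)) \<and> App D t (rho s' i) = Some (rho s (\<pi> i))" if "i \<in> dm s'" for i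
      using t(2)[OF that] by (auto simp: rs_def pt_def split: if_splits)
    with t(1) dms show ?thesis unfolding sub_def by blast
  qed
  define \<phi>' where "\<phi>' = (\<lambda>x. all_tv (dm s) (\<lambda>c. imp_tv D (pt c) (\<phi> c x)))"
  have phiD: "T s' (\<lambda>c. \<phi> (\<pi> c) (y c))"
    if "T s' (\<lambda>c. \<phi>' (y c))" "\<And>i. i \<in> dm s' \<Longrightarrow> \<pi> i \<in> dm s" "T s' (\<lambda>c. pt (\<pi> c))" for s' :: "('u, 'a) stage" and \<pi> y
  proof -
    have "T s' (\<lambda>c. imp_tv D (pt (\<pi> c)) (\<phi> (\<pi> c) (y c)))"
      using that(1) unfolding \<phi>'_def by (rule T_allE) (rule that(2))
    then show ?thesis using that(3) by (rule T_mp)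
  qed
  have "T s (\<lambda>c. \<phi>' (z c))"
  proof (rule uniform_induct[OF _ _ z])
    fix s1 :: "('u, 'a) stage" and x assume x: "x \<in> el s1 V" and IH: "T s1 (\<lambda>c. all_tv (fst ` ent (x c)) \<phi>')"
    show "T s1 (\<lambda>c. \<phi>' (x c))" unfolding \<phi>'_def
    proof (rule T_allI[of "\<lambda>x. x"])
      fix s2 :: "('u, 'a) stage" and \<pi> g assume s2: "sub \<pi> s2 s1" and g: "\<And>i. i \<in> dm s2 \<Longrightarrow> g i \<in> dm s"
      show "T s2 (\<lambda>c. imp_tv D (pt (g c)) (\<phi> (g c) (x (\<pi> c))))"
      proof (rule T_impI)
        fix s3 :: "('u, 'a) stage" and \<rho> assume s3: "sub \<rho> s3 s2" and pt: "T s3 (\<lambda>c. pt (g (\<rho> c)))"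
        have c3: "g (\<rho> i) \<in> dm s" if "i \<in> dm s3" for i by (rule g[OF sub_dm[OF s3 that]])
        show "T s3 (\<lambda>c. \<phi> (g (\<rho> c)) (x (\<pi> (\<rho> c))))"
        proof (rule st[OF pt_sub[OF c3 pt] el_sub[OF s3 el_sub[OF s2 x]]])
          show "T s3 (\<lambda>c. all_tv (fst ` ent (x (\<pi> (\<rho> c)))) (\<phi> (g (\<rho> c))))"
          proof (rule T_allI[of "\<lambda>x. x"])
            fix s4 :: "('u, 'a) stage" and \<sigma> y assume s4: "sub \<sigma> s4 s3"
              and y: "\<And>c. c \<in> dm s4 \<Longrightarrow> y c \<in> fst ` ent (x (\<pi> (\<rho> (\<sigma> c))))"
            have "T s4 (\<lambda>c. all_tv (fst ` ent (x (\<pi> (\<rho> (\<sigma> c))))) \<phi>')"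
              by (rule T_sub[OF sub_trans[OF s4 sub_trans[OF s3 s2]] IH]) simp
            then have "T s4 (\<lambda>c. \<phi>' (y c))" by (rule T_allE) (rule y)
            then show "T s4 (\<lambda>c. \<phi> (g (\<rho> (\<sigma> c))) (y c))"
              by (rule phiD) (rule c3[OF sub_dm[OF s4]], assumption, rule T_sub[OF s4 pt pt_Sig[OF c3]])
          next
            fix i y assume i: "i \<in> dm s3" and "y \<in> fst ` ent (x (\<pi> (\<rho> i)))"
            then have "y \<in> V" using elD[OF el_sub[OF s3 el_sub[OF s2 x]] i] ent_fst by blast
            then show "\<phi> (g (\<rho> i)) y \<in> Sig D" by (rule sg[OF c3[OF i]])
          qed (simp add: inj_on_def)
        qed
      qed (rule pt_Sig[OF g])
    qed (simp_all add: inj_on_def)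
  qed (simp add: \<phi>'_def)
  then show ?thesis
  proof (rule phiD)
    obtain t where "t \<in> Sharp D" "\<forall>x. App D t x = Some x" using ex_id by blast
    then show "T s (\<lambda>c. pt c)" unfolding T_def by (intro bexI[of _ t]) (simp_all add: rs_def pt_def)
  qed
qed

lemma induction:
  fixes s :: "('u, 'a) stage"
  assumes b: "vars_below (n + 1) \<phi>" and e: "envs n s e"
  shows "sat s (ax_induction \<phi>) e"
  unfolding ax_induction_def
proof (rule sat_impI[OF _ e], goal_cases)
  case outer: (2 s1 \<pi>)
  have b: "vars_below (Suc n) \<phi>" using b by simp
  note bl = vars_below_lift[OF b, of 1]
  show ?case
  proof (rule sat_allI[OF b outer(2)], goal_cases)
    case (1 s2 \<rho> v)
    show ?case
    proof (rule uniform_induct_at[OF _ _ 1(3)])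
      fix i z assume "i \<in> dm s2" "z \<in> V"
      then show "val \<phi> (case_nat z (e (\<pi> (\<rho> i)))) \<in> Sig D"
        using val_Sig[OF b env_case] envsD[OF 1(2)] by simp
    next
      fix s3 :: "('u, 'a) stage" and \<sigma> z assume s3: "sub \<sigma> s3 s2" and z: "z \<in> el s3 V"
        and IH: "T s3 (\<lambda>c. all_tv (fst ` ent (z c)) (\<lambda>z. val \<phi> (case_nat z (e (\<pi> (\<rho> (\<sigma> c)))))))"
      note e3 = envs_sub[OF s3 1(2)]
      have "sat s3 (Forall (Imp (Forall (Imp (Mem 0 1) (lift 1 \<phi>))) \<phi>)) (\<lambda>c. e (\<pi> (\<rho> (\<sigma> c))))"
        by (rule val_sub[OF sub_trans[OF s3 1(1)] outer(3) _ envsD[OF outer(2)]]) (use b bl in simp_all)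
      from sat_allE[OF this z] show "sat s3 \<phi> (\<lambda>c. case_nat (z c) (e (\<pi> (\<rho> (\<sigma> c)))))"
      proof (rule sat_mp)
        show "sat s3 (Forall (Imp (Mem 0 1) (lift 1 \<phi>))) (\<lambda>c. case_nat (z c) (e (\<pi> (\<rho> (\<sigma> c)))))"
        proof (rule sat_allI[OF _ envs_case[OF z e3]], goal_cases)
          case inner: (2 s4 \<tau> w)
          show ?case
          proof (rule sat_impI[OF _ envs_case[OF inner(3,2)]], goal_cases)
            case (2 s5 \<upsilon>)
            note w5 = el_sub[OF 2(1) inner(3)] and e5 = envs_sub[OF 2(1) envs_sub[OF inner(1) e3]]
              and z5 = el_sub[OF 2(1) el_sub[OF inner(1) z]]
            have "ME s5 (\<lambda>c. w (\<upsilon> c)) (\<lambda>c. z (\<tau> (\<upsilon> c)))" using 2(3) w5 z5 by (simp add: ME_def)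
            then have "sat s5 \<phi> (\<lambda>c. case_nat (w (\<upsilon> c)) (e (\<pi> (\<rho> (\<sigma> (\<tau> (\<upsilon> c)))))))"
            proof (rule ME_sat[OF _ b envs_case[OF w5 e5]])
              fix s6 :: "('u, 'a) stage" and \<xi> q assume s6: "sub \<xi> s6 s5" and q: "entel s6 q (\<lambda>c. z (\<tau> (\<upsilon> (\<xi> c))))"
                and eq: "EQ s6 (\<lambda>c. w (\<upsilon> (\<xi> c))) (\<lambda>c. fst (q c))"
              have "T s6 (\<lambda>c. all_tv (fst ` ent (z (\<tau> (\<upsilon> (\<xi> c))))) (\<lambda>z. val \<phi> (case_nat z (e (\<pi> (\<rho> (\<sigma> (\<tau> (\<upsilon> (\<xi> c))))))))))"
                by (rule T_sub[OF sub_trans[OF s6 sub_trans[OF 2(1) inner(1)]] IH]) simp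
              then have "sat s6 \<phi> (\<lambda>c. case_nat (fst (q c)) (e (\<pi> (\<rho> (\<sigma> (\<tau> (\<upsilon> (\<xi> c))))))))"
                by (rule T_allE) (use q in \<open>simp add: entel_def\<close>)
              from envs_ext[OF b EQ_sym[OF eq] envs_sub[OF s6 e5] this]
              show "sat s6 \<phi> (\<lambda>c. case_nat (w (\<upsilon> (\<xi> c))) (e (\<pi> (\<rho> (\<sigma> (\<tau> (\<upsilon> (\<xi> c))))))))" .
            qed
            then show ?case unfolding val_lift1 .
          qed simp
        qed (use bl in simp)
      qed
    qed
  qed
qed (use b vars_below_lift[of "Suc n" \<phi> 1] in simp)

lemma collection:
  fixes s :: "('u, 'a) stage"
  assumes b: "vars_below (n + 3) \<phi>" and e: "envs n s e"
  shows "sat s (ax_collection \<phi>) e"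
  unfolding ax_collection_def
proof (rule sat_allI[OF _ e], goal_cases)
  case a: (2 s1 \<pi> a)
  have b: "vars_below (Suc (Suc (Suc n))) \<phi>" using b by (simp add: numeral_3_eq_3)
  note bl = vars_below_lift[OF b, of 2]
  show ?case
  proof (rule sat_impI[OF _ envs_case[OF a(3,2)]], goal_cases)
    case outer: (2 s2 \<rho>)
    define a' where "a' = (\<lambda>c. a (\<rho> c))"
    define f where "f = (\<lambda>c. case_nat (a' c) (e (\<pi> (\<rho> c))))"
    have a': "a' \<in> el s2 V" unfolding a'_def by (rule el_sub[OF outer(1) a(3)])
    have f: "envs (Suc n) s2 f" using outer(2) by (simp add: f_def a'_def)
    have h: "sat s2 (Forall (Imp (Mem 0 1) (Exists \<phi>))) f" using outer(3) by (simp add: f_def a'_def)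
    define W where "W = (\<lambda>c. \<Union>v\<in>fst ` ent (a' c). wit (\<lambda>y. val \<phi> (case_nat y (case_nat v (f c)))))"
    define B where "B = (\<lambda>c. nm (W c \<times> {top_tv D}))"
    have B0: "B i \<in> V \<and> ent (B i) = W i \<times> {top_tv D}" if i: "i \<in> dm s2" for i
    proof -
      have "W i \<times> {top_tv D} \<subseteq> V \<times> Sig D" using wit(1) by (auto simp: W_def)
      moreover have "small (W i \<times> {top_tv D})" unfolding W_def
        by (intro small_Times small_UN small_image ent_small elD[OF a' i] wit(2) small_finite) simp
      ultimately show ?thesis unfolding B_def using nm by blast
    qed
    have B: "B \<in> el s2 V" using B0 by (simp add: el_def)
    have "sat s2 (Exists (Forall (Imp (Mem 0 2) (Exists (And (Mem 0 2) (lift 2 \<phi>)))))) f"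
    proof (rule sat_exI[OF _ f B])
      show "sat s2 (Forall (Imp (Mem 0 2) (Exists (And (Mem 0 2) (lift 2 \<phi>))))) (\<lambda>c. case_nat (B c) (f c))"
      proof (rule sat_allI[OF _ envs_case[OF B f]], goal_cases)
        case x: (2 s3 \<sigma> x)
        show ?case
        proof (rule sat_impI[OF _ envs_case[OF x(3,2)]], goal_cases)
          case (2 s4 \<tau>)
          note s42 = sub_trans[OF 2(1) x(1)]
          note x4 = el_sub[OF 2(1) x(3)] and a4 = el_sub[OF s42 a'] and B4 = el_sub[OF s42 B] and f4 = envs_sub[OF s42 f]
          have ex: "vars_below (Suc (Suc (Suc n))) (Exists (And (Mem 0 2) (lift 2 \<phi>)))" using bl by simp
          have "ME s4 (\<lambda>c. x (\<tau> c)) (\<lambda>c. a' (\<sigma> (\<tau> c)))" using 2(3) x4 a4 by (simp add: ME_def numeral_2_eq_2 f_def)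
          then show ?case
          proof (rule ME_sat[OF _ ex envs_case[OF x4 envs_case[OF B4 f4]]])
            fix s5 :: "('u, 'a) stage" and \<upsilon> q assume s5: "sub \<upsilon> s5 s4" and q: "entel s5 q (\<lambda>c. a' (\<sigma> (\<tau> (\<upsilon> c))))"
              and eq: "EQ s5 (\<lambda>c. x (\<tau> (\<upsilon> c))) (\<lambda>c. fst (q c))"
            define v where "v = (\<lambda>c. fst (q c))"
            have v: "v \<in> el s5 V" using entel_el(2)[OF q] by (simp add: v_def)
            note s52 = sub_trans[OF s5 s42]
            note B5 = el_sub[OF s5 B4] and f5 = envs_sub[OF s5 f4] and a5 = el_sub[OF s5 a4]
            have "sat s5 (Forall (Imp (Mem 0 1) (Exists \<phi>))) (\<lambda>c. f (\<sigma> (\<tau> (\<upsilon> c))))"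
              by (rule val_sub[OF s52 h _ envsD[OF f]]) (use b in simp_all)
            from sat_mp[OF sat_allE[OF this v]] ME_ent[OF q]
            have "sat s5 (Exists \<phi>) (\<lambda>c. case_nat (v c) (f (\<sigma> (\<tau> (\<upsilon> c)))))"
              by (simp add: ME_def v_def f_def)
            then have h5: "T s5 (\<lambda>c. j (ex_tv (wit (\<lambda>y. val \<phi> (case_nat y (case_nat (v c) (f (\<sigma> (\<tau> (\<upsilon> c)))))))) (\<lambda>y. val \<phi> (case_nat y (case_nat (v c) (f (\<sigma> (\<tau> (\<upsilon> c)))))))))"
              by (simp add: wit(3))
            have sg: "val \<phi> (case_nat y (case_nat (v i) (f (\<sigma> (\<tau> (\<upsilon> i)))))) \<in> Sig D" if "i \<in> dm s5" "y \<in> V" for i y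
              by (rule val_Sig[OF b env_case[OF _ env_case]]) (use that elD[OF v] envsD[OF f5] in simp_all)
            have "T s5 (\<lambda>c. j (ex_tv V (\<lambda>y. and_tv D (memV y (B (\<sigma> (\<tau> (\<upsilon> c))))) (val \<phi> (case_nat y (case_nat (v c) (f (\<sigma> (\<tau> (\<upsilon> c))))))))))"
            proof (rule T_jmono[OF h5])
              fix i assume i: "i \<in> dm s5"
              then show "ex_tv (wit (\<lambda>y. val \<phi> (case_nat y (case_nat (v i) (f (\<sigma> (\<tau> (\<upsilon> i)))))))) (\<lambda>y. val \<phi> (case_nat y (case_nat (v i) (f (\<sigma> (\<tau> (\<upsilon> i))))))) \<in> Sig D"
                using sg wit(1) by (intro Sig_ex) blast
              show "ex_tv V (\<lambda>y. and_tv D (memV y (B (\<sigma> (\<tau> (\<upsilon> i))))) (val \<phi> (case_nat y (case_nat (v i) (f (\<sigma> (\<tau> (\<upsilon> i)))))))) \<in> Sig D"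
                using sg i elD[OF B5 i] by (intro Sig_ex Sig_and memV_Sig)
            next
              fix s6 :: "('u, 'a) stage" and \<xi> assume s6: "sub \<xi> s6 s5"
                and t: "T s6 (\<lambda>c. ex_tv (wit (\<lambda>y. val \<phi> (case_nat y (case_nat (v (\<xi> c)) (f (\<sigma> (\<tau> (\<upsilon> (\<xi> c))))))))) (\<lambda>y. val \<phi> (case_nat y (case_nat (v (\<xi> c)) (f (\<sigma> (\<tau> (\<upsilon> (\<xi> c)))))))))"
              obtain y where y: "\<And>i. i \<in> dm s6 \<Longrightarrow> y i \<in> wit (\<lambda>y. val \<phi> (case_nat y (case_nat (v (\<xi> i)) (f (\<sigma> (\<tau> (\<upsilon> (\<xi> i))))))))"
                "T s6 (\<lambda>c. val \<phi> (case_nat (y c) (case_nat (v (\<xi> c)) (f (\<sigma> (\<tau> (\<upsilon> (\<xi> c))))))))"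
                using T_exE[OF t] by blast
              have q6: "entel s6 (\<lambda>c. q (\<xi> c)) (\<lambda>c. a' (\<sigma> (\<tau> (\<upsilon> (\<xi> c)))))" by (rule entel_sub[OF s6 q])
              have "(y i, top_tv D) \<in> ent (B (\<sigma> (\<tau> (\<upsilon> (\<xi> i)))))" if i: "i \<in> dm s6" for i
              proof -
                have "v (\<xi> i) \<in> fst ` ent (a' (\<sigma> (\<tau> (\<upsilon> (\<xi> i)))))" using q6 i by (simp add: entel_def v_def)
                then have "y i \<in> W (\<sigma> (\<tau> (\<upsilon> (\<xi> i))))" unfolding W_def by (rule UN_I) (rule y(1)[OF i])
                then show ?thesis using B0[OF sub_dm[OF s52 sub_dm[OF s6 i]]] by simp
              qed
              then have "entel s6 (\<lambda>c. (y c, top_tv D)) (\<lambda>c. B (\<sigma> (\<tau> (\<upsilon> (\<xi> c)))))"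
                unfolding entel_def using el_sub[OF s6 B5] T_top by simp
              from ME_ent[OF this] y(2)
              show "T s6 (\<lambda>c. ex_tv V (\<lambda>y. and_tv D (memV y (B (\<sigma> (\<tau> (\<upsilon> (\<xi> c)))))) (val \<phi> (case_nat y (case_nat (v (\<xi> c)) (f (\<sigma> (\<tau> (\<upsilon> (\<xi> c))))))))))"
                by (intro T_exI[of s6 y]) (simp_all add: T_and ME_def el_def)
            qed
            then have "sat s5 (Exists (And (Mem 0 2) (lift 2 \<phi>))) (\<lambda>c. case_nat (v c) (case_nat (B (\<sigma> (\<tau> (\<upsilon> c)))) (f (\<sigma> (\<tau> (\<upsilon> c))))))"
              by (simp add: val_lift2)
            from envs_ext[OF ex EQ_sym[OF eq[folded v_def]] envs_case[OF B5 f5] this]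
            show "sat s5 (Exists (And (Mem 0 2) (lift 2 \<phi>))) (\<lambda>c. case_nat (x (\<tau> (\<upsilon> c))) (case_nat (B (\<sigma> (\<tau> (\<upsilon> c)))) (f (\<sigma> (\<tau> (\<upsilon> c))))))" .
          qed
        qed simp
      qed (use bl in simp)
    qed (use bl in simp)
    then show ?case by (simp add: f_def a'_def)
  qed (use b in simp)
qed (use b vars_below_lift[of "Suc (Suc (Suc n))" \<phi> 2] in \<open>simp add: numeral_3_eq_3\<close>)

lemma T_empty: "dm s = {} \<Longrightarrow> T s P"
  unfolding T_def using kk_ss(1) by auto

abbreviation succ_fm :: fm where "succ_fm \<equiv> Or (Mem 0 1) (Eq 0 1)"

primrec num :: "nat \<Rightarrow> 'u" where
  "num 0 = nm {}"
| "num (Suc m) = compr succ_fm (insert (num m) (fst ` ent (num m))) (\<lambda>_. num m)"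

lemma compr_succ: "compr succ_fm U (case_nat x e) = compr succ_fm U (\<lambda>_. x)"
  by (simp add: compr_def)

lemma ent_image: "x \<in> V \<Longrightarrow> fst ` ent x \<subseteq> V" using ent_fst by blast

lemma num_V: "num m \<in> V"
proof (induction m)
  case 0
  show ?case using nm[of "{}"] by (simp add: small_finite)
next
  case (Suc m)
  have "insert (num m) (fst ` ent (num m)) = {num m} \<union> fst ` ent (num m)" by simp
  then have "small (insert (num m) (fst ` ent (num m)))"
    using small_Un[OF small_finite small_image[OF ent_small[OF Suc]]] by (metis finite.emptyI finite_insert)
  then show ?case using compr(1)[of 1 succ_fm "\<lambda>_. num m"] Suc ent_image[OF Suc] by (simp add: env_def)
qed

lemma infinity:
  fixes s :: "('u, 'a) stage"
  shows "sat s ax_infinity e"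
  unfolding ax_infinity_def
proof -
  define w where "w = nm (range (\<lambda>n. (num n, top_tv D)))"
  have w: "w \<in> V" "ent w = range (\<lambda>n. (num n, top_tv D))"
    unfolding w_def by (rule nm; use num_V in \<open>auto intro: small_image[OF small_nat]\<close>)+
  have wel: "(\<lambda>c. w) \<in> el s V" and nel: "(\<lambda>c. num (m c)) \<in> el s V" for s :: "('u, 'a) stage" and m
    using w(1) num_V by (simp_all add: el_def)
  have num: "T s (\<lambda>c. memV (num (m c)) w)" for s :: "('u, 'a) stage" and m
    using ME_ent[of s "\<lambda>c. (num (m c), top_tv D)" "\<lambda>c. w"] wel w(2) T_top[of s] by (simp add: entel_def ME_def)
  have empty: "sat s (Exists (And (Mem 0 1) (Forall (Neg (Mem 0 1))))) (\<lambda>c. case_nat w (e c))" for s :: "('u, 'a) stage" and e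
  proof (rule sat_exI[OF _ envs_case[OF wel envs_0] nel])
    show "sat s (And (Mem 0 1) (Forall (Neg (Mem 0 1)))) (\<lambda>c. case_nat (num 0) (case_nat w (e c)))"
      unfolding val.simps(4) T_and Neg_def
    proof (intro conjI sat_allI[OF _ envs_case[OF nel envs_case[OF wel envs_0]]])
      fix s1 :: "('u, 'a) stage" and \<pi> v assume v: "v \<in> el s1 V"
      show "sat s1 (Imp (Mem 0 1) Bot) (\<lambda>c. case_nat (v c) (case_nat (num 0) (case_nat w (e (\<pi> c)))))"
      proof (rule sat_impI[OF _ envs_case[OF v envs_case[OF nel envs_0]]], goal_cases)
        case (2 s2 \<rho>)
        then have "ME s2 (\<lambda>c. v (\<rho> c)) (\<lambda>c. num 0)" using el_sub[OF 2(1) v] nel[of "\<lambda>_. 0" s2] by (simp add: ME_def)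
        then show ?case
        proof (rule ME_sat[OF _ _ 2(2)])
          fix s3 :: "('u, 'a) stage" and \<sigma> q assume "entel s3 q (\<lambda>c. num 0)"
          moreover have "ent (num 0) = {}" using nm(2)[of "{}"] by (simp add: small_finite)
          ultimately have "dm s3 = {}" by (auto simp: entel_def)
          then show "sat s3 Bot (\<lambda>c. case_nat (v (\<rho> (\<sigma> c))) (case_nat (num 0) (case_nat w (e (\<pi> (\<rho> (\<sigma> c)))))))"
            by (rule T_empty)
        qed simp
      qed simp
    qed (use num[of s "\<lambda>_. 0"] in simp_all)
  qed (simp add: Neg_def)
  have lift: "Or (Mem 0 2) (Eq 0 2) = lift 1 succ_fm" by (simp add: lift_var_def)
  have succ: "sat s (Exists (And (Mem 0 2) (Forall (Iff (Mem 0 1) (Or (Mem 0 2) (Eq 0 2))))))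
      (\<lambda>c. case_nat (num (m c)) (case_nat w (e c)))" for s :: "('u, 'a) stage" and e m
  proof (rule sat_exI)
    let ?x = "\<lambda>c. case_nat (num (m c)) (case_nat w (e c))"
    let ?U = "\<lambda>c. insert (num (m c)) (fst ` ent (num (m c)))"
    show x: "envs 2 s ?x" using envs_case[OF nel envs_case[OF wel envs_0]] by (simp add: numeral_2_eq_2)
    show "(\<lambda>c. num (Suc (m c))) \<in> el s V" by (rule nel)
    have "sat s (Forall (Iff (Mem 0 1) (lift 1 succ_fm))) (\<lambda>c. case_nat (compr succ_fm (?U c) (?x c)) (?x c))"
    proof (rule comprehension(2)[OF _ x])
      fix i
      show "?U i \<subseteq> V" using num_V ent_image[OF num_V] by simp
      have "small ({num (m i)} \<union> fst ` ent (num (m i)))"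
        by (intro small_Un small_finite small_image ent_small num_V) simp
      then show "small (?U i)" by simp
    next
      fix s' :: "('u, 'a) stage" and \<pi> v assume s': "sub \<pi> s' s" and v: "v \<in> el s' V"
        and "sat s' succ_fm (\<lambda>c. case_nat (v c) (?x (\<pi> c)))"
      then have "T s' (\<lambda>c. j (or_tv (memV (v c) (num (m (\<pi> c)))) (eqV (v c) (num (m (\<pi> c))))))" by simp
      then show "T s' (\<lambda>c. j (ex_tv (?U (\<pi> c)) (eqV (v c))))"
      proof (rule T_jbind)
        fix i assume i: "i \<in> dm s'"
        show "ex_tv (?U (\<pi> i)) (eqV (v i)) \<in> Sig D" using elD[OF v i] by (intro Sig_ex eqV_Sig)
      next
        fix s2 :: "('u, 'a) stage" and \<rho> assume s2: "sub \<rho> s2 s'"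
          and or: "T s2 (\<lambda>c. or_tv (memV (v (\<rho> c)) (num (m (\<pi> (\<rho> c))))) (eqV (v (\<rho> c)) (num (m (\<pi> (\<rho> c))))))"
        note v2 = el_sub[OF s2 v]
        have sg: "ex_tv (?U (\<pi> (\<rho> i))) (eqV (v (\<rho> i))) \<in> Sig D" if i: "i \<in> dm s2" for i
          using elD[OF v2 i] by (intro Sig_ex eqV_Sig)
        show "T s2 (\<lambda>c. j (ex_tv (?U (\<pi> (\<rho> c))) (eqV (v (\<rho> c)))))"
        proof (rule T_orE[OF or])
          fix i assume i: "i \<in> dm s2"
          show "memV (v (\<rho> i)) (num (m (\<pi> (\<rho> i)))) \<in> Sig D" "eqV (v (\<rho> i)) (num (m (\<pi> (\<rho> i)))) \<in> Sig D"
            using elD[OF v2 i] num_V by simp_all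
          show "j (ex_tv (?U (\<pi> (\<rho> i))) (eqV (v (\<rho> i)))) \<in> Sig D" by (rule j_Sig[OF sg[OF i]])
        next
          fix s3 :: "('u, 'a) stage" and \<sigma> assume s3: "sub \<sigma> s3 s2"
            and t: "T s3 (\<lambda>c. memV (v (\<rho> (\<sigma> c))) (num (m (\<pi> (\<rho> (\<sigma> c))))))"
          note v3 = el_sub[OF s3 v2]
          have "ME s3 (\<lambda>c. v (\<rho> (\<sigma> c))) (\<lambda>c. num (m (\<pi> (\<rho> (\<sigma> c)))))" using t v3 nel by (simp add: ME_def)
          from T_memE[OF this] show "T s3 (\<lambda>c. j (ex_tv (?U (\<pi> (\<rho> (\<sigma> c)))) (eqV (v (\<rho> (\<sigma> c))))))"
          proof (rule T_jmono)
            fix i assume i: "i \<in> dm s3"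
            show "ex_tv (fst ` ent (num (m (\<pi> (\<rho> (\<sigma> i)))))) (eqV (v (\<rho> (\<sigma> i)))) \<in> Sig D"
              "ex_tv (?U (\<pi> (\<rho> (\<sigma> i)))) (eqV (v (\<rho> (\<sigma> i)))) \<in> Sig D"
              using elD[OF v3 i] by (intro Sig_ex eqV_Sig; assumption)+
          next
            fix s4 :: "('u, 'a) stage" and \<tau> assume "T s4 (\<lambda>c. ex_tv (fst ` ent (num (m (\<pi> (\<rho> (\<sigma> (\<tau> c))))))) (eqV (v (\<rho> (\<sigma> (\<tau> c))))))"
            then show "T s4 (\<lambda>c. ex_tv (?U (\<pi> (\<rho> (\<sigma> (\<tau> c))))) (eqV (v (\<rho> (\<sigma> (\<tau> c))))))"
              by (rule T_mono) (auto simp: ex_tv_def)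
          qed
        next
          fix s3 :: "('u, 'a) stage" and \<sigma> assume s3: "sub \<sigma> s3 s2" and "T s3 (\<lambda>c. eqV (v (\<rho> (\<sigma> c))) (num (m (\<pi> (\<rho> (\<sigma> c))))))"
          then have "T s3 (\<lambda>c. ex_tv (?U (\<pi> (\<rho> (\<sigma> c)))) (eqV (v (\<rho> (\<sigma> c)))))"
            by (intro T_exI[of s3 "\<lambda>c. num (m (\<pi> (\<rho> (\<sigma> c))))"]) simp_all
          then show "T s3 (\<lambda>c. j (ex_tv (?U (\<pi> (\<rho> (\<sigma> c)))) (eqV (v (\<rho> (\<sigma> c))))))"
            by (rule T_jI[rotated]) (rule sg[OF sub_dm[OF s3]])
        qed
      qed (use elD[OF v] num_V in simp)
    qed simp
    then have "sat s (Forall (Iff (Mem 0 1) (lift 1 succ_fm))) (\<lambda>c. case_nat (num (Suc (m c))) (?x c))"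
      unfolding compr_succ num.simps .
    moreover have "sat s (Mem 0 2) (\<lambda>c. case_nat (num (Suc (m c))) (?x c))"
      using num[of s "\<lambda>c. Suc (m c)"] by (simp add: numeral_2_eq_2)
    ultimately show "sat s (And (Mem 0 2) (Forall (Iff (Mem 0 1) (Or (Mem 0 2) (Eq 0 2))))) (\<lambda>c. case_nat (num (Suc (m c))) (?x c))"
      unfolding lift val.simps(4) T_and by (rule conjI[rotated])
  qed (simp add: Iff_def)
  show "sat s (Exists (And (Exists (And (Mem 0 1) (Forall (Neg (Mem 0 1)))))
     (Forall (Imp (Mem 0 1) (Exists (And (Mem 0 2) (Forall (Iff (Mem 0 1) (Or (Mem 0 2) (Eq 0 2)))))))))) e"
  proof (rule sat_exI[OF _ envs_0 wel], goal_cases)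
    case 2
    show ?case unfolding val.simps(4)[of "Exists _"] T_and
    proof (intro conjI empty sat_allI[OF _ envs_case[OF wel envs_0]], goal_cases)
      case x: (2 s1 \<pi> x)
      show ?case
      proof (rule sat_impI[OF _ envs_case[OF x(3,2)]], goal_cases)
        case (2 s2 \<rho>)
        note x2 = el_sub[OF 2(1) x(3)]
        have "ME s2 (\<lambda>c. x (\<rho> c)) (\<lambda>c. w)" using 2(3) x2 wel by (simp add: ME_def)
        then show ?case
        proof (rule ME_sat[OF _ _ 2(2)])
          fix s3 :: "('u, 'a) stage" and \<sigma> q assume s3: "sub \<sigma> s3 s2" and q: "entel s3 q (\<lambda>c. w)"
            and eq: "EQ s3 (\<lambda>c. x (\<rho> (\<sigma> c))) (\<lambda>c. fst (q c))"
          have "\<forall>i\<in>dm s3. \<exists>m. fst (q i) = num m" using q w(2) by (force simp: entel_def)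
          then obtain m where m: "\<And>i. i \<in> dm s3 \<Longrightarrow> fst (q i) = num (m i)" by metis
          have "EQ s3 (\<lambda>c. num (m c)) (\<lambda>c. x (\<rho> (\<sigma> c)))"
            using EQ_sym[OF eq] nel m T_cong[of s3 "\<lambda>c. eqV (fst (q c)) (x (\<rho> (\<sigma> c)))" "\<lambda>c. eqV (num (m c)) (x (\<rho> (\<sigma> c)))"]
            by (simp add: EQ_def)
          from envs_ext[OF _ this envs_case[OF wel envs_0] succ]
          show "sat s3 (Exists (And (Mem 0 2) (Forall (Iff (Mem 0 1) (Or (Mem 0 2) (Eq 0 2))))))
              (\<lambda>c. case_nat (x (\<rho> (\<sigma> c))) (case_nat w (e (\<pi> (\<rho> (\<sigma> c))))))"
            by (simp add: Iff_def)
        qed (simp add: Iff_def)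
      qed simp
    qed (simp add: Iff_def)
  qed (simp add: Iff_def Neg_def)
qed

lemma holds_IZF:
  assumes "\<phi> \<in> IZF"
  shows "holds ST M \<phi>"
proof -
  have base: "vars_below 0 ax_extensionality" "vars_below 0 ax_pairing" "vars_below 0 ax_union"
    "vars_below 0 ax_power_set" "vars_below 0 ax_infinity"
    by (simp_all add: ax_extensionality_def ax_pairing_def ax_union_def ax_power_set_def ax_infinity_def Iff_def Neg_def)
  have closure: "holds ST M ((Forall ^^ n) \<psi>)"
    if "vars_below n \<psi>" "\<And>(s :: ('u, 'a) stage) x. envs n s x \<Longrightarrow> sat s \<psi> x" for n \<psi>
    by (rule holdsI) (use that sat_closure[of 0 n \<psi>, OF _ _ envs_0] in \<open>simp_all add: vars_below_closure\<close>)
  from assms consider "\<phi> \<in> {ax_extensionality, ax_pairing, ax_union, ax_power_set, ax_infinity}"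
    | n \<psi> where "\<phi> = (Forall ^^ n) (ax_separation \<psi>)" "vars_below (n + 2) \<psi>"
    | n \<psi> where "\<phi> = (Forall ^^ n) (ax_collection \<psi>)" "vars_below (n + 3) \<psi>"
    | n \<psi> where "\<phi> = (Forall ^^ n) (ax_induction \<psi>)" "vars_below (n + 1) \<psi>"
    unfolding IZF_def by blast
  then show ?thesis
  proof cases
    case 1
    then show ?thesis
      using holdsI[OF base(1) extensionality] holdsI[OF base(2) pairing_axiom] holdsI[OF base(3) union]
        holdsI[OF base(4) power_set] holdsI[OF base(5) infinity] by blast
  next
    case (2 n \<psi>)
    show ?thesis unfolding 2(1)
      by (rule closure[OF _ separation[OF 2(2)]]) (use 2(2) vars_below_lift[OF 2(2), of 1] in \<open>simp add: ax_separation_def Iff_def\<close>)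
  next
    case (3 n \<psi>)
    show ?thesis unfolding 3(1)
      by (rule closure[OF _ collection[OF 3(2)]])
        (use 3(2) vars_below_lift[OF 3(2), of 2] in \<open>simp add: ax_collection_def numeral_3_eq_3\<close>)
  next
    case (4 n \<psi>)
    show ?thesis unfolding 4(1)
      by (rule closure[OF _ induction[OF 4(2)]]) (use 4(2) vars_below_lift[OF 4(2), of 1] in \<open>simp add: ax_induction_def\<close>)
  qed
qed

lemma internal_IZF_model_M: "internal_IZF_model ST M"
  unfolding internal_IZF_model_def using is_rel_structure_M holds_IZF by blast

end

subsection \<open>Existence of the object of names\<close>

text \<open>A name is a small set of pairs of a name and a truth value, indexed by elements of the
  field of \<open>\<kappa>\<close>.\<close>

datatype ('k, 'a) tree = Nm (nodes: "'k \<Rightarrow> (('k, 'a) tree \<times> 'a set \<times> 'a set) option")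

definition entries :: "('k, 'a) tree \<Rightarrow> (('k, 'a) tree \<times> 'a tval) set" where
  "entries t = {p. \<exists>i. nodes t i = Some p}"

primrec label :: "'k list \<Rightarrow> ('k, 'a) tree \<Rightarrow> 'a tval option" where
  "label [] t = None"
| "label (i # is) t = (case nodes t i of None \<Rightarrow> None | Some (u, A) \<Rightarrow> if is = [] then Some A else label is u)"

lemma tree_induct:
  assumes "\<And>t. (\<And>u A. (u, A) \<in> entries t \<Longrightarrow> P u) \<Longrightarrow> P t"
  shows "P (t :: ('k, 'a) tree)"
proof (induction t)
  case (Nm f)
  show ?case
  proof (rule assms)
    fix u A assume "(u, A) \<in> entries (Nm f)"
    then obtain i where "f i = Some (u, A)" by (auto simp: entries_def)
    then have "Some (u, A) \<in> range f" by (metis rangeI)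
    then show "P u" using Nm[of "Some (u, A)" "(u, A)" u] by simp
  qed
qed

lemma wf_entries: "wf {(u, t :: ('k, 'a) tree). u \<in> fst ` entries t}"
proof (rule wfUNIVI)
  fix P :: "('k, 'a) tree \<Rightarrow> bool" and x
  assume h: "\<forall>x. (\<forall>y. (y, x) \<in> {(u, t). u \<in> fst ` entries t} \<longrightarrow> P y) \<longrightarrow> P x"
  show "P x" by (rule tree_induct) (use h in force)
qed

lemma label_inj: "(\<And>xs. label xs t = label xs t') \<Longrightarrow> t = t'"
proof (induction t arbitrary: t' rule: tree_induct)
  case (1 t)
  have "nodes t i = nodes t' i" for i
  proof (cases "nodes t i")
    case None
    then show ?thesis using 1(2)[of "[i]"] by (auto split: option.splits)
  next
    case (Some p)
    obtain u A where p: "p = (u, A)" by (cases p)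
    obtain u' where u': "nodes t' i = Some (u', A)"
      using 1(2)[of "[i]"] Some p by (auto split: option.splits)
    have "label xs u = label xs u'" for xs
      using 1(2)[of "i # xs"] Some p u' by (cases xs) auto
    then have "u = u'" by (rule 1(1)[rotated]) (use Some p in \<open>auto simp: entries_def\<close>)
    then show ?thesis using Some p u' by simp
  qed
  then show ?case by (intro tree.expand) (rule ext)
qed

context inaccessible
begin

inductive_set names_of :: "'a nested_pca \<Rightarrow> ('k, 'a) tree set" for D :: "'a nested_pca" where
  "dom f \<subseteq> Field \<kappa> \<Longrightarrow> small (dom f) \<Longrightarrow> (\<And>u A. (u, A) \<in> entries (Nm f) \<Longrightarrow> u \<in> names_of D) \<Longrightarrow>
     snd ` entries (Nm f) \<subseteq> Sig D \<Longrightarrow> Nm f \<in> names_of D"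

lemma entries_names_of:
  assumes "t \<in> names_of D"
  shows "entries t \<subseteq> names_of D \<times> Sig D" "small (entries t)" "dom (nodes t) \<subseteq> Field \<kappa>"
proof -
  have "entries t \<subseteq> names_of D \<times> Sig D \<and> small (dom (nodes t)) \<and> dom (nodes t) \<subseteq> Field \<kappa>"
    using assms by cases force
  moreover have "entries t \<subseteq> (\<lambda>i. the (nodes t i)) ` dom (nodes t)"
    unfolding entries_def by force
  ultimately show "entries t \<subseteq> names_of D \<times> Sig D" "small (entries t)" "dom (nodes t) \<subseteq> Field \<kappa>"
    using small_mono[OF small_image] by blast+
qed

lemma label_names_of: "t \<in> names_of D \<Longrightarrow> label xs t = Some A \<Longrightarrow> xs \<in> lists (Field \<kappa>) \<and> A \<in> Sig D"
proof (induction xs arbitrary: t)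
  case (Cons i xs)
  obtain u B where u: "nodes t i = Some (u, B)" "if xs = [] then B = A else label xs u = Some A"
    using Cons(3) by (auto split: option.splits if_splits)
  have e: "(u, B) \<in> entries t" "i \<in> dom (nodes t)" using u(1) by (auto simp: entries_def)
  then have "u \<in> names_of D" "B \<in> Sig D" "i \<in> Field \<kappa>" using entries_names_of[OF Cons(2)] by blast+
  then show ?case using u(2) Cons.IH[of u] by (cases "xs = []") auto
qed simp

lemma ex_entries:
  assumes "S \<subseteq> names_of D \<times> Sig D" "small S"
  shows "\<exists>t \<in> names_of D. entries t = S"
proof -
  have "|S| <o |Field \<kappa>|"
    using assms(2) card_of_Field_ordIso[OF Card_order] ordIso_symmetric ordLess_ordIso_trans unfolding small_def by blast
  then obtain g where g: "inj_on g S" "g ` S \<subseteq> Field \<kappa>"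
    using ordLess_imp_ordLeq card_of_ordLeq[of S "Field \<kappa>"] by blast
  define f where "f = (\<lambda>i. if i \<in> g ` S then Some (inv_into S g i) else None)"
  have dom: "dom f = g ` S" by (simp add: f_def dom_if)
  have ent: "entries (Nm f) = S"
  proof (intro set_eqI iffI)
    fix p assume "p \<in> entries (Nm f)"
    then obtain i where "f i = Some p" by (auto simp: entries_def)
    then have "i \<in> g ` S" "p = inv_into S g i" by (auto simp: f_def split: if_splits)
    then show "p \<in> S" by (simp add: inv_into_into)
  next
    fix p assume "p \<in> S"
    then have "f (g p) = Some p" using g(1) by (simp add: f_def)
    then show "p \<in> entries (Nm f)" by (auto simp: entries_def)
  qed
  have "Nm f \<in> names_of D"
  proof (rule names_of.intros; unfold dom ent)
    show "g ` S \<subseteq> Field \<kappa>" "small (g ` S)" using g(2) small_image[OF assms(2)] by blast+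
    show "u \<in> names_of D" if "(u, A) \<in> S" for u A using assms(1) that by blast
    show "snd ` S \<subseteq> Sig D" using assms(1) by auto
  qed
  with ent show ?thesis by blast
qed

end

locale name_trees = local_op D pr pf ps j + inaccessible \<kappa>
  for D :: "'a nested_pca" and pr :: "'u \<Rightarrow> 'u \<Rightarrow> 'u" and pf ps :: "'u \<Rightarrow> 'u" and j :: "'a tval \<Rightarrow> 'a tval"
    and \<kappa> :: "'k rel" +
  assumes small_pca: "small (UNIV :: 'a set)" and inaccessible_less: "\<kappa> <o |UNIV :: 'u set|"
begin

lemma card_Field: "|Field \<kappa>| <o |UNIV :: 'u set|"
  using ordIso_ordLess_trans[OF card_of_Field_ordIso[OF Card_order] inaccessible_less] .

lemma card_nat: "|UNIV :: nat set| <o |UNIV :: 'u set|"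
  using small_nat inaccessible_less ordLess_transitive unfolding small_def by blast

lemma card_lists: "|lists (Field \<kappa>)| <o |UNIV :: 'u set|"
proof -
  define g :: "'k list \<Rightarrow> (nat \<times> 'k) set" where "g xs = {(i, x). i < length xs \<and> xs ! i = x}" for xs
  have "inj_on g (lists (Field \<kappa>))"
  proof (rule inj_onI)
    fix xs ys assume e: "g xs = g ys"
    have i: "i < length xs \<and> xs ! i = x \<longleftrightarrow> i < length ys \<and> ys ! i = x" for i x
      using e unfolding g_def by (auto simp: set_eq_iff)
    then have "i < length xs \<longleftrightarrow> i < length ys" for i by blast
    then have "length xs = length ys" by (metis nat_neq_iff)
    then show "xs = ys" using i by (intro nth_equalityI) blast+
  qed
  moreover have "g ` lists (Field \<kappa>) \<subseteq> Pow (UNIV \<times> Field \<kappa>)" by (auto simp: g_def)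
  ultimately have "|lists (Field \<kappa>)| \<le>o |Pow ((UNIV :: nat set) \<times> Field \<kappa>)|"
    using card_of_ordLeq[of "lists (Field \<kappa>)"] by blast
  then show ?thesis
    by (rule ordLeq_ordLess_trans) (intro card_Pow_less card_Times_less card_nat card_Field)
qed

lemma card_names_of: "|names_of D| <o |UNIV :: 'u set|"
proof -
  define g :: "('k, 'a) tree \<Rightarrow> ('k list \<times> 'a tval) set" where "g t = {(xs, A). label xs t = Some A}" for t
  have "inj_on g (names_of D)"
  proof (rule inj_onI)
    fix t t' assume e: "g t = g t'"
    have "label xs t = Some A \<longleftrightarrow> label xs t' = Some A" for xs A
    proof -
      have "(xs, A) \<in> g t \<longleftrightarrow> (xs, A) \<in> g t'" by (simp add: e)
      then show ?thesis by (simp add: g_def)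
    qed
    then have "label xs t = label xs t'" for xs by (metis not_None_eq)
    then show "t = t'" by (rule label_inj)
  qed
  moreover have "g ` names_of D \<subseteq> Pow (lists (Field \<kappa>) \<times> Sig D)"
    unfolding g_def using label_names_of by blast
  ultimately have "|names_of D| \<le>o |Pow (lists (Field \<kappa>) \<times> Sig D)|"
    using card_of_ordLeq[of "names_of D"] by blast
  then show ?thesis
    by (rule ordLeq_ordLess_trans) (intro card_Pow_less card_Times_less card_lists card_Sig)
qed

lemma ex_names: "\<exists>V ent. names D pr pf ps j \<kappa> V ent"
proof -
  obtain e :: "('k, 'a) tree \<Rightarrow> 'u" where e: "inj_on e (names_of D)"
    using card_names_of ordLess_imp_ordLeq card_of_ordLeq[of "names_of D" "UNIV :: 'u set"] by blast
  define i where "i = inv_into (names_of D) e"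
  have ie: "i (e t) = t" if "t \<in> names_of D" for t using e that by (simp add: i_def)
  define V where "V = e ` names_of D"
  have iV: "i x \<in> names_of D" "e (i x) = x" if "x \<in> V" for x using that ie by (auto simp: V_def)
  define ent where "ent x = map_prod e id ` entries (i x)" for x
  have "names D pr pf ps j \<kappa> V ent"
  proof unfold_locales
    show "small (UNIV :: 'a set)" by (rule small_pca)
    show "|V| <o |UNIV :: 'u set|"
      unfolding V_def by (rule ordLeq_ordLess_trans[OF card_of_image card_names_of])
    show "ent x \<subseteq> V \<times> Sig D" "small (ent x)" if "x \<in> V" for x
      using entries_names_of[OF iV(1)[OF that]] unfolding ent_def V_def by (auto intro: small_image)
    show "\<exists>x\<in>V. ent x = S" if S: "S \<subseteq> V \<times> Sig D" "small S" for S
    proof -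
      have "map_prod i id ` S \<subseteq> names_of D \<times> Sig D" using S(1) iV by auto
      from ex_entries[OF this small_image[OF S(2)]]
      obtain t where t: "t \<in> names_of D" "entries t = map_prod i id ` S" by blast
      have "map_prod e id ` map_prod i id ` S = S"
        unfolding image_image using S(1) iV(2) by (force simp: map_prod_def)
      then have "ent (e t) = S" by (simp add: ent_def ie t)
      then show ?thesis using t(1) unfolding V_def by blast
    qed
    have "{(z, x). x \<in> V \<and> z \<in> fst ` ent x} \<subseteq> inv_image {(u, t). u \<in> fst ` entries t} i"
    proof clarify
      fix x p assume x: "x \<in> V" and "p \<in> ent x"
      then obtain q where q: "q \<in> entries (i x)" "p = map_prod e id q" by (auto simp: ent_def)
      then have "fst q \<in> names_of D" using entries_names_of(1)[OF iV(1)[OF x]] by auto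
      then show "(fst p, x) \<in> inv_image {(u, t). u \<in> fst ` entries t} i" using q ie by simp
    qed
    then show "wf {(z, x). x \<in> V \<and> z \<in> fst ` ent x}" by (rule wf_subset[OF wf_inv_image[OF wf_entries]])
  qed
  then show ?thesis by blast
qed

end

theorem theorem4p3:
  fixes D :: "'a nested_pca"
    and j :: "'a tval \<Rightarrow> 'a tval"
    and \<kappa> :: "'k rel"
  assumes "is_nested_pca D"
    and "set_universe TYPE('u)"
    and "strongly_inaccessible \<kappa>"
    and "|UNIV :: 'a set| <o \<kappa>"
    and "\<kappa> <o |UNIV :: 'u set|"
    and "local_operator D j"
  shows "\<exists>M. internal_IZF_model
               (subtopos D j :: (('u, 'a) rt_obj, ('u, 'a) rt_arr) category) M"
proof -
  have "|(UNIV :: 'u set) \<times> (UNIV :: 'u set)| =o |UNIV :: 'u set|"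
    using assms(2) by (intro card_of_Times_same_infinite) (simp add: set_universe_def)
  then obtain h :: "'u \<times> 'u \<Rightarrow> 'u" where h: "bij h"
    unfolding card_of_ordIso[symmetric] UNIV_Times_UNIV by blast
  define pr where "pr = (\<lambda>x y. h (x, y))"
  define pf where "pf = (\<lambda>u. fst (inv h u))"
  define ps where "ps = (\<lambda>u. snd (inv h u))"
  have inj: "inv h (h q) = q" and surj: "h (inv h u) = u" for q u
    using inv_f_f[OF bij_is_inj[OF h]] surj_f_inv_f[OF bij_is_surj[OF h]] by blast+
  have inacc: "inaccessible \<kappa>" by (rule inaccessible.intro[OF assms(3)])
  interpret name_trees D pr pf ps j \<kappa>
  proof unfold_locales
    show "pf (pr x y) = x" "ps (pr x y) = y" "pr (pf u) (ps u) = u" for x y u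
      by (simp_all add: pr_def pf_def ps_def inj surj)
    show "|UNIV :: 'a set| <o |UNIV :: 'u set|" by (rule ordLess_transitive[OF assms(4,5)])
    show "inaccessible.small \<kappa> (UNIV :: 'a set)"
      unfolding inaccessible.small_def[OF inacc] by (rule assms(4))
  qed (rule assms)+
  obtain V ent where "names D pr pf ps j \<kappa> V ent" using ex_names by blast
  then interpret names D pr pf ps j \<kappa> V ent .
  show ?thesis using internal_IZF_model_M by blast
qed

end
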